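(* Let $\Bbbk$ be a field, $n\ge 1$, $e$, $I=\mathbb Z/e\mathbb Z$, an $S_n$-orbit $\mathcal C\subseteq I^n$ and $\Lambda=(\Lambda_i)_{i\in I}\in\mathbb N^I$ with $\sum_{i\in I}\Lambda_i<\infty$ be as in the context. The cyclotomic KLR algebra $\mathcal R(\Lambda)$ of type A and the block of the cyclotomic (degenerate or non-degenerate) affine Hecke algebra of $S_n$ attached to $\mathcal C$ are both realized as the same quotient $\tilde{\mathcal L}(\Lambda)=\tilde{\mathcal L}/\langle y_1^{\Lambda_{i_1}}\epsilon(\boldsymbol i)\mid \boldsymbol i\in\mathcal C\rangle$ of the algebra $\tilde{\mathcal L}$. That is, there are isomorphisms of $\Bbbk$-algebras as follows. (1) In the degenerate case ($e=\mathrm{char}\,\Bbbk$): $\mathcal R(\Lambda)\cong\tilde{\mathcal L}(\Lambda)\cong \mathcal H(\Lambda)e(\mathcal C)$. (2) In the non-degenerate case ($1\ne q\in\Bbbk^\times$ and $e$ the quantum characteristic of $q$): $\mathcal R(\Lambda)\cong\tilde{\mathcal L}(\Lambda)\cong \mathcal H_q(\Lambda)e(\mathcal C)$.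
   Context: **Index sets.** $\sigma_1,\dots,\sigma_{n-1}$ are the basic transpositions of $S_n$; $\mathbb N=\{0,1,2,\dots\}$. In the degenerate case $e=\mathrm{char}\,\Bbbk$, and $i\in I=\mathbb Z/e\mathbb Z$ is also viewed as an element of $\Bbbk$ (injectively). In the non-degenerate case $q\in\Bbbk^\times$, $q\neq1$, and $e$ is the smallest positive integer with $1+q+\cdots+q^{e-1}=0$, or $e=0$ if there is none; then $q^i\in\Bbbk$ is well defined for $i\in I$. $S_n$ acts on $I^n$ by $w(\boldsymbol i)_s=i_{w^{-1}(s)}$, and $\mathcal C$ is a fixed orbit. **KLR relations.** For symbols $y_1,\dots,y_n$, $\psi_1,\dots,\psi_{n-1}$, $\epsilon(\boldsymbol i)$ ($\boldsymbol i\in\mathcal C$), for all admissible indices: - $\epsilon(\boldsymbol i)\epsilon(\boldsymbol j)=\delta_{\boldsymbol i,\boldsymbol j}\epsilon(\boldsymbol i)$, $\sum_{\boldsymbol i\in\mathcal C}\epsilon(\boldsymbol i)=1$; $y_r\epsilon(\boldsymbol i)=\epsilon(\boldsymbol i)y_r$, $y_ry_s=y_sy_r$; $\psi_r\epsilon(\boldsymbol i)=\epsilon(\sigma_r(\boldsymbol i))\psi_r$. - $\psi_ry_s\epsilon(\boldsymbol i)=[y_{\sigma_r(s)}\psi_r+\delta_{i_r,i_{r+1}}\partial_r(y_s)]\epsilon(\boldsymbol i)$, where $\partial_r(y_r)=-1$, $\partial_r(y_{r+1})=1$, and $\partial_r(y_s)=0$ for $s\ne r,r+1$. - $\psi_r^2\epsilon(\boldsymbol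 i)$ equals: $0$ if $i_r=i_{r+1}$; $(y_r-y_{r+1})\epsilon(\boldsymbol i)$ if $i_r-i_{r+1}=1$, $e\ne2$; $(y_{r+1}-y_r)\epsilon(\boldsymbol i)$ if $i_r-i_{r+1}=-1$, $e\neq2$; $-(y_r-y_{r+1})^2\epsilon(\boldsymbol i)$ if $i_r-i_{r+1}=1$, $e=2$; $\epsilon(\boldsymbol i)$ if $i_r-i_{r+1}\ne0,\pm1$. - $\psi_r\psi_s=\psi_s\psi_r$ if $|r-s|>1$. - $(\psi_r\psi_{r+1}\psi_r-\psi_{r+1}\psi_r\psi_{r+1})\epsilon(\boldsymbol i)$ equals: $-\epsilon(\boldsymbol i)$ if $i_{r+2}=i_r$, $i_r-i_{r+1}=1$, $e\ne2$; $\epsilon(\boldsymbol i)$ if $i_{r+2}=i_r$, $i_r-i_{r+1}=-1$, $e\neq2$; $(y_r+y_{r+2}-2y_{r+1})\epsilon(\boldsymbol i)$ if $i_{r+2}=i_r$, $i_r-i_{r+1}=1$, $e=2$; $0$ otherwise. $\mathcal R$ (the KLR algebra of type A) is the unital $\Bbbk$-algebra generated by $y_1,\dots,y_n,\psi_1,\dots,\psi_{n-1},\epsilon(\boldsymbol i)$ ($\boldsymbol i\in\mathcal C$) subject to the KLR relations, and $\mathcal R(\Lambda)=\mathcal R/\langle y_1^{\Lambda_{i_1}}\epsilon(\boldsymbol i)\mid\boldsymbol i\in\mathcal C\rangle$. $\tilde{\mathcal L}$ (the semi-rationalization algebra) is the unital $\Bbbk$-algebra generated by these elements together with $f^{-1}$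 for every polynomial $f\in\Bbbk[y]=\Bbbk[y_1,\dots,y_n]$ with $f(0)\ne0$, subject to the KLR relations and $ff^{-1}=f^{-1}f=1$. **Hecke algebras.** The degenerate affine Hecke algebra $\mathcal H$ is generated by $X_1,\dots,X_n,T_1,\dots,T_{n-1}$ with relations $X_rX_s=X_sX_r$; $T_rX_s=X_{\sigma_r(s)}T_r+\partial_r(X_s)$; $T_r^2=1$; $T_rT_s=T_sT_r$ if $|r-s|>1$; $T_rT_{r+1}T_r=T_{r+1}T_rT_{r+1}$. The affine Hecke algebra $\mathcal H_q$ is generated by $X_1^{\pm1},\dots,X_n^{\pm1},T_1,\dots,T_{n-1}$ with relations: the $X_r^{\pm1}$ commute and $X_rX_r^{-1}=1=X_r^{-1}X_r$; $T_rX_s=X_{\sigma_r(s)}T_r+(q-1)X_{r+1}\partial_r(X_s)$; $T_r^2=(q-1)T_r+q$; and the same commutation and braid relations for the $T_r$. Here $\partial_r(X_r)=-1$, $\partial_r(X_{r+1})=1$, $\partial_r(X_s)=0$ otherwise. The cyclotomic quotients are $\mathcal H(\Lambda)=\mathcal H/\langle\prod_{i\in I}(X_1-i)^{\Lambda_i}\rangle$ and $\mathcal H_q(\Lambda)=\mathcal H_q/\langle\prod_{i\in I}(X_1-q^i)^{\Lambda_i}\rangle$. In $\mathcal H(\Lambda)$ (resp. $\mathcal H_q(\Lambda)$) there is a (known) system $\{e(\boldsymbol i)\mid\boldsymbol i\in I^n\}$ of mutually orthogonal idempotents, all but finitely many zero, with $\sum_{\boldsymbol i\in I^n}e(\boldsymbol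 i)=1$ and with $e(\boldsymbol i)\mathcal H(\Lambda)=\{h\mid (X_r-i_r)^mh=0\ \text{for all }1\le r\le n,\ m\gg0\}$ (resp. $e(\boldsymbol i)\mathcal H_q(\Lambda)=\{h\mid (X_r-q^{i_r})^mh=0\ \text{for all }1\le r\le n,\ m\gg0\}$). Put $e(\mathcal C)=\sum_{\boldsymbol i\in\mathcal C}e(\boldsymbol i)$; this is a central idempotent, and $\mathcal H(\Lambda)e(\mathcal C)$, $\mathcal H_q(\Lambda)e(\mathcal C)$ are the blocks in question. *)

theory Defs
  imports
    "HOL-Algebra.QuotRing"
    "HOL-Algebra.Module"
    "HOL-Library.Poly_Mapping"
    "HOL-Library.FuncSet"
    "HOL-Combinatorics.Permutations"
    "HOL-Number_Theory.Cong"
begin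

section \<open>Algebras over a field given by generators and relations\<close>

text \<open>
  The ground field is a type \<open>'k\<close> of class \<^class>\<open>field\<close>. A (noncommutative, unital) algebra over it
  is a record of type \<open>('k, 'a) module\<close>: a ring in the sense of HOL-Algebra together with a scalar
  multiplication by elements of \<open>'k\<close>. The locale \<^locale>\<open>algebra\<close> of HOL-Algebra is restricted to
  commutative rings, hence is not used.
\<close>

definition alg_isomorphic :: "('k, 'a) module \<Rightarrow> ('k, 'b) module \<Rightarrow> bool" (infix \<open>\<cong>\<^sub>a\<^sub>l\<^sub>g\<close> 50) where
  "A \<cong>\<^sub>a\<^sub>l\<^sub>g B \<longleftrightarrow>
     (\<exists>h \<in> ring_iso A B. \<forall>c. \<forall>x \<in> carrier A. h (c \<odot>\<^bsub>A\<^esub> x) = c \<odot>\<^bsub>B\<^esub> h x)"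

text \<open>The quotient \<open>A/\<langle>S\<rangle>\<close> by the two-sided ideal generated by \<open>S\<close>, and the class of an element in it.\<close>

definition quot_alg :: "('k, 'a) module \<Rightarrow> 'a set \<Rightarrow> ('k, 'a set) module" where
  "quot_alg A S =
     \<lparr>carrier = carrier (A Quot genideal A S),
      monoid.mult = monoid.mult (A Quot genideal A S),
      one = one (A Quot genideal A S),
      ring.zero = ring.zero (A Quot genideal A S),
      add = add (A Quot genideal A S),
      smult = (\<lambda>c X. \<Union>x\<in>X. genideal A S +>\<^bsub>A\<^esub> (c \<odot>\<^bsub>A\<^esub> x))\<rparr>"

definition quot_class :: "('k, 'a) module \<Rightarrow> 'a set \<Rightarrow> 'a \<Rightarrow> 'a set" where
  "quot_class A S x = genideal A S +>\<^bsub>A\<^esub> x"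

text \<open>
  Words in letters from \<open>'g\<close> (the free monoid). It is written additively, so that
  \<open>'g wrd \<Rightarrow>\<^sub>0 'k\<close> with the convolution product of \<^theory>\<open>HOL-Library.Poly_Mapping\<close> is the free
  associative algebra on \<open>'g\<close>.
\<close>

datatype 'g wrd = Wrd (letters: "'g list")

instantiation wrd :: (type) monoid_add
begin

definition zero_wrd :: "'a wrd" where "zero_wrd = Wrd []"

definition plus_wrd :: "'a wrd \<Rightarrow> 'a wrd \<Rightarrow> 'a wrd" where
  "plus_wrd u v = Wrd (letters u @ letters v)"

instance
  by standard (auto simp: zero_wrd_def plus_wrd_def)

end

definition scal :: "'k::field \<Rightarrow> ('g wrd \<Rightarrow>\<^sub>0 'k)" where
  "scal c = Poly_Mapping.single 0 c"

definition gen :: "'g \<Rightarrow> ('g wrd \<Rightarrow>\<^sub>0 'k::field)" where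
  "gen g = Poly_Mapping.single (Wrd [g]) 1"

text \<open>The free unital algebra on a set \<open>G\<close> of letters.\<close>

definition free_alg :: "'g set \<Rightarrow> ('k::field, 'g wrd \<Rightarrow>\<^sub>0 'k) module" where
  "free_alg G =
     \<lparr>carrier = {p. \<forall>w \<in> Poly_Mapping.keys p. set (letters w) \<subseteq> G},
      monoid.mult = (*), one = 1, ring.zero = 0, add = (+),
      smult = (\<lambda>c p. scal c * p)\<rparr>"

text \<open>A set of relations \<open>l = r\<close> is given as a binary predicate on the free algebra.\<close>

definition relators :: "('a::minus \<Rightarrow> 'a \<Rightarrow> bool) \<Rightarrow> 'a set" where
  "relators R = {l - r | l r. R l r}"

definition presented_alg ::
    "'g set \<Rightarrow> (('g wrd \<Rightarrow>\<^sub>0 'k::field) \<Rightarrow> ('g wrd \<Rightarrow>\<^sub>0 'k) \<Rightarrow> bool) \<Rightarrow> ('k, ('g wrd \<Rightarrow>\<^sub>0 'k) set) module" where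
  "presented_alg G R = quot_alg (free_alg G) (relators R)"

definition presented_class ::
    "'g set \<Rightarrow> (('g wrd \<Rightarrow>\<^sub>0 'k::field) \<Rightarrow> ('g wrd \<Rightarrow>\<^sub>0 'k) \<Rightarrow> bool) \<Rightarrow> ('g wrd \<Rightarrow>\<^sub>0 'k) \<Rightarrow> ('g wrd \<Rightarrow>\<^sub>0 'k) set" where
  "presented_class G R = quot_class (free_alg G) (relators R)"


section \<open>Index sets\<close>

text \<open>
  \<open>\<int>/e\<int>\<close> is represented by the integers \<open>0, \<dots>, e - 1\<close> if \<open>e > 0\<close>, and by all integers if \<open>e = 0\<close>
  (recall \<open>i mod 0 = i\<close>). Equations between elements of \<open>\<int>/e\<int>\<close> involving arithmetic are written as
  congruences modulo \<open>e\<close>.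
\<close>

definition residue_set :: "nat \<Rightarrow> int set" where
  "residue_set e = {i. i mod int e = i}"

text \<open>\<open>I\<^sup>n\<close>: tuples are functions on \<open>{1..n}\<close>, extended by \<^const>\<open>undefined\<close>.\<close>

definition tuples :: "nat \<Rightarrow> nat \<Rightarrow> (nat \<Rightarrow> int) set" where
  "tuples n e = {1..n} \<rightarrow>\<^sub>E residue_set e"

definition perm_act :: "(nat \<Rightarrow> nat) \<Rightarrow> (nat \<Rightarrow> int) \<Rightarrow> (nat \<Rightarrow> int)" where
  "perm_act w i = (\<lambda>s. i (inv_into UNIV w s))"

definition is_orbit :: "nat \<Rightarrow> nat \<Rightarrow> (nat \<Rightarrow> int) set \<Rightarrow> bool" where
  "is_orbit n e C \<longleftrightarrow> (\<exists>i \<in> tuples n e. C = {perm_act w i | w. w permutes {1..n}})"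

abbreviation sigma :: "nat \<Rightarrow> nat \<Rightarrow> nat" where
  "sigma r \<equiv> transpose r (Suc r)"

definition quantum_char :: "'k::field \<Rightarrow> nat" where
  "quantum_char q =
     (if \<exists>e>0. (\<Sum>k<e. q ^ k) = 0 then LEAST e. e > 0 \<and> (\<Sum>k<e. q ^ k) = 0 else 0)"

text \<open>\<open>\<partial>\<^sub>r\<close> on the variable with index \<open>s\<close>.\<close>

definition partial :: "nat \<Rightarrow> nat \<Rightarrow> 'a::ring_1" where
  "partial r s = (if s = r then -1 else if s = Suc r then 1 else 0)"


section \<open>The KLR algebra and the semi-rationalization algebra\<close>

text \<open>
  Polynomials in \<open>y\<^sub>1, \<dots>, y\<^sub>n\<close>: finitely supported functions from exponent vectors to \<open>'k\<close>,
  where exponent vectors have support in \<open>{1..n}\<close>. The value at \<open>0\<close> is the constant coefficient.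
\<close>

type_synonym 'k mpol = "(nat \<Rightarrow>\<^sub>0 nat) \<Rightarrow>\<^sub>0 'k"

datatype 'p klr_gen = Y nat | Psi nat | Eps "nat \<Rightarrow> int" | Inv 'p

type_synonym 'k klr_free = "'k mpol klr_gen wrd \<Rightarrow>\<^sub>0 'k"

definition mpols :: "nat \<Rightarrow> 'k::field mpol set" where
  "mpols n = {f. \<forall>m \<in> Poly_Mapping.keys f. Poly_Mapping.keys m \<subseteq> {1..n}}"

definition units_at_0 :: "nat \<Rightarrow> 'k::field mpol set" where
  "units_at_0 n = {f \<in> mpols n. Poly_Mapping.lookup f 0 \<noteq> 0}"

abbreviation yg :: "nat \<Rightarrow> 'k::field klr_free" where "yg r \<equiv> gen (Y r)"
abbreviation psig :: "nat \<Rightarrow> 'k::field klr_free" where "psig r \<equiv> gen (Psi r)"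
abbreviation epsg :: "(nat \<Rightarrow> int) \<Rightarrow> 'k::field klr_free" where "epsg i \<equiv> gen (Eps i)"

definition mpol_in_y :: "nat \<Rightarrow> 'k::field mpol \<Rightarrow> 'k klr_free" where
  "mpol_in_y n f =
     (\<Sum>m \<in> Poly_Mapping.keys f.
        scal (Poly_Mapping.lookup f m) *
        prod_list (map (\<lambda>r. yg r ^ Poly_Mapping.lookup m r) [1..<Suc n]))"

definition psi_square :: "nat \<Rightarrow> (nat \<Rightarrow> int) \<Rightarrow> nat \<Rightarrow> 'k::field klr_free" where
  "psi_square e i r =
     (if i r = i (r+1) then 0
      else if [i r - i (r+1) = 1] (mod int e) \<and> e \<noteq> 2 then yg r - yg (r+1)
      else if [i r - i (r+1) = -1] (mod int e) \<and> e \<noteq> 2 then yg (r+1) - yg r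
      else if [i r - i (r+1) = 1] (mod int e) \<and> e = 2 then - ((yg r - yg (r+1)) ^ 2)
      else 1)"

definition braid_defect :: "nat \<Rightarrow> (nat \<Rightarrow> int) \<Rightarrow> nat \<Rightarrow> 'k::field klr_free" where
  "braid_defect e i r =
     (if i (r+2) = i r \<and> [i r - i (r+1) = 1] (mod int e) \<and> e \<noteq> 2 then -1
      else if i (r+2) = i r \<and> [i r - i (r+1) = -1] (mod int e) \<and> e \<noteq> 2 then 1
      else if i (r+2) = i r \<and> [i r - i (r+1) = 1] (mod int e) \<and> e = 2
        then yg r + yg (r+2) - 2 * yg (r+1)
      else 0)"

inductive klr_rel :: "nat \<Rightarrow> nat \<Rightarrow> (nat \<Rightarrow> int) set \<Rightarrow> 'k::field klr_free \<Rightarrow> 'k klr_free \<Rightarrow> bool"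
  for n e C where
  eps_eps: "i \<in> C \<Longrightarrow> j \<in> C \<Longrightarrow> klr_rel n e C (epsg i * epsg j) (if i = j then epsg i else 0)"
| eps_sum: "klr_rel n e C (\<Sum>i\<in>C. epsg i) 1"
| y_eps: "r \<in> {1..n} \<Longrightarrow> i \<in> C \<Longrightarrow> klr_rel n e C (yg r * epsg i) (epsg i * yg r)"
| y_y: "r \<in> {1..n} \<Longrightarrow> s \<in> {1..n} \<Longrightarrow> klr_rel n e C (yg r * yg s) (yg s * yg r)"
| psi_eps: "r \<in> {1..<n} \<Longrightarrow> i \<in> C \<Longrightarrow>
    klr_rel n e C (psig r * epsg i) (epsg (perm_act (sigma r) i) * psig r)"
| psi_y: "r \<in> {1..<n} \<Longrightarrow> s \<in> {1..n} \<Longrightarrow> i \<in> C \<Longrightarrow>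
    klr_rel n e C (psig r * yg s * epsg i)
      ((yg (sigma r s) * psig r + (if i r = i (r+1) then partial r s else 0)) * epsg i)"
| psi_psi: "r \<in> {1..<n} \<Longrightarrow> i \<in> C \<Longrightarrow>
    klr_rel n e C (psig r ^ 2 * epsg i) (psi_square e i r * epsg i)"
| psi_comm: "r \<in> {1..<n} \<Longrightarrow> s \<in> {1..<n} \<Longrightarrow> \<bar>int r - int s\<bar> > 1 \<Longrightarrow>
    klr_rel n e C (psig r * psig s) (psig s * psig r)"
| psi_braid: "1 \<le> r \<Longrightarrow> r + 1 < n \<Longrightarrow> i \<in> C \<Longrightarrow>
    klr_rel n e C ((psig r * psig (r+1) * psig r - psig (r+1) * psig r * psig (r+1)) * epsg i)
      (braid_defect e i r * epsg i)"

inductive semirat_rel :: "nat \<Rightarrow> nat \<Rightarrow> (nat \<Rightarrow> int) set \<Rightarrow> 'k::field klr_free \<Rightarrow> 'k klr_free \<Rightarrow> bool"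
  for n e C where
  klr: "klr_rel n e C a b \<Longrightarrow> semirat_rel n e C a b"
| inv_right: "f \<in> units_at_0 n \<Longrightarrow> semirat_rel n e C (mpol_in_y n f * gen (Inv f)) 1"
| inv_left: "f \<in> units_at_0 n \<Longrightarrow> semirat_rel n e C (gen (Inv f) * mpol_in_y n f) 1"

definition klr_gens :: "nat \<Rightarrow> (nat \<Rightarrow> int) set \<Rightarrow> 'p klr_gen set" where
  "klr_gens n C = Y ` {1..n} \<union> Psi ` {1..<n} \<union> Eps ` C"

definition semirat_gens :: "nat \<Rightarrow> (nat \<Rightarrow> int) set \<Rightarrow> 'k::field mpol klr_gen set" where
  "semirat_gens n C = klr_gens n C \<union> Inv ` units_at_0 n"

definition klr_alg :: "nat \<Rightarrow> nat \<Rightarrow> (nat \<Rightarrow> int) set \<Rightarrow> ('k::field, 'k klr_free set) module" where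
  "klr_alg n e C = presented_alg (klr_gens n C) (klr_rel n e C)"

definition semirat_alg :: "nat \<Rightarrow> nat \<Rightarrow> (nat \<Rightarrow> int) set \<Rightarrow> ('k::field, 'k klr_free set) module" where
  "semirat_alg n e C = presented_alg (semirat_gens n C) (semirat_rel n e C)"

definition klr_cyc_elems :: "(nat \<Rightarrow> int) set \<Rightarrow> (int \<Rightarrow> nat) \<Rightarrow> 'k::field klr_free set" where
  "klr_cyc_elems C \<Lambda> = {yg 1 ^ \<Lambda> (i 1) * epsg i | i. i \<in> C}"

definition cyclotomic_klr ::
    "nat \<Rightarrow> nat \<Rightarrow> (nat \<Rightarrow> int) set \<Rightarrow> (int \<Rightarrow> nat) \<Rightarrow> ('k::field, 'k klr_free set set) module" where
  "cyclotomic_klr n e C \<Lambda> =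
     quot_alg (klr_alg n e C)
       (presented_class (klr_gens n C) (klr_rel n e C) ` klr_cyc_elems C \<Lambda>)"

definition cyclotomic_semirat ::
    "nat \<Rightarrow> nat \<Rightarrow> (nat \<Rightarrow> int) set \<Rightarrow> (int \<Rightarrow> nat) \<Rightarrow> ('k::field, 'k klr_free set set) module" where
  "cyclotomic_semirat n e C \<Lambda> =
     quot_alg (semirat_alg n e C)
       (presented_class (semirat_gens n C) (semirat_rel n e C) ` klr_cyc_elems C \<Lambda>)"


section \<open>Affine Hecke algebras and their cyclotomic quotients\<close>

datatype hecke_gen = GX nat | GXinv nat | GT nat

type_synonym 'k hecke_free = "hecke_gen wrd \<Rightarrow>\<^sub>0 'k"

abbreviation hX :: "nat \<Rightarrow> 'k::field hecke_free" where "hX r \<equiv> gen (GX r)"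
abbreviation hXinv :: "nat \<Rightarrow> 'k::field hecke_free" where "hXinv r \<equiv> gen (GXinv r)"
abbreviation hT :: "nat \<Rightarrow> 'k::field hecke_free" where "hT r \<equiv> gen (GT r)"

inductive deg_hecke_rel :: "nat \<Rightarrow> 'k::field hecke_free \<Rightarrow> 'k hecke_free \<Rightarrow> bool" for n where
  X_X: "r \<in> {1..n} \<Longrightarrow> s \<in> {1..n} \<Longrightarrow> deg_hecke_rel n (hX r * hX s) (hX s * hX r)"
| T_X: "r \<in> {1..<n} \<Longrightarrow> s \<in> {1..n} \<Longrightarrow>
    deg_hecke_rel n (hT r * hX s) (hX (sigma r s) * hT r + partial r s)"
| T_T: "r \<in> {1..<n} \<Longrightarrow> deg_hecke_rel n (hT r ^ 2) 1"
| T_comm: "r \<in> {1..<n} \<Longrightarrow> s \<in> {1..<n} \<Longrightarrow> \<bar>int r - int s\<bar> > 1 \<Longrightarrow>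
    deg_hecke_rel n (hT r * hT s) (hT s * hT r)"
| T_braid: "1 \<le> r \<Longrightarrow> r + 1 < n \<Longrightarrow>
    deg_hecke_rel n (hT r * hT (r+1) * hT r) (hT (r+1) * hT r * hT (r+1))"

inductive hecke_rel :: "'k::field \<Rightarrow> nat \<Rightarrow> 'k hecke_free \<Rightarrow> 'k hecke_free \<Rightarrow> bool" for q n where
  X_X: "r \<in> {1..n} \<Longrightarrow> s \<in> {1..n} \<Longrightarrow> hecke_rel q n (hX r * hX s) (hX s * hX r)"
| X_Xinv: "r \<in> {1..n} \<Longrightarrow> s \<in> {1..n} \<Longrightarrow> hecke_rel q n (hX r * hXinv s) (hXinv s * hX r)"
| Xinv_Xinv: "r \<in> {1..n} \<Longrightarrow> s \<in> {1..n} \<Longrightarrow>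
    hecke_rel q n (hXinv r * hXinv s) (hXinv s * hXinv r)"
| X_inv_right: "r \<in> {1..n} \<Longrightarrow> hecke_rel q n (hX r * hXinv r) 1"
| X_inv_left: "r \<in> {1..n} \<Longrightarrow> hecke_rel q n (hXinv r * hX r) 1"
| T_X: "r \<in> {1..<n} \<Longrightarrow> s \<in> {1..n} \<Longrightarrow>
    hecke_rel q n (hT r * hX s) (hX (sigma r s) * hT r + scal (q - 1) * hX (r+1) * partial r s)"
| T_T: "r \<in> {1..<n} \<Longrightarrow> hecke_rel q n (hT r ^ 2) (scal (q - 1) * hT r + scal q)"
| T_comm: "r \<in> {1..<n} \<Longrightarrow> s \<in> {1..<n} \<Longrightarrow> \<bar>int r - int s\<bar> > 1 \<Longrightarrow>
    hecke_rel q n (hT r * hT s) (hT s * hT r)"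
| T_braid: "1 \<le> r \<Longrightarrow> r + 1 < n \<Longrightarrow>
    hecke_rel q n (hT r * hT (r+1) * hT r) (hT (r+1) * hT r * hT (r+1))"

definition deg_hecke_gens :: "nat \<Rightarrow> hecke_gen set" where
  "deg_hecke_gens n = GX ` {1..n} \<union> GT ` {1..<n}"

definition hecke_gens :: "nat \<Rightarrow> hecke_gen set" where
  "hecke_gens n = GX ` {1..n} \<union> GXinv ` {1..n} \<union> GT ` {1..<n}"

definition deg_hecke_alg :: "nat \<Rightarrow> ('k::field, 'k hecke_free set) module" where
  "deg_hecke_alg n = presented_alg (deg_hecke_gens n) (deg_hecke_rel n)"

definition hecke_alg :: "'k::field \<Rightarrow> nat \<Rightarrow> ('k, 'k hecke_free set) module" where
  "hecke_alg q n = presented_alg (hecke_gens n) (hecke_rel q n)"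

text \<open>
  The element \<open>\<Prod>\<^sub>i (X\<^sub>1 - v i)\<^bsup>\<Lambda> i\<^esup>\<close>. Here \<open>v : I \<rightarrow> \<k>\<close> is \<open>i \<mapsto> i\<close> in the degenerate and \<open>i \<mapsto> q\<^sup>i\<close>
  in the non-degenerate case. The product runs over the (finite) support of \<open>\<Lambda>\<close>; its factors
  commute with each other, so that listing them in increasing order of \<open>i\<close> is immaterial.
\<close>

definition hecke_cyc_elem :: "(int \<Rightarrow> 'k) \<Rightarrow> nat \<Rightarrow> (int \<Rightarrow> nat) \<Rightarrow> 'k::field hecke_free" where
  "hecke_cyc_elem v e \<Lambda> =
     prod_list (map (\<lambda>i. (hX 1 - scal (v i)) ^ \<Lambda> i)
       (sorted_list_of_set {i \<in> residue_set e. \<Lambda> i \<noteq> 0}))"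

definition deg_val :: "int \<Rightarrow> 'k::field" where
  "deg_val i = of_int i"

definition q_val :: "'k::field \<Rightarrow> int \<Rightarrow> 'k" where
  "q_val q i = q powi i"

definition deg_cyc_ideal :: "nat \<Rightarrow> nat \<Rightarrow> (int \<Rightarrow> nat) \<Rightarrow> 'k::field hecke_free set set" where
  "deg_cyc_ideal n e \<Lambda> =
     {presented_class (deg_hecke_gens n) (deg_hecke_rel n) (hecke_cyc_elem deg_val e \<Lambda>)}"

definition cyclotomic_deg_hecke ::
    "nat \<Rightarrow> nat \<Rightarrow> (int \<Rightarrow> nat) \<Rightarrow> ('k::field, 'k hecke_free set set) module" where
  "cyclotomic_deg_hecke n e \<Lambda> = quot_alg (deg_hecke_alg n) (deg_cyc_ideal n e \<Lambda>)"

definition deg_X :: "nat \<Rightarrow> nat \<Rightarrow> (int \<Rightarrow> nat) \<Rightarrow> nat \<Rightarrow> 'k::field hecke_free set set" where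
  "deg_X n e \<Lambda> r =
     quot_class (deg_hecke_alg n) (deg_cyc_ideal n e \<Lambda>)
       (presented_class (deg_hecke_gens n) (deg_hecke_rel n) (hX r))"

definition q_cyc_ideal :: "'k::field \<Rightarrow> nat \<Rightarrow> nat \<Rightarrow> (int \<Rightarrow> nat) \<Rightarrow> 'k hecke_free set set" where
  "q_cyc_ideal q n e \<Lambda> =
     {presented_class (hecke_gens n) (hecke_rel q n) (hecke_cyc_elem (q_val q) e \<Lambda>)}"

definition cyclotomic_hecke ::
    "'k::field \<Rightarrow> nat \<Rightarrow> nat \<Rightarrow> (int \<Rightarrow> nat) \<Rightarrow> ('k, 'k hecke_free set set) module" where
  "cyclotomic_hecke q n e \<Lambda> = quot_alg (hecke_alg q n) (q_cyc_ideal q n e \<Lambda>)"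

definition q_X :: "'k::field \<Rightarrow> nat \<Rightarrow> nat \<Rightarrow> (int \<Rightarrow> nat) \<Rightarrow> nat \<Rightarrow> 'k hecke_free set set" where
  "q_X q n e \<Lambda> r =
     quot_class (hecke_alg q n) (q_cyc_ideal q n e \<Lambda>)
       (presented_class (hecke_gens n) (hecke_rel q n) (hX r))"


section \<open>Weight idempotents and blocks\<close>

text \<open>
  \<open>E\<close> is the system of weight idempotents of the algebra \<open>A\<close> with respect to the elements
  \<open>X 1, \<dots>, X n\<close>: \<open>E i A\<close> is the simultaneous generalized eigenspace where \<open>X r\<close> has eigenvalue
  \<open>v (i r)\<close>. These conditions determine \<open>E\<close> on \<open>I\<^sup>n\<close> uniquely.
\<close>

definition weight_idempotents ::
    "(int \<Rightarrow> 'k) \<Rightarrow> nat \<Rightarrow> nat \<Rightarrow> ('k::field, 'a) module \<Rightarrow> (nat \<Rightarrow> 'a) \<Rightarrow> ((nat \<Rightarrow> int) \<Rightarrow> 'a) \<Rightarrow> bool" where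
  "weight_idempotents v n e A X E \<longleftrightarrow>
     (\<forall>i \<in> tuples n e. E i \<in> carrier A) \<and>
     (\<forall>i \<in> tuples n e. \<forall>j \<in> tuples n e.
        E i \<otimes>\<^bsub>A\<^esub> E j = (if i = j then E i else \<zero>\<^bsub>A\<^esub>)) \<and>
     finite {i \<in> tuples n e. E i \<noteq> \<zero>\<^bsub>A\<^esub>} \<and>
     finsum A E {i \<in> tuples n e. E i \<noteq> \<zero>\<^bsub>A\<^esub>} = \<one>\<^bsub>A\<^esub> \<and>
     (\<forall>i \<in> tuples n e.
        (\<lambda>h. E i \<otimes>\<^bsub>A\<^esub> h) ` carrier A =
        {h \<in> carrier A. \<forall>r \<in> {1..n}. \<exists>M::nat. \<forall>m\<ge>M.
           ((X r \<ominus>\<^bsub>A\<^esub> (v (i r) \<odot>\<^bsub>A\<^esub> \<one>\<^bsub>A\<^esub>)) [^]\<^bsub>A\<^esub> m) \<otimes>\<^bsub>A\<^esub> h = \<zero>\<^bsub>A\<^esub>})"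

text \<open>\<open>A e(C)\<close> for \<open>e(C) = \<Sum>\<^bsub>i \<in> C\<^esub> E i\<close>, as an algebra with unit \<open>e(C)\<close>.\<close>

definition block_alg ::
    "('k, 'a) module \<Rightarrow> ((nat \<Rightarrow> int) \<Rightarrow> 'a) \<Rightarrow> (nat \<Rightarrow> int) set \<Rightarrow> ('k, 'a) module" where
  "block_alg A E C =
     A\<lparr>carrier := (\<lambda>h. h \<otimes>\<^bsub>A\<^esub> finsum A E C) ` carrier A, one := finsum A E C\<rparr>"

end

theory Submission
  imports Defs Complex_Main
begin

text \<open>
  \<^bold>\<open>Idea.\<close> On the weight space of a tuple \<open>i\<close> the polynomial generators are scalars plus nilpotent
  elements, so every polynomial that does not vanish at the weight is invertible there. Two things
  follow.

  First, in the cyclotomic KLR algebra all polynomials in \<open>y\<close> with nonzero constant term are already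
  invertible: the cyclotomic relation makes \<open>y\<^sub>1\<close> nilpotent, and nilpotency passes from strand to
  strand (\<open>y_nilp\<close>). Adjoining the inverses therefore changes nothing (\<open>klr_semirat_iso\<close>).

  Second, Hecke generators and KLR generators can be expressed through each other. The polynomial
  variables are related by \<open>X\<^sub>r = v(i\<^sub>r) + w(i\<^sub>r) y\<^sub>r\<close>. The generators \<open>T\<^sub>r\<close> and \<open>\<psi>\<^sub>r\<close> are related by an
  equation (\<open>linked\<close>) that identifies \<open>\<psi>\<^sub>r\<close>, up to invertible polynomials, with the intertwiner of the
  Hecke algebra, or with \<open>T\<^sub>r + 1\<close> on weights with two equal neighbouring residues. Each side of the
  equation determines the other. The quadratic relations correspond by direct computation. The
  commutation and braid relations correspond because the link, multiplied through, turns the braid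
  defect of the \<open>T\<close>s into a multiple of that of the \<open>\<psi>\<close>s by a factor that can be cancelled; a
  case distinction according to coincidences among three neighbouring residues is needed
  (\<open>braid_iff\<close>).

  The cyclotomic relations correspond as well (\<open>cyclotomic_iff\<close>): on a weight space all but one factor
  of the product are invertible. So there are homomorphisms in both directions between the
  cyclotomic KLR algebra and the block, and they are inverse to each other because matched
  generators determine one another (\<open>matched_transport\<close>, \<open>klr_block_iso\<close>).

  The degenerate and the non-degenerate case are treated together: writing \<open>X = 1 + (q - 1) x\<close> in the
  non-degenerate case, the relations in \<open>x\<close> specialize at \<open>q = 1\<close> to those of the degenerate algebra
  (\<open>quantum\<close>). Computations take place in a ring type, the linear endomorphisms of a free vector
  space, into which the quotient algebras are embedded (\<open>embedding\<close>); units of corners become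
  idempotents \<open>u\<close> of that ring.
\<close>

section \<open>Algebras over a field as records, their homomorphisms and quotients\<close>
text \<open>An associative unital algebra in record form. The library's locale for algebras over a
  ring requires a commutative carrier, hence a locale of its own.\<close>

locale kalg = ring A for A :: "('k::field, 'a) module" (structure) +
  assumes smult_closed [simp, intro]: "x \<in> carrier A ==> c \<odot> x \<in> carrier A"
    and smult_add_left: "x \<in> carrier A ==> (c + d) \<odot> x = c \<odot> x \<oplus> d \<odot> x"
    and smult_add_right: "x \<in> carrier A ==> y \<in> carrier A ==> c \<odot> (x \<oplus> y) = c \<odot> x \<oplus> c \<odot> y"
    and smult_smult: "x \<in> carrier A ==> (c * d) \<odot> x = c \<odot> (d \<odot> x)"
    and smult_one [simp]: "x \<in> carrier A ==> 1 \<odot> x = x"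
    and smult_mult_left: "x \<in> carrier A ==> y \<in> carrier A ==> (c \<odot> x) \<otimes> y = c \<odot> (x \<otimes> y)"
    and smult_mult_right: "x \<in> carrier A ==> y \<in> carrier A ==> x \<otimes> (c \<odot> y) = c \<odot> (x \<otimes> y)"

definition alg_hom :: "('k, 'a) module \<Rightarrow> ('k, 'b) module \<Rightarrow> ('a \<Rightarrow> 'b) \<Rightarrow> bool" where
  "alg_hom A B h \<longleftrightarrow> h \<in> ring_hom A B \<and> (\<forall>c. \<forall>x \<in> carrier A. h (c \<odot>\<^bsub>A\<^esub> x) = c \<odot>\<^bsub>B\<^esub> h x)"

lemma alg_homD:
  assumes "alg_hom A B h"
  shows "x \<in> carrier A ==> h x \<in> carrier B"
    and "x \<in> carrier A ==> y \<in> carrier A ==> h (x \<otimes>\<^bsub>A\<^esub> y) = h x \<otimes>\<^bsub>B\<^esub> h y"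
    and "x \<in> carrier A ==> y \<in> carrier A ==> h (x \<oplus>\<^bsub>A\<^esub> y) = h x \<oplus>\<^bsub>B\<^esub> h y"
    and "h \<one>\<^bsub>A\<^esub> = \<one>\<^bsub>B\<^esub>"
    and "x \<in> carrier A ==> h (c \<odot>\<^bsub>A\<^esub> x) = c \<odot>\<^bsub>B\<^esub> h x"
  using assms unfolding alg_hom_def by (auto simp: ring_hom_def)

lemma alg_homI:
  assumes "\<And>x. x \<in> carrier A ==> h x \<in> carrier B"
    and "\<And>x y. x \<in> carrier A ==> y \<in> carrier A ==> h (x \<otimes>\<^bsub>A\<^esub> y) = h x \<otimes>\<^bsub>B\<^esub> h y"
    and "\<And>x y. x \<in> carrier A ==> y \<in> carrier A ==> h (x \<oplus>\<^bsub>A\<^esub> y) = h x \<oplus>\<^bsub>B\<^esub> h y"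
    and "h \<one>\<^bsub>A\<^esub> = \<one>\<^bsub>B\<^esub>"
    and "\<And>c x. x \<in> carrier A ==> h (c \<odot>\<^bsub>A\<^esub> x) = c \<odot>\<^bsub>B\<^esub> h x"
  shows "alg_hom A B h"
  using assms unfolding alg_hom_def by (auto simp: ring_hom_def)

lemma alg_hom_compose:
  assumes "alg_hom A B f" "alg_hom B C g"
  shows "alg_hom A C (g \<circ> f)"
  by (rule alg_homI) (use assms in \<open>simp_all add: alg_homD[OF assms(1)] alg_homD[OF assms(2)]\<close>)

lemma alg_hom_ring_hom_ring:
  assumes "kalg A" "kalg B" "alg_hom A B h"
  shows "ring_hom_ring A B h"
  using assms by (intro ring_hom_ringI2) (auto simp: alg_hom_def kalg_def)

lemma alg_hom_zero:
  assumes "kalg A" "kalg B" "alg_hom A B h"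
  shows "h \<zero>\<^bsub>A\<^esub> = \<zero>\<^bsub>B\<^esub>"
proof -
  interpret ring_hom_ring A B h by (rule alg_hom_ring_hom_ring[OF assms])
  show ?thesis by simp
qed

lemma alg_hom_minus:
  assumes "kalg A" "kalg B" "alg_hom A B h" "x \<in> carrier A" "y \<in> carrier A"
  shows "h (x \<ominus>\<^bsub>A\<^esub> y) = h x \<ominus>\<^bsub>B\<^esub> h y"
proof -
  interpret ring_hom_ring A B h by (rule alg_hom_ring_hom_ring[OF assms(1-3)])
  show ?thesis using assms(4,5) by (simp add: a_minus_def)
qed

lemma alg_isomorphicI:
  assumes f: "alg_hom A B f" and g: "alg_hom B A g"
    and gf: "\<And>x. x \<in> carrier A ==> g (f x) = x"
    and fg: "\<And>y. y \<in> carrier B ==> f (g y) = y"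
  shows "A \<cong>\<^sub>a\<^sub>l\<^sub>g B"
proof -
  have "bij_betw f (carrier A) (carrier B)"
    by (rule bij_betw_byWitness[where f' = g]) (use gf fg alg_homD(1)[OF f] alg_homD(1)[OF g] in auto)
  then show ?thesis
    using f unfolding alg_isomorphic_def ring_iso_def alg_hom_def by blast
qed

lemma alg_isomorphic_trans:
  assumes "A \<cong>\<^sub>a\<^sub>l\<^sub>g B" "B \<cong>\<^sub>a\<^sub>l\<^sub>g C"
  shows "A \<cong>\<^sub>a\<^sub>l\<^sub>g C"
proof -
  obtain f g where f: "f \<in> ring_iso A B" "\<forall>c. \<forall>x \<in> carrier A. f (c \<odot>\<^bsub>A\<^esub> x) = c \<odot>\<^bsub>B\<^esub> f x"
    and g: "g \<in> ring_iso B C" "\<forall>c. \<forall>x \<in> carrier B. g (c \<odot>\<^bsub>B\<^esub> x) = c \<odot>\<^bsub>C\<^esub> g x"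
    using assms unfolding alg_isomorphic_def by blast
  have "f x \<in> carrier B" if "x \<in> carrier A" for x
    using f(1) that by (auto simp: ring_iso_def ring_hom_def)
  then show ?thesis unfolding alg_isomorphic_def
    using f g by (intro bexI[of _ "g \<circ> f"] ring_iso_set_trans) auto
qed

lemma alg_isomorphic_sym:
  assumes "kalg A" "A \<cong>\<^sub>a\<^sub>l\<^sub>g B"
  shows "B \<cong>\<^sub>a\<^sub>l\<^sub>g A"
proof -
  interpret kalg A by fact
  obtain f where f: "f \<in> ring_iso A B" "\<forall>c. \<forall>x \<in> carrier A. f (c \<odot>\<^bsub>A\<^esub> x) = c \<odot>\<^bsub>B\<^esub> f x"
    using assms(2) unfolding alg_isomorphic_def by blast
  let ?g = "inv_into (carrier A) f"
  have bij: "bij_betw f (carrier A) (carrier B)" using f(1) by (simp add: ring_iso_def)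
  have "?g (c \<odot>\<^bsub>B\<^esub> y) = c \<odot>\<^bsub>A\<^esub> ?g y" if y: "y \<in> carrier B" for c y
  proof -
    have gy: "?g y \<in> carrier A" using bij y by (metis bij_betw_def inv_into_into)
    have "f (c \<odot>\<^bsub>A\<^esub> ?g y) = c \<odot>\<^bsub>B\<^esub> y"
      using f(2) gy bij y by (simp add: bij_betw_inv_into_right)
    then show ?thesis using bij gy by (metis bij_betw_inv_into_left smult_closed)
  qed
  then show ?thesis unfolding alg_isomorphic_def
    using ring_iso_set_sym[OF ring_axioms f(1)] by blast
qed

text \<open>A quotient algebra differs from the quotient ring only by its scalar
  multiplication.\<close>

lemma ring_eq_fields:
  assumes "ring R" "carrier S = carrier R" "monoid.mult S = monoid.mult R" "one S = one R"
    "ring.zero S = ring.zero R" "add S = add R"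
  shows "ring S"
proof -
  interpret R: ring R by fact
  show ?thesis
  proof (rule ringI)
    show "abelian_group S"
      by (rule abelian_groupI) (auto simp: assms R.a_ac intro: R.l_neg R.a_inv_closed bexI[of _ "\<ominus>\<^bsub>R\<^esub> _"])
    show "Group.monoid S"
      by (rule monoidI) (auto simp: assms R.m_assoc)
  qed (auto simp: assms R.l_distr R.r_distr)
qed

context kalg
begin

lemma smult_zero_right [simp]: "c \<odot> \<zero> = \<zero>"
proof -
  have "c \<odot> \<zero> \<oplus> c \<odot> \<zero> = c \<odot> \<zero>" using smult_add_right[of \<zero> \<zero> c] by simp
  then show ?thesis by (metis add.r_cancel_one smult_closed zero_closed)
qed

text \<open>An ideal is a subspace because \<open>c \<odot> x = (c \<odot> 1) \<otimes>
  x\<close>.\<close>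

lemma ideal_smult_closed:
  assumes "ideal I A" "x \<in> I"
  shows "c \<odot> x \<in> I"
proof -
  interpret ideal I A by fact
  have x: "x \<in> carrier A" using assms(2) a_Hcarr by blast
  have "c \<odot> x = (c \<odot> \<one>) \<otimes> x" using x by (simp add: smult_mult_left)
  then show ?thesis using assms(2) I_l_closed by simp
qed

context
  fixes S assumes S: "S \<subseteq> carrier A"
begin

interpretation I: ideal "genideal A S" A by (rule genideal_ideal[OF S])

lemma quot_carrier: "carrier (quot_alg A S) = quot_class A S ` carrier A"
  by (auto simp: quot_alg_def quot_class_def FactRing_simps)

lemma quot_smult:
  assumes x: "x \<in> carrier A"
  shows "c \<odot>\<^bsub>quot_alg A S\<^esub> quot_class A S x = quot_class A S (c \<odot> x)"
proof -
  have "genideal A S +> c \<odot> x' = genideal A S +> c \<odot> x" if x': "x' \<in> genideal A S +> x" for x'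
  proof -
    obtain h where h: "h \<in> genideal A S" "x' = h \<oplus> x"
      using x' by (auto simp: a_r_coset_def')
    have hc: "h \<in> carrier A" using h(1) I.a_Hcarr by blast
    have "c \<odot> x' \<in> genideal A S +> c \<odot> x"
      using h hc x ideal_smult_closed[OF I.is_ideal h(1)] by (auto simp: a_r_coset_def' smult_add_right)
    then show ?thesis
      using I.a_repr_independence' x smult_closed by metis
  qed
  moreover have "genideal A S +> x \<noteq> {}" using x I.a_rcos_self by blast
  ultimately have "(\<Union>x'\<in>genideal A S +> x. genideal A S +> c \<odot> x') = genideal A S +> c \<odot> x"
    by (rule SUP_eq_const[rotated])
  then show ?thesis by (simp add: quot_alg_def quot_class_def)
qed

lemma quot_ring: "ring (quot_alg A S)"
  by (rule ring_eq_fields[OF I.quotient_is_ring]) (simp_all add: quot_alg_def)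

lemma quot_hom: "alg_hom A (quot_alg A S) (quot_class A S)"
proof (rule alg_homI)
  note h = I.rcos_ring_hom
  show "quot_class A S (x \<otimes> y) = quot_class A S x \<otimes>\<^bsub>quot_alg A S\<^esub> quot_class A S y"
    if "x \<in> carrier A" "y \<in> carrier A" for x y
    using ring_hom_mult[OF h that] by (simp add: quot_alg_def quot_class_def)
  show "quot_class A S (x \<oplus> y) = quot_class A S x \<oplus>\<^bsub>quot_alg A S\<^esub> quot_class A S y"
    if "x \<in> carrier A" "y \<in> carrier A" for x y
    using ring_hom_add[OF h that] by (simp add: quot_alg_def quot_class_def)
  show "quot_class A S \<one> = \<one>\<^bsub>quot_alg A S\<^esub>"
    using ring_hom_one[OF h] by (simp add: quot_alg_def quot_class_def)
qed (simp_all add: quot_carrier quot_smult)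

lemma quot_kalg: "kalg (quot_alg A S)"
proof -
  interpret Q: ring "quot_alg A S" by (rule quot_ring)
  note h = alg_homD[OF quot_hom]
  show ?thesis
    by unfold_locales
      (auto simp: quot_carrier quot_smult smult_add_left smult_add_right smult_smult smult_mult_left
        smult_mult_right h(2,3)[symmetric])
qed

lemma quot_class_eq_iff:
  assumes "x \<in> carrier A" "y \<in> carrier A"
  shows "quot_class A S x = quot_class A S y \<longleftrightarrow> x \<ominus> y \<in> genideal A S"
proof -
  have "x \<in> genideal A S +> y \<longleftrightarrow> genideal A S +> x = genideal A S +> y"
    using assms I.a_repr_independence'[of x y] I.a_rcos_self[of x] by auto
  then show ?thesis
    unfolding quot_class_def using I.a_rcos_module_minus[OF ring_axioms assms(2,1)] by simp
qed

lemma quot_class_gen: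
  assumes "s \<in> S"
  shows "quot_class A S s = \<zero>\<^bsub>quot_alg A S\<^esub>"
proof -
  have s: "s \<in> carrier A" using assms S by blast
  have "s \<in> genideal A S" using assms genideal_self[OF S] by blast
  then have "quot_class A S s = quot_class A S \<zero>"
    using quot_class_eq_iff[OF s zero_closed] s by (simp add: a_minus_def)
  then show ?thesis using alg_hom_zero[OF kalg_axioms quot_kalg quot_hom] by simp
qed

text \<open>The universal property of a quotient by relations.\<close>

lemma quot_lift:
  assumes B: "kalg B" and h: "alg_hom A B h" and z: "\<And>s. s \<in> S ==> h s = \<zero>\<^bsub>B\<^esub>"
  obtains h' where "alg_hom (quot_alg A S) B h'"
    "\<And>x. x \<in> carrier A ==> h' (quot_class A S x) = h x"
proof -
  interpret B: kalg B by (rule B)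
  note kid = ring_hom_ring.kernel_is_ideal[OF alg_hom_ring_hom_ring[OF kalg_axioms B h]]
  note hD = alg_homD[OF h]
  have ker: "genideal A S \<subseteq> a_kernel A B h"
    by (rule genideal_minimal[OF kid]) (use S z in \<open>auto simp: a_kernel_def'\<close>)
  have wd: "h x = h y" if "x \<in> carrier A" "y \<in> carrier A" "quot_class A S x = quot_class A S y" for x y
  proof -
    have "x \<ominus> y \<in> a_kernel A B h" using that(3) ker quot_class_eq_iff[OF that(1,2)] by auto
    then have "h x \<ominus>\<^bsub>B\<^esub> h y = \<zero>\<^bsub>B\<^esub>"
      using that alg_hom_minus[OF kalg_axioms B h] by (simp add: a_kernel_def')
    then have "h x \<oplus>\<^bsub>B\<^esub> \<ominus>\<^bsub>B\<^esub> h y = \<zero>\<^bsub>B\<^esub>" by (simp add: B.minus_eq)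
    then show ?thesis
      using B.minus_equality[of "h x" "\<ominus>\<^bsub>B\<^esub> h y"] that hD(1) by simp
  qed
  define h' where "h' X = h (inv_into (carrier A) (quot_class A S) X)" for X
  have h': "h' (quot_class A S x) = h x" if "x \<in> carrier A" for x
  proof -
    have "quot_class A S x \<in> quot_class A S ` carrier A" using that by blast
    from wd[OF inv_into_into[OF this] that f_inv_into_f[OF this]] show ?thesis
      unfolding h'_def .
  qed
  note q = alg_homD[OF quot_hom]
  have "alg_hom (quot_alg A S) B h'"
    by (rule alg_homI)
      (auto simp: quot_carrier h' hD quot_smult q(2,3)[symmetric] q(4)[symmetric])
  then show ?thesis using h' that by blast
qed

end
end

lemma quot_hom_ext:
  assumes "kalg A" "S \<subseteq> carrier A"
    and "\<And>x. x \<in> carrier A ==> f (quot_class A S x) = g (quot_class A S x)"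
    and "X \<in> carrier (quot_alg A S)"
  shows "f X = g X"
  using assms kalg.quot_carrier[OF assms(1,2)] by auto

section \<open>Free algebras and presentations\<close>

lemma free_alg_simps [simp]:
  "carrier (free_alg G) = {p. \<forall>w \<in> Poly_Mapping.keys p. set (letters w) \<subseteq> G}"
  "monoid.mult (free_alg G) = (*)" "one (free_alg G) = 1" "ring.zero (free_alg G) = 0"
  "add (free_alg G) = (+)" "smult (free_alg G) = (\<lambda>c p. scal c * p)"
  by (simp_all add: free_alg_def)

definition words_in :: "'g set \<Rightarrow> ('g wrd \<Rightarrow>\<^sub>0 'k::field) set" where
  "words_in G = {p. \<forall>w \<in> Poly_Mapping.keys p. set (letters w) \<subseteq> G}"

lemma carrier_free_alg: "carrier (free_alg G) = words_in G"
  by (simp add: words_in_def)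

lemma words_in_mult: "p \<in> words_in G ==> q \<in> words_in G ==> p * q \<in> words_in G"
  using keys_mult[of p q] by (fastforce simp: words_in_def plus_wrd_def)

lemma words_in_add: "p \<in> words_in G ==> q \<in> words_in G ==> p + q \<in> words_in G"
  using Poly_Mapping.keys_add[of p q] by (fastforce simp: words_in_def)

lemma words_in_uminus: "p \<in> words_in G ==> - p \<in> words_in G"
  by (simp add: words_in_def in_keys_iff)

lemma words_in_minus: "p \<in> words_in G ==> q \<in> words_in G ==> p - q \<in> words_in G"
  using words_in_add[of p G "- q"] words_in_uminus[of q G] by simp

lemma words_in_0: "0 \<in> words_in G" by (simp add: words_in_def)

lemma words_in_scal: "scal c \<in> words_in G"
  by (simp add: words_in_def scal_def zero_wrd_def)

lemma words_in_1: "1 \<in> words_in G"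
  using words_in_scal[of 1 G] by (simp add: scal_def)

lemma words_in_numeral: "numeral k \<in> words_in G"
  using words_in_scal[of "numeral k" G] by (simp add: scal_def)

lemma words_in_gen: "g \<in> G ==> gen g \<in> words_in G"
  by (simp add: words_in_def gen_def)

lemma words_in_power: "p \<in> words_in G ==> p ^ n \<in> words_in G"
  by (induction n) (auto simp: words_in_1 words_in_mult)

lemma words_in_sum: "(\<And>i. i \<in> I ==> f i \<in> words_in G) ==> sum f I \<in> words_in G"
  by (induction I rule: infinite_finite_induct) (auto simp: words_in_0 words_in_add)

lemma words_in_prod_list: "(\<And>p. p \<in> set ps ==> p \<in> words_in G) ==> prod_list ps \<in> words_in G"
  by (induction ps) (auto simp: words_in_1 words_in_mult)

lemmas words_in_intros = words_in_mult words_in_add words_in_uminus words_in_minus words_in_0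
  words_in_1 words_in_numeral words_in_scal words_in_gen words_in_power words_in_sum
  words_in_prod_list

lemma scal_add: "scal (c + d) = scal c + scal d" by (simp add: scal_def single_add)
lemma scal_mult: "scal (c * d) = scal c * scal d" by (simp add: scal_def mult_single)
lemma scal_1 [simp]: "scal 1 = 1" by (simp add: scal_def)

lemma poly_mapping_sum_single: "p = (\<Sum>w \<in> Poly_Mapping.keys p. Poly_Mapping.single w (Poly_Mapping.lookup p w))"
  by (rule poly_mapping_eqI)
    (simp add: lookup_sum lookup_single when_def in_keys_iff sum.delta' cong: if_cong)

lemma scal_central: "p * scal c = scal c * p"
proof -
  have "p * scal c = (\<Sum>w \<in> Poly_Mapping.keys p. Poly_Mapping.single w (Poly_Mapping.lookup p w) * scal c)"
    by (subst poly_mapping_sum_single[of p]) (simp add: sum_distrib_right)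
  also have "\<dots> = (\<Sum>w \<in> Poly_Mapping.keys p. scal c * Poly_Mapping.single w (Poly_Mapping.lookup p w))"
    by (simp add: scal_def mult_single mult.commute)
  also have "\<dots> = scal c * p"
    by (subst (2) poly_mapping_sum_single[of p]) (simp add: sum_distrib_left)
  finally show ?thesis .
qed

lemma free_kalg: "kalg (free_alg G)"
proof -
  have "ring (free_alg G)"
  proof (rule ringI)
    show "abelian_group (free_alg G)"
      by (rule abelian_groupI; unfold carrier_free_alg)
        (auto simp: add_ac words_in_intros intro!: bexI[of _ "- _"])
    show "Group.monoid (free_alg G)"
      by (rule monoidI; unfold carrier_free_alg) (auto simp: mult.assoc words_in_intros)
  qed (auto simp: algebra_simps)
  then interpret ring "free_alg G" .
  have comm: "p * (scal c * q) = scal c * (p * q)" for p q :: "'a wrd \<Rightarrow>\<^sub>0 'b" and c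
    by (metis mult.assoc scal_central)
  show ?thesis
  proof (unfold_locales, unfold carrier_free_alg)
    show "x \<otimes>\<^bsub>free_alg G\<^esub> (c \<odot>\<^bsub>free_alg G\<^esub> y) = c \<odot>\<^bsub>free_alg G\<^esub> (x \<otimes>\<^bsub>free_alg G\<^esub> y)" for x y and c :: 'b
      using comm by simp
  qed (auto simp: words_in_intros scal_add scal_mult distrib_left distrib_right mult.assoc)
qed

text \<open>Evaluation of words; \<open>u\<close> is the image of the empty word, which need not be the unit of the
  target ring.\<close>

locale scalars =
  fixes \<kappa> :: "'k::field \<Rightarrow> 'r::ring_1"
  assumes \<kappa>_add: "\<kappa> (c + d) = \<kappa> c + \<kappa> d"
    and \<kappa>_mult: "\<kappa> (c * d) = \<kappa> c * \<kappa> d"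
    and \<kappa>_1 [simp]: "\<kappa> 1 = 1"
    and \<kappa>_central: "z * \<kappa> c = \<kappa> c * z"
begin

lemma \<kappa>_0 [simp]: "\<kappa> 0 = 0"
  using \<kappa>_add[of 0 0] by simp

lemma \<kappa>_minus: "\<kappa> (c - d) = \<kappa> c - \<kappa> d"
  using \<kappa>_add[of "c - d" d] by (simp add: algebra_simps)

lemma \<kappa>_uminus: "\<kappa> (- d) = - \<kappa> d"
  using \<kappa>_minus[of 0 d] by simp

lemma \<kappa>_inverse: "c \<noteq> 0 ==> \<kappa> (inverse c) * \<kappa> c = 1"
  using \<kappa>_mult[of "inverse c" c] by simp

lemma \<kappa>_cancel: "c \<noteq> 0 ==> \<kappa> c * a = \<kappa> c * b ==> a = b"
  by (metis \<kappa>_inverse mult.assoc mult_1_left)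

lemma \<kappa>_of_nat: "\<kappa> (of_nat m) = of_nat m"
  by (induction m) (auto simp: \<kappa>_add)

end

locale word_eval = scalars \<kappa> for \<kappa> :: "'k::field \<Rightarrow> 'r::ring_1" +
  fixes u :: 'r and \<phi> :: "'g \<Rightarrow> 'r"
  assumes uu: "u * u = u" and u_left: "u * \<phi> g = \<phi> g" and u_right: "\<phi> g * u = \<phi> g"
begin

definition ev_word :: "'g wrd \<Rightarrow> 'r" where
  "ev_word w = u * prod_list (map \<phi> (letters w))"

definition ev :: "('g wrd \<Rightarrow>\<^sub>0 'k) \<Rightarrow> 'r" where
  "ev p = (\<Sum>w \<in> Poly_Mapping.keys p. \<kappa> (Poly_Mapping.lookup p w) * ev_word w)"

lemma ev_word_right: "ev_word w * u = ev_word w"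
proof -
  have "u * prod_list (map \<phi> l) * u = u * prod_list (map \<phi> l)" for l
    by (induction l rule: rev_induct) (simp_all add: uu mult.assoc u_right)
  then show ?thesis by (simp add: ev_word_def)
qed

lemma ev_word_plus: "ev_word (v + w) = ev_word v * ev_word w"
proof -
  have "ev_word v * ev_word w = ev_word v * u * prod_list (map \<phi> (letters w))"
    by (simp add: ev_word_def mult.assoc)
  also have "\<dots> = ev_word (v + w)"
    by (simp only: ev_word_right) (simp add: ev_word_def plus_wrd_def mult.assoc)
  finally show ?thesis by simp
qed

lemma ev_superset:
  assumes "finite S" "Poly_Mapping.keys p \<subseteq> S"
  shows "ev p = (\<Sum>w \<in> S. \<kappa> (Poly_Mapping.lookup p w) * ev_word w)"
  unfolding ev_def by (rule sum.mono_neutral_left) (use assms in \<open>auto simp: in_keys_iff\<close>)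

lemma ev_add: "ev (p + q) = ev p + ev q"
proof -
  let ?S = "Poly_Mapping.keys p \<union> Poly_Mapping.keys q"
  have "Poly_Mapping.keys (p + q) \<subseteq> ?S" by (rule Poly_Mapping.keys_add)
  then show ?thesis
    using ev_superset[of ?S "p + q"] ev_superset[of ?S p] ev_superset[of ?S q]
    by (simp add: lookup_add \<kappa>_add algebra_simps sum.distrib)
qed

lemma ev_0 [simp]: "ev 0 = 0" by (simp add: ev_def)

lemma ev_minus: "ev (p - q) = ev p - ev q"
  using ev_add[of "p - q" q] by (simp add: algebra_simps)

lemma ev_uminus: "ev (- q) = - ev q"
  using ev_minus[of 0 q] by simp

lemma ev_sum: "ev (sum f I) = (\<Sum>i\<in>I. ev (f i))"
  by (induction I rule: infinite_finite_induct) (auto simp: ev_add)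

lemma ev_single: "ev (Poly_Mapping.single w c) = \<kappa> c * ev_word w"
  by (simp add: ev_def)

lemma ev_mult: "ev (p * q) = ev p * ev q"
proof -
  have s: "ev (Poly_Mapping.single v c * Poly_Mapping.single w d)
      = ev (Poly_Mapping.single v c) * ev (Poly_Mapping.single w d)" for v w c d
    by (simp add: mult_single ev_single ev_word_plus \<kappa>_mult) (metis \<kappa>_central mult.assoc)
  have "ev (p * q) = ev ((\<Sum>v\<in>Poly_Mapping.keys p. Poly_Mapping.single v (Poly_Mapping.lookup p v))
      * (\<Sum>w\<in>Poly_Mapping.keys q. Poly_Mapping.single w (Poly_Mapping.lookup q w)))"
    by (simp flip: poly_mapping_sum_single)
  also have "\<dots> = ev (\<Sum>v\<in>Poly_Mapping.keys p. Poly_Mapping.single v (Poly_Mapping.lookup p v))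
      * ev (\<Sum>w\<in>Poly_Mapping.keys q. Poly_Mapping.single w (Poly_Mapping.lookup q w))"
    by (simp add: sum_product ev_sum s)
  finally show ?thesis by (simp flip: poly_mapping_sum_single)
qed

lemma ev_scal: "ev (scal c) = \<kappa> c * u"
  by (simp add: scal_def ev_single ev_word_def zero_wrd_def)

lemma ev_1: "ev 1 = u"
  using ev_scal[of 1] by simp

lemma ev_gen: "ev (gen g) = \<phi> g"
  by (simp add: gen_def ev_single ev_word_def u_left)

lemma ev_u: "u * ev p = ev p" "ev p * u = ev p"
  using ev_mult[of 1 p] ev_mult[of p 1] by (simp_all add: ev_1)

lemma ev_2: "ev (2 * p) = 2 * ev p"
  by (simp add: mult_2 ev_add)

text \<open>The factor \<open>u\<close> matters for \<open>m = 0\<close> only: the empty word goes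
  to \<open>u\<close>, not to \<open>1\<close>.\<close>

lemma ev_power: "ev (p ^ m) = ev p ^ m * u"
  by (induction m) (simp_all add: ev_1 ev_mult mult.assoc)

lemmas ev_simps = ev_add ev_minus ev_uminus ev_sum ev_mult ev_scal ev_1 ev_gen ev_2

end

text \<open>The algebra generated by \<open>G\<close> with relations \<open>R\<close> and with the additional relations \<open>s = 0\<close>,
  \<open>s \<in> S\<close>; it is built in two steps.\<close>

definition cyc_alg where
  "cyc_alg G R S = quot_alg (presented_alg G R) (presented_class G R ` S)"

definition cyc_class where
  "cyc_class G R S p = quot_class (presented_alg G R) (presented_class G R ` S) (presented_class G R p)"

locale presentation =
  fixes G :: "'g set" and R :: "('g wrd \<Rightarrow>\<^sub>0 'k::field) \<Rightarrow> ('g wrd \<Rightarrow>\<^sub>0 'k) \<Rightarrow> bool"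
    and S :: "('g wrd \<Rightarrow>\<^sub>0 'k) set"
  assumes R_closed: "R l r ==> l \<in> words_in G \<and> r \<in> words_in G" and S_closed: "S \<subseteq> words_in G"
begin

lemma relators_closed: "relators R \<subseteq> carrier (free_alg G)"
  unfolding carrier_free_alg using R_closed by (auto simp: relators_def intro: words_in_minus)

lemmas free_quot =
  kalg.quot_carrier[OF free_kalg relators_closed, folded presented_alg_def presented_class_def]
  kalg.quot_hom[OF free_kalg relators_closed, folded presented_alg_def presented_class_def]
  kalg.quot_kalg[OF free_kalg relators_closed, folded presented_alg_def]

lemma S_image_closed: "presented_class G R ` S \<subseteq> carrier (presented_alg G R)"
  using S_closed unfolding free_quot(1) carrier_free_alg by blast

lemmas cyc_quot =
  kalg.quot_carrier[OF free_quot(3) S_image_closed, folded cyc_alg_def]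
  kalg.quot_hom[OF free_quot(3) S_image_closed, folded cyc_alg_def]
  kalg.quot_kalg[OF free_quot(3) S_image_closed, folded cyc_alg_def]

lemma cyc_kalg: "kalg (cyc_alg G R S)" by (rule cyc_quot(3))

lemma cyc_hom: "alg_hom (free_alg G) (cyc_alg G R S) (cyc_class G R S)"
  using alg_hom_compose[OF free_quot(2) cyc_quot(2)] by (simp add: cyc_class_def[abs_def] comp_def)

lemma cyc_carrier: "carrier (cyc_alg G R S) = cyc_class G R S ` words_in G"
  unfolding cyc_quot(1) free_quot(1) carrier_free_alg by (simp add: image_image cyc_class_def)

lemma cyc_rel:
  assumes "R l r" shows "cyc_class G R S l = cyc_class G R S r"
proof -
  have c: "l \<in> words_in G" "r \<in> words_in G" using R_closed[OF assms] by auto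
  have "l - r \<in> relators R" using assms by (auto simp: relators_def)
  then have z: "presented_class G R (l - r) = \<zero>\<^bsub>presented_alg G R\<^esub>"
    unfolding presented_class_def presented_alg_def
    by (rule kalg.quot_class_gen[OF free_kalg relators_closed])
  note h = alg_homD[OF free_quot(2), unfolded carrier_free_alg]
  interpret P: kalg "presented_alg G R" by (rule free_quot(3))
  have "presented_class G R l = presented_class G R ((l - r) + r)" by simp
  also have "\<dots> = \<zero>\<^bsub>presented_alg G R\<^esub> \<oplus>\<^bsub>presented_alg G R\<^esub> presented_class G R r"
    using h(3)[of "l - r" r] c z by (simp add: words_in_minus)
  also have "\<dots> = presented_class G R r" using h(1)[OF c(2)] by simp
  finally show ?thesis by (simp add: cyc_class_def)
qed

lemma cyc_zero:
  assumes "s \<in> S" shows "cyc_class G R S s = \<zero>\<^bsub>cyc_alg G R S\<^esub>"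
  unfolding cyc_class_def cyc_alg_def
  using kalg.quot_class_gen[OF free_quot(3) S_image_closed] assms by blast

text \<open>The universal property of a presentation, applied twice: first to the relations, then
  to the cyclotomic ones.\<close>

lemma cyc_lift:
  assumes B: "kalg B" and h: "alg_hom (free_alg G) B h"
    and r: "\<And>l r. R l r ==> h l = h r" and s: "\<And>s. s \<in> S ==> h s = \<zero>\<^bsub>B\<^esub>"
  obtains h' where "alg_hom (cyc_alg G R S) B h'" "\<And>p. p \<in> words_in G ==> h' (cyc_class G R S p) = h p"
proof -
  interpret B: kalg B by (rule B)
  have "h p = \<zero>\<^bsub>B\<^esub>" if p: "p \<in> relators R" for p
  proof -
    obtain l r where lr: "p = l - r" "R l r" using p by (auto simp: relators_def)
    have c: "l \<in> words_in G" "r \<in> words_in G" using R_closed[OF lr(2)] by auto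
    have "h l = h ((l - r) + r)" by simp
    also have "\<dots> = h (l - r) \<oplus>\<^bsub>B\<^esub> h r"
      using alg_homD(3)[OF h, unfolded carrier_free_alg, of "l - r" r] c by (simp add: words_in_minus)
    finally have "h r = h (l - r) \<oplus>\<^bsub>B\<^esub> h r" using assms(3)[OF lr(2)] by simp
    then show ?thesis
      using alg_homD(1)[OF h, unfolded carrier_free_alg] c lr
      by (metis B.add.l_cancel_one' B.add.r_cancel_one words_in_minus)
  qed
  then obtain h1 where h1: "alg_hom (presented_alg G R) B h1"
      "\<And>p. p \<in> words_in G ==> h1 (presented_class G R p) = h p"
    using kalg.quot_lift[OF free_kalg relators_closed B h] unfolding presented_alg_def presented_class_def carrier_free_alg
    by metis
  have "h1 s = \<zero>\<^bsub>B\<^esub>" if "s \<in> presented_class G R ` S" for s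
    using that s h1(2) S_closed by auto
  then obtain h2 where h2: "alg_hom (cyc_alg G R S) B h2"
      "\<And>x. x \<in> carrier (presented_alg G R) ==> h2 (quot_class (presented_alg G R) (presented_class G R ` S) x) = h1 x"
    using kalg.quot_lift[OF free_quot(3) S_image_closed B h1(1)] unfolding cyc_alg_def by metis
  have "h2 (cyc_class G R S p) = h p" if "p \<in> words_in G" for p
    using that h2(2) h1(2) unfolding free_quot(1) carrier_free_alg cyc_class_def by auto
  then show ?thesis using that h2(1) by blast
qed

text \<open>The free algebra is generated by its letters, so properties stable under the
  operations need to be checked on letters only.\<close>

lemma free_alg_induct [consumes 1]:
  fixes p :: "'g wrd \<Rightarrow>\<^sub>0 'k"
  assumes p: "p \<in> words_in G" and g: "\<And>g. g \<in> G ==> P (gen g)" and one: "P 1"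
    and add: "\<And>a b. a \<in> words_in G ==> b \<in> words_in G ==> P a ==> P b ==> P (a + b)"
    and mult: "\<And>a b. a \<in> words_in G ==> b \<in> words_in G ==> P a ==> P b ==> P (a * b)"
    and smult: "\<And>a c. a \<in> words_in G ==> P a ==> P (scal c * a)"
  shows "P p"
proof -
  have w: "P (Poly_Mapping.single (Wrd l) 1) \<and> Poly_Mapping.single (Wrd l) (1::'k) \<in> words_in G" if "set l \<subseteq> G" for l
    using that
  proof (induction l)
    case Nil
    then show ?case using one words_in_1[of G] by (simp flip: single_one zero_wrd_def)
  next
    case (Cons g l)
    have eq: "Poly_Mapping.single (Wrd (g # l)) (1::'k) = gen g * Poly_Mapping.single (Wrd l) 1"
      by (simp add: gen_def mult_single plus_wrd_def)
    have gG: "g \<in> G" and l: "P (Poly_Mapping.single (Wrd l) 1)" "Poly_Mapping.single (Wrd l) (1::'k) \<in> words_in G"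
      using Cons by auto
    show ?case
      unfolding eq using mult[OF words_in_gen[OF gG] l(2) g[OF gG] l(1)]
        words_in_mult[OF words_in_gen[OF gG] l(2)] by blast
  qed
  have 0: "P 0" using smult[OF words_in_1 one, of 0] by (simp add: scal_def)
  have t: "P (Poly_Mapping.single v (Poly_Mapping.lookup p v)) \<and> Poly_Mapping.single v (Poly_Mapping.lookup p v) \<in> words_in G"
    if "v \<in> Poly_Mapping.keys p" for v
  proof -
    have "P (Poly_Mapping.single v 1)" "Poly_Mapping.single v (1::'k) \<in> words_in G"
      using w[of "letters v"] p that by (auto simp: words_in_def)
    then have "P (scal (Poly_Mapping.lookup p v) * Poly_Mapping.single v 1)"
      "scal (Poly_Mapping.lookup p v) * Poly_Mapping.single v 1 \<in> words_in G"
      using smult by (auto intro: words_in_intros)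
    then show ?thesis by (simp add: scal_def mult_single)
  qed
  have "P (\<Sum>v\<in>K. Poly_Mapping.single v (Poly_Mapping.lookup p v)) \<and>
      (\<Sum>v\<in>K. Poly_Mapping.single v (Poly_Mapping.lookup p v)) \<in> words_in G"
    if "finite K" "K \<subseteq> Poly_Mapping.keys p" for K
    using that
  proof (induction K)
    case empty then show ?case using 0 by (simp add: words_in_0)
  next
    case (insert v K) then show ?case using t[of v] add by (auto intro: words_in_add)
  qed
  then show ?thesis using poly_mapping_sum_single[of p] by (metis finite_keys order_refl)
qed

lemma cyc_hom_ext:
  assumes B: "alg_hom (cyc_alg G R S) B f" "alg_hom (cyc_alg G R S) B f'"
    and g: "\<And>g. g \<in> G ==> f (cyc_class G R S (gen g)) = f' (cyc_class G R S (gen g))"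
    and x: "x \<in> carrier (cyc_alg G R S)"
  shows "f x = f' x"
proof -
  note D = alg_homD[OF alg_hom_compose[OF cyc_hom B(1)], unfolded carrier_free_alg comp_def]
    alg_homD[OF alg_hom_compose[OF cyc_hom B(2)], unfolded carrier_free_alg comp_def]
  obtain p where p: "p \<in> words_in G" "x = cyc_class G R S p" using x cyc_carrier by auto
  have "f (cyc_class G R S p) = f' (cyc_class G R S p)"
    using p(1)
    by (induction rule: free_alg_induct)
      (use D g in \<open>simp_all\<close>)
  then show ?thesis using p by simp
qed

end

section \<open>Embedding record algebras into a ring type\<close>

definition vscale :: "'k::field \<Rightarrow> ('b \<Rightarrow>\<^sub>0 'k) \<Rightarrow> ('b \<Rightarrow>\<^sub>0 'k)" where
  "vscale c v = Poly_Mapping.map ((*) c) v"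

lemma lookup_vscale [simp]: "Poly_Mapping.lookup (vscale c v) b = c * Poly_Mapping.lookup v b"
  by (simp add: vscale_def Poly_Mapping.map.rep_eq when_def)

interpretation vs: vector_space "vscale :: 'k::field \<Rightarrow> ('b \<Rightarrow>\<^sub>0 'k) \<Rightarrow> ('b \<Rightarrow>\<^sub>0 'k)"
  by unfold_locales (auto intro!: poly_mapping_eqI simp: lookup_add algebra_simps)

interpretation vs: vector_space_pair "vscale :: 'k::field \<Rightarrow> ('b \<Rightarrow>\<^sub>0 'k) \<Rightarrow> ('b \<Rightarrow>\<^sub>0 'k)"
  "vscale :: 'k::field \<Rightarrow> ('b \<Rightarrow>\<^sub>0 'k) \<Rightarrow> ('b \<Rightarrow>\<^sub>0 'k)"
  by unfold_locales

text \<open>Linear endomorphisms of the vector space with basis \<open>'b\<close>. They form a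
  ring type in which every record algebra with elements in \<open>'b\<close> embeds; working there
  makes the algebraic automation for types available.\<close>

typedef (overloaded) ('b, 'k) lin_end =
  "{f :: ('b \<Rightarrow>\<^sub>0 'k::field) \<Rightarrow> ('b \<Rightarrow>\<^sub>0 'k).
      (\<forall>v w. f (v + w) = f v + f w) \<and> (\<forall>c v. f (vscale c v) = vscale c (f v))}"
  by (rule exI[of _ id]) simp

setup_lifting type_definition_lin_end

instantiation lin_end :: (type, field) ring_1
begin

lift_definition zero_lin_end :: "('a, 'b) lin_end" is "\<lambda>v. 0" by simp
lift_definition one_lin_end :: "('a, 'b) lin_end" is "\<lambda>v. v" by simp
lift_definition plus_lin_end :: "('a, 'b) lin_end \<Rightarrow> ('a, 'b) lin_end \<Rightarrow> ('a, 'b) lin_end"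
  is "\<lambda>f g v. f v + g v" by (simp add: vs.scale_right_distrib)
lift_definition minus_lin_end :: "('a, 'b) lin_end \<Rightarrow> ('a, 'b) lin_end \<Rightarrow> ('a, 'b) lin_end"
  is "\<lambda>f g v. f v - g v" by (simp add: vs.scale_right_diff_distrib)
lift_definition uminus_lin_end :: "('a, 'b) lin_end \<Rightarrow> ('a, 'b) lin_end"
  is "\<lambda>f v. - f v" by simp
lift_definition times_lin_end :: "('a, 'b) lin_end \<Rightarrow> ('a, 'b) lin_end \<Rightarrow> ('a, 'b) lin_end"
  is "\<lambda>f g v. f (g v)" by simp

instance
proof
  have "(\<lambda>v :: 'a \<Rightarrow>\<^sub>0 'b. 0) \<noteq> (\<lambda>v. v)"
  proof
    assume "(\<lambda>v :: 'a \<Rightarrow>\<^sub>0 'b. 0) = (\<lambda>v. v)"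
    from fun_cong[OF this, of "Poly_Mapping.single undefined 1"] show False
      by (metis lookup_single_eq lookup_zero zero_neq_one)
  qed
  then show "0 \<noteq> (1 :: ('a, 'b) lin_end)" by transfer
qed (transfer; simp add: fun_eq_iff add_ac; fail | transfer; simp add: fun_eq_iff)+

end

lift_definition homothety :: "'k::field \<Rightarrow> ('b, 'k) lin_end" is vscale
  by (simp add: vs.scale_right_distrib vs.scale_scale mult.commute)

lemma scalars_homothety: "scalars (homothety :: 'k::field \<Rightarrow> ('b, 'k) lin_end)"
  by unfold_locales (transfer; simp add: fun_eq_iff vs.scale_left_distrib vs.scale_scale)+

text \<open>\<open>\<rho>\<close> embeds \<open>A\<close> into a typed ring; the unit of \<open>A\<close> goes to an idempotent.\<close>

definition embeds :: "('k::field \<Rightarrow> 'r::ring_1) \<Rightarrow> ('k, 'a) module \<Rightarrow> ('a \<Rightarrow> 'r) \<Rightarrow> bool" where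
  "embeds \<kappa> A \<rho> \<longleftrightarrow> scalars \<kappa> \<and> inj_on \<rho> (carrier A) \<and>
     (\<forall>x \<in> carrier A. \<forall>y \<in> carrier A. \<rho> (x \<oplus>\<^bsub>A\<^esub> y) = \<rho> x + \<rho> y \<and> \<rho> (x \<otimes>\<^bsub>A\<^esub> y) = \<rho> x * \<rho> y) \<and>
     (\<forall>c. \<forall>x \<in> carrier A. \<rho> (c \<odot>\<^bsub>A\<^esub> x) = \<kappa> c * \<rho> x)"

context kalg
begin

text \<open>The formal linear combination \<open>v\<close> of elements of \<open>A\<close>,
  evaluated in \<open>A\<close>.\<close>

definition realize :: "('a \<Rightarrow>\<^sub>0 'k) \<Rightarrow> 'a" where
  "realize v = finsum A (\<lambda>b. Poly_Mapping.lookup v b \<odot> b) (Poly_Mapping.keys v \<inter> carrier A)"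

lemma smult_zero_left [simp]: "x \<in> carrier A ==> 0 \<odot> x = \<zero>"
  using smult_add_left[of x 0 0] by (metis add.r_cancel_one add_0 smult_closed)

lemma realize_superset:
  assumes "finite S" "S \<subseteq> carrier A" "Poly_Mapping.keys v \<inter> carrier A \<subseteq> S"
  shows "realize v = finsum A (\<lambda>b. Poly_Mapping.lookup v b \<odot> b) S"
  unfolding realize_def
  by (rule add.finprod_mono_neutral_cong_left) (use assms in \<open>auto simp: in_keys_iff\<close>)

lemma realize_closed [simp, intro]: "realize v \<in> carrier A"
  unfolding realize_def by (rule finsum_closed) auto

lemma realize_add: "realize (v + w) = realize v \<oplus> realize w"
proof -
  let ?S = "(Poly_Mapping.keys v \<union> Poly_Mapping.keys w) \<inter> carrier A"
  have "realize (v + w) = finsum A (\<lambda>b. Poly_Mapping.lookup (v + w) b \<odot> b) ?S"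
    by (rule realize_superset) (use Poly_Mapping.keys_add[of v w] in auto)
  also have "\<dots> = finsum A (\<lambda>b. Poly_Mapping.lookup v b \<odot> b \<oplus> Poly_Mapping.lookup w b \<odot> b) ?S"
    by (rule finsum_cong') (auto simp: lookup_add smult_add_left)
  also have "\<dots> = finsum A (\<lambda>b. Poly_Mapping.lookup v b \<odot> b) ?S \<oplus> finsum A (\<lambda>b. Poly_Mapping.lookup w b \<odot> b) ?S"
    by (rule finsum_addf) auto
  also have "finsum A (\<lambda>b. Poly_Mapping.lookup v b \<odot> b) ?S = realize v"
    by (rule realize_superset[symmetric]) auto
  also have "finsum A (\<lambda>b. Poly_Mapping.lookup w b \<odot> b) ?S = realize w"
    by (rule realize_superset[symmetric]) auto
  finally show ?thesis .
qed

lemma smult_finsum: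
  assumes "finite S" "\<And>b. b \<in> S ==> f b \<in> carrier A"
  shows "c \<odot> finsum A f S = finsum A (\<lambda>b. c \<odot> f b) S"
  using assms by (induction S) (auto simp: smult_add_right Pi_def)

lemma realize_scale: "realize (vscale c v) = c \<odot> realize v"
proof -
  let ?S = "Poly_Mapping.keys v \<inter> carrier A"
  have "realize (vscale c v) = finsum A (\<lambda>b. Poly_Mapping.lookup (vscale c v) b \<odot> b) ?S"
    by (rule realize_superset) (auto simp: in_keys_iff)
  also have "\<dots> = finsum A (\<lambda>b. c \<odot> (Poly_Mapping.lookup v b \<odot> b)) ?S"
    by (rule finsum_cong') (auto simp: smult_smult)
  also have "\<dots> = c \<odot> realize v"
    unfolding realize_def by (rule smult_finsum[symmetric]) auto
  finally show ?thesis .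
qed

lemma realize_single: "x \<in> carrier A ==> realize (Poly_Mapping.single x 1) = x"
  by (simp add: realize_def)

text \<open>A linear section of \<open>realize\<close>, from a complement of its kernel.\<close>

lemma linear_section:
  obtains s where "\<And>x. x \<in> carrier A ==> realize (s x) = x"
    "\<And>x y. x \<in> carrier A ==> y \<in> carrier A ==> s (x \<oplus> y) = s x + s y"
    "\<And>c x. x \<in> carrier A ==> s (c \<odot> x) = vscale c (s x)"
proof -
  define N where "N = {v. realize v = \<zero>}"
  have r0: "realize 0 = \<zero>" by (simp add: realize_def)
  have rdiff: "realize (v - w) = \<zero> \<longleftrightarrow> realize v = realize w" for v w
  proof -
    have "realize v = realize (v - w) \<oplus> realize w"
      using realize_add[of "v - w" w] by simp
    then show ?thesis by (metis add.l_cancel_one' realize_closed add.r_cancel_one zero_closed l_zero)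
  qed
  have sub: "vs.subspace N"
    by (rule vs.subspaceI) (auto simp: N_def r0 realize_add realize_scale)
  obtain B0 where B0: "B0 \<subseteq> N" "vs.independent B0" "N \<subseteq> vs.span B0"
    using vs.maximal_independent_subset[of N] by blast
  obtain B1 where B1: "B0 \<subseteq> B1" "vs.independent B1" "UNIV \<subseteq> vs.span B1"
    using vs.maximal_independent_subset_extend[of B0 UNIV] B0(2) by auto
  obtain p where p: "Vector_Spaces.linear vscale vscale p" "\<forall>b\<in>B1. p b = (if b \<in> B0 then 0 else b)"
    using vs.linear_independent_extend[OF B1(2), of "\<lambda>b. if b \<in> B0 then 0 else b"] by blast
  interpret p: Vector_Spaces.linear vscale vscale p by (rule p(1))
  have pN: "p v = 0" if "v \<in> N" for v
    by (rule vs.linear_eq_0_on_span[OF p(1), of B0]) (use p(2) B0 B1 that in auto)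
  have "p v - v \<in> N" for v
  proof -
    have "v \<in> vs.span B1" using B1 by auto
    then show ?thesis
    proof (induction rule: vs.span_induct_alt)
      case base then show ?case using vs.subspace_0[OF sub] by (simp add: p.zero)
    next
      case (step c x y)
      have "p x - x \<in> N" using p(2) step B0(1) vs.subspace_neg[OF sub] vs.subspace_0[OF sub] by auto
      then have "vscale c (p x - x) + (p y - y) \<in> N"
        using step sub by (intro vs.subspace_add vs.subspace_scale) auto
      then show ?case by (simp add: p.add p.scale vs.scale_right_diff_distrib algebra_simps)
    qed
  qed
  then have rp: "realize (p v) = realize v" for v using rdiff by (simp add: N_def)
  have peq: "p v = p w" if "realize v = realize w" for v w
    using pN[of "v - w"] that rdiff by (simp add: N_def p.diff)
  show ?thesis
  proof (rule that[of "\<lambda>x. p (Poly_Mapping.single x 1)"])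
    show "p (Poly_Mapping.single (x \<oplus> y) 1) = p (Poly_Mapping.single x 1) + p (Poly_Mapping.single y 1)"
      if "x \<in> carrier A" "y \<in> carrier A" for x y
      using that by (subst p.add[symmetric], intro peq) (simp add: realize_single realize_add)
    show "p (Poly_Mapping.single (c \<odot> x) 1) = vscale c (p (Poly_Mapping.single x 1))"
      if "x \<in> carrier A" for c x
      using that by (subst p.scale[symmetric], intro peq) (simp add: realize_single realize_scale)
  qed (simp add: rp realize_single)
qed

text \<open>A linear section \<open>s\<close> of the evaluation map makes \<open>x \<mapsto> s
  \<circ> (x \<otimes> -) \<circ> realize\<close> a faithful representation by
  endomorphisms.\<close>

lemma embedding:
  obtains \<rho> :: "'a \<Rightarrow> ('a, 'k) lin_end" where "embeds homothety A \<rho>"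
proof -
  obtain s where s: "\<And>x. x \<in> carrier A ==> realize (s x) = x"
    "\<And>x y. x \<in> carrier A ==> y \<in> carrier A ==> s (x \<oplus> y) = s x + s y"
    "\<And>c x. x \<in> carrier A ==> s (c \<odot> x) = vscale c (s x)"
    using linear_section by blast
  define f where "f x v = (if x \<in> carrier A then s (x \<otimes> realize v) else 0)" for x v
  define \<rho> where "\<rho> x = Abs_lin_end (f x)" for x
  have Rep: "Rep_lin_end (\<rho> x) = f x" for x
    unfolding \<rho>_def
    by (rule Abs_lin_end_inverse)
      (auto simp: f_def realize_add realize_scale r_distr s(2,3) smult_mult_right)
  have "x = y" if "x \<in> carrier A" "y \<in> carrier A" "\<rho> x = \<rho> y" for x y
  proof -
    have "f x (Poly_Mapping.single \<one> 1) = f y (Poly_Mapping.single \<one> 1)"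
      using that(3) Rep by metis
    then have "s x = s y" using that by (simp add: f_def realize_single)
    then show ?thesis using s(1) that by metis
  qed
  moreover have "\<rho> (x \<oplus> y) = \<rho> x + \<rho> y" "\<rho> (x \<otimes> y) = \<rho> x * \<rho> y"
    if "x \<in> carrier A" "y \<in> carrier A" for x y
    by (rule Rep_lin_end_inject[THEN iffD1], rule ext,
        use that in \<open>simp add: Rep plus_lin_end.rep_eq times_lin_end.rep_eq f_def l_distr s m_assoc\<close>)+
  moreover have "\<rho> (c \<odot> x) = homothety c * \<rho> x" if "x \<in> carrier A" for c x
    by (rule Rep_lin_end_inject[THEN iffD1], rule ext,
        use that in \<open>simp add: Rep homothety.rep_eq times_lin_end.rep_eq f_def smult_mult_left s\<close>)
  ultimately have "embeds homothety A \<rho>"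
    unfolding embeds_def by (auto simp: inj_on_def scalars_homothety)
  then show ?thesis using that by blast
qed

end

section \<open>Nilpotency and cancellation\<close>

text \<open>\<open>a\<close> is nilpotent on \<open>z\<close>.\<close>

definition nilp :: "'r::ring_1 \<Rightarrow> 'r \<Rightarrow> bool" where
  "nilp a z \<longleftrightarrow> (\<exists>m. a ^ m * z = 0)"

lemma nilp_le: "a ^ m * z = 0 ==> m \<le> k ==> a ^ k * (z::'r::ring_1) = 0"
  by (metis le_Suc_ex add.commute power_add mult.assoc mult_zero_right)

lemma power_commute: "a * b = b * (a::'r::ring_1) ==> a ^ m * b = b * a ^ m"
  by (rule power_commuting_commutes)

text \<open>The binomial theorem, organized as an induction on \<open>m + k\<close>: one of the
  two summands is used up in each step.\<close>

lemma binomial_nilpotent: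
  assumes "a * b = b * (a::'r::ring_1)" "a ^ m * z = 0" "b ^ k * z = 0"
  shows "(a + b) ^ (m + k) * z = 0"
  using assms(2,3)
proof (induction "m + k" arbitrary: m k z)
  case 0 then show ?case by simp
next
  case (Suc N)
  show ?case
  proof (cases "m = 0 \<or> k = 0")
    case True then show ?thesis using Suc by auto
  next
    case False
    then obtain m' k' where mk: "m = Suc m'" "k = Suc k'" by (meson not0_implies_Suc)
    have 1: "(a + b) ^ (m' + k) * (a * z) = 0"
    proof (rule Suc(1))
      show "a ^ m' * (a * z) = 0" using Suc(3) mk by (simp add: mult.assoc[symmetric] power_commutes)
      have "b ^ k * a = a * b ^ k" using power_commute[of b a k] assms(1) by simp
      then show "b ^ k * (a * z) = 0" using Suc(4) by (metis mult.assoc mult_zero_right)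
    qed (use Suc mk in simp)
    have 2: "(a + b) ^ (m + k') * (b * z) = 0"
    proof (rule Suc(1))
      show "b ^ k' * (b * z) = 0" using Suc(4) mk by (simp add: mult.assoc[symmetric] power_commutes)
      have "a ^ m * b = b * a ^ m" using power_commute[of a b m] assms(1) by simp
      then show "a ^ m * (b * z) = 0" using Suc(3) by (metis mult.assoc mult_zero_right)
    qed (use Suc mk in simp)
    have "(a + b) ^ (m + k) * z = (a + b) ^ N * ((a + b) * z)"
      using Suc(2) by (metis mult.assoc power_Suc2)
    also have "\<dots> = (a + b) ^ N * (a * z) + (a + b) ^ N * (b * z)"
      by (simp add: distrib_left distrib_right)
    also have "\<dots> = 0" using 1 2 Suc(2) mk by simp
    finally show ?thesis .
  qed
qed

lemma nilp_add: "a * b = b * a ==> nilp a z ==> nilp b z ==> nilp (a + b) z"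
  unfolding nilp_def using binomial_nilpotent by blast

lemma power_mult_commuting:
  assumes "a * b = b * (a::'r::ring_1)"
  shows "(a * b) ^ m = b ^ m * a ^ m"
proof (induction m)
  case (Suc m)
  have "(a * b) ^ Suc m = (a * b) * (b ^ m * a ^ m)" by (simp only: power_Suc Suc)
  also have "\<dots> = b * (a * b ^ m) * a ^ m" by (metis assms mult.assoc)
  also have "a * b ^ m = b ^ m * a" using power_commute[of b a m] assms by simp
  finally show ?case by (simp add: mult.assoc)
qed simp

lemma nilp_mult: "a * b = b * a ==> nilp a z ==> nilp (a * b) z"
  unfolding nilp_def by (metis power_mult_commuting mult.assoc mult_zero_right)

lemma nilp_uminus: "nilp a z ==> nilp (- a) z"
  using nilp_mult[of a "- 1" z] by simp

lemma nilp_diff: "a * b = b * a ==> nilp a z ==> nilp b z ==> nilp (a - b) z"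
  using nilp_add[of a "- b" z] nilp_uminus[of b z] by simp

lemma nilp_zero: "nilp 0 z"
  unfolding nilp_def by (rule exI[of _ 1]) simp

lemma nilp_sum:
  assumes "\<And>j. j \<in> J ==> nilp (f j) z" "\<And>j k. j \<in> J ==> k \<in> J ==> f j * f k = f k * f j"
  shows "nilp (sum f J) z"
  using assms
proof (induction J rule: infinite_finite_induct)
  case (insert j J)
  have "f j * sum f J = sum f J * f j"
    using insert.prems(2) by (simp add: sum_distrib_left sum_distrib_right cong: sum.cong)
  then show ?case using insert by (simp add: nilp_add)
qed (simp_all add: nilp_zero)

lemma nilp_mult_right: "z * b = b * z ==> nilp a z ==> nilp a (z * b)"
  unfolding nilp_def by (metis mult.assoc mult_zero_left)

lemma nilp_power_eq: "a ^ m = b * c ==> a * b = b * a ==> a * c = c * a ==> b * c = c * b ==> nilp b z ==> nilp a z"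
  unfolding nilp_def by (metis power_mult_commuting mult.assoc mult_zero_right power_mult)

context scalars
begin

lemma \<kappa>_mult_left: "z * (\<kappa> c * w) = \<kappa> c * (z * w)"
  by (metis \<kappa>_central mult.assoc)

lemma nilp_\<kappa>: "nilp a z ==> nilp (\<kappa> c * a) z"
  using nilp_mult[of a "\<kappa> c" z] by (simp add: \<kappa>_central)

text \<open>A nonzero scalar plus a nilpotent element cannot annihilate anything: \<open>N\<close>
  would act on \<open>z\<close> as the nonzero scalar \<open>- c\<close>.\<close>

lemma cancel_left:
  assumes "nilp N z" "c \<noteq> 0" "(\<kappa> c + N) * z = 0"
  shows "z = 0"
proof -
  have Nz: "N * z = \<kappa> (- c) * z"
    using assms(3) by (simp add: distrib_right \<kappa>_uminus eq_neg_iff_add_eq_0 add.commute)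
  have "N ^ m * z = \<kappa> ((- c) ^ m) * z" for m
  proof (induction m)
    case (Suc m)
    have "N ^ Suc m * z = N * (N ^ m * z)" by (simp add: mult.assoc)
    also have "\<dots> = \<kappa> ((- c) ^ m) * (N * z)" by (simp add: Suc \<kappa>_mult_left)
    also have "\<dots> = \<kappa> ((- c) ^ Suc m) * z" by (metis Nz \<kappa>_mult mult.assoc power_Suc2)
    finally show ?case .
  qed simp
  then obtain m where "\<kappa> ((- c) ^ m) * z = \<kappa> ((- c) ^ m) * 0" using assms(1) unfolding nilp_def by auto
  then show ?thesis by (rule \<kappa>_cancel[rotated]) (use assms(2) in simp)
qed

lemma cancel_right:
  assumes "nilp N E" "c \<noteq> 0" "N * E = E * N" "z * ((\<kappa> c + N) * E) = 0"
  shows "z * E = 0"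
proof -
  have zN: "(z * E) * N = \<kappa> (- c) * (z * E)"
    using assms(3,4) by (simp add: distrib_right distrib_left \<kappa>_uminus \<kappa>_mult_left mult.assoc
        eq_neg_iff_add_eq_0 add.commute)
  have "z * E * N ^ m = \<kappa> ((- c) ^ m) * (z * E)" for m
  proof (induction m)
    case (Suc m)
    have "z * E * N ^ Suc m = (z * E * N ^ m) * N" by (simp add: mult.assoc power_commutes)
    also have "\<dots> = \<kappa> ((- c) ^ m) * (z * E * N)" by (subst Suc) (simp add: mult.assoc)
    also have "\<dots> = \<kappa> ((- c) ^ Suc m) * (z * E)" by (metis zN \<kappa>_mult mult.assoc power_Suc2)
    finally show ?case .
  qed simp
  moreover obtain m where "N ^ m * E = 0" using assms(1) unfolding nilp_def by auto
  moreover have "E * N ^ m = N ^ m * E" using power_commute[OF assms(3), of m] by simp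
  ultimately have "\<kappa> ((- c) ^ m) * (z * E) = \<kappa> ((- c) ^ m) * 0" by (metis mult.assoc mult_zero_right)
  then show ?thesis by (rule \<kappa>_cancel[rotated]) (use assms(2) in simp)
qed

definition subalg :: "'r set \<Rightarrow> bool" where
  "subalg S \<longleftrightarrow> (\<forall>a\<in>S. \<forall>b\<in>S. a + b \<in> S \<and> a * b \<in> S) \<and> (\<forall>c. \<forall>a\<in>S. \<kappa> c * a \<in> S)"

lemma subalg_minus: "subalg S ==> a \<in> S ==> b \<in> S ==> a - b \<in> S"
  unfolding subalg_def using \<kappa>_uminus[of 1] by (metis \<kappa>_1 add_uminus_conv_diff mult_minus1)

lemma subalg_uminus: "subalg S ==> a \<in> S ==> - a \<in> S"
  unfolding subalg_def using \<kappa>_uminus[of 1] by (metis \<kappa>_1 mult_minus1)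

lemma subalg_zero: "subalg S ==> a \<in> S ==> 0 \<in> S"
  using subalg_minus[of S a a] by simp

lemma subalg_sum: "subalg S ==> 0 \<in> S ==> (\<And>j. j \<in> J ==> f j \<in> S) ==> sum f J \<in> S"
  by (induction J rule: infinite_finite_induct) (auto simp: subalg_def)

text \<open>The geometric series inverts \<open>c + N\<close>. It stays in every subalgebra and
  commutes with everything that commutes with \<open>N\<close> and \<open>z\<close>; both are
  needed to remain inside the corners and quotients considered later.\<close>

lemma inverse_exists:
  assumes "nilp N z" "c \<noteq> 0"
  obtains w where "(\<kappa> c + N) * w = z"
    "\<And>a. a * N = N * a ==> a * z = z * a ==> a * w = w * a"
    "\<And>S. subalg S ==> N \<in> S ==> z \<in> S ==> w \<in> S"
proof -
  have "\<exists>w. (\<kappa> c + N) * w = z \<and> (\<forall>a. a * N = N * a \<longrightarrow> a * z = z * a \<longrightarrow> a * w = w * a)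
      \<and> (\<forall>S. subalg S \<longrightarrow> N \<in> S \<longrightarrow> z \<in> S \<longrightarrow> w \<in> S)" if "N ^ m * z = 0" for m
    using that
  proof (induction m arbitrary: z)
    case 0
    then show ?case by (intro exI[of _ 0]) (auto intro: subalg_zero)
  next
    case (Suc m)
    have "N ^ m * (N * z) = 0" using Suc.prems by (metis mult.assoc power_Suc2)
    from Suc.IH[OF this] obtain w where w: "(\<kappa> c + N) * w = N * z"
      "\<And>a. a * N = N * a ==> a * (N * z) = (N * z) * a ==> a * w = w * a"
      "\<And>S. subalg S ==> N \<in> S ==> N * z \<in> S ==> w \<in> S" by blast
    show ?case
    proof (intro exI conjI allI impI)
      show "(\<kappa> c + N) * (\<kappa> (inverse c) * (z - w)) = z"
      proof -
        have "(\<kappa> c + N) * (\<kappa> (inverse c) * (z - w)) = \<kappa> (inverse c) * ((\<kappa> c + N) * (z - w))"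
          by (rule \<kappa>_mult_left)
        also have "(\<kappa> c + N) * (z - w) = \<kappa> c * z" using w(1) by (simp add: algebra_simps)
        finally show ?thesis using \<kappa>_inverse[OF assms(2)] by (simp add: mult.assoc[symmetric])
      qed
      show "a * (\<kappa> (inverse c) * (z - w)) = \<kappa> (inverse c) * (z - w) * a"
        if "a * N = N * a" "a * z = z * a" for a
      proof -
        have "a * (N * z) = N * z * a" using that by (metis mult.assoc)
        then have "a * w = w * a" using w(2) that by blast
        then have "a * (z - w) = (z - w) * a" using that by (simp add: algebra_simps)
        then show ?thesis by (metis \<kappa>_mult_left mult.assoc)
      qed
      show "\<kappa> (inverse c) * (z - w) \<in> S" if "subalg S" "N \<in> S" "z \<in> S" for S
        using that w(3)[of S] subalg_minus[of S z w] by (auto simp: subalg_def)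
    qed
  qed
  then show ?thesis using assms(1) that unfolding nilp_def by metis
qed

end

section \<open>Quantum integers\<close>

text \<open>A common parametrization of the two cases: \<open>v i\<close> is the residue
  \<open>i\<close> in the degenerate case and the quantum integer \<open>(q\<^sup>i - 1) / (q -
  1)\<close> in the non-degenerate case. With \<open>X = 1 + (q - 1) x\<close> the non-degenerate
  relations take a form that specializes to the degenerate ones at \<open>q = 1\<close>.\<close>

locale quantum =
  fixes q :: "'k::field" and e :: nat and v :: "int \<Rightarrow> 'k"
  assumes q_nz: "q \<noteq> 0" and v_0: "v 0 = 0" and v_Suc: "v (i + 1) = q * v i + 1"
    and v_eq_iff: "v i = v j \<longleftrightarrow> [i = j] (mod int e)"
begin

definition w :: "int \<Rightarrow> 'k" where "w i = 1 + (q - 1) * v i"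

lemma w_Suc: "w (i + 1) = q * w i"
  unfolding w_def v_Suc by (simp add: algebra_simps)

lemma w_nz: "w i \<noteq> 0"
proof (induction i rule: int_induct[where k = 0])
  case base then show ?case by (simp add: w_def v_0)
next
  case (step1 i) then show ?case using q_nz by (simp add: w_Suc)
next
  case (step2 i) then show ?case using w_Suc[of "i - 1"] by auto
qed

lemma w_cong: "[i = j] (mod int e) ==> w i = w j"
  using v_eq_iff by (simp add: w_def)

lemma zero_not_one: "\<not> [0 = 1] (mod int e)"
  using v_eq_iff[of 0 1] v_Suc[of 0] v_0 by simp

lemma v_step_iff: "v i - q * v j - 1 = 0 \<longleftrightarrow> [i - j = 1] (mod int e)"
proof -
  have "v i - q * v j - 1 = 0 \<longleftrightarrow> v i = v (j + 1)" unfolding v_Suc by (auto simp: algebra_simps)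
  also have "\<dots> \<longleftrightarrow> [i = j + 1] (mod int e)" by (rule v_eq_iff)
  also have "\<dots> \<longleftrightarrow> [i - j = 1] (mod int e)"
    by (simp add: cong_iff_dvd_diff algebra_simps)
  finally show ?thesis .
qed

end

section \<open>Systems of weight idempotents\<close>

lemma perm_act_transpose [simp]: "perm_act (sigma r) i s = i (sigma r s)"
  by (simp add: perm_act_def)

lemma perm_act_involutive [simp]: "perm_act (sigma r) (perm_act (sigma r) i) = i"
  by (rule ext) simp

text \<open>Orthogonal idempotents \<open>\<epsilon> i\<close> whose sum is the local unit
  \<open>u\<close>, such that \<open>x r\<close> is \<open>v (i r)\<close> plus a nilpotent
  element on \<open>\<epsilon> i\<close>. The local unit allows one to treat a block as a corner
  of the surrounding ring.\<close>

locale weight_system = scalars \<kappa> + quantum q e v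
  for \<kappa> :: "'k::field \<Rightarrow> 'r::ring_1" and q :: 'k and e and v :: "int \<Rightarrow> 'k" +
  fixes n :: nat and C :: "(nat \<Rightarrow> int) set" and u :: 'r and x :: "nat \<Rightarrow> 'r" and \<epsilon> :: "(nat \<Rightarrow> int) \<Rightarrow> 'r"
  assumes C_finite: "finite C" and C_tuples: "C \<subseteq> tuples n e"
    and \<epsilon>_mult: "i \<in> C ==> j \<in> C ==> \<epsilon> i * \<epsilon> j = (if i = j then \<epsilon> i else 0)"
    and \<epsilon>_sum: "(\<Sum>i\<in>C. \<epsilon> i) = u"
    and x_u: "r \<in> {1..n} ==> x r * u = x r" and u_x: "r \<in> {1..n} ==> u * x r = x r"
    and x_\<epsilon>: "r \<in> {1..n} ==> i \<in> C ==> x r * \<epsilon> i = \<epsilon> i * x r"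
    and x_x: "r \<in> {1..n} ==> s \<in> {1..n} ==> x r * x s = x s * x r"
    and x_nilp: "i \<in> C ==> r \<in> {1..n} ==> nilp (x r - \<kappa> (v (i r))) (\<epsilon> i)"
begin

lemma \<epsilon>_idem: "i \<in> C ==> \<epsilon> i * \<epsilon> i = \<epsilon> i" by (simp add: \<epsilon>_mult)

lemma u_\<epsilon>: "i \<in> C ==> u * \<epsilon> i = \<epsilon> i" "i \<in> C ==> \<epsilon> i * u = \<epsilon> i"
  using C_finite by (simp_all add: \<epsilon>_sum[symmetric] sum_distrib_left sum_distrib_right \<epsilon>_mult
      if_distrib sum.delta sum.delta' cong: if_cong)

lemma u_u: "u * u = u"
proof -
  have "u * u = (\<Sum>i\<in>C. u * \<epsilon> i)" by (simp add: \<epsilon>_sum[symmetric] sum_distrib_left)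
  also have "\<dots> = u" using \<epsilon>_sum by (simp add: u_\<epsilon>)
  finally show ?thesis .
qed

lemma residue_eq: "i \<in> C ==> j \<in> C ==> r \<in> {1..n} ==> s \<in> {1..n} ==> v (i r) = v (j s) \<longleftrightarrow> i r = j s"
  using C_tuples unfolding v_eq_iff
  by (auto simp: tuples_def residue_set_def cong_def PiE_iff subset_iff)

lemma tuple_eqI: "i \<in> tuples n e ==> j \<in> tuples n e ==> (\<And>r. r \<in> {1..n} ==> i r = j r) ==> i = j"
  unfolding tuples_def by (intro PiE_ext[of i "{1..n}" "\<lambda>_. residue_set e" j]) auto

lemma perm_act_tuples: "i \<in> tuples n e ==> r \<in> {1..<n} ==> perm_act (sigma r) i \<in> tuples n e"
  by (auto simp: tuples_def PiE_iff extensional_def transpose_def)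

text \<open>Polynomials in the \<open>x r\<close> commute with each other and with the idempotents.\<close>

inductive pol :: "'r \<Rightarrow> bool" where
  pol_x: "r \<in> {1..n} ==> pol (x r)"
| pol_u: "pol u"
| pol_\<kappa>: "pol (\<kappa> c)"
| pol_add: "pol f ==> pol g ==> pol (f + g)"
| pol_diff: "pol f ==> pol g ==> pol (f - g)"
| pol_mult: "pol f ==> pol g ==> pol (f * g)"

lemma pol_commute_gen:
  assumes "pol f" "\<And>r. r \<in> {1..n} ==> x r * z = z * x r" "u * z = z * u"
  shows "f * z = z * f"
  using assms(1)
proof induction
  case (pol_mult f g) then show ?case by (metis mult.assoc)
qed (simp_all add: assms(2,3) \<kappa>_central[of z] algebra_simps)

lemma pol_\<epsilon>: "pol f ==> i \<in> C ==> f * \<epsilon> i = \<epsilon> i * f"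
  by (rule pol_commute_gen) (auto simp: x_\<epsilon> u_\<epsilon>)

lemma pol_commute: "pol f ==> pol g ==> f * g = g * f"
proof (rule pol_commute_gen)
  show "x r * g = g * x r" if "pol g" "r \<in> {1..n}" for r
    by (rule pol_commute_gen[OF that(1), symmetric]) (use that in \<open>auto simp: x_x x_u u_x\<close>)
  show "u * g = g * u" if "pol g"
    by (rule pol_commute_gen[OF that(1), symmetric]) (auto simp: x_u u_x)
qed auto

lemma eq_by_weights:
  assumes "a * u = a" "b * u = b" "\<And>i. i \<in> C ==> a * \<epsilon> i = b * \<epsilon> i"
  shows "a = b"
proof -
  have "a * u = b * u" unfolding \<epsilon>_sum[symmetric] sum_distrib_left by (rule sum.cong) (auto simp: assms)
  then show ?thesis using assms by simp
qed

text \<open>Right multiplication by \<open>f\<close> is injective on the weight space of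
  \<open>i\<close>.\<close>

definition regular :: "'r \<Rightarrow> (nat \<Rightarrow> int) \<Rightarrow> bool" where
  "regular f i \<longleftrightarrow> f * \<epsilon> i = \<epsilon> i * f \<and> (\<forall>z. z * f * \<epsilon> i = 0 \<longrightarrow> z * \<epsilon> i = 0)"

lemma regular_cancel: "regular f i ==> z * f * \<epsilon> i = z' * f * \<epsilon> i ==> z * \<epsilon> i = z' * \<epsilon> i"
  unfolding regular_def by (metis eq_iff_diff_eq_0 left_diff_distrib)

lemma regular_mult: "regular f i ==> regular g i ==> regular (f * g) i"
  unfolding regular_def by (metis mult.assoc)

lemma regularI:
  assumes "f * \<epsilon> i = (\<kappa> c + N) * \<epsilon> i" "nilp N (\<epsilon> i)" "c \<noteq> 0" "N * \<epsilon> i = \<epsilon> i * N" "f * \<epsilon> i = \<epsilon> i * f"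
  shows "regular f i"
  unfolding regular_def
proof (intro conjI allI impI assms(5))
  fix z assume "z * f * \<epsilon> i = 0"
  then have "z * ((\<kappa> c + N) * \<epsilon> i) = 0" using assms(1) by (simp add: mult.assoc)
  then show "z * \<epsilon> i = 0" using cancel_right assms by blast
qed

lemma regular_\<kappa>: "c \<noteq> 0 ==> regular (\<kappa> c) i"
  by (rule regularI[of _ _ c 0]) (auto simp: nilp_zero \<kappa>_central)

definition d where "d r s = x r - x s"
definition G where "G r s = x r - \<kappa> q * x s - u"
definition h where "h r = u + \<kappa> (q - 1) * x r"
text \<open>The polynomial by which the intertwiner and \<open>\<psi>\<close> differ:
  \<open>G\<close> vanishes at weights with \<open>i r - i s = 1\<close>, where a scalar takes its
  place.\<close>

definition gg where "gg a b r s = (if [a - b = 1] (mod int e) then \<kappa> (w a) else G r s)"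

lemma linear_\<epsilon>:
  assumes "i \<in> C" "r \<in> {1..n}" "s \<in> {1..n}"
  shows "\<exists>N. (\<kappa> a * x r + \<kappa> b * x s + \<kappa> c * u) * \<epsilon> i = (\<kappa> (a * v (i r) + b * v (i s) + c) + N) * \<epsilon> i
    \<and> nilp N (\<epsilon> i) \<and> N * \<epsilon> i = \<epsilon> i * N"
proof (intro exI conjI)
  define R S where "R = x r - \<kappa> (v (i r))" and "S = x s - \<kappa> (v (i s))"
  let ?N = "\<kappa> a * R + \<kappa> b * S"
  have RS: "R * S = S * R" using x_x[OF assms(2,3)]
    by (simp add: R_def S_def algebra_simps \<kappa>_central[of "x r"] \<kappa>_central[of "x s"] \<kappa>_mult[symmetric] mult.commute)
  show "(\<kappa> a * x r + \<kappa> b * x s + \<kappa> c * u) * \<epsilon> i = (\<kappa> (a * v (i r) + b * v (i s) + c) + ?N) * \<epsilon> i"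
    by (simp add: R_def S_def algebra_simps \<kappa>_add \<kappa>_mult u_\<epsilon>[OF assms(1)])
  show "nilp ?N (\<epsilon> i)"
  proof (rule nilp_add)
    show "\<kappa> a * R * (\<kappa> b * S) = \<kappa> b * S * (\<kappa> a * R)"
    proof -
      have "\<kappa> a * R * (\<kappa> b * S) = \<kappa> (a * b) * (R * S)" "\<kappa> b * S * (\<kappa> a * R) = \<kappa> (b * a) * (S * R)"
        by (simp_all add: mult.assoc \<kappa>_mult \<kappa>_mult_left[of R] \<kappa>_mult_left[of S])
      then show ?thesis using RS by (simp add: mult.commute)
    qed
  qed (use x_nilp assms in \<open>auto intro: nilp_\<kappa> simp: R_def S_def\<close>)
  have "R * \<epsilon> i = \<epsilon> i * R" "S * \<epsilon> i = \<epsilon> i * S"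
    using x_\<epsilon> assms by (simp_all add: R_def S_def algebra_simps \<kappa>_central[of "\<epsilon> i"])
  then show "?N * \<epsilon> i = \<epsilon> i * ?N" by (simp add: distrib_left distrib_right mult.assoc \<kappa>_mult_left[of "\<epsilon> i"])
qed

lemma poly_\<epsilon>:
  assumes "i \<in> C" "r \<in> {1..n}" "s \<in> {1..n}"
  shows "d r s * \<epsilon> i = \<epsilon> i * d r s" "G r s * \<epsilon> i = \<epsilon> i * G r s" "h r * \<epsilon> i = \<epsilon> i * h r"
    "gg a b r s * \<epsilon> i = \<epsilon> i * gg a b r s"
  using x_\<epsilon>[OF assms(2,1)] x_\<epsilon>[OF assms(3,1)]
  by (simp_all add: d_def G_def h_def gg_def algebra_simps \<kappa>_mult_left[of "\<epsilon> i"] u_\<epsilon>[OF assms(1)] \<kappa>_central[of "\<epsilon> i"])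

lemma regular_linear:
  assumes "i \<in> C" "r \<in> {1..n}" "s \<in> {1..n}" "a * v (i r) + b * v (i s) + c \<noteq> 0"
    and f: "f = \<kappa> a * x r + \<kappa> b * x s + \<kappa> c * u"
  shows "regular f i"
proof -
  obtain N where "f * \<epsilon> i = (\<kappa> (a * v (i r) + b * v (i s) + c) + N) * \<epsilon> i"
    "nilp N (\<epsilon> i)" "N * \<epsilon> i = \<epsilon> i * N" using linear_\<epsilon>[OF assms(1-3)] f by metis
  moreover have "f * \<epsilon> i = \<epsilon> i * f"
    using x_\<epsilon>[OF assms(2,1)] x_\<epsilon>[OF assms(3,1)] f
    by (simp add: distrib_left distrib_right mult.assoc \<kappa>_mult_left[of "\<epsilon> i"] u_\<epsilon>[OF assms(1)])
  ultimately show ?thesis using regularI assms(4) by blast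
qed

lemma inverse_linear:
  assumes "i \<in> C" "r \<in> {1..n}" "s \<in> {1..n}" "a * v (i r) + b * v (i s) + c \<noteq> 0"
    and f: "f = \<kappa> a * x r + \<kappa> b * x s + \<kappa> c * u"
    and S: "subalg S" "f \<in> S" "\<epsilon> i \<in> S"
  obtains y where "y * f = \<epsilon> i" "y * \<epsilon> i = y" "y \<in> S"
proof -
  obtain N where N: "f * \<epsilon> i = (\<kappa> (a * v (i r) + b * v (i s) + c) + N) * \<epsilon> i"
    "nilp N (\<epsilon> i)" "N * \<epsilon> i = \<epsilon> i * N" using linear_\<epsilon>[OF assms(1-3)] f by metis
  let ?c = "a * v (i r) + b * v (i s) + c"
  have \<epsilon>: "\<epsilon> i * \<epsilon> i = \<epsilon> i" using \<epsilon>_idem assms(1) by blast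
  let ?N = "N * \<epsilon> i"
  have "nilp ?N (\<epsilon> i)" using N(3) by (intro nilp_mult N(2)) simp
  then obtain y where y: "(\<kappa> ?c + ?N) * y = \<epsilon> i"
    "\<And>a. a * ?N = ?N * a ==> a * \<epsilon> i = \<epsilon> i * a ==> a * y = y * a"
    "\<And>S. subalg S ==> ?N \<in> S ==> \<epsilon> i \<in> S ==> y \<in> S"
    using inverse_exists[OF _ assms(4)] by metis
  have c: "\<epsilon> i * y = y * \<epsilon> i" by (rule y(2)) (use N(3) \<epsilon> in \<open>metis mult.assoc\<close>)+
  have fN: "f * \<epsilon> i = (\<kappa> ?c + ?N) * \<epsilon> i" using N(1) \<epsilon> by (simp add: distrib_right mult.assoc)
  have Nf: "?N = f * \<epsilon> i - \<kappa> ?c * \<epsilon> i" using N(1) by (simp add: distrib_right)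
  then have "?N \<in> S" using S subalg_minus[OF S(1)] by (auto simp: subalg_def)
  then have yS: "y \<in> S" using y(3) S by blast
  show ?thesis
  proof (rule that[of "\<epsilon> i * y"])
    show "\<epsilon> i * y * f = \<epsilon> i"
    proof -
      have f\<epsilon>: "f * \<epsilon> i = \<epsilon> i * f" using x_\<epsilon>[OF assms(2,1)] x_\<epsilon>[OF assms(3,1)] f
        by (simp add: distrib_left distrib_right mult.assoc \<kappa>_mult_left[of "\<epsilon> i"] u_\<epsilon>[OF assms(1)])
      have "f * ?N = ?N * f"
        unfolding Nf using f\<epsilon> by (simp add: left_diff_distrib right_diff_distrib mult.assoc \<kappa>_mult_left[of f])
          (metis f\<epsilon> mult.assoc)
      then have fy: "f * y = y * f" using y(2) f\<epsilon> by blast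
      have "\<epsilon> i * y * f = f * \<epsilon> i * y" using fy f\<epsilon> by (metis mult.assoc)
      also have "\<dots> = (\<kappa> ?c + ?N) * y * \<epsilon> i" using fN by (simp add: c mult.assoc)
      finally show ?thesis using y(1) \<epsilon> by simp
    qed
    show "\<epsilon> i * y \<in> S" using yS S by (auto simp: subalg_def)
  qed (use c \<epsilon> in \<open>metis mult.assoc\<close>)+
qed

lemma d_linear: "d r s = \<kappa> 1 * x r + \<kappa> (- 1) * x s + \<kappa> 0 * u"
  by (simp add: d_def \<kappa>_uminus)

lemma G_linear: "G r s = \<kappa> 1 * x r + \<kappa> (- q) * x s + \<kappa> (- 1) * u"
  by (simp add: G_def \<kappa>_uminus)

lemma regular_d: "i \<in> C ==> r \<in> {1..n} ==> s \<in> {1..n} ==> i r \<noteq> i s ==> regular (d r s) i"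
  by (rule regular_linear[OF _ _ _ _ d_linear]) (use residue_eq in auto)

lemma regular_G: "i \<in> C ==> r \<in> {1..n} ==> s \<in> {1..n} ==> \<not> [i r - i s = 1] (mod int e) ==> regular (G r s) i"
  by (rule regular_linear[OF _ _ _ _ G_linear]) (use v_step_iff in auto)

lemma pol_d: "r \<in> {1..n} ==> s \<in> {1..n} ==> pol (d r s)"
  and pol_G: "r \<in> {1..n} ==> s \<in> {1..n} ==> pol (G r s)"
  and pol_h: "r \<in> {1..n} ==> pol (h r)"
  and pol_gg: "r \<in> {1..n} ==> s \<in> {1..n} ==> pol (gg a b r s)"
  by (auto simp: d_def G_def h_def gg_def intro!: pol.intros)

lemmas pol_intros = pol.intros pol_d pol_G pol_h pol_gg

lemma regular_gg: "i \<in> C ==> r \<in> {1..n} ==> s \<in> {1..n} ==> i r = a ==> i s = b ==> regular (gg a b r s) i"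
  by (auto simp: gg_def regular_\<kappa>[OF w_nz] intro: regular_G)

end

section \<open>Hecke and KLR generators on weight spaces\<close>

locale hecke_rep = weight_system +
  fixes T :: "nat \<Rightarrow> 'b"
  assumes T_u: "r \<in> {1..<n} ==> T r * u = T r" and u_T: "r \<in> {1..<n} ==> u * T r = T r"
    and T_x1: "r \<in> {1..<n} ==> T r * x r = x (Suc r) * T r - h (Suc r)"
    and T_x2: "r \<in> {1..<n} ==> T r * x (Suc r) = x r * T r + h (Suc r)"
    and T_x3: "r \<in> {1..<n} ==> s \<in> {1..n} ==> s \<noteq> r ==> s \<noteq> Suc r ==> T r * x s = x s * T r"
    and T_T: "r \<in> {1..<n} ==> T r * T r = \<kappa> (q - 1) * T r + \<kappa> q * u"

context weight_system
begin

text \<open>Sylvester's argument: an operator between generalized eigenspaces for different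
  eigenvalues that commutes with the action is zero.\<close>

lemma sylvester:
  assumes "a * z = z * b" "\<epsilon> j * z = z" "z * \<epsilon> i = z"
    and "nilp (a - \<kappa> \<alpha>) (\<epsilon> j)" "nilp (b - \<kappa> \<beta>) (\<epsilon> i)" "b * \<epsilon> i = \<epsilon> i * b" "\<alpha> \<noteq> \<beta>"
  shows "z = 0"
proof -
  have "nilp (a - \<kappa> \<beta>) z"
  proof -
    obtain m where m: "(b - \<kappa> \<beta>) ^ m * \<epsilon> i = 0" using assms(5) unfolding nilp_def by blast
    have "(b - \<kappa> \<beta>) ^ m * \<epsilon> i = \<epsilon> i * (b - \<kappa> \<beta>) ^ m"
      by (rule power_commute) (simp add: algebra_simps assms(6) \<kappa>_central[of "\<epsilon> i"])
    then have 0: "z * (b - \<kappa> \<beta>) ^ m = 0" using m assms(3) by (metis mult.assoc mult_zero_right)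
    have "(a - \<kappa> \<beta>) * z = z * (b - \<kappa> \<beta>)"
      by (simp add: algebra_simps assms(1) \<kappa>_central[of z])
    then have "(a - \<kappa> \<beta>) ^ k * z = z * (b - \<kappa> \<beta>) ^ k" for k
    proof (induction k)
      case (Suc k)
      then show ?case by (metis mult.assoc power_Suc power_Suc2)
    qed simp
    then show ?thesis using 0 unfolding nilp_def by auto
  qed
  moreover have "nilp (a - \<kappa> \<alpha>) z"
  proof -
    obtain m where m: "(a - \<kappa> \<alpha>) ^ m * \<epsilon> j = 0" using assms(4) unfolding nilp_def by blast
    then have "(a - \<kappa> \<alpha>) ^ m * z = 0" using assms(2) by (metis mult.assoc mult_zero_left)
    then show ?thesis unfolding nilp_def by blast
  qed
  moreover have "(a - \<kappa> \<alpha>) * (a - \<kappa> \<beta>) = (a - \<kappa> \<beta>) * (a - \<kappa> \<alpha>)"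
  proof -
    have "(a - \<kappa> c) * (a - \<kappa> c') = a * a - \<kappa> (c + c') * a + \<kappa> (c * c')" for c c'
      by (simp add: left_diff_distrib right_diff_distrib distrib_right \<kappa>_central[of a] \<kappa>_add \<kappa>_mult)
    then show ?thesis by (simp add: add.commute mult.commute)
  qed
  ultimately have "nilp ((a - \<kappa> \<alpha>) - (a - \<kappa> \<beta>)) z" using nilp_diff by blast
  then have "nilp (\<kappa> (\<beta> - \<alpha>)) z" by (simp add: \<kappa>_minus)
  then have "nilp (- \<kappa> (\<beta> - \<alpha>)) z" by (rule nilp_uminus)
  then show ?thesis by (rule cancel_left[where c = "\<beta> - \<alpha>"]) (use assms(7) in auto)
qed

lemma nilp_sum_prod:
  assumes "i \<in> C" "r \<in> {1..n}" "s \<in> {1..n}"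
  shows "nilp (x r + x s - \<kappa> (v (i r) + v (i s))) (\<epsilon> i)"
    and "nilp (x r * x s - \<kappa> (v (i r) * v (i s))) (\<epsilon> i)"
proof -
  define R S where "R = x r - \<kappa> (v (i r))" and "S = x s - \<kappa> (v (i s))"
  have p: "pol R" "pol S" "pol (x s)" "pol (\<kappa> (v (i r)))" using assms by (auto simp: R_def S_def intro!: pol.intros)
  have nR: "nilp R (\<epsilon> i)" and nS: "nilp S (\<epsilon> i)" using x_nilp assms by (auto simp: R_def S_def)
  have "nilp (R + S) (\<epsilon> i)" using nilp_add nR nS pol_commute p by blast
  then show "nilp (x r + x s - \<kappa> (v (i r) + v (i s))) (\<epsilon> i)" by (simp add: R_def S_def \<kappa>_add algebra_simps)
  have "nilp (R * x s + \<kappa> (v (i r)) * S) (\<epsilon> i)"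
    by (intro nilp_add nilp_mult nilp_\<kappa> nR nS pol_commute p pol_mult)
  then show "nilp (x r * x s - \<kappa> (v (i r) * v (i s))) (\<epsilon> i)" by (simp add: R_def S_def \<kappa>_mult algebra_simps)
qed

end

context hecke_rep
begin

text \<open>The intertwiner of the Hecke algebra; it exchanges \<open>x r\<close> and \<open>x
  (Suc r)\<close>.\<close>

definition F where "F r = T r * d r (Suc r) + h (Suc r)"

text \<open>\<open>T r\<close> moves a weight space at most to itself and to its image under the
  transposition: the intertwiner \<open>F r\<close> does so by Sylvester's argument, and \<open>F
  r\<close> equals \<open>T r\<close> times the invertible \<open>x r - x (Suc r)\<close> up to
  terms that preserve weights.\<close>

lemma T_weights:
  assumes r: "r \<in> {1..<n}" and ij: "i \<in> C" "j \<in> C" and nz: "\<epsilon> j * T r * \<epsilon> i \<noteq> 0"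
  shows "j = i \<or> j = perm_act (sigma r) i"
proof -
  define z where "z = \<epsilon> j * T r * \<epsilon> i"
  have z: "\<epsilon> j * z = z" "z * \<epsilon> i = z"
    using \<epsilon>_idem ij by (simp_all add: z_def mult.assoc[symmetric]) (simp add: mult.assoc \<epsilon>_idem)
  have rn: "r \<in> {1..n}" "Suc r \<in> {1..n}" using r by auto
  have comm: "f * z = z * f" if "pol f" "T r * f = f * T r" for f
    using pol_\<epsilon>[OF that(1) ij(1)] pol_\<epsilon>[OF that(1) ij(2)] that(2) unfolding z_def by (metis mult.assoc)
  have other: "j s = i s" if s: "s \<in> {1..n}" "s \<noteq> r" "s \<noteq> Suc r" for s
  proof (rule ccontr)
    assume "j s \<noteq> i s"
    then have "v (j s) \<noteq> v (i s)" using residue_eq ij s by blast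
    then have "z = 0"
      using sylvester[OF comm[OF pol_x] z x_nilp x_nilp x_\<epsilon>] T_x3 r s ij by blast
    then show False using nz by (simp add: z_def)
  qed
  have "T r * (x r + x (Suc r)) = (x r + x (Suc r)) * T r"
    using T_x1[OF r] T_x2[OF r] by (simp add: algebra_simps)
  then have sum: "v (j r) + v (j (Suc r)) = v (i r) + v (i (Suc r))"
    using sylvester[OF comm z nilp_sum_prod(1)[OF ij(2) rn] nilp_sum_prod(1)[OF ij(1) rn] pol_\<epsilon>[OF _ ij(1)]]
      pol_add[OF pol_x pol_x, OF rn] nz unfolding z_def by blast
  have "T r * (x r * x (Suc r)) = (x r * x (Suc r)) * T r"
  proof -
    have "T r * (x r * x (Suc r)) = (x (Suc r) * T r - h (Suc r)) * x (Suc r)"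
      by (simp add: T_x1[OF r] mult.assoc[symmetric])
    also have "\<dots> = x (Suc r) * (x r * T r + h (Suc r)) - h (Suc r) * x (Suc r)"
      by (simp add: T_x2[OF r] left_diff_distrib mult.assoc)
    also have "\<dots> = x (Suc r) * x r * T r"
      using pol_commute[OF pol_x[OF rn(2)] pol_h[OF rn(2)]] by (simp add: algebra_simps)
    finally show ?thesis using x_x[OF rn] by simp
  qed
  then have prod: "v (j r) * v (j (Suc r)) = v (i r) * v (i (Suc r))"
    using sylvester[OF comm z nilp_sum_prod(2)[OF ij(2) rn] nilp_sum_prod(2)[OF ij(1) rn] pol_\<epsilon>[OF _ ij(1)]]
      pol_mult[OF pol_x pol_x, OF rn] nz unfolding z_def by blast
  have "(v (j r) - v (i r)) * (v (j r) - v (i (Suc r))) = 0"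
  proof -
    have "(v (j r) - v (i r)) * (v (j r) - v (i (Suc r)))
        = v (j r) * v (j r) - v (j r) * (v (i r) + v (i (Suc r))) + v (i r) * v (i (Suc r))"
      by (simp add: algebra_simps)
    then show ?thesis unfolding sum[symmetric] prod[symmetric] by (simp add: algebra_simps)
  qed
  then have "(j r = i r \<and> j (Suc r) = i (Suc r)) \<or> (j r = i (Suc r) \<and> j (Suc r) = i r)"
    using sum residue_eq[OF ij(2,1) rn(1) rn(1)] residue_eq[OF ij(2,1) rn(1) rn(2)]
      residue_eq[OF ij(2,1) rn(2) rn(1)] residue_eq[OF ij(2,1) rn(2) rn(2)] by auto
  then show ?thesis
  proof
    assume *: "j r = i r \<and> j (Suc r) = i (Suc r)"
    have "j s = i s" if "s \<in> {1..n}" for s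
      using other[OF that] * by (cases "s = r"; cases "s = Suc r") auto
    then have "j = i" using tuple_eqI ij C_tuples by blast
    then show ?thesis ..
  next
    assume *: "j r = i (Suc r) \<and> j (Suc r) = i r"
    have "j s = perm_act (sigma r) i s" if "s \<in> {1..n}" for s
      using other[OF that] * by (cases "s = r"; cases "s = Suc r") (auto simp: transpose_def)
    then have "j = perm_act (sigma r) i" using tuple_eqI ij C_tuples perm_act_tuples r by blast
    then show ?thesis ..
  qed
qed

lemma F_x:
  assumes r: "r \<in> {1..<n}" and s: "s \<in> {1..n}"
  shows "F r * x s = x (sigma r s) * F r"
proof -
  have rn: "r \<in> {1..n}" "Suc r \<in> {1..n}" using r by auto
  note pc = pol_commute[OF pol_d[OF rn] pol_x] pol_commute[OF pol_h[OF rn(2)] pol_x]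
  have xs: "F r * x s = (T r * x s) * d r (Suc r) + x s * h (Suc r)"
    by (simp add: F_def distrib_right mult.assoc pc[OF s])
  consider "s = r" | "s = Suc r" | "s \<noteq> r" "s \<noteq> Suc r" by blast
  then show ?thesis
  proof cases
    case 1
    have "F r * x r = x (Suc r) * T r * d r (Suc r) - h (Suc r) * d r (Suc r) + x r * h (Suc r)"
      using xs by (simp add: 1 T_x1[OF r] algebra_simps)
    also have "h (Suc r) * d r (Suc r) = x r * h (Suc r) - x (Suc r) * h (Suc r)"
      using pc(2)[OF rn(1)] pc(2)[OF rn(2)] by (simp add: d_def right_diff_distrib)
    finally show ?thesis using 1 by (simp add: F_def algebra_simps)
  next
    case 2
    have "F r * x (Suc r) = x r * T r * d r (Suc r) + h (Suc r) * d r (Suc r) + x (Suc r) * h (Suc r)"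
      using xs by (simp add: 2 T_x2[OF r] algebra_simps)
    also have "h (Suc r) * d r (Suc r) = x r * h (Suc r) - x (Suc r) * h (Suc r)"
      using pc(2)[OF rn(1)] pc(2)[OF rn(2)] by (simp add: d_def right_diff_distrib)
    finally show ?thesis using 2 by (simp add: F_def algebra_simps)
  next
    case 3
    then show ?thesis using xs T_x3[OF r s 3] by (simp add: F_def algebra_simps)
  qed
qed

lemma T_G:
  assumes r: "r \<in> {1..<n}"
  shows "(T r + u) * x r = x (Suc r) * (T r + u) + G r (Suc r)"
    and "(T r + u) * x (Suc r) = x r * (T r + u) - G r (Suc r)"
proof -
  have rn: "r \<in> {1..n}" "Suc r \<in> {1..n}" using r by auto
  show "(T r + u) * x r = x (Suc r) * (T r + u) + G r (Suc r)"
    by (simp add: distrib_right distrib_left T_x1[OF r] u_x[OF rn(1)] x_u[OF rn(2)] G_def h_def \<kappa>_minus algebra_simps)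
  show "(T r + u) * x (Suc r) = x r * (T r + u) - G r (Suc r)"
    by (simp add: distrib_right distrib_left T_x2[OF r] u_x[OF rn(2)] x_u[OF rn(1)] G_def h_def \<kappa>_minus algebra_simps)
qed

lemma F_F:
  assumes r: "r \<in> {1..<n}"
  shows "F r * F r = G r (Suc r) * G (Suc r) r"
proof -
  have rn: "r \<in> {1..n}" "Suc r \<in> {1..n}" using r by auto
  let ?b = "\<kappa> (q - 1)"
  have q: "\<kappa> q = ?b + 1" using \<kappa>_add[of "q - 1" 1] by simp
  have Tx: "x (Suc r) * T r = T r * x r + u + ?b * x (Suc r)" "x r * T r = T r * x (Suc r) - u - ?b * x (Suc r)"
    using T_x1[OF r] T_x2[OF r] by (simp_all add: h_def algebra_simps)
  note rules = u_x[OF rn(1)] x_u[OF rn(1)] u_x[OF rn(2)] x_u[OF rn(2)] u_u T_u[OF r] u_T[OF r] T_T[OF r, unfolded q]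
    x_x[OF rn(2,1)] Tx \<kappa>_central[of "x r"] \<kappa>_central[of "x (Suc r)"] \<kappa>_central[of "T r"] \<kappa>_central[of u]
  have ext: "A * B = D ==> A * (B * E) = D * E" for A B D E :: 'b by (metis mult.assoc)
  show ?thesis
    unfolding F_def G_def h_def d_def q
    by (simp add: algebra_simps rules rules[THEN ext])
qed

end

section \<open>Passing between the two sets of generators\<close>

locale orbit_system = weight_system +
  assumes C_closed: "r \<in> {1..<n} ==> i \<in> C ==> perm_act (sigma r) i \<in> C"
begin

text \<open>The Brundan-Kleshchev formulas without denominators. Where \<open>i r = i (Suc
  r)\<close> the difference \<open>x r - x (Suc r)\<close> is nilpotent and \<open>\<psi>\<close>
  is obtained from \<open>T + u\<close>; elsewhere from the intertwiner. All factors are regular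
  on the weight space, so \<open>t\<close> and \<open>p\<close> determine each other
  there.\<close>

definition linked :: "'b \<Rightarrow> 'b \<Rightarrow> nat \<Rightarrow> (nat \<Rightarrow> int) \<Rightarrow> bool" where
  "linked t p r i \<longleftrightarrow>
    (if i r = i (Suc r) then \<kappa> (w (i r)) * (t + u) * \<epsilon> i = - (p * G r (Suc r)) * \<epsilon> i
     else (t * d r (Suc r) + h (Suc r)) * \<epsilon> i = p * gg (i r) (i (Suc r)) r (Suc r) * \<epsilon> i)"

lemma only_one:
  assumes "u * z = z" "k \<in> C" "\<And>j. j \<in> C ==> j \<noteq> k ==> \<epsilon> j * z = 0"
  shows "\<epsilon> k * z = z"
proof -
  have "z = (\<Sum>j\<in>C. \<epsilon> j * z)" using assms(1) by (simp add: \<epsilon>_sum[symmetric] sum_distrib_right)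
  also have "\<dots> = (\<Sum>j\<in>C. if j = k then \<epsilon> k * z else 0)"
    by (rule sum.cong) (use assms in auto)
  finally show ?thesis using assms(2) C_finite by simp
qed

lemma G_swap_regular:
  assumes r: "r \<in> {1..<n}" and i: "i \<in> C" "i r = i (Suc r)"
  shows "regular (G r (Suc r)) i" "regular (G (Suc r) r) i"
  using r i zero_not_one by (auto intro!: regular_G)

lemma linked_unique:
  assumes r: "r \<in> {1..<n}" and i: "i \<in> C"
  shows "linked t p r i ==> linked t p' r i ==> p * \<epsilon> i = p' * \<epsilon> i"
    and "linked t p r i ==> linked t' p r i ==> t * \<epsilon> i = t' * \<epsilon> i"
proof -
  have rn: "r \<in> {1..n}" "Suc r \<in> {1..n}" using r by auto
  assume l: "linked t p r i"
  show "p * \<epsilon> i = p' * \<epsilon> i" if l': "linked t p' r i"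
  proof (cases "i r = i (Suc r)")
    case True
    have "p * G r (Suc r) * \<epsilon> i = p' * G r (Suc r) * \<epsilon> i"
      using l l' True by (simp add: linked_def)
    then show ?thesis using regular_cancel G_swap_regular(1)[OF r i True] by blast
  next
    case False
    have "p * gg (i r) (i (Suc r)) r (Suc r) * \<epsilon> i = p' * gg (i r) (i (Suc r)) r (Suc r) * \<epsilon> i"
      using l l' False by (simp add: linked_def)
    then show ?thesis using regular_cancel regular_gg[OF i rn refl refl] by blast
  qed
  show "t * \<epsilon> i = t' * \<epsilon> i" if l': "linked t' p r i"
  proof (cases "i r = i (Suc r)")
    case True
    have "\<kappa> (w (i r)) * ((t + u) * \<epsilon> i) = \<kappa> (w (i r)) * ((t' + u) * \<epsilon> i)"
      using l l' True by (simp add: linked_def mult.assoc)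
    then have "(t + u) * \<epsilon> i = (t' + u) * \<epsilon> i" by (rule \<kappa>_cancel[OF w_nz])
    then show ?thesis by (simp add: distrib_right)
  next
    case False
    have "t * d r (Suc r) * \<epsilon> i + h (Suc r) * \<epsilon> i = t' * d r (Suc r) * \<epsilon> i + h (Suc r) * \<epsilon> i"
      using l l' False by (simp add: linked_def distrib_right)
    then have "t * d r (Suc r) * \<epsilon> i = t' * d r (Suc r) * \<epsilon> i" by (rule add_right_imp_eq)
    then show ?thesis using regular_cancel regular_d[OF i rn False] by blast
  qed
qed

lemma gg_linear: "i r = a ==> i s = b ==> \<exists>a' b' c'. gg a b r s * \<epsilon> i = (\<kappa> a' * x r + \<kappa> b' * x s + \<kappa> c' * u) * \<epsilon> i
    \<and> a' * v (i r) + b' * v (i s) + c' \<noteq> 0" if "i \<in> C"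
proof (cases "[a - b = 1] (mod int e)")
  case True
  then show ?thesis
    by (intro exI[of _ 0] exI[of _ "w a"]) (use that in \<open>simp add: gg_def mult.assoc u_\<epsilon> w_nz\<close>)
next
  case False
  assume "i r = a" "i s = b"
  then show ?thesis
    by (intro exI[of _ 1] exI[of _ "- q"] exI[of _ "- 1"])
      (use False v_step_iff[of a b] in \<open>simp add: gg_def G_def \<kappa>_uminus\<close>)
qed

text \<open>The polynomial factors in the link are a nonzero scalar plus a nilpotent element on
  the weight space, hence invertible.\<close>

lemma linked_exists:
  assumes r: "r \<in> {1..<n}" and i: "i \<in> C" and S: "subalg S" "u \<in> S" "x r \<in> S" "x (Suc r) \<in> S" "\<epsilon> i \<in> S"
  shows "t \<in> S ==> \<exists>p\<in>S. linked t p r i \<and> p * \<epsilon> i = p"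
    and "p \<in> S ==> \<exists>t\<in>S. linked t p r i \<and> t * \<epsilon> i = t"
proof -
  have rn: "r \<in> {1..n}" "Suc r \<in> {1..n}" using r by auto
  have Scl: "a \<in> S ==> b \<in> S ==> a + b \<in> S" "a \<in> S ==> b \<in> S ==> a * b \<in> S"
    "a \<in> S ==> b \<in> S ==> a - b \<in> S" "a \<in> S ==> - a \<in> S" "a \<in> S ==> \<kappa> c * a \<in> S" for a b c
    using S(1) subalg_minus subalg_uminus by (auto simp: subalg_def)
  have pol_S: "d r (Suc r) \<in> S" "G r (Suc r) \<in> S" "h (Suc r) \<in> S"
    using S by (simp_all add: d_def G_def h_def Scl)
  have inv: "\<exists>y\<in>S. y * f * \<epsilon> i = \<epsilon> i \<and> y * \<epsilon> i = y"
    if f: "f * \<epsilon> i = (\<kappa> a * x r + \<kappa> b * x (Suc r) + \<kappa> c * u) * \<epsilon> i" "a * v (i r) + b * v (i (Suc r)) + c \<noteq> 0"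
    for a b c f
  proof -
    obtain y where "y * (\<kappa> a * x r + \<kappa> b * x (Suc r) + \<kappa> c * u) = \<epsilon> i" "y * \<epsilon> i = y" "y \<in> S"
      by (rule inverse_linear[OF i rn f(2) refl S(1)]) (use S Scl in auto)
    then show ?thesis using f(1) \<epsilon>_idem[OF i] by (metis mult.assoc)
  qed
  show "\<exists>p\<in>S. linked t p r i \<and> p * \<epsilon> i = p" if t: "t \<in> S"
  proof (cases "i r = i (Suc r)")
    case True
    have "\<exists>y\<in>S. y * G r (Suc r) * \<epsilon> i = \<epsilon> i \<and> y * \<epsilon> i = y"
      by (rule inv[of _ 1 "- q" "- 1"])
        (use v_step_iff[of "i r" "i (Suc r)"] True zero_not_one in \<open>simp_all add: G_def \<kappa>_uminus\<close>)
    then obtain y where y: "y \<in> S" "y * G r (Suc r) * \<epsilon> i = \<epsilon> i" "y * \<epsilon> i = y" by blast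
    let ?p = "- (\<kappa> (w (i r)) * (t + u) * y)"
    have "?p * G r (Suc r) * \<epsilon> i = - (\<kappa> (w (i r)) * (t + u) * \<epsilon> i)"
      using y(2) by (simp add: mult.assoc)
    then have "linked t ?p r i" using True by (simp add: linked_def)
    moreover have "?p * \<epsilon> i = ?p" using y(3) by (simp add: mult.assoc)
    moreover have "?p \<in> S" using t S(2) y(1) by (intro Scl)
    ultimately show ?thesis by blast
  next
    case False
    have "\<exists>y\<in>S. y * gg (i r) (i (Suc r)) r (Suc r) * \<epsilon> i = \<epsilon> i \<and> y * \<epsilon> i = y"
      using gg_linear[OF i refl refl, of r "Suc r"] inv by blast
    then obtain y where y: "y \<in> S" "y * gg (i r) (i (Suc r)) r (Suc r) * \<epsilon> i = \<epsilon> i" "y * \<epsilon> i = y" by blast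
    let ?p = "(t * d r (Suc r) + h (Suc r)) * y"
    have "?p * gg (i r) (i (Suc r)) r (Suc r) * \<epsilon> i = (t * d r (Suc r) + h (Suc r)) * \<epsilon> i"
      using y(2) by (simp add: mult.assoc)
    then have "linked t ?p r i" using False by (simp add: linked_def)
    moreover have "?p * \<epsilon> i = ?p" using y(3) by (simp add: mult.assoc)
    moreover have "?p \<in> S" using t pol_S y(1) by (intro Scl)
    ultimately show ?thesis by blast
  qed
  show "\<exists>t\<in>S. linked t p r i \<and> t * \<epsilon> i = t" if p: "p \<in> S"
  proof (cases "i r = i (Suc r)")
    case True
    let ?t = "- (\<kappa> (inverse (w (i r))) * (p * G r (Suc r) * \<epsilon> i)) - \<epsilon> i"
    have "\<kappa> (w (i r)) * (?t + u) * \<epsilon> i = - (\<kappa> (w (i r)) * \<kappa> (inverse (w (i r))) * (p * G r (Suc r) * \<epsilon> i))"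
      by (simp add: algebra_simps \<epsilon>_idem[OF i] u_\<epsilon>[OF i])
    also have "\<kappa> (w (i r)) * \<kappa> (inverse (w (i r))) = 1"
      using \<kappa>_mult[of "w (i r)" "inverse (w (i r))"] w_nz by simp
    finally have "linked ?t p r i" using True by (simp add: linked_def)
    moreover have "?t * \<epsilon> i = ?t" by (simp add: left_diff_distrib mult.assoc \<epsilon>_idem[OF i])
    moreover have "?t \<in> S" using p S pol_S by (intro Scl)
    ultimately show ?thesis by blast
  next
    case False
    have "\<exists>y\<in>S. y * d r (Suc r) * \<epsilon> i = \<epsilon> i \<and> y * \<epsilon> i = y"
      by (rule inv[of _ 1 "- 1" 0]) (use False residue_eq[OF i i rn] in \<open>simp_all add: d_def \<kappa>_uminus\<close>)
    then obtain y where y: "y \<in> S" "y * d r (Suc r) * \<epsilon> i = \<epsilon> i" "y * \<epsilon> i = y" by blast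
    have gS: "gg (i r) (i (Suc r)) r (Suc r) * \<epsilon> i \<in> S"
      using pol_S S Scl by (auto simp: gg_def)
    let ?t = "(p * (gg (i r) (i (Suc r)) r (Suc r) * \<epsilon> i) - h (Suc r) * \<epsilon> i) * y"
    have "?t * d r (Suc r) * \<epsilon> i = (p * (gg (i r) (i (Suc r)) r (Suc r) * \<epsilon> i) - h (Suc r) * \<epsilon> i) * \<epsilon> i"
      using y(2) by (simp add: mult.assoc)
    then have "linked ?t p r i" using False by (simp add: linked_def algebra_simps \<epsilon>_idem[OF i])
    moreover have "?t * \<epsilon> i = ?t" using y(3) by (simp add: mult.assoc)
    moreover have "?t \<in> S" using p pol_S S y(1) by (intro gS Scl)
    ultimately show ?thesis by blast
  qed
qed

lemma gg_swap:
  assumes "\<And>s. s \<in> {1..n} ==> z * x s * E = x (sigma r s) * z * E" "z * u = u * z"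
    and E: "\<And>s. s \<in> {1..n} ==> x s * E = E * x s" "u * E = E" "E * u = E" and st: "s \<in> {1..n}" "t \<in> {1..n}"
  shows "z * gg a b s t * E = gg a b (sigma r s) (sigma r t) * z * E"
proof -
  have "u * (z * E) = z * (u * E)" using assms(2) by (metis mult.assoc)
  then show ?thesis
    using assms(1)[OF st(1)] assms(1)[OF st(2)]
    by (simp add: gg_def G_def algebra_simps \<kappa>_central[of z] \<kappa>_mult_left[of z])
qed

end

locale klr_rep = orbit_system +
  fixes \<psi> :: "nat \<Rightarrow> 'b"
  assumes \<psi>_u: "r \<in> {1..<n} ==> \<psi> r * u = \<psi> r" and u_\<psi>: "r \<in> {1..<n} ==> u * \<psi> r = \<psi> r"
    and \<psi>_\<epsilon>: "r \<in> {1..<n} ==> i \<in> C ==> \<psi> r * \<epsilon> i = \<epsilon> (perm_act (sigma r) i) * \<psi> r"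
    and \<psi>_x1: "r \<in> {1..<n} ==> i \<in> C ==> i r = i (Suc r) ==>
        \<psi> r * x r * \<epsilon> i = (x (Suc r) * \<psi> r - \<kappa> (w (i r))) * \<epsilon> i"
    and \<psi>_x2: "r \<in> {1..<n} ==> i \<in> C ==> i r = i (Suc r) ==>
        \<psi> r * x (Suc r) * \<epsilon> i = (x r * \<psi> r + \<kappa> (w (i r))) * \<epsilon> i"
    and \<psi>_x3: "r \<in> {1..<n} ==> i \<in> C ==> s \<in> {1..n} ==> i r \<noteq> i (Suc r) \<or> s \<noteq> r \<and> s \<noteq> Suc r ==>
        \<psi> r * x s * \<epsilon> i = x (sigma r s) * \<psi> r * \<epsilon> i"
    and \<psi>_\<psi>0: "r \<in> {1..<n} ==> i \<in> C ==> i r = i (Suc r) ==> \<psi> r * \<psi> r * \<epsilon> i = 0"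
    and \<psi>_\<psi>1: "r \<in> {1..<n} ==> i \<in> C ==> i r \<noteq> i (Suc r) ==>
        \<psi> r * \<psi> r * (gg (i r) (i (Suc r)) r (Suc r) * gg (i (Suc r)) (i r) (Suc r) r) * \<epsilon> i
        = G r (Suc r) * G (Suc r) r * \<epsilon> i"

locale hecke_link = orbit_system + hecke_rep +
  fixes \<psi> :: "nat \<Rightarrow> 'b"
  assumes \<psi>_u: "r \<in> {1..<n} ==> \<psi> r * u = \<psi> r" and u_\<psi>: "r \<in> {1..<n} ==> u * \<psi> r = \<psi> r"
    and link: "r \<in> {1..<n} ==> i \<in> C ==> linked (T r) (\<psi> r) r i"
begin

context
  fixes r i assumes r: "r \<in> {1..<n}" and i: "i \<in> C"
begin

lemma rn: "r \<in> {1..n}" "Suc r \<in> {1..n}" using r by auto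

lemma T_arrow:
  assumes eq: "i r = i (Suc r)"
  shows "\<epsilon> i * (T r * \<epsilon> i) = T r * \<epsilon> i"
proof -
  have "perm_act (sigma r) i = i" by (rule ext) (use eq in \<open>auto simp: transpose_def\<close>)
  then show ?thesis
    using only_one[of "T r * \<epsilon> i" i] T_weights[OF r i] i u_T[OF r] by (metis mult.assoc)
qed

lemma F_arrow:
  assumes ne: "i r \<noteq> i (Suc r)"
  shows "\<epsilon> (perm_act (sigma r) i) * (F r * \<epsilon> i) = F r * \<epsilon> i"
proof (rule only_one)
  have F: "F r * \<epsilon> i = T r * \<epsilon> i * d r (Suc r) + \<epsilon> i * h (Suc r)"
    using pol_\<epsilon>[OF pol_d[OF rn] i] pol_\<epsilon>[OF pol_h[OF rn(2)] i]
    by (simp add: F_def distrib_right mult.assoc)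
  show "u * (F r * \<epsilon> i) = F r * \<epsilon> i"
    unfolding F by (simp add: distrib_left mult.assoc[symmetric] u_T[OF r] u_\<epsilon>[OF i])
  show "perm_act (sigma r) i \<in> C" using C_closed r i by blast
  fix j assume j: "j \<in> C" "j \<noteq> perm_act (sigma r) i"
  show "\<epsilon> j * (F r * \<epsilon> i) = 0"
  proof (cases "j = i")
    case False
    have "\<epsilon> j * (F r * \<epsilon> i) = (\<epsilon> j * T r * \<epsilon> i) * d r (Suc r) + (\<epsilon> j * \<epsilon> i) * h (Suc r)"
      unfolding F by (simp add: distrib_left mult.assoc)
    moreover have "\<epsilon> j * T r * \<epsilon> i = 0" using T_weights[OF r i j(1)] j False by blast
    ultimately show ?thesis using False \<epsilon>_mult[OF j(1) i] by simp
  next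
    case True
    let ?z = "\<epsilon> i * (F r * \<epsilon> i)"
    have "x (Suc r) * ?z = ?z * x r"
    proof -
      have "x (Suc r) * ?z = \<epsilon> i * (x (Suc r) * F r * \<epsilon> i)"
        using x_\<epsilon>[OF rn(2) i] by (metis mult.assoc)
      also have "x (Suc r) * F r = F r * x r" using F_x[OF r rn(1)] by simp
      also have "\<epsilon> i * (F r * x r * \<epsilon> i) = ?z * x r" using x_\<epsilon>[OF rn(1) i] by (metis mult.assoc)
      finally show ?thesis .
    qed
    moreover have "\<epsilon> i * ?z = ?z" "?z * \<epsilon> i = ?z"
      using \<epsilon>_idem[OF i] by (simp_all add: mult.assoc) (simp_all add: mult.assoc[symmetric])
    ultimately have "?z = 0"
      using sylvester[of "x (Suc r)" ?z "x r" i i "v (i (Suc r))" "v (i r)"] x_nilp[OF i rn(1)] x_nilp[OF i rn(2)]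
        x_\<epsilon>[OF rn(1) i] residue_eq[OF i i rn(2,1)] ne by auto
    then show ?thesis using True by simp
  qed
qed

lemma link_ne: "i r \<noteq> i (Suc r) ==> F r * \<epsilon> i = \<psi> r * gg (i r) (i (Suc r)) r (Suc r) * \<epsilon> i"
  and link_eq: "i r = i (Suc r) ==> \<kappa> (w (i r)) * (T r + u) * \<epsilon> i = - (\<psi> r * G r (Suc r) * \<epsilon> i)"
  using link[OF r i] by (simp_all add: linked_def F_def)

lemma \<psi>_arrow: "\<epsilon> (perm_act (sigma r) i) * \<psi> r * \<epsilon> i = \<psi> r * \<epsilon> i"
proof (cases "i r = i (Suc r)")
  case True
  have s: "perm_act (sigma r) i = i" by (rule ext) (use True in \<open>auto simp: transpose_def\<close>)
  have "\<epsilon> i * (\<kappa> (w (i r)) * (T r + u) * \<epsilon> i) = \<kappa> (w (i r)) * (\<epsilon> i * (T r * \<epsilon> i) + \<epsilon> i * \<epsilon> i)"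
    by (simp add: distrib_left distrib_right mult.assoc \<kappa>_mult_left[of "\<epsilon> i"] u_\<epsilon>[OF i])
  also have "\<dots> = \<kappa> (w (i r)) * (T r + u) * \<epsilon> i"
    by (simp add: T_arrow[OF True] \<epsilon>_idem[OF i] distrib_left distrib_right mult.assoc u_\<epsilon>[OF i])
  finally have "\<epsilon> i * \<psi> r * G r (Suc r) * \<epsilon> i = \<psi> r * G r (Suc r) * \<epsilon> i"
    unfolding link_eq[OF True] by (simp add: mult.assoc)
  then show ?thesis unfolding s using regular_cancel G_swap_regular(1)[OF r i True] by blast
next
  case False
  have "\<epsilon> (perm_act (sigma r) i) * \<psi> r * gg (i r) (i (Suc r)) r (Suc r) * \<epsilon> i
      = \<psi> r * gg (i r) (i (Suc r)) r (Suc r) * \<epsilon> i"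
    using F_arrow[OF False] unfolding link_ne[OF False] by (simp add: mult.assoc)
  then show ?thesis using regular_cancel regular_gg[OF i rn refl refl] by blast
qed

lemma \<psi>_x_ne:
  assumes "i r \<noteq> i (Suc r)" "s \<in> {1..n}"
  shows "\<psi> r * x s * \<epsilon> i = x (sigma r s) * \<psi> r * \<epsilon> i"
proof -
  let ?g = "gg (i r) (i (Suc r)) r (Suc r)"
  have "(\<psi> r * x s) * ?g * \<epsilon> i = (\<psi> r * ?g * \<epsilon> i) * x s"
    using pol_commute[OF pol_gg[OF rn] pol_x[OF assms(2)]] x_\<epsilon>[OF assms(2) i] by (metis mult.assoc)
  also have "\<dots> = F r * x s * \<epsilon> i" using x_\<epsilon>[OF assms(2) i] link_ne[OF assms(1)] by (metis mult.assoc)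
  also have "\<dots> = x (sigma r s) * \<psi> r * ?g * \<epsilon> i"
    using F_x[OF r assms(2)] link_ne[OF assms(1)] by (metis mult.assoc)
  finally show ?thesis using regular_cancel regular_gg[OF i rn refl refl] by blast
qed

lemma \<psi>_x_eq:
  assumes eq: "i r = i (Suc r)" and s: "s \<in> {1..n}" and T: "(T r + u) * x s = x s' * (T r + u) + \<kappa> c * G r (Suc r)"
  shows "\<psi> r * x s * \<epsilon> i = (x s' * \<psi> r - \<kappa> (c * w (i r))) * \<epsilon> i"
proof -
  let ?g = "G r (Suc r)"
  let ?w = "\<kappa> (w (i r))"
  have "(\<psi> r * x s) * ?g * \<epsilon> i = (\<psi> r * ?g * \<epsilon> i) * x s"
    using pol_commute[OF pol_G[OF rn] pol_x[OF s]] x_\<epsilon>[OF s i] by (metis mult.assoc)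
  also have "\<dots> = - (?w * ((T r + u) * x s) * \<epsilon> i)"
    using x_\<epsilon>[OF s i] link_eq[OF eq] by (metis mult.assoc mult_minus_left minus_minus)
  also have "\<dots> = - (x s' * (?w * (T r + u) * \<epsilon> i)) - \<kappa> (c * w (i r)) * ?g * \<epsilon> i"
    unfolding T by (simp add: algebra_simps \<kappa>_mult_left[of "x s'"] \<kappa>_mult) (metis \<kappa>_mult mult.assoc mult.commute)
  also have "\<dots> = (x s' * \<psi> r - \<kappa> (c * w (i r))) * ?g * \<epsilon> i"
    unfolding link_eq[OF eq] by (simp add: algebra_simps)
  finally show ?thesis using regular_cancel G_swap_regular(1)[OF r i eq] by blast
qed

lemma \<psi>_x1: "i r = i (Suc r) ==> \<psi> r * x r * \<epsilon> i = (x (Suc r) * \<psi> r - \<kappa> (w (i r))) * \<epsilon> i"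
  using \<psi>_x_eq[OF _ rn(1), of "Suc r" 1] T_G(1)[OF r] by simp

lemma \<psi>_x2: "i r = i (Suc r) ==> \<psi> r * x (Suc r) * \<epsilon> i = (x r * \<psi> r + \<kappa> (w (i r))) * \<epsilon> i"
  using \<psi>_x_eq[OF _ rn(2), of r "- 1"] T_G(2)[OF r] by (simp add: \<kappa>_uminus)

lemma \<psi>_x3:
  assumes s: "s \<in> {1..n}" "i r \<noteq> i (Suc r) \<or> s \<noteq> r \<and> s \<noteq> Suc r"
  shows "\<psi> r * x s * \<epsilon> i = x (sigma r s) * \<psi> r * \<epsilon> i"
proof (cases "i r = i (Suc r)")
  case True
  have "(T r + u) * x s = x s * (T r + u) + \<kappa> 0 * G r (Suc r)"
    using T_x3[OF r s(1)] s(2) True by (simp add: distrib_left distrib_right x_u[OF s(1)] u_x[OF s(1)])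
  from \<psi>_x_eq[OF True s(1) this] show ?thesis using s(2) True by (simp add: transpose_def)
next
  case False
  then show ?thesis using \<psi>_x_ne s by blast
qed

lemma \<psi>_\<psi>0:
  assumes eq: "i r = i (Suc r)" shows "\<psi> r * \<psi> r * \<epsilon> i = 0"
proof -
  let ?g = "G r (Suc r)" and ?g' = "G (Suc r) r" and ?w = "\<kappa> (w (i r))"
  have s: "perm_act (sigma r) i = i" by (rule ext) (use eq in \<open>auto simp: transpose_def\<close>)
  have ar: "\<epsilon> i * (\<psi> r * \<epsilon> i) = \<psi> r * \<epsilon> i" using \<psi>_arrow by (simp add: s mult.assoc)
  have 1: "\<psi> r * ?g' * \<epsilon> i = ?g * \<psi> r * \<epsilon> i + ?w * \<kappa> (q + 1) * \<epsilon> i"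
  proof -
    have "\<psi> r * ?g' * \<epsilon> i = \<psi> r * x (Suc r) * \<epsilon> i - \<kappa> q * (\<psi> r * x r * \<epsilon> i) - \<psi> r * \<epsilon> i"
      by (simp add: G_def left_diff_distrib right_diff_distrib mult.assoc \<kappa>_mult_left[of "\<psi> r"] u_\<epsilon>[OF i])
    also have "\<dots> = (x r * \<psi> r + ?w) * \<epsilon> i - \<kappa> q * ((x (Suc r) * \<psi> r - ?w) * \<epsilon> i) - u * \<psi> r * \<epsilon> i"
      by (simp only: \<psi>_x1[OF eq] \<psi>_x2[OF eq] u_\<psi>[OF r])
    also have "\<dots> = ?g * \<psi> r * \<epsilon> i + (?w + \<kappa> q * ?w) * \<epsilon> i"
      by (simp add: G_def left_diff_distrib right_diff_distrib distrib_right mult.assoc)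
    also have "?w + \<kappa> q * ?w = ?w * \<kappa> (q + 1)"
      by (simp add: \<kappa>_add distrib_left \<kappa>_central[of ?w q])
    finally show ?thesis .
  qed
  have TT: "(T r + u) * (T r + u) = \<kappa> (q + 1) * (T r + u)"
    by (simp add: algebra_simps T_T[OF r] T_u[OF r] u_T[OF r] u_u \<kappa>_add \<kappa>_minus)
  let ?z = "?w * (T r + u) * \<epsilon> i"
  have z\<epsilon>: "\<epsilon> i * ?z = ?z" unfolding link_eq[OF eq] using ar pol_\<epsilon>[OF pol_G[OF rn] i]
    by (metis (no_types, lifting) mult.assoc mult_minus_right)
  have "?w * (T r + u) * ?z = ?z * ?z" using z\<epsilon> by (metis mult.assoc)
  also have "\<dots> = \<psi> r * ?g * \<epsilon> i * (\<psi> r * ?g * \<epsilon> i)" unfolding link_eq[OF eq] by simp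
  also have "\<dots> = \<psi> r * (?g * \<psi> r * \<epsilon> i) * ?g"
    using ar pol_\<epsilon>[OF pol_G[OF rn] i] by (metis mult.assoc)
  also have "?g * \<psi> r * \<epsilon> i = \<psi> r * ?g' * \<epsilon> i - ?w * \<kappa> (q + 1) * \<epsilon> i" using 1 by simp
  also have "\<psi> r * \<dots> * ?g = \<psi> r * \<psi> r * (?g' * ?g) * \<epsilon> i - ?w * \<kappa> (q + 1) * (\<psi> r * ?g * \<epsilon> i)"
    using pol_\<epsilon>[OF pol_G[OF rn] i]
    by (simp add: algebra_simps \<kappa>_mult_left[of "\<psi> r"])
  also have "?w * (T r + u) * ?z = ?w * \<kappa> (q + 1) * ?z"
  proof -
    have "?w * (T r + u) * ?z = ?w * (?w * ((T r + u) * (T r + u) * \<epsilon> i))"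
      by (simp add: mult.assoc \<kappa>_mult_left[of "T r + u"])
    then show ?thesis unfolding TT by (simp add: mult.assoc) (metis \<kappa>_central mult.assoc)
  qed
  finally have "\<psi> r * \<psi> r * (?g' * ?g) * \<epsilon> i = 0" unfolding link_eq[OF eq] by simp
  moreover have "regular (?g' * ?g) i" using regular_mult G_swap_regular[OF r i eq] by blast
  ultimately show ?thesis by (auto simp: regular_def)
qed

end

lemma \<psi>_\<psi>1:
  assumes r: "r \<in> {1..<n}" and i: "i \<in> C" and ne: "i r \<noteq> i (Suc r)"
  shows "\<psi> r * \<psi> r * (gg (i r) (i (Suc r)) r (Suc r) * gg (i (Suc r)) (i r) (Suc r) r) * \<epsilon> i
    = G r (Suc r) * G (Suc r) r * \<epsilon> i"
proof -
  let ?j = "perm_act (sigma r) i"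
  let ?g = "gg (i r) (i (Suc r)) r (Suc r)" and ?h = "gg (i (Suc r)) (i r) (Suc r) r"
    and ?h' = "gg (i (Suc r)) (i r) r (Suc r)"
  note rn = rn[OF r i]
  have j: "?j \<in> C" using C_closed r i by blast
  have "T r * (d r (Suc r) * u) = T r * d r (Suc r)"
    by (simp add: pol_commute[OF pol_d[OF rn] pol_u]) (simp add: mult.assoc[symmetric] T_u[OF r])
  moreover have "u * (T r * d r (Suc r)) = T r * d r (Suc r)" using u_T[OF r] by (simp add: mult.assoc[symmetric])
  ultimately have Fu: "F r * u = u * F r"
    using pol_commute[OF pol_h[OF rn(2)] pol_u] by (simp add: F_def distrib_left distrib_right mult.assoc)
  have "F r * gg (i (Suc r)) (i r) (Suc r) r * u = gg (i (Suc r)) (i r) (sigma r (Suc r)) (sigma r r) * F r * u"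
  proof (rule gg_swap[OF _ Fu])
    show "F r * x s * u = x (sigma r s) * F r * u" if "s \<in> {1..n}" for s using F_x[OF r that] by simp
  qed (use rn in \<open>auto simp: x_u u_x u_u\<close>)
  then have Fh: "F r * ?h * u = ?h' * F r * u" by simp
  have Fh': "F r * ?h * \<epsilon> i = ?h' * F r * \<epsilon> i"
    using arg_cong[OF Fh, of "\<lambda>z. z * \<epsilon> i"] u_\<epsilon>[OF i] by (simp add: mult.assoc)
  have Fj: "F r * \<epsilon> ?j = \<psi> r * ?h' * \<epsilon> ?j"
    using link_ne[OF r j] ne by simp
  have "\<psi> r * \<psi> r * (?g * ?h) * \<epsilon> i = \<psi> r * (\<psi> r * ?g * \<epsilon> i) * ?h"
    using pol_\<epsilon>[OF pol_gg[OF rn(2,1)] i] by (metis mult.assoc)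
  also have "\<dots> = \<psi> r * (F r * ?h * \<epsilon> i)"
    using pol_\<epsilon>[OF pol_gg[OF rn(2,1)] i] link_ne[OF r i ne] by (metis mult.assoc)
  also have "\<dots> = \<psi> r * ?h' * \<epsilon> ?j * (F r * \<epsilon> i)"
    unfolding Fh' using F_arrow[OF r i ne] by (metis mult.assoc)
  also have "\<dots> = F r * F r * \<epsilon> i" using Fj F_arrow[OF r i ne] by (metis mult.assoc)
  finally show ?thesis using F_F[OF r] by simp
qed

sublocale klr: klr_rep
proof
  fix r i assume r: "r \<in> {1..<n}" and i: "i \<in> C"
  let ?j = "perm_act (sigma r) i"
  have j: "?j \<in> C" using C_closed r i by blast
  show "\<psi> r * \<epsilon> i = \<epsilon> ?j * \<psi> r"
  proof (rule eq_by_weights)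
    show "\<psi> r * \<epsilon> i * u = \<psi> r * \<epsilon> i" by (simp add: mult.assoc u_\<epsilon>[OF i])
    show "\<epsilon> ?j * \<psi> r * u = \<epsilon> ?j * \<psi> r" by (simp add: mult.assoc \<psi>_u[OF r])
    fix k assume k: "k \<in> C"
    let ?l = "perm_act (sigma r) k"
    have l: "?l \<in> C" using C_closed r k by blast
    have "\<epsilon> ?j * \<psi> r * \<epsilon> k = \<epsilon> ?j * \<epsilon> ?l * (\<psi> r * \<epsilon> k)" using \<psi>_arrow[OF r k] by (metis mult.assoc)
    moreover have "?j = ?l \<longleftrightarrow> i = k" by (metis perm_act_involutive)
    ultimately show "\<psi> r * \<epsilon> i * \<epsilon> k = \<epsilon> ?j * \<psi> r * \<epsilon> k"
      using \<psi>_arrow[OF r k] \<epsilon>_mult[OF i k] \<epsilon>_mult[OF j l] by (auto simp: mult.assoc)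
  qed
qed (fact \<psi>_u u_\<psi> \<psi>_x1 \<psi>_x2 \<psi>_x3 \<psi>_\<psi>0 \<psi>_\<psi>1)+

end

section \<open>Intertwiners of a rank three Hecke algebra\<close>

text \<open>The subalgebra generated by two adjacent \<open>T\<close>s and three
  \<open>x\<close>s, with abstract names so that normal forms can be computed; the braid relation
  is not assumed.\<close>

locale hecke_rank3 =
  fixes T1 T2 x1 x2 x3 b u :: "'r::ring_1"
  assumes b: "T1*b=b*T1" "T2*b=b*T2" "x1*b=b*x1" "x2*b=b*x2" "x3*b=b*x3" "u*b=b*u"
   and u: "u*T1=T1" "T1*u=T1" "u*T2=T2" "T2*u=T2" "u*x1=x1" "u*x2=x2" "u*x3=x3" "x1*u=x1" "x2*u=x2" "x3*u=x3" "u*u=u"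
   and x: "x2*x1=x1*x2" "x3*x1=x1*x3" "x3*x2=x2*x3"
   and xT: "x2*T1 = T1*x1 + (u + b*x2)" "x1*T1 = T1*x2 - (u+b*x2)" "x3*T1 = T1*x3"
    "x3*T2 = T2*x2 + (u + b*x3)" "x2*T2 = T2*x3 - (u+b*x3)" "x1*T2 = T2*x1"
   and TT: "T1*T1 = b*T1 + b*u + u" "T2*T2 = b*T2 + b*u+u"
begin

definition "F1 = T1*(x1-x2)+(u+b*x2)"
definition "F2 = T2*(x2-x3)+(u+b*x3)"

lemma mult_eq_left: "A*B = C ==> A*(B*D) = C*(D::'r)"
  by (metis mult.assoc)

lemmas nf = b u x xT TT
lemmas nf' = nf[THEN mult_eq_left]

text \<open>The failure of the intertwiners to braid is a polynomial multiple of the braid defect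
  of \<open>T\<close>. Both sides have the same normal form, with the polynomials on the
  right.\<close>

lemma braid_aab: "F1*F2*T1 - T2*F1*F2 = (T1*T2*T1-T2*T1*T2)*(x1-x3)*(x2-x3)"
    by (simp add: algebra_simps nf nf' F1_def F2_def)

lemma braid_abb: "T1*F2*F1 - F2*F1*T2 = (T1*T2*T1-T2*T1*T2)*(x1-x2)*(x1-x3)"
    by (simp add: algebra_simps nf nf' F1_def F2_def)

lemma braid_aba: "F1*T2*F1 - F2*T1*F2 +
  (u+b*x3)*((x2-(b+1)*x1-u) - (b+1)*(x3-(b+1)*x2-u)) = (T1*T2*T1-T2*T1*T2)*(x1-x2)*(x2-x3)"
    by (simp add: algebra_simps nf nf' F1_def F2_def)
end

section \<open>From the KLR generators to the Hecke generators\<close>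

text \<open>The converse passage: the Hecke relations are verified after multiplication by regular
  polynomials.\<close>

locale klr_link = klr_rep +
  fixes T :: "nat \<Rightarrow> 'b"
  assumes T_u: "r \<in> {1..<n} ==> T r * u = T r" and u_T: "r \<in> {1..<n} ==> u * T r = T r"
    and link: "r \<in> {1..<n} ==> i \<in> C ==> linked (T r) (\<psi> r) r i"
begin

context
  fixes r i assumes r: "r \<in> {1..<n}" and i: "i \<in> C"
begin

lemma rn: "r \<in> {1..n}" "Suc r \<in> {1..n}" using r by auto

lemma link_ne: "i r \<noteq> i (Suc r) ==> (T r * d r (Suc r) + h (Suc r)) * \<epsilon> i = \<psi> r * gg (i r) (i (Suc r)) r (Suc r) * \<epsilon> i"
  and link_eq: "i r = i (Suc r) ==> \<kappa> (w (i r)) * (T r + u) * \<epsilon> i = - (\<psi> r * G r (Suc r) * \<epsilon> i)"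
  using link[OF r i] by (simp_all add: linked_def)

lemma T_x_ne:
  assumes ne: "i r \<noteq> i (Suc r)" and s: "s \<in> {1..n}" and c: "x (sigma r s) - x s = \<kappa> c * d r (Suc r)"
  shows "T r * x s * \<epsilon> i = (x (sigma r s) * T r + \<kappa> c * h (Suc r)) * \<epsilon> i"
proof -
  let ?d = "d r (Suc r)" and ?h = "h (Suc r)" and ?g = "gg (i r) (i (Suc r)) r (Suc r)" and ?y = "x (sigma r s)"
  have ss: "sigma r s \<in> {1..n}" using s r by (auto simp: transpose_def)
  note cm = pol_commute[OF pol_d[OF rn] pol_x[OF s]] pol_commute[OF pol_h[OF rn(2)] pol_x[OF s]]
    pol_commute[OF pol_gg[OF rn] pol_x[OF s]] pol_commute[OF pol_h[OF rn(2)] pol_x[OF ss]]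
    x_\<epsilon>[OF s i] pol_\<epsilon>[OF pol_gg[OF rn] i]
  have "(T r * ?d + ?h) * x s * \<epsilon> i = (T r * ?d + ?h) * \<epsilon> i * x s" using x_\<epsilon>[OF s i] by (metis mult.assoc)
  also have "\<dots> = \<psi> r * ?g * \<epsilon> i * x s" by (simp only: link_ne[OF ne])
  also have "\<dots> = \<psi> r * x s * \<epsilon> i * ?g" using cm(3,5,6) by (metis mult.assoc)
  also have "\<psi> r * x s * \<epsilon> i = ?y * \<psi> r * \<epsilon> i" by (rule \<psi>_x3[OF r i s]) (use ne in blast)
  also have "?y * \<psi> r * \<epsilon> i * ?g = ?y * (\<psi> r * ?g * \<epsilon> i)" using cm(6) by (metis mult.assoc)
  also have "\<dots> = ?y * ((T r * ?d + ?h) * \<epsilon> i)" by (simp only: link_ne[OF ne])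
  finally have "T r * x s * ?d * \<epsilon> i + x s * ?h * \<epsilon> i = ?y * T r * ?d * \<epsilon> i + ?y * ?h * \<epsilon> i"
    using cm(1,2) by (simp add: distrib_left distrib_right mult.assoc)
  then have "T r * x s * ?d * \<epsilon> i = ?y * T r * ?d * \<epsilon> i + (?y - x s) * ?h * \<epsilon> i"
    by (simp add: algebra_simps)
  also have "\<dots> = (?y * T r + \<kappa> c * ?h) * ?d * \<epsilon> i"
    unfolding c using pol_commute[OF pol_d[OF rn] pol_h[OF rn(2)]] by (simp add: distrib_right mult.assoc)
  finally show ?thesis using regular_cancel regular_d[OF i rn ne] by blast
qed

lemma T_x_eq:
  assumes eq: "i r = i (Suc r)" and s: "s \<in> {1..n}"
    and c: "\<psi> r * x s * \<epsilon> i = (x s' * \<psi> r - \<kappa> (c * w (i r))) * \<epsilon> i"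
  shows "(T r + u) * x s * \<epsilon> i = (x s' * (T r + u) + \<kappa> c * G r (Suc r)) * \<epsilon> i"
proof -
  let ?g = "G r (Suc r)" and ?w = "\<kappa> (w (i r))"
  note cm = pol_commute[OF pol_G[OF rn] pol_x[OF s]] x_\<epsilon>[OF s i] pol_\<epsilon>[OF pol_G[OF rn] i]
  have "?w * ((T r + u) * x s * \<epsilon> i) = ?w * (T r + u) * \<epsilon> i * x s" using cm(2) by (metis mult.assoc)
  also have "\<dots> = - (\<psi> r * x s * \<epsilon> i * ?g)" unfolding link_eq[OF eq] using cm by (metis mult.assoc mult_minus_left)
  also have "\<dots> = x s' * (- (\<psi> r * ?g * \<epsilon> i)) + \<kappa> (c * w (i r)) * ?g * \<epsilon> i"
    unfolding c using cm(3) by (simp add: left_diff_distrib mult.assoc)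
  also have "\<dots> = ?w * ((x s' * (T r + u) + \<kappa> c * ?g) * \<epsilon> i)"
    unfolding link_eq[OF eq, symmetric]
    by (simp add: distrib_left distrib_right mult.assoc \<kappa>_mult_left[of "x s'"] \<kappa>_mult \<kappa>_mult_left[of "\<kappa> c"])
  finally show ?thesis by (rule \<kappa>_cancel[OF w_nz])
qed

lemma T_x1_\<epsilon>: "T r * x r * \<epsilon> i = (x (Suc r) * T r - h (Suc r)) * \<epsilon> i"
proof (cases "i r = i (Suc r)")
  case True
  have "(T r + u) * x r * \<epsilon> i = (x (Suc r) * (T r + u) + \<kappa> 1 * G r (Suc r)) * \<epsilon> i"
    by (rule T_x_eq[OF True rn(1)]) (use \<psi>_x1[OF r i True] in simp)
  then show ?thesis
    by (simp add: G_def h_def \<kappa>_minus algebra_simps u_x[OF rn(1)] x_u[OF rn(2)] u_\<epsilon>[OF i])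
next
  case False
  have "T r * x r * \<epsilon> i = (x (sigma r r) * T r + \<kappa> (- 1) * h (Suc r)) * \<epsilon> i"
    by (rule T_x_ne[OF False rn(1)]) (simp add: d_def \<kappa>_uminus)
  then show ?thesis by (simp add: \<kappa>_uminus)
qed

lemma T_x2_\<epsilon>: "T r * x (Suc r) * \<epsilon> i = (x r * T r + h (Suc r)) * \<epsilon> i"
proof (cases "i r = i (Suc r)")
  case True
  have "(T r + u) * x (Suc r) * \<epsilon> i = (x r * (T r + u) + \<kappa> (- 1) * G r (Suc r)) * \<epsilon> i"
    by (rule T_x_eq[OF True rn(2)]) (use \<psi>_x2[OF r i True] in \<open>simp add: \<kappa>_uminus\<close>)
  then show ?thesis
    by (simp add: G_def h_def \<kappa>_minus \<kappa>_uminus algebra_simps u_x[OF rn(2)] x_u[OF rn(1)] u_\<epsilon>[OF i])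
next
  case False
  have "T r * x (Suc r) * \<epsilon> i = (x (sigma r (Suc r)) * T r + \<kappa> 1 * h (Suc r)) * \<epsilon> i"
    by (rule T_x_ne[OF False rn(2)]) (simp add: d_def)
  then show ?thesis by simp
qed

lemma T_x3_\<epsilon>:
  assumes s: "s \<in> {1..n}" "s \<noteq> r" "s \<noteq> Suc r"
  shows "T r * x s * \<epsilon> i = x s * T r * \<epsilon> i"
proof (cases "i r = i (Suc r)")
  case True
  have "(T r + u) * x s * \<epsilon> i = (x s * (T r + u) + \<kappa> 0 * G r (Suc r)) * \<epsilon> i"
    by (rule T_x_eq[OF True s(1)]) (use \<psi>_x3[OF r i s(1)] s in \<open>simp add: transpose_def\<close>)
  then show ?thesis by (simp add: algebra_simps u_x[OF s(1)] x_u[OF s(1)] u_\<epsilon>[OF i])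
next
  case False
  have "T r * x s * \<epsilon> i = (x (sigma r s) * T r + \<kappa> 0 * h (Suc r)) * \<epsilon> i"
    by (rule T_x_ne[OF False s(1)]) (use s in \<open>simp add: transpose_def\<close>)
  then show ?thesis using s by (simp add: transpose_def)
qed

end

context
  fixes r assumes r: "r \<in> {1..<n}"
begin

lemma rn': "r \<in> {1..n}" "Suc r \<in> {1..n}" using r by auto

lemma T_x1: "T r * x r = x (Suc r) * T r - h (Suc r)"
  by (rule eq_by_weights)
    (use T_x1_\<epsilon>[OF r] x_u[OF rn'(1)] T_u[OF r] pol_commute[OF pol_h[OF rn'(2)] pol_u] in
      \<open>simp_all add: left_diff_distrib mult.assoc h_def distrib_right distrib_left u_u x_u[OF rn'(2)]\<close>)

lemma T_x2: "T r * x (Suc r) = x r * T r + h (Suc r)"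
  by (rule eq_by_weights)
    (use T_x2_\<epsilon>[OF r] x_u[OF rn'(2)] T_u[OF r] in
      \<open>simp_all add: mult.assoc h_def distrib_right distrib_left u_u\<close>)

lemma T_x3: "s \<in> {1..n} ==> s \<noteq> r ==> s \<noteq> Suc r ==> T r * x s = x s * T r"
  by (rule eq_by_weights)
    (use T_x3_\<epsilon>[OF r] T_u[OF r] in \<open>simp_all add: mult.assoc x_u\<close>)

lemma quadratic_identity:
  "h (Suc r) * (T r * d r (Suc r) + h (Suc r)) - T r * h (Suc r) * d r (Suc r) - G (Suc r) r * G r (Suc r)
    = (\<kappa> (q - 1) * T r + \<kappa> q * u) * d r (Suc r) * d r (Suc r)"
proof -
  note rn = rn'
  let ?b = "\<kappa> (q - 1)"
  have q: "\<kappa> q = ?b + 1" using \<kappa>_add[of "q - 1" 1] by simp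
  have Tx: "x (Suc r) * T r = T r * x r + u + ?b * x (Suc r)" "x r * T r = T r * x (Suc r) - u - ?b * x (Suc r)"
    using T_x1 T_x2 by (simp_all add: h_def algebra_simps)
  note rules = u_x[OF rn(1)] x_u[OF rn(1)] u_x[OF rn(2)] x_u[OF rn(2)] u_u T_u[OF r] u_T[OF r]
    x_x[OF rn(2,1)] Tx \<kappa>_central[of "x r"] \<kappa>_central[of "x (Suc r)"] \<kappa>_central[of "T r"] \<kappa>_central[of u]
  have ext: "A * B = D ==> A * (B * E) = D * E" for A B D E :: 'b by (metis mult.assoc)
  show ?thesis
    unfolding G_def h_def d_def q
    by (simp add: algebra_simps rules rules[THEN ext])
qed

lemma T_T_\<epsilon>:
  assumes i: "i \<in> C"
  shows "T r * T r * \<epsilon> i = (\<kappa> (q - 1) * T r + \<kappa> q * u) * \<epsilon> i"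
proof (cases "i r = i (Suc r)")
  case True
  let ?g = "G r (Suc r)" and ?g' = "G (Suc r) r" and ?w = "\<kappa> (w (i r))"
  have s: "perm_act (sigma r) i = i" by (rule ext) (use True in \<open>auto simp: transpose_def\<close>)
  have ar: "\<epsilon> i * \<psi> r = \<psi> r * \<epsilon> i" using \<psi>_\<epsilon>[OF r i] by (simp add: s)
  have g\<epsilon>: "?g * \<epsilon> i = \<epsilon> i * ?g" by (rule pol_\<epsilon>[OF pol_G[OF rn'] i])
  have 1: "?g * \<psi> r * \<epsilon> i = \<psi> r * ?g' * \<epsilon> i - ?w * \<kappa> (q + 1) * \<epsilon> i"
  proof -
    have "\<psi> r * ?g' * \<epsilon> i = \<psi> r * x (Suc r) * \<epsilon> i - \<kappa> q * (\<psi> r * x r * \<epsilon> i) - \<psi> r * \<epsilon> i"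
      by (simp add: G_def left_diff_distrib right_diff_distrib mult.assoc \<kappa>_mult_left[of "\<psi> r"] u_\<epsilon>[OF i])
    also have "\<dots> = (x r * \<psi> r + ?w) * \<epsilon> i - \<kappa> q * ((x (Suc r) * \<psi> r - ?w) * \<epsilon> i) - u * \<psi> r * \<epsilon> i"
      by (simp only: \<psi>_x1[OF r i True] \<psi>_x2[OF r i True] u_\<psi>[OF r])
    also have "\<dots> = ?g * \<psi> r * \<epsilon> i + (?w + \<kappa> q * ?w) * \<epsilon> i"
      by (simp add: G_def left_diff_distrib right_diff_distrib distrib_right mult.assoc)
    also have "?w + \<kappa> q * ?w = ?w * \<kappa> (q + 1)"
      by (simp add: \<kappa>_add distrib_left \<kappa>_central[of ?w q])
    finally show ?thesis by simp
  qed
  have "?w * (T r + u) * \<epsilon> i * (?w * (T r + u) * \<epsilon> i) = \<psi> r * ?g * \<epsilon> i * (\<psi> r * ?g * \<epsilon> i)"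
    unfolding link_eq[OF r i True] by simp
  also have "\<dots> = \<psi> r * (?g * \<psi> r * \<epsilon> i) * ?g" using ar g\<epsilon> \<epsilon>_idem[OF i] by (metis mult.assoc)
  also have "\<dots> = (\<psi> r * \<psi> r * \<epsilon> i) * (?g' * ?g) - ?w * \<kappa> (q + 1) * (\<psi> r * ?g * \<epsilon> i)"
    unfolding 1 using pol_\<epsilon>[OF pol_G[OF rn'(2,1)] i] pol_\<epsilon>[OF pol_G[OF rn'] i]
    by (simp add: algebra_simps \<kappa>_mult_left[of "\<psi> r"])
  also have "\<dots> = ?w * \<kappa> (q + 1) * (?w * (T r + u) * \<epsilon> i)"
    unfolding link_eq[OF r i True] \<psi>_\<psi>0[OF r i True] by simp
  finally have *: "?w * (T r + u) * \<epsilon> i * (?w * (T r + u) * \<epsilon> i) = ?w * \<kappa> (q + 1) * (?w * (T r + u) * \<epsilon> i)" .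
  have "\<epsilon> i * (?w * (T r + u) * \<epsilon> i) = ?w * (T r + u) * \<epsilon> i"
    unfolding link_eq[OF r i True] using ar g\<epsilon> \<epsilon>_idem[OF i] by (metis mult.assoc mult_minus_right)
  then have "?w * ((T r + u) * (?w * (T r + u) * \<epsilon> i)) = ?w * (\<kappa> (q + 1) * (?w * (T r + u) * \<epsilon> i))"
    using * by (metis mult.assoc)
  then have "(T r + u) * (?w * (T r + u) * \<epsilon> i) = \<kappa> (q + 1) * (?w * (T r + u) * \<epsilon> i)"
    by (rule \<kappa>_cancel[OF w_nz])
  then have "?w * ((T r + u) * (T r + u) * \<epsilon> i) = ?w * (\<kappa> (q + 1) * (T r + u) * \<epsilon> i)"
    by (metis \<kappa>_mult_left mult.assoc)
  then have "(T r + u) * (T r + u) * \<epsilon> i = \<kappa> (q + 1) * (T r + u) * \<epsilon> i"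
    by (rule \<kappa>_cancel[OF w_nz])
  then show ?thesis
    by (simp add: algebra_simps T_u[OF r] u_T[OF r] u_u u_\<epsilon>[OF i] \<kappa>_add \<kappa>_minus)
next
  case False
  let ?j = "perm_act (sigma r) i"
  let ?d = "d r (Suc r)" and ?h = "h (Suc r)" and ?g = "gg (i r) (i (Suc r)) r (Suc r)"
    and ?k = "gg (i (Suc r)) (i r) r (Suc r)" and ?k' = "gg (i (Suc r)) (i r) (Suc r) r"
  have j: "?j \<in> C" using C_closed r i by blast
  note rn = rn'
  have ar: "\<psi> r * \<epsilon> i = \<epsilon> ?j * (\<psi> r * \<epsilon> i)" using \<psi>_\<epsilon>[OF r i] \<epsilon>_idem[OF i] by (metis mult.assoc)
  have Tj: "T r * ?d * \<epsilon> ?j = (\<psi> r * ?k - ?h) * \<epsilon> ?j"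
    using link_ne[OF r j] False by (simp add: algebra_simps)
  have Ti: "T r * ?d * \<epsilon> i = (\<psi> r * ?g - ?h) * \<epsilon> i"
    using link_ne[OF r i] False by (simp add: algebra_simps)
  have \<psi>d: "\<psi> r * ?d * \<epsilon> i = - (?d * \<psi> r * \<epsilon> i)"
    using \<psi>_x3[OF r i rn(1)] \<psi>_x3[OF r i rn(2)] False by (simp add: d_def algebra_simps)
  have k: "?k * \<psi> r * \<epsilon> i = \<psi> r * ?k' * \<epsilon> i"
  proof -
    have "\<psi> r * gg (i (Suc r)) (i r) (Suc r) r * \<epsilon> i = gg (i (Suc r)) (i r) (sigma r (Suc r)) (sigma r r) * \<psi> r * \<epsilon> i"
      by (rule gg_swap) (use False \<psi>_x3[OF r i] \<psi>_u[OF r] u_\<psi>[OF r] x_\<epsilon> i u_\<epsilon> rn in auto)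
    then show ?thesis by simp
  qed
  note pc = pol_commute[OF pol_d[OF rn] pol_gg[OF rn]] pol_\<epsilon>[OF pol_gg[OF rn] i] pol_\<epsilon>[OF pol_d[OF rn] i]
  have "T r * T r * (?d * ?d) * \<epsilon> i = T r * (T r * ?d * \<epsilon> i) * ?d" using pc(3) by (metis mult.assoc)
  also have "\<dots> = T r * \<psi> r * ?g * ?d * \<epsilon> i - T r * ?h * ?d * \<epsilon> i"
    unfolding Ti using pc(3) by (simp add: algebra_simps)
  also have "T r * \<psi> r * ?g * ?d * \<epsilon> i = T r * (\<psi> r * ?d * \<epsilon> i) * ?g" using pc by (metis mult.assoc)
  also have "\<dots> = - (T r * ?d * \<epsilon> ?j * (\<psi> r * \<epsilon> i) * ?g)"
    unfolding \<psi>d using ar by (simp add: mult.assoc)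
  also have "\<dots> = - (\<psi> r * (?k * \<psi> r * \<epsilon> i) * ?g) + ?h * (\<psi> r * \<epsilon> i * ?g)"
    unfolding Tj using ar by (simp add: algebra_simps)
  also have "\<dots> = - (\<psi> r * \<psi> r * (?g * ?k') * \<epsilon> i) + ?h * (\<psi> r * ?g * \<epsilon> i)"
  proof -
    have "?k' * (\<epsilon> i * ?g) = ?g * (?k' * \<epsilon> i)"
    proof -
      have "?k' * (\<epsilon> i * ?g) = (?k' * ?g) * \<epsilon> i" by (simp only: pc(2) mult.assoc)
      also have "?k' * ?g = ?g * ?k'" by (rule pol_commute[OF pol_gg[OF rn(2,1)] pol_gg[OF rn]])
      finally show ?thesis by (simp only: mult.assoc)
    qed
    moreover have "\<epsilon> i * ?g = ?g * \<epsilon> i" by (simp only: pc(2))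
    ultimately show ?thesis unfolding k by (simp only: mult.assoc)
  qed
  also have "\<dots> = (?h * (T r * ?d + ?h) - G (Suc r) r * G r (Suc r)) * \<epsilon> i"
    unfolding \<psi>_\<psi>1[OF r i False] link_ne[OF r i False, symmetric]
    using pol_commute[OF pol_G[OF rn] pol_G[OF rn(2,1)]] by (simp add: left_diff_distrib mult.assoc)
  finally have "T r * T r * (?d * ?d) * \<epsilon> i
      = (?h * (T r * ?d + ?h) - T r * ?h * ?d - G (Suc r) r * G r (Suc r)) * \<epsilon> i"
    by (simp add: left_diff_distrib)
  also have "\<dots> = (\<kappa> (q - 1) * T r + \<kappa> q * u) * (?d * ?d) * \<epsilon> i"
    unfolding quadratic_identity by (simp only: mult.assoc)
  finally show ?thesis
    using regular_cancel regular_mult[OF regular_d[OF i rn False] regular_d[OF i rn False]] by blast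
qed

lemma T_T: "T r * T r = \<kappa> (q - 1) * T r + \<kappa> q * u"
  by (rule eq_by_weights) (use T_T_\<epsilon> T_u[OF r] in \<open>simp_all add: distrib_right mult.assoc u_u\<close>)

end

sublocale hecke: hecke_rep
  by unfold_locales (fact T_u u_T T_x1 T_x2 T_x3 T_T)+

end

section \<open>Equivalence of the braid relations\<close>
text \<open>Hecke and KLR generators for the same weights that determine each other; no braid or
  far commutation relations are assumed.\<close>

locale bk = orbit_system + hecke_rep + klr_rep +
  assumes link: "r \<in> {1..<n} ==> i \<in> C ==> linked (T r) (\<psi> r) r i"
begin

text \<open>\<open>z\<close> lies in the weight space of \<open>j\<close>; equations are applied
  to such \<open>z\<close> to read off the weight met by each factor.\<close>

definition wt :: "(nat \<Rightarrow> int) \<Rightarrow> 'b \<Rightarrow> bool" where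
  "wt j z \<longleftrightarrow> j \<in> C \<and> \<epsilon> j * z = z"

lemma wt_\<epsilon>: "i \<in> C ==> wt i (\<epsilon> i)" by (simp add: wt_def \<epsilon>_idem)

lemma wt_pol: "wt j z ==> pol f ==> wt j (f * z)"
  unfolding wt_def using pol_\<epsilon>[of f j] by (metis mult.assoc)

lemma wt_\<psi>: "wt j z ==> r \<in> {1..<n} ==> wt (perm_act (sigma r) j) (\<psi> r * z)"
  unfolding wt_def using \<psi>_\<epsilon>[of r j] C_closed[of r j] by (metis mult.assoc)

lemma wt_u: "wt j z ==> u * z = z"
  unfolding wt_def by (metis mult.assoc u_\<epsilon>(1))

lemma F_wt:
  assumes "wt j z" "r \<in> {1..<n}" "j r \<noteq> j (Suc r)"
  shows "F r * z = \<psi> r * (gg (j r) (j (Suc r)) r (Suc r) * z)"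
proof -
  have "F r * \<epsilon> j = \<psi> r * gg (j r) (j (Suc r)) r (Suc r) * \<epsilon> j"
    using link[OF assms(2), of j] assms by (simp add: linked_def F_def wt_def)
  then show ?thesis using assms(1) unfolding wt_def by (metis mult.assoc)
qed

lemma T_wt:
  assumes "wt j z" "r \<in> {1..<n}" "j r = j (Suc r)"
  shows "\<kappa> (w (j r)) * (T r * z) = - (\<psi> r * (G r (Suc r) * z)) - \<kappa> (w (j r)) * z"
proof -
  have "\<kappa> (w (j r)) * (T r + u) * \<epsilon> j = - (\<psi> r * G r (Suc r) * \<epsilon> j)"
    using link[OF assms(2), of j] assms by (simp add: linked_def wt_def)
  then have "\<kappa> (w (j r)) * (T r + u) * \<epsilon> j * z = - (\<psi> r * G r (Suc r) * \<epsilon> j) * z" by simp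
  then have "\<kappa> (w (j r)) * ((T r + u) * z) = - (\<psi> r * (G r (Suc r) * z))"
    using assms(1) unfolding wt_def by (simp add: mult.assoc)
  then show ?thesis by (simp add: distrib_right distrib_left wt_u[OF assms(1)] eq_diff_eq)
qed

lemma x_\<psi>_ne:
  assumes "wt j z" "r \<in> {1..<n}" "j r \<noteq> j (Suc r) \<or> s \<noteq> r \<and> s \<noteq> Suc r" "s \<in> {1..n}"
  shows "x s * (\<psi> r * z) = \<psi> r * (x (sigma r s) * z)"
proof -
  have s: "sigma r s \<in> {1..n}" using assms by (auto simp: transpose_def)
  have "\<psi> r * x (sigma r s) * \<epsilon> j = x s * \<psi> r * \<epsilon> j"
    using \<psi>_x3[OF assms(2) _ s, of j] assms by (auto simp: wt_def transpose_def split: if_splits)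
  then show ?thesis using assms(1) unfolding wt_def by (metis mult.assoc)
qed

lemma x_\<psi>_eq:
  assumes "wt j z" "r \<in> {1..<n}" "j r = j (Suc r)"
  shows "x (Suc r) * (\<psi> r * z) = \<psi> r * (x r * z) + \<kappa> (w (j r)) * z"
    and "x r * (\<psi> r * z) = \<psi> r * (x (Suc r) * z) - \<kappa> (w (j r)) * z"
proof -
  have j: "j \<in> C" "\<epsilon> j * z = z" using assms(1) by (auto simp: wt_def)
  have "\<psi> r * x r * \<epsilon> j * z = (x (Suc r) * \<psi> r - \<kappa> (w (j r))) * \<epsilon> j * z"
    using \<psi>_x1[OF assms(2) j(1) assms(3)] by simp
  then show "x (Suc r) * (\<psi> r * z) = \<psi> r * (x r * z) + \<kappa> (w (j r)) * z"
    by (simp add: mult.assoc j(2) left_diff_distrib)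
  have "\<psi> r * x (Suc r) * \<epsilon> j * z = (x r * \<psi> r + \<kappa> (w (j r))) * \<epsilon> j * z"
    using \<psi>_x2[OF assms(2) j(1) assms(3)] by simp
  then show "x r * (\<psi> r * z) = \<psi> r * (x (Suc r) * z) - \<kappa> (w (j r)) * z"
    by (simp add: mult.assoc j(2) distrib_right)
qed

lemma \<psi>_\<psi>_eq: "wt j z ==> r \<in> {1..<n} ==> j r = j (Suc r) ==> \<psi> r * (\<psi> r * z) = 0"
  unfolding wt_def using \<psi>_\<psi>0[of r j] by (metis mult.assoc mult_zero_left)

lemma gg_\<psi>:
  assumes "wt j z" "r \<in> {1..<n}" "j r \<noteq> j (Suc r) \<or> {s, t} \<inter> {r, Suc r} = {}" "s \<in> {1..n}" "t \<in> {1..n}"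
  shows "gg a b s t * (\<psi> r * z) = \<psi> r * (gg a b (sigma r s) (sigma r t) * z)"
    and "G s t * (\<psi> r * z) = \<psi> r * (G (sigma r s) (sigma r t) * z)"
proof -
  have X: "x s * (\<psi> r * z) = \<psi> r * (x (sigma r s) * z)" "x t * (\<psi> r * z) = \<psi> r * (x (sigma r t) * z)"
    using x_\<psi>_ne[OF assms(1,2)] assms(3-5) by auto
  have U: "u * (\<psi> r * z) = \<psi> r * z" "u * z = z" using wt_u wt_\<psi> assms(1,2) by blast+
  show "G s t * (\<psi> r * z) = \<psi> r * (G (sigma r s) (sigma r t) * z)"
    by (simp add: G_def left_diff_distrib right_diff_distrib mult.assoc X U \<kappa>_mult_left[of "\<psi> r"])
  then show "gg a b s t * (\<psi> r * z) = \<psi> r * (gg a b (sigma r s) (sigma r t) * z)"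
    by (simp add: gg_def \<kappa>_mult_left[of "\<psi> r"])
qed

lemma G_\<psi>_eq:
  assumes "wt j z" "r \<in> {1..<n}" "j r = j (Suc r)" "t \<in> {1..n}" "t \<noteq> r" "t \<noteq> Suc r"
  shows "G (Suc r) t * (\<psi> r * z) = \<psi> r * (G r t * z) + \<kappa> (w (j r)) * z"
    and "G r t * (\<psi> r * z) = \<psi> r * (G (Suc r) t * z) - \<kappa> (w (j r)) * z"
    and "G t (Suc r) * (\<psi> r * z) = \<psi> r * (G t r * z) - \<kappa> q * (\<kappa> (w (j r)) * z)"
    and "G t r * (\<psi> r * z) = \<psi> r * (G t (Suc r) * z) + \<kappa> q * (\<kappa> (w (j r)) * z)"
proof -
  have X: "x t * (\<psi> r * z) = \<psi> r * (x t * z)"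
    using x_\<psi>_ne[OF assms(1,2), of t] assms(4-6) by (simp add: transpose_def)
  have U: "u * (\<psi> r * z) = \<psi> r * z" "u * z = z" using wt_u wt_\<psi> assms(1,2) by blast+
  note * = X U x_\<psi>_eq[OF assms(1-3)] \<kappa>_mult_left[of "\<psi> r"]
  show "G (Suc r) t * (\<psi> r * z) = \<psi> r * (G r t * z) + \<kappa> (w (j r)) * z"
    and "G r t * (\<psi> r * z) = \<psi> r * (G (Suc r) t * z) - \<kappa> (w (j r)) * z"
    and "G t (Suc r) * (\<psi> r * z) = \<psi> r * (G t r * z) - \<kappa> q * (\<kappa> (w (j r)) * z)"
    and "G t r * (\<psi> r * z) = \<psi> r * (G t (Suc r) * z) + \<kappa> q * (\<kappa> (w (j r)) * z)"
    by (simp_all add: G_def algebra_simps *)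
qed

lemma gg_gg_\<psi>_eq:
  assumes a: "wt j z" "r \<in> {1..<n}" "j r = j (Suc r)" "t \<in> {1..n}" "t \<noteq> r" "t \<noteq> Suc r"
  shows "gg a b r t * (gg a b (Suc r) t * (\<psi> r * z)) = \<psi> r * (gg a b r t * (gg a b (Suc r) t * z))"
    and "gg a b t r * (gg a b t (Suc r) * (\<psi> r * z)) = \<psi> r * (gg a b t r * (gg a b t (Suc r) * z))"
proof -
  have rn: "r \<in> {1..n}" "Suc r \<in> {1..n}" using a(2) by auto
  note pc = pol_commute[OF pol_G[OF rn(1) a(4)] pol_G[OF rn(2) a(4)]] pol_commute[OF pol_G[OF a(4) rn(1)] pol_G[OF a(4) rn(2)]]
  note at1 = wt_pol[OF a(1) pol_G[OF rn(1) a(4)]] and at2 = wt_pol[OF a(1) pol_G[OF a(4) rn(1)]]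
  have 1: "G r t * (G (Suc r) t * (\<psi> r * z)) = \<psi> r * (G r t * (G (Suc r) t * z))"
  proof -
    have "G r t * (G (Suc r) t * (\<psi> r * z)) = G r t * (\<psi> r * (G r t * z)) + \<kappa> (w (j r)) * (G r t * z)"
      by (simp add: G_\<psi>_eq(1)[OF a] distrib_left \<kappa>_mult_left[of "G r t"])
    also have "\<dots> = \<psi> r * (G (Suc r) t * (G r t * z))" by (simp add: G_\<psi>_eq(2)[OF at1 a(2-6)])
    finally show ?thesis using pc(1) by (metis mult.assoc)
  qed
  have 2: "G t r * (G t (Suc r) * (\<psi> r * z)) = \<psi> r * (G t r * (G t (Suc r) * z))"
  proof -
    have "G t r * (G t (Suc r) * (\<psi> r * z)) = G t r * (\<psi> r * (G t r * z)) - \<kappa> q * (\<kappa> (w (j r)) * (G t r * z))"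
      by (simp add: G_\<psi>_eq(3)[OF a] right_diff_distrib \<kappa>_mult_left[of "G t r"])
    also have "\<dots> = \<psi> r * (G t (Suc r) * (G t r * z))" by (simp add: G_\<psi>_eq(4)[OF at2 a(2-6)])
    finally show ?thesis using pc(2) by (metis mult.assoc)
  qed
  show "gg a b r t * (gg a b (Suc r) t * (\<psi> r * z)) = \<psi> r * (gg a b r t * (gg a b (Suc r) t * z))"
    using 1 by (simp add: gg_def \<kappa>_mult_left[of "\<psi> r"])
  show "gg a b t r * (gg a b t (Suc r) * (\<psi> r * z)) = \<psi> r * (gg a b t r * (gg a b t (Suc r) * z))"
    using 2 by (simp add: gg_def \<kappa>_mult_left[of "\<psi> r"])
qed

subsection \<open>Distant generators\<close>
text \<open>A uniform way to write the link: \<open>(T r * la + lb) * \<epsilon> i = \<psi> r * lg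
  * \<epsilon> i\<close> in all cases.\<close>

definition la where "la r i = (if i r = i (Suc r) then \<kappa> (w (i r)) else d r (Suc r))"
definition lb where "lb r i = (if i r = i (Suc r) then \<kappa> (w (i r)) * u else h (Suc r))"
definition lg where "lg r i = (if i r = i (Suc r) then - G r (Suc r) else gg (i r) (i (Suc r)) r (Suc r))"

lemma pol_uminus: "pol f ==> pol (- f)"
  using pol_diff[OF pol_\<kappa>[of 0]] by simp

lemma regular_uminus: "regular f i ==> regular (- f) i"
  by (simp add: regular_def)

context
  fixes r s assumes r: "r \<in> {1..<n}" and s: "s \<in> {1..<n}" and far: "\<bar>int r - int s\<bar> > 1"
begin

lemma rn: "r \<in> {1..n}" "Suc r \<in> {1..n}" using r by auto

lemma pol_l: "pol (la r i)" "pol (lb r i)" "pol (lg r i)"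
  using rn by (auto simp: la_def lb_def lg_def intro!: pol_intros pol_uminus)

lemma link_wt:
  assumes "wt j z" shows "T r * (la r j * z) = \<psi> r * (lg r j * z) - lb r j * z"
proof -
  have j: "j \<in> C" "\<epsilon> j * z = z" using assms by (auto simp: wt_def)
  have "T r * la r j * \<epsilon> j = \<psi> r * lg r j * \<epsilon> j - lb r j * \<epsilon> j"
    using link[OF r j(1)]
    by (auto simp: linked_def la_def lb_def lg_def algebra_simps \<kappa>_mult_left[of "T r"] split: if_splits)
  then have "T r * la r j * \<epsilon> j * z = \<psi> r * lg r j * \<epsilon> j * z - lb r j * \<epsilon> j * z"
    by (simp add: left_diff_distrib)
  then show ?thesis by (simp add: mult.assoc j)
qed

lemma l_sigma: "la r (perm_act (sigma s) i) = la r i" "lb r (perm_act (sigma s) i) = lb r i"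
  "lg r (perm_act (sigma s) i) = lg r i"
  using far by (auto simp: la_def lb_def lg_def transpose_def)

lemma l_\<psi>:
  assumes "wt j z"
  shows "la r i * (\<psi> s * z) = \<psi> s * (la r i * z)" "lb r i * (\<psi> s * z) = \<psi> s * (lb r i * z)"
    "lg r i * (\<psi> s * z) = \<psi> s * (lg r i * z)"
proof -
  have "r \<noteq> s" "Suc r \<noteq> s" "r \<noteq> Suc s" using far by auto
  then have X: "x r * (\<psi> s * z) = \<psi> s * (x r * z)" "x (Suc r) * (\<psi> s * z) = \<psi> s * (x (Suc r) * z)"
    using x_\<psi>_ne[OF assms s, of r] x_\<psi>_ne[OF assms s, of "Suc r"] rn by (auto simp: transpose_def)
  have U: "u * (\<psi> s * z) = \<psi> s * z" "u * z = z" using wt_u wt_\<psi> assms s by blast+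
  note * = X U \<kappa>_mult_left[of "\<psi> s"]
  show "la r i * (\<psi> s * z) = \<psi> s * (la r i * z)" "lb r i * (\<psi> s * z) = \<psi> s * (lb r i * z)"
    "lg r i * (\<psi> s * z) = \<psi> s * (lg r i * z)"
    by (simp_all add: la_def lb_def lg_def gg_def G_def h_def d_def algebra_simps *)
qed

lemma far_half:
  assumes i: "i \<in> C" and pl: "pol (la s i)" "pol (lb s i)" "pol (lg s i)"
    and link_s: "\<And>z. wt i z ==> T s * (la s i * z) = \<psi> s * (lg s i * z) - lb s i * z"
  shows "T r * (T s * (la s i * (la r i * \<epsilon> i))) = \<psi> r * (\<psi> s * (lg s i * (lg r i * \<epsilon> i)))
    - \<psi> s * (lg s i * (lb r i * \<epsilon> i)) - \<psi> r * (lg r i * (lb s i * \<epsilon> i)) + lb s i * (lb r i * \<epsilon> i)"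
proof -
  let ?E = "\<epsilon> i"
  have wt: "wt i (f * ?E)" if "pol f" for f using wt_pol wt_\<epsilon> i that by blast
  have cm: "f * (g * ?E) = g * (f * ?E)" if "pol f" "pol g" for f g
    using pol_commute[OF that] by (metis mult.assoc)
  have as: "wt (perm_act (sigma s) i) (\<psi> s * (lg s i * ?E))" using wt_\<psi> wt pl s by blast
  have "T r * (T s * (la s i * (la r i * ?E))) = T r * (\<psi> s * (lg s i * (la r i * ?E))) - T r * (lb s i * (la r i * ?E))"
    by (simp add: link_s[OF wt[OF pol_l(1)]] right_diff_distrib)
  also have "lg s i * (la r i * ?E) = la r i * (lg s i * ?E)" by (rule cm[OF pl(3) pol_l(1)])
  also have "\<psi> s * \<dots> = la r i * (\<psi> s * (lg s i * ?E))" by (rule l_\<psi>(1)[OF wt[OF pl(3)], symmetric])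
  also have "T r * \<dots> = \<psi> r * (lg r i * (\<psi> s * (lg s i * ?E))) - lb r i * (\<psi> s * (lg s i * ?E))"
    using link_wt[OF as] by (simp add: l_sigma)
  also have "lg r i * (\<psi> s * (lg s i * ?E)) = \<psi> s * (lg s i * (lg r i * ?E))"
    using l_\<psi>(3)[OF wt[OF pl(3)]] cm[OF pl(3) pol_l(3)] by simp
  also have "lb r i * (\<psi> s * (lg s i * ?E)) = \<psi> s * (lg s i * (lb r i * ?E))"
    using l_\<psi>(2)[OF wt[OF pl(3)]] cm[OF pl(3) pol_l(2)] by simp
  also have "lb s i * (la r i * ?E) = la r i * (lb s i * ?E)" by (rule cm[OF pl(2) pol_l(1)])
  also have "T r * \<dots> = \<psi> r * (lg r i * (lb s i * ?E)) - lb r i * (lb s i * ?E)"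
    by (rule link_wt[OF wt[OF pl(2)]])
  also have "lb r i * (lb s i * ?E) = lb s i * (lb r i * ?E)" by (rule cm[OF pol_l(2) pl(2)])
  finally show ?thesis by simp
qed

end

lemma regular_l:
  assumes "r \<in> {1..<n}" "i \<in> C"
  shows "regular (la r i) i" "regular (lg r i) i"
proof -
  have rn: "r \<in> {1..n}" "Suc r \<in> {1..n}" using assms by auto
  show "regular (la r i) i" using assms rn by (auto simp: la_def regular_\<kappa>[OF w_nz] intro: regular_d)
  show "regular (lg r i) i"
    using assms rn G_swap_regular(1)[OF assms] by (auto simp: lg_def intro: regular_uminus regular_gg)
qed

text \<open>Multiply the commutators by the regular factors of both links. These factors depend on
  disjoint pairs of strands, so they pass through the distant generator unchanged.\<close>

lemma far_commute_iff:
  assumes r: "r \<in> {1..<n}" and s: "s \<in> {1..<n}" and far: "\<bar>int r - int s\<bar> > 1"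
  shows "T r * T s = T s * T r \<longleftrightarrow> \<psi> r * \<psi> s = \<psi> s * \<psi> r"
proof -
  have far': "\<bar>int s - int r\<bar> > 1" using far by simp
  have main: "(T r * T s - T s * T r) * (la s i * la r i) * \<epsilon> i = (\<psi> r * \<psi> s - \<psi> s * \<psi> r) * (lg s i * lg r i) * \<epsilon> i"
    if i: "i \<in> C" for i
  proof -
    note 1 = far_half[OF r s far i pol_l[OF s r far'] link_wt[OF s r far']]
    note 2 = far_half[OF s r far' i pol_l[OF r s far] link_wt[OF r s far]]
    note pr = pol_l[OF r s far, of i] and ps = pol_l[OF s r far', of i]
    have cm: "f * (g * \<epsilon> i) = g * (f * \<epsilon> i)" if "pol f" "pol g" for f g
      using pol_commute[OF that] by (metis mult.assoc)
    have "T r * (T s * (la s i * (la r i * \<epsilon> i))) - T s * (T r * (la s i * (la r i * \<epsilon> i)))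
      = \<psi> r * (\<psi> s * (lg s i * (lg r i * \<epsilon> i))) - \<psi> s * (\<psi> r * (lg s i * (lg r i * \<epsilon> i)))"
      using 1 2 cm[OF pr(1) ps(1)] cm[OF pr(3) ps(3)] cm[OF pr(2) ps(2)] by simp
    then show ?thesis by (simp add: left_diff_distrib mult.assoc)
  qed
  have reg: "regular (la s i * la r i) i" "regular (lg s i * lg r i) i" if "i \<in> C" for i
    using regular_mult regular_l r s that by blast+
  show ?thesis
  proof
    assume e: "T r * T s = T s * T r"
    show "\<psi> r * \<psi> s = \<psi> s * \<psi> r"
    proof (rule eq_by_weights)
      fix i assume i: "i \<in> C"
      have "(\<psi> r * \<psi> s - \<psi> s * \<psi> r) * (lg s i * lg r i) * \<epsilon> i = 0" using main[OF i] e by simp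
      then have "(\<psi> r * \<psi> s - \<psi> s * \<psi> r) * \<epsilon> i = 0" using reg(2)[OF i] unfolding regular_def by blast
      then show "\<psi> r * \<psi> s * \<epsilon> i = \<psi> s * \<psi> r * \<epsilon> i" by (simp add: left_diff_distrib)
    qed (use \<psi>_u r s in \<open>simp_all add: mult.assoc\<close>)
  next
    assume e: "\<psi> r * \<psi> s = \<psi> s * \<psi> r"
    show "T r * T s = T s * T r"
    proof (rule eq_by_weights)
      fix i assume i: "i \<in> C"
      have "(T r * T s - T s * T r) * (la s i * la r i) * \<epsilon> i = 0" using main[OF i] e by simp
      then have "(T r * T s - T s * T r) * \<epsilon> i = 0" using reg(1)[OF i] unfolding regular_def by blast
      then show "T r * T s * \<epsilon> i = T s * T r * \<epsilon> i" by (simp add: left_diff_distrib)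
    qed (use T_u r s in \<open>simp_all add: mult.assoc\<close>)
  qed
qed

end

section \<open>Braid defects with at most two equal adjacent residues\<close>

context bk
begin

definition DT where "DT r = T r * T (Suc r) * T r - T (Suc r) * T r * T (Suc r)"
definition DP where "DP r = \<psi> r * \<psi> (Suc r) * \<psi> r - \<psi> (Suc r) * \<psi> r * \<psi> (Suc r)"

end

text \<open>Three neighbouring strands \<open>r, s, t\<close> and a weight \<open>i\<close>.\<close>

locale bk3 = bk +
  fixes r s t :: nat and i :: "nat \<Rightarrow> int"
  assumes r: "r \<in> {1..<n}" and s: "s \<in> {1..<n}" and i: "i \<in> C" and st: "s = Suc r" "t = Suc s"
begin

lemma rst: "r \<in> {1..n}" "s \<in> {1..n}" "t \<in> {1..n}" "Suc r \<in> {1..n}" "Suc s \<in> {1..n}"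
  "t \<noteq> r" "t \<noteq> s" "r \<noteq> s" "s \<noteq> r" "r \<noteq> t" "s \<noteq> t"
  "sigma r r = s" "sigma r s = r" "sigma r t = t" "sigma s r = r" "sigma s s = t" "sigma s t = s"
  "r \<noteq> Suc s" "Suc s \<noteq> r" "Suc r \<noteq> t" "t \<noteq> Suc r"
  using r s st by (auto simp: transpose_def)

lemma pas: "perm_act (sigma r) f r = f s" "perm_act (sigma r) f s = f r" "perm_act (sigma r) f t = f t"
  "perm_act (sigma s) f r = f r" "perm_act (sigma s) f s = f t" "perm_act (sigma s) f t = f s"
  by (simp_all only: perm_act_transpose rst)

lemma hecke_rank3: "hecke_rank3 (T r) (T s) (x r) (x s) (x t) (\<kappa> (q - 1)) u"
proof -
  have q: "\<kappa> q = \<kappa> (q - 1) + 1" using \<kappa>_add[of "q - 1" 1] by simp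
  note * = T_u u_T T_x1[OF r] T_x2[OF r] T_x1[OF s] T_x2[OF s] T_x3[OF r, of t] T_x3[OF s, of r] T_T
    x_x u_x x_u u_u \<kappa>_central rst r s
  show ?thesis
    by unfold_locales
      (use * in \<open>simp_all add: st h_def q algebra_simps\<close>)
qed

lemma F_r: "wt j z ==> j r \<noteq> j s ==> F r * z = \<psi> r * (gg (j r) (j s) r s * z)"
  and F_s: "wt j z ==> j s \<noteq> j t ==> F s * z = \<psi> s * (gg (j s) (j t) s t * z)"
  and T_r: "wt j z ==> j r = j s ==> \<kappa> (w (j r)) * (T r * z) = - (\<psi> r * (G r s * z)) - \<kappa> (w (j r)) * z"
  and T_s: "wt j z ==> j s = j t ==> \<kappa> (w (j s)) * (T s * z) = - (\<psi> s * (G s t * z)) - \<kappa> (w (j s)) * z"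
  using F_wt[OF _ r] F_wt[OF _ s] T_wt[OF _ r] T_wt[OF _ s] unfolding st by blast+

lemma g_r:
  assumes "wt j z" "j r \<noteq> j s"
  shows "gg a b s t * (\<psi> r * z) = \<psi> r * (gg a b r t * z)" "gg a b r t * (\<psi> r * z) = \<psi> r * (gg a b s t * z)"
    "G s t * (\<psi> r * z) = \<psi> r * (G r t * z)" "G r t * (\<psi> r * z) = \<psi> r * (G s t * z)"
proof -
  have c: "j r \<noteq> j (Suc r) \<or> X" for X using assms(2) st by simp
  note * = gg_\<psi>[OF assms(1) r c]
  show "gg a b s t * (\<psi> r * z) = \<psi> r * (gg a b r t * z)" "gg a b r t * (\<psi> r * z) = \<psi> r * (gg a b s t * z)"
    "G s t * (\<psi> r * z) = \<psi> r * (G r t * z)" "G r t * (\<psi> r * z) = \<psi> r * (G s t * z)"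
    using *[OF rst(2,3)] *[OF rst(1,3)] unfolding rst(12-14) by blast+
qed

lemma g_s:
  assumes "wt j z" "j s \<noteq> j t"
  shows "gg a b r s * (\<psi> s * z) = \<psi> s * (gg a b r t * z)" "gg a b r t * (\<psi> s * z) = \<psi> s * (gg a b r s * z)"
    "G r s * (\<psi> s * z) = \<psi> s * (G r t * z)" "G r t * (\<psi> s * z) = \<psi> s * (G r s * z)"
proof -
  have c: "j s \<noteq> j (Suc s) \<or> X" for X using assms(2) st by simp
  note * = gg_\<psi>[OF assms(1) s c]
  show "gg a b r s * (\<psi> s * z) = \<psi> s * (gg a b r t * z)" "gg a b r t * (\<psi> s * z) = \<psi> s * (gg a b r s * z)"
    "G r s * (\<psi> s * z) = \<psi> s * (G r t * z)" "G r t * (\<psi> s * z) = \<psi> s * (G r s * z)"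
    using *[OF rst(1,2)] *[OF rst(1,3)] unfolding rst(15-17) by blast+
qed

interpretation R: hecke_rank3 "T r" "T s" "x r" "x s" "x t" "\<kappa> (q - 1)" u
  by (rule hecke_rank3)

lemma RF: "R.F1 = F r" "R.F2 = F s"
  unfolding R.F1_def R.F2_def by (simp_all add: F_def d_def h_def st)

lemma pols: "a \<in> {r, s, t} ==> b \<in> {r, s, t} ==> pol (G a b) \<and> pol (gg a' b' a b) \<and> pol (d a b) \<and> pol (h a)"
  using rst by (auto intro!: pol_intros)

lemma cm: "pol f ==> pol g ==> f * (g * z) = g * (f * z)"
  using pol_commute[of f g] by (metis mult.assoc)

lemma DT_wt:
  "DT r * d r t * d s t = F r * F s * T r - T s * F r * F s"
  "DT r * d r s * d r t = T r * F s * F r - F s * F r * T s"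
  "DT r * d r s * d s t = F r * T s * F r - F s * T r * F s + h t * (G s r - \<kappa> q * G t s)"
proof -
  have q: "\<kappa> q = \<kappa> (q - 1) + 1" using \<kappa>_add[of "q - 1" 1] by simp
  show "DT r * d r t * d s t = F r * F s * T r - T s * F r * F s"
    using R.braid_aab unfolding RF by (simp add: DT_def st d_def)
  show "DT r * d r s * d r t = T r * F s * F r - F s * F r * T s"
    using R.braid_abb unfolding RF by (simp add: DT_def st d_def)
  show "DT r * d r s * d s t = F r * T s * F r - F s * T r * F s + h t * (G s r - \<kappa> q * G t s)"
    using R.braid_aba unfolding RF by (simp add: DT_def st d_def h_def G_def q)
qed

lemma DP_E: "DP r * z = \<psi> r * (\<psi> s * (\<psi> r * z)) - \<psi> s * (\<psi> r * (\<psi> s * z))"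
  by (simp add: DP_def st left_diff_distrib mult.assoc)

text \<open>All three residues distinct.\<close>

lemma braid_distinct:
  assumes "i r \<noteq> i s" "i r \<noteq> i t" "i s \<noteq> i t"
  shows "DT r * (d r t * (d s t * d r s)) * \<epsilon> i
    = DP r * (gg (i s) (i t) s t * (gg (i r) (i t) r t * gg (i r) (i s) r s)) * \<epsilon> i"
proof -
  let ?E = "\<epsilon> i" and ?gab = "gg (i r) (i s)" and ?gac = "gg (i r) (i t)" and ?gbc = "gg (i s) (i t)"
  have E: "wt i (f * ?E)" if "pol f" for f using wt_pol wt_\<epsilon> i that by blast
  note sg = wt_\<psi>[OF _ r] wt_\<psi>[OF _ s]
  have pg: "pol (gg a b k l)" if "k \<in> {r, s, t}" "l \<in> {r, s, t}" for a b k l using pols that by blast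
  have p: "pol (?gab r s)" "pol (?gac r t)" "pol (?gbc s t)" "pol (?gac s t)" "pol (?gab s t)" "pol (?gbc r s)" "pol (?gac r s)" "pol (?gbc r t)" "pol (?gab r t)"
    by (rule pg; simp)+
  have e1: "F r * ?E = \<psi> r * (?gab r s * ?E)" using F_r[OF wt_\<epsilon>[OF i]] assms by simp
  note w1 = E[OF p(1)]
  note w1' = sg(1)[OF w1]
  have e2: "F s * (\<psi> r * (?gab r s * ?E)) = \<psi> s * (\<psi> r * (?gac r t * (?gab r s * ?E)))"
    using F_s[OF w1'] g_r(1)[OF w1] assms by (simp add: pas del: perm_act_transpose)
  note w2 = wt_pol[OF w1 p(2)]
  note w2' = sg(1)[OF w2] sg(2)[OF sg(1)[OF w2]]
  have e3: "F r * (\<psi> s * (\<psi> r * (?gac r t * (?gab r s * ?E))))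
      = \<psi> r * (\<psi> s * (\<psi> r * (?gbc s t * (?gac r t * (?gab r s * ?E)))))"
    using F_r[OF w2'(2)] g_s(1)[OF w2'(1)] g_r(2)[OF w2] assms by (simp add: pas del: perm_act_transpose)
  have f1: "F s * ?E = \<psi> s * (?gbc s t * ?E)" using F_s[OF wt_\<epsilon>[OF i]] assms by simp
  note v1 = E[OF p(3)]
  note v1' = sg(2)[OF v1]
  have f2: "F r * (\<psi> s * (?gbc s t * ?E)) = \<psi> r * (\<psi> s * (?gac r t * (?gbc s t * ?E)))"
    using F_r[OF v1'] g_s(1)[OF v1] assms by (simp add: pas del: perm_act_transpose)
  note v2 = wt_pol[OF v1 p(2)]
  note v2' = sg(2)[OF v2] sg(1)[OF sg(2)[OF v2]]
  have f3: "F s * (\<psi> r * (\<psi> s * (?gac r t * (?gbc s t * ?E))))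
      = \<psi> s * (\<psi> r * (\<psi> s * (?gab r s * (?gac r t * (?gbc s t * ?E)))))"
    using F_s[OF v2'(2)] g_r(1)[OF v2'(1)] g_s(2)[OF v2] assms by (simp add: pas del: perm_act_transpose)
  have "?gab r s * (?gac r t * (?gbc s t * ?E)) = ?gbc s t * (?gac r t * (?gab r s * ?E))"
    using cm[OF p(1,3)] cm[OF p(2,3)] cm[OF p(1,2)] by simp
  then have rhs: "F r * (F s * (F r * ?E)) - F s * (F r * (F s * ?E)) = DP r * (?gbc s t * (?gac r t * (?gab r s * ?E)))"
    unfolding e1 e2 e3 f1 f2 f3 DP_E by simp
  have "F r * F s * F r - F s * F r * F s = DT r * d r t * d s t * d r s"
  proof -
    have hx: "F r * F s * h s = h t * (F r * F s)"
    proof -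
      have 1: "F s * x s = x t * F s" "F r * x t = x t * F r"
        using F_x[OF s rst(2)] F_x[OF r rst(3)] unfolding rst(12-17) by blast+
      have uF: "F r * u = F r" "u * F r = F r" "F s * u = F s" "u * F s = F s"
        unfolding RF[symmetric] R.F1_def R.F2_def by (simp_all add: algebra_simps R.nf R.nf')
      have "F s * h s = h t * F s" "F r * h t = h t * F r"
        unfolding h_def using 1 uF
        by (simp_all add: distrib_left distrib_right mult.assoc \<kappa>_mult_left[of "F s"] \<kappa>_mult_left[of "F r"])
      then show ?thesis by (metis mult.assoc)
    qed
    have "F r * F s * F r - F s * F r * F s = F r * F s * (T r * d r s + h s) - (T s * d s t + h t) * (F r * F s)"
    proof -
      have Fr: "T r * d r s + h s = F r" "T s * d s t + h t = F s" by (simp_all add: F_def st)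
      show ?thesis by (simp only: Fr mult.assoc)
    qed
    also have "\<dots> = F r * F s * T r * d r s - T s * (d s t * (F r * F s))"
      using hx by (simp add: distrib_left distrib_right mult.assoc)
    also have "d s t * (F r * F s) = F r * F s * d r s"
    proof -
      have A: "d s t * F r = F r * d r t" and B: "d r t * F s = F s * d r s"
        using F_x[OF r rst(1), unfolded rst(12-17)] F_x[OF r rst(3), unfolded rst(12-17)]
          F_x[OF s rst(1), unfolded rst(12-17)] F_x[OF s rst(2), unfolded rst(12-17)]
        by (simp_all add: d_def left_diff_distrib right_diff_distrib)
      have "d s t * (F r * F s) = F r * (d r t * F s)" by (simp only: mult.assoc[symmetric] A)
      then show ?thesis by (simp only: B mult.assoc)
    qed
    finally show ?thesis unfolding DT_wt(1) by (simp add: left_diff_distrib mult.assoc)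
  qed
  then have "(F r * F s * F r - F s * F r * F s) * ?E = DT r * d r t * d s t * d r s * ?E" by simp
  then have "DT r * (d r t * (d s t * (d r s * ?E))) = F r * (F s * (F r * ?E)) - F s * (F r * (F s * ?E))"
    by (simp add: left_diff_distrib mult.assoc)
  then show ?thesis using rhs by (simp add: mult.assoc)
qed

text \<open>Residues \<open>(a, a, b)\<close>.\<close>

lemma braid_aab:
  assumes "i r = i s" "i s \<noteq> i t"
  shows "\<kappa> (w (i r)) * (DT r * (d r t * (d s t * \<epsilon> i)))
    = - (DP r * (G r s * (gg (i r) (i t) r t * (gg (i r) (i t) s t * \<epsilon> i))))"
proof -
  let ?E = "\<epsilon> i" and ?g = "gg (i r) (i t)" and ?c = "\<kappa> (w (i r))"
  have E: "wt i ?E" "\<And>f. pol f ==> wt i (f * ?E)" using wt_pol wt_\<epsilon> i by blast+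
  note sg = wt_\<psi>[OF _ r] wt_\<psi>[OF _ s]
  have p: "pol (G k l)" "pol (?g k l)" if "k \<in> {r, s, t}" "l \<in> {r, s, t}" for k l using pols that by blast+
  have pp: "pol (G r s)" "pol (?g r t)" "pol (?g s t)" "pol (?g r s)" "pol (G s t)" "pol (G r t)" by (rule p; simp)+
  have FF: "F r * (F s * z) = \<psi> r * (\<psi> s * (?g r t * (?g s t * z)))" if z: "wt i z" for z
  proof -
    have 1: "F s * z = \<psi> s * (?g s t * z)" using F_s[OF z] assms by simp
    note w1 = wt_pol[OF z pp(3)]
    show ?thesis unfolding 1
      using F_r[OF sg(2)[OF w1]] g_s(1)[OF w1] assms by (simp add: pas del: perm_act_transpose)
  qed
  have T1: "?c * (T r * ?E) = - (\<psi> r * (G r s * ?E)) - ?c * ?E" using T_r[OF E(1)] assms by simp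
  note w1 = E(2)[OF pp(1)]
  have si: "perm_act (sigma r) i = i" by (rule ext) (use assms in \<open>auto simp: transpose_def st\<close>)
  have w1': "wt i (\<psi> r * (G r s * ?E))" using sg(1)[OF w1] si by simp
  have sym: "?g r t * (?g s t * (\<psi> r * z)) = \<psi> r * (?g r t * (?g s t * z))" if "wt i z" for z
    using gg_gg_\<psi>_eq(1)[OF that r _ rst(3) rst(6), folded st(1)] assms(1) rst(7) by simp
  have A: "?c * (F r * (F s * (T r * ?E))) = - (\<psi> r * (\<psi> s * (\<psi> r * (?g r t * (?g s t * (G r s * ?E))))))
      - ?c * (\<psi> r * (\<psi> s * (?g r t * (?g s t * ?E))))"
  proof -
    have "?c * (F r * (F s * (T r * ?E))) = F r * (F s * (?c * (T r * ?E)))"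
      by (simp add: \<kappa>_mult_left[of "F r"] \<kappa>_mult_left[of "F s"])
    also have "\<dots> = - (F r * (F s * (\<psi> r * (G r s * ?E)))) - ?c * (F r * (F s * ?E))"
      unfolding T1 by (simp add: right_diff_distrib \<kappa>_mult_left[of "F r"] \<kappa>_mult_left[of "F s"])
    finally show ?thesis unfolding FF[OF w1'] FF[OF E(1)] sym[OF w1] .
  qed
  let ?Z = "?g r t * (?g s t * ?E)"
  have z: "wt i ?Z" using E wt_pol pp by blast
  note z1 = sg(2)[OF z] sg(1)[OF sg(2)[OF z]]
  have B: "?c * (T s * (F r * (F s * ?E))) = - (\<psi> s * (\<psi> r * (\<psi> s * (G r s * ?Z)))) - ?c * (\<psi> r * (\<psi> s * ?Z))"
  proof -
    have "?c * (T s * (\<psi> r * (\<psi> s * ?Z))) = - (\<psi> s * (G s t * (\<psi> r * (\<psi> s * ?Z)))) - ?c * (\<psi> r * (\<psi> s * ?Z))"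
      using T_s[OF z1(2)] assms(1) by (simp add: pas del: perm_act_transpose)
    moreover have "G s t * (\<psi> r * (\<psi> s * ?Z)) = \<psi> r * (G r t * (\<psi> s * ?Z))"
      using g_r(3)[OF z1(1)] assms by (simp add: pas del: perm_act_transpose)
    moreover have "G r t * (\<psi> s * ?Z) = \<psi> s * (G r s * ?Z)"
      using g_s(4)[OF z] assms(2) by simp
    ultimately show ?thesis unfolding FF[OF E(1)] by simp
  qed
  have C: "?g r t * (?g s t * (G r s * ?E)) = G r s * ?Z"
    using cm[OF pp(1,2)] cm[OF pp(1,3)] by simp
  have "DT r * (d r t * (d s t * ?E)) = F r * (F s * (T r * ?E)) - T s * (F r * (F s * ?E))"
    using arg_cong[OF DT_wt(1), of "\<lambda>z. z * ?E"] by (simp add: left_diff_distrib mult.assoc)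
  then have "?c * (DT r * (d r t * (d s t * ?E))) = ?c * (F r * (F s * (T r * ?E))) - ?c * (T s * (F r * (F s * ?E)))"
    by (simp add: right_diff_distrib)
  then show ?thesis unfolding A B C DP_E by simp
qed

text \<open>Residues \<open>(a, b, b)\<close>.\<close>

lemma braid_abb:
  assumes "i r \<noteq> i s" "i s = i t"
  shows "\<kappa> (w (i s)) * (DT r * (d r s * (d r t * \<epsilon> i)))
    = - (DP r * (G s t * (gg (i r) (i s) r s * (gg (i r) (i s) r t * \<epsilon> i))))"
proof -
  let ?E = "\<epsilon> i" and ?g = "gg (i r) (i s)" and ?c = "\<kappa> (w (i s))"
  have E: "wt i ?E" "\<And>f. pol f ==> wt i (f * ?E)" using wt_pol wt_\<epsilon> i by blast+
  note sg = wt_\<psi>[OF _ r] wt_\<psi>[OF _ s]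
  have p: "pol (G k l)" "pol (?g k l)" if "k \<in> {r, s, t}" "l \<in> {r, s, t}" for k l using pols that by blast+
  have pp: "pol (G s t)" "pol (?g r s)" "pol (?g r t)" "pol (?g s t)" by (rule p; simp)+
  have FF: "F s * (F r * z) = \<psi> s * (\<psi> r * (?g r t * (?g r s * z)))" if z: "wt i z" for z
  proof -
    have 1: "F r * z = \<psi> r * (?g r s * z)" using F_r[OF z] assms by simp
    note w1 = wt_pol[OF z pp(2)]
    show ?thesis unfolding 1
      using F_s[OF sg(1)[OF w1]] g_r(1)[OF w1] assms by (simp add: pas del: perm_act_transpose)
  qed
  have T1: "?c * (T s * ?E) = - (\<psi> s * (G s t * ?E)) - ?c * ?E" using T_s[OF E(1)] assms by simp
  note w1 = E(2)[OF pp(1)]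
  have si: "perm_act (sigma s) i = i" by (rule ext) (use assms in \<open>auto simp: transpose_def st\<close>)
  have w1': "wt i (\<psi> s * (G s t * ?E))" using sg(2)[OF w1] si by simp
  have sym: "?g r t * (?g r s * (\<psi> s * z)) = \<psi> s * (?g r t * (?g r s * z))" if "wt i z" for z
  proof -
    have "?g r s * (?g r t * (\<psi> s * z)) = \<psi> s * (?g r s * (?g r t * z))"
      using gg_gg_\<psi>_eq(2)[OF that s _ rst(1) rst(8), folded st(2)] assms(2) rst(10) by simp
    then show ?thesis by (simp only: cm[OF pp(2,3)])
  qed
  have A: "?c * (F s * (F r * (T s * ?E))) = - (\<psi> s * (\<psi> r * (\<psi> s * (?g r t * (?g r s * (G s t * ?E))))))
      - ?c * (\<psi> s * (\<psi> r * (?g r t * (?g r s * ?E))))"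
  proof -
    have "?c * (F s * (F r * (T s * ?E))) = F s * (F r * (?c * (T s * ?E)))"
      by (simp add: \<kappa>_mult_left[of "F r"] \<kappa>_mult_left[of "F s"])
    also have "\<dots> = - (F s * (F r * (\<psi> s * (G s t * ?E)))) - ?c * (F s * (F r * ?E))"
      unfolding T1 by (simp add: right_diff_distrib \<kappa>_mult_left[of "F r"] \<kappa>_mult_left[of "F s"])
    finally show ?thesis unfolding FF[OF w1'] FF[OF E(1)] sym[OF w1] .
  qed
  let ?Z = "?g r t * (?g r s * ?E)"
  have z: "wt i ?Z" using E wt_pol pp by blast
  note z1 = sg(1)[OF z] sg(2)[OF sg(1)[OF z]]
  have B: "?c * (T r * (F s * (F r * ?E))) = - (\<psi> r * (\<psi> s * (\<psi> r * (G s t * ?Z)))) - ?c * (\<psi> s * (\<psi> r * ?Z))"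
  proof -
    have "?c * (T r * (\<psi> s * (\<psi> r * ?Z))) = - (\<psi> r * (G r s * (\<psi> s * (\<psi> r * ?Z)))) - ?c * (\<psi> s * (\<psi> r * ?Z))"
      using T_r[OF z1(2)] assms(2) by (simp add: pas del: perm_act_transpose)
    moreover have "G r s * (\<psi> s * (\<psi> r * ?Z)) = \<psi> s * (G r t * (\<psi> r * ?Z))"
      using g_s(3)[OF z1(1)] assms by (simp add: pas del: perm_act_transpose)
    moreover have "G r t * (\<psi> r * ?Z) = \<psi> r * (G s t * ?Z)"
      using g_r(4)[OF z] assms(1) by simp
    ultimately show ?thesis unfolding FF[OF E(1)] by simp
  qed
  have C: "?g r t * (?g r s * (G s t * ?E)) = G s t * ?Z"
    using cm[OF pp(1,2)] cm[OF pp(1,3)] by simp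
  have "DT r * (d r s * (d r t * ?E)) = T r * (F s * (F r * ?E)) - F s * (F r * (T s * ?E))"
    using arg_cong[OF DT_wt(2), of "\<lambda>z. z * ?E"] by (simp add: left_diff_distrib mult.assoc)
  then have "?c * (DT r * (d r s * (d r t * ?E))) = ?c * (T r * (F s * (F r * ?E))) - ?c * (F s * (F r * (T s * ?E)))"
    by (simp add: right_diff_distrib)
  then show ?thesis unfolding A B C DP_E using cm[OF pp(3,2)] by simp
qed

end

section \<open>Braid defects with equal outer residues\<close>

context weight_system
begin

text \<open>The KLR braid defect expressed in the variables \<open>x\<close>; division by
  \<open>w\<close> converts \<open>G\<close> to the difference of two nilpotent variables.\<close>

definition xdefect where
  "xdefect i r s t = (if i t \<noteq> i r then 0
    else if [i r - i s = 1] (mod int e) \<and> [i s - i r = 1] (mod int e)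
      then \<kappa> (inverse (w (i r))) * G r s - \<kappa> (inverse (w (i s))) * G s t
    else if [i r - i s = 1] (mod int e) then - 1
    else if [i s - i r = 1] (mod int e) then 1
    else 0)"

end

context bk3
begin

text \<open>Residues \<open>(a, a, a)\<close>.\<close>

lemma braid_aaa:
  assumes "i r = i s" "i s = i t"
  shows "\<kappa> (w (i r)) * (\<kappa> (w (i r)) * (\<kappa> (w (i r)) * (DT r * \<epsilon> i)))
    = - (DP r * (G r s * (G r t * (G s t * \<epsilon> i))))"
proof -
  let ?E = "\<epsilon> i" and ?c = "\<kappa> (w (i r))" and ?S = "T r + u" and ?S' = "T s + u"
  have E: "wt i ?E" using wt_\<epsilon> i by blast
  have p: "pol (G k l)" if "k \<in> {r, s, t}" "l \<in> {r, s, t}" for k l using pols that by blast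
  have pp: "pol (G r s)" "pol (G r t)" "pol (G s t)" by (rule p; simp)+
  have si: "perm_act (sigma r) i = i" "perm_act (sigma s) i = i"
    by (rule ext; use assms in \<open>auto simp: transpose_def st\<close>)+
  have wr: "wt i (\<psi> r * z)" and ws: "wt i (\<psi> s * z)" if "wt i z" for z
    using wt_\<psi>[OF that r] wt_\<psi>[OF that s] si by simp_all
  have wsum: "wt i y ==> wt i z ==> wt i (y + z)" and w\<kappa>: "wt i y ==> wt i (\<kappa> c * y)" and wm: "wt i y ==> wt i (- y)"
    for y z c
    by (simp_all add: wt_def distrib_left \<kappa>_mult_left[of "\<epsilon> i"])
  note wp = wt_pol[OF _ pp(1)] wt_pol[OF _ pp(2)] wt_pol[OF _ pp(3)]
  have S: "?c * (?S * z) = - (\<psi> r * (G r s * z))" and S': "?c * (?S' * z) = - (\<psi> s * (G s t * z))" if "wt i z" for z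
    using T_r[OF that] T_s[OF that] assms wt_u[OF that] by (simp_all add: distrib_left distrib_right)
  have Sw: "wt i (?S * z)" "wt i (?S' * z)" if "wt i z" for z
  proof -
    have "?c * (\<epsilon> i * (?S * z)) = \<epsilon> i * (?c * (?S * z))" by (simp add: \<kappa>_mult_left[of "\<epsilon> i"])
    also have "\<dots> = ?c * (?S * z)" unfolding S[OF that] using wr[OF wp(1)[OF that]] by (simp add: wt_def)
    finally show "wt i (?S * z)" using \<kappa>_cancel[OF w_nz] i by (simp add: wt_def)
    have "?c * (\<epsilon> i * (?S' * z)) = \<epsilon> i * (?c * (?S' * z))" by (simp add: \<kappa>_mult_left[of "\<epsilon> i"])
    also have "\<dots> = ?c * (?S' * z)" unfolding S'[OF that] using ws[OF wp(3)[OF that]] by (simp add: wt_def)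
    finally show "wt i (?S' * z)" using \<kappa>_cancel[OF w_nz] i by (simp add: wt_def)
  qed
  have Gr: "G s t * (\<psi> r * z) = \<psi> r * (G r t * z) + ?c * z" "G r t * (\<psi> r * z) = \<psi> r * (G s t * z) - ?c * z" if "wt i z" for z
    using G_\<psi>_eq(1,2)[OF that r _ rst(3,6), folded st(1)] assms(1) rst(7) by simp_all
  have Gs: "G r s * (\<psi> s * z) = \<psi> s * (G r t * z) + \<kappa> q * (?c * z)" "G r t * (\<psi> s * z) = \<psi> s * (G r s * z) - \<kappa> q * (?c * z)" if "wt i z" for z
    using G_\<psi>_eq(3,4)[OF that s _ rst(1,8), folded st(2)] assms rst(10) by simp_all
  have P0: "\<psi> r * (\<psi> r * z) = 0" "\<psi> s * (\<psi> s * z) = 0" if "wt i z" for z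
    using \<psi>_\<psi>_eq[OF that r, folded st(1)] \<psi>_\<psi>_eq[OF that s, folded st(2)] assms by simp_all
  note cmE = cm[OF pp(1,2)] cm[OF pp(1,3)] cm[OF pp(2,3)]
  note \<kappa>l = \<kappa>_mult_left[of "\<psi> r"] \<kappa>_mult_left[of "\<psi> s"] \<kappa>_mult_left[of "G r s"] \<kappa>_mult_left[of "G r t"] \<kappa>_mult_left[of "G s t"]
    \<kappa>_mult_left[of "?S"] \<kappa>_mult_left[of "?S'"]
  have A: "\<psi> r * (G r s * (\<psi> s * (G s t * (\<psi> r * z)))) = \<psi> r * (\<psi> s * (\<psi> r * (G s t * (G r t * z)))) + \<kappa> q * (?c * (?c * (\<psi> r * z)))"
    if z: "wt i z" for z
  proof -
    have y: "wt i (\<psi> r * (G r t * z) + ?c * z)" by (intro wsum w\<kappa> wr wp z)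
    show ?thesis unfolding Gr(1)[OF z] Gs(1)[OF y]
      using Gr(2)[OF wp(2)[OF z]] P0(1)[OF wp(2)[OF z]] by (simp add: distrib_left right_diff_distrib \<kappa>l)
  qed
  have B: "\<psi> s * (G s t * (\<psi> r * (G r s * (\<psi> s * z)))) = \<psi> s * (\<psi> r * (\<psi> s * (G r s * (G r t * z)))) + \<kappa> q * (?c * (?c * (\<psi> s * z)))"
    if z: "wt i z" for z
  proof -
    have y: "wt i (\<psi> s * (G r t * z) + \<kappa> q * (?c * z))" by (intro wsum w\<kappa> ws wp z)
    show ?thesis unfolding Gs(1)[OF z] Gr(1)[OF y]
      using Gs(2)[OF wp(2)[OF z]] P0(2)[OF wp(2)[OF z]]
      by (simp add: distrib_left right_diff_distrib \<kappa>l \<kappa>_mult_left[of ?c q])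
  qed
  have SSS: "?c * (?c * (?c * (?S * (?S' * (?S * ?E))))) = - (\<psi> r * (\<psi> s * (\<psi> r * (G s t * (G r t * (G r s * ?E)))))) - \<kappa> q * (?c * (?c * (\<psi> r * (G r s * ?E))))"
  proof -
    have "?c * (?c * (?c * (?S * (?S' * (?S * ?E))))) = ?c * (?S * (?c * (?S' * (?c * (?S * ?E)))))"
      by (simp add: \<kappa>l)
    also have "\<dots> = - (\<psi> r * (G r s * (\<psi> s * (G s t * (\<psi> r * (G r s * ?E))))))"
      unfolding S[OF E] using S'[OF wm[OF wr[OF wp(1)[OF E]]]] S[OF ws[OF wp(3)[OF wr[OF wp(1)[OF E]]]]] by simp
    finally show ?thesis unfolding A[OF wp(1)[OF E]] by simp
  qed
  have SSS': "?c * (?c * (?c * (?S' * (?S * (?S' * ?E))))) = - (\<psi> s * (\<psi> r * (\<psi> s * (G r s * (G r t * (G s t * ?E)))))) - \<kappa> q * (?c * (?c * (\<psi> s * (G s t * ?E))))"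
  proof -
    have "?c * (?c * (?c * (?S' * (?S * (?S' * ?E))))) = ?c * (?S' * (?c * (?S * (?c * (?S' * ?E)))))"
      by (simp add: \<kappa>l)
    also have "\<dots> = - (\<psi> s * (G s t * (\<psi> r * (G r s * (\<psi> s * (G s t * ?E))))))"
      unfolding S'[OF E] using S[OF wm[OF ws[OF wp(3)[OF E]]]] S'[OF wr[OF wp(1)[OF ws[OF wp(3)[OF E]]]]] by simp
    finally show ?thesis unfolding B[OF wp(3)[OF E]] by simp
  qed
  have q: "\<kappa> q = \<kappa> (q - 1) + 1" using \<kappa>_add[of "q - 1" 1] by simp
  have "DT r = ?S * ?S' * ?S - ?S' * ?S * ?S' - \<kappa> q * (?S - ?S')"
  proof -
    note uT = T_u[OF r] T_u[OF s] u_T[OF r] u_T[OF s] u_u T_T[OF r] T_T[OF s]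
    have ext: "A * B = D ==> A * (B * E) = D * E" for A B D E :: 'b by (metis mult.assoc)
    show ?thesis
      by (simp add: DT_def st(1)[symmetric] algebra_simps uT uT[THEN ext] q)
  qed
  then have "DT r * ?E = (?S * ?S' * ?S - ?S' * ?S * ?S' - \<kappa> q * (?S - ?S')) * ?E" by simp
  then have "DT r * ?E = ?S * (?S' * (?S * ?E)) - ?S' * (?S * (?S' * ?E)) - \<kappa> q * (?S * ?E - ?S' * ?E)"
    by (simp only: left_diff_distrib mult.assoc)
  then have "?c * (?c * (?c * (DT r * ?E))) = ?c * (?c * (?c * (?S * (?S' * (?S * ?E)))))
      - ?c * (?c * (?c * (?S' * (?S * (?S' * ?E))))) - \<kappa> q * (?c * (?c * (?c * (?S * ?E) - ?c * (?S' * ?E))))"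
    by (simp only: right_diff_distrib) (simp add: \<kappa>_mult_left[of ?c q])
  then show ?thesis
    unfolding SSS SSS' S[OF E] S'[OF E] DP_E using cmE by (simp add: right_diff_distrib)
qed

text \<open>Residues \<open>(a, b, a)\<close>.\<close>

abbreviation "defect \<equiv> xdefect i r s t"

lemma braid_aba:
  assumes ne: "i r \<noteq> i s" and eq: "i t = i r"
  shows "\<kappa> (w (i r)) * (DT r * (d r s * (d s t * \<epsilon> i)))
    = - ((DP r - defect) * (G r t * (gg (i r) (i s) r s * (gg (i s) (i r) s t * \<epsilon> i))))"
proof -
  let ?E = "\<epsilon> i" and ?a = "i r" and ?b = "i s"
  let ?c = "\<kappa> (w ?a)" and ?c' = "\<kappa> (w ?b)" and ?g = "gg ?a ?b" and ?g' = "gg ?b ?a"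
  have E: "wt i ?E" using wt_\<epsilon> i by blast
  note sg = wt_\<psi>[OF _ r] wt_\<psi>[OF _ s]
  have p: "pol (G k l)" "pol (?g k l)" "pol (?g' k l)" if "k \<in> {r, s, t}" "l \<in> {r, s, t}" for k l using pols that by blast+
  have pG: "pol (G r s)" "pol (G s r)" "pol (G s t)" "pol (G t s)" "pol (G r t)" by (rule p; simp)+
  have pg: "pol (?g r s)" "pol (?g s t)" "pol (?g t s)" "pol (?g r t)" "pol (?g' r s)" "pol (?g' s r)" "pol (?g' s t)" "pol (?g' r t)"
    by (rule p; simp)+
  let ?A = "[?a - ?b = 1] (mod int e)" and ?B = "[?b - ?a = 1] (mod int e)"
  have gA: "?g k l = (if ?A then ?c else G k l)" and gB: "?g' k l = (if ?B then ?c' else G k l)" for k l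
    by (simp_all add: gg_def)
  have qc: "?B ==> \<kappa> q * ?c = ?c'" "?A ==> \<kappa> q * ?c' = ?c"
  proof -
    show "\<kappa> q * ?c = ?c'" if ?B
    proof -
      have "w ?b = w (?a + 1)" by (rule w_cong) (use that in \<open>simp add: cong_iff_dvd_diff algebra_simps\<close>)
      then show ?thesis by (simp add: w_Suc \<kappa>_mult)
    qed
    show "\<kappa> q * ?c' = ?c" if ?A
    proof -
      have "w ?a = w (?b + 1)" by (rule w_cong) (use that in \<open>simp add: cong_iff_dvd_diff algebra_simps\<close>)
      then show ?thesis by (simp add: w_Suc \<kappa>_mult)
    qed
  qed
  have e1: "F r * ?E = \<psi> r * (?g r s * ?E)" using F_r[OF E] ne by simp
  have e2: "F s * ?E = \<psi> s * (?g' s t * ?E)" using F_s[OF E] ne eq by simp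
  note w1 = wt_pol[OF E pg(1)] and w2 = wt_pol[OF E pg(7)]
  note v1 = sg(1)[OF w1] and v2 = sg(2)[OF w2]
  have FFr: "F r * (F r * ?E) = G r s * (G s r * ?E)" and FFs: "F s * (F s * ?E) = G s t * (G t s * ?E)"
  proof -
    have "F r * F r = G r s * G s r" "F s * F s = G s t * G t s" using F_F[OF r] F_F[OF s] by (simp_all add: st)
    then show "F r * (F r * ?E) = G r s * (G s r * ?E)" "F s * (F s * ?E) = G s t * (G t s * ?E)"
      by (metis mult.assoc)+
  qed
  \<comment> \<open>If \<open>b - a \<noteq> 1\<close>, the factor \<open>G s r\<close> of \<open>F r * F r\<close> cancels, and similarly at the other end.\<close>
  have \<psi>\<psi>r: "\<psi> r * (\<psi> r * (?g r s * ?E)) = G r s * ?E" if nB: "\<not> ?B"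
  proof -
    have "F r * (F r * ?E) = \<psi> r * (?g' r s * (\<psi> r * (?g r s * ?E)))"
      unfolding e1 using F_r[OF v1] ne by (simp add: pas del: perm_act_transpose)
    also have "?g' r s * (\<psi> r * (?g r s * ?E)) = \<psi> r * (G s r * (?g r s * ?E))"
      using gg_\<psi>(2)[OF w1 r, of r s] ne rst(1,2) nB unfolding gB rst(12,13) by (simp add: st)
    also have "G s r * (?g r s * ?E) = ?g r s * (G s r * ?E)" by (rule cm[OF pG(2) pg(1)])
    finally have "(\<psi> r * \<psi> r * ?g r s) * G s r * ?E = G r s * G s r * ?E"
      unfolding FFr by (simp add: mult.assoc)
    moreover have "regular (G s r) i" using regular_G[OF i rst(2,1)] nB by simp
    ultimately have "\<psi> r * \<psi> r * ?g r s * ?E = G r s * ?E" using regular_cancel by blast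
    then show ?thesis by (simp only: mult.assoc)
  qed
  have \<psi>\<psi>s: "\<psi> s * (\<psi> s * (?g' s t * ?E)) = G s t * ?E" if nA: "\<not> ?A"
  proof -
    have "F s * (F s * ?E) = \<psi> s * (?g s t * (\<psi> s * (?g' s t * ?E)))"
      unfolding e2 using F_s[OF v2] ne eq by (simp add: pas del: perm_act_transpose)
    also have "?g s t * (\<psi> s * (?g' s t * ?E)) = \<psi> s * (G t s * (?g' s t * ?E))"
      using gg_\<psi>(2)[OF w2 s, of s t] ne eq rst(2,3) nA unfolding gA rst(16,17) by (simp add: st)
    also have "G t s * (?g' s t * ?E) = ?g' s t * (G t s * ?E)" by (rule cm[OF pG(4) pg(7)])
    finally have "(\<psi> s * \<psi> s * ?g' s t) * G t s * ?E = G s t * G t s * ?E"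
      unfolding FFs by (simp add: mult.assoc)
    moreover have "regular (G t s) i" using regular_G[OF i rst(3,2)] nA eq by simp
    ultimately have "\<psi> s * \<psi> s * ?g' s t * ?E = G s t * ?E" using regular_cancel by blast
    then show ?thesis by (simp only: mult.assoc)
  qed
  let ?al = "G r t * (?g r s * (?g' s t * ?E))"
  have L1: "?c * (F r * (T s * (F r * ?E))) = - (\<psi> r * (\<psi> s * (\<psi> r * ?al))) - ?c * (G r s * (G s r * ?E))
      - (if ?B then 0 else \<kappa> q * (?c * (G r t * (G r s * ?E))))"
  proof -
    let ?Z = "?g r s * ?E"
    have t: "?c * (T s * (\<psi> r * ?Z)) = - (\<psi> s * (G s t * (\<psi> r * ?Z))) - ?c * (\<psi> r * ?Z)"
      using T_s[OF v1] eq by (simp add: pas del: perm_act_transpose)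
    have g: "G s t * (\<psi> r * ?Z) = \<psi> r * (G r t * ?Z)" using g_r(3)[OF w1 ne] .
    have w3: "wt (perm_act (sigma r) i) (\<psi> r * (G r t * ?Z))" by (rule sg(1)[OF wt_pol[OF w1 pG(5)]])
    have si: "perm_act (sigma s) (perm_act (sigma r) i) = perm_act (sigma r) i"
      by (rule ext) (use eq in \<open>auto simp: transpose_def st\<close>)
    have w4: "wt (perm_act (sigma r) i) (\<psi> s * (\<psi> r * (G r t * ?Z)))" using sg(2)[OF w3] si by simp
    have "?c * (F r * (T s * (F r * ?E))) = F r * (?c * (T s * (F r * ?E)))" by (simp add: \<kappa>_mult_left[of "F r"])
    also have "\<dots> = - (F r * (\<psi> s * (\<psi> r * (G r t * ?Z)))) - ?c * (F r * (F r * ?E))"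
      unfolding e1 t g by (simp add: right_diff_distrib \<kappa>_mult_left[of "F r"])
    also have "F r * (\<psi> s * (\<psi> r * (G r t * ?Z))) = \<psi> r * (?g' r s * (\<psi> s * (\<psi> r * (G r t * ?Z))))"
      using F_r[OF w4] ne by (simp add: pas del: perm_act_transpose)
    also have "\<dots> = \<psi> r * (\<psi> s * (\<psi> r * ?al)) + (if ?B then 0 else \<kappa> q * (?c * (G r t * (G r s * ?E))))"
    proof (cases ?B)
      case True
      have "\<psi> r * (?g' r s * (\<psi> s * (\<psi> r * (G r t * ?Z)))) = \<psi> r * (\<psi> s * (\<psi> r * (?c' * (G r t * ?Z))))"
        using True by (simp add: gB \<kappa>_mult_left[of "\<psi> s"] \<kappa>_mult_left[of "\<psi> r"])
      also have "?c' * (G r t * ?Z) = ?al"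
        using True by (simp add: gB[of s t] \<kappa>_mult_left[of "G r t"] \<kappa>_mult_left[of "?g r s"])
      finally show ?thesis using True by simp
    next
      case False
      let ?Y = "\<psi> r * (G r t * ?Z)"
      have "?g' r s * (\<psi> s * ?Y) = \<psi> s * (G r t * ?Y) + \<kappa> q * (?c * ?Y)"
        using G_\<psi>_eq(4)[OF w3 s _ rst(1,8), folded st(2)] eq rst(10) False by (simp add: gB pas del: perm_act_transpose)
      also have "G r t * ?Y = \<psi> r * (G s t * (G r t * ?Z))" by (rule g_r(4)[OF wt_pol[OF w1 pG(5)] ne])
      finally have 1: "\<psi> r * (?g' r s * (\<psi> s * ?Y)) = \<psi> r * (\<psi> s * (\<psi> r * (G s t * (G r t * ?Z)))) + \<kappa> q * (?c * (\<psi> r * ?Y))"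
        by (simp add: distrib_left \<kappa>_mult_left[of "\<psi> r"])
      have "G s t * (G r t * ?Z) = ?al"
        using False cm[OF pG(3,5)] cm[OF pG(3) pg(1)] by (simp add: gB)
      moreover have "\<psi> r * ?Y = G r t * (G r s * ?E)"
      proof -
        have "G r t * (?g r s * ?E) = ?g r s * ?E * G r t"
          by (simp only: cm[OF pG(5) pg(1), of ?E] pol_\<epsilon>[OF pG(5) i] mult.assoc)
        then have "\<psi> r * ?Y = \<psi> r * (\<psi> r * (?g r s * ?E)) * G r t" by (simp add: mult.assoc)
        then show ?thesis unfolding \<psi>\<psi>r[OF False]
          by (simp only: mult.assoc pol_\<epsilon>[OF pG(5) i, symmetric] cm[OF pG(1,5), of ?E])
      qed
      ultimately show ?thesis unfolding 1 using False by simp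
    qed
    finally show ?thesis unfolding FFr by simp
  qed
  have L2: "?c * (F s * (T r * (F s * ?E))) = - (\<psi> s * (\<psi> r * (\<psi> s * ?al))) - ?c * (G s t * (G t s * ?E))
      - (if ?A then 0 else ?c * (G r t * (G s t * ?E)))"
  proof -
    let ?Z = "?g' s t * ?E"
    have t: "?c * (T r * (\<psi> s * ?Z)) = - (\<psi> r * (G r s * (\<psi> s * ?Z))) - ?c * (\<psi> s * ?Z)"
      using T_r[OF v2] eq by (simp add: pas del: perm_act_transpose)
    have ne': "i s \<noteq> i t" using ne eq by simp
    have g: "G r s * (\<psi> s * ?Z) = \<psi> s * (G r t * ?Z)" using g_s(3)[OF w2 ne'] .
    have w3: "wt (perm_act (sigma s) i) (\<psi> s * (G r t * ?Z))" by (rule sg(2)[OF wt_pol[OF w2 pG(5)]])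
    have si: "perm_act (sigma r) (perm_act (sigma s) i) = perm_act (sigma s) i"
      by (rule ext) (use eq in \<open>auto simp: transpose_def st\<close>)
    have w4: "wt (perm_act (sigma s) i) (\<psi> r * (\<psi> s * (G r t * ?Z)))" using sg(1)[OF w3] si by simp
    have "?c * (F s * (T r * (F s * ?E))) = F s * (?c * (T r * (F s * ?E)))" by (simp add: \<kappa>_mult_left[of "F s"])
    also have "\<dots> = - (F s * (\<psi> r * (\<psi> s * (G r t * ?Z)))) - ?c * (F s * (F s * ?E))"
      unfolding e2 t g by (simp add: right_diff_distrib \<kappa>_mult_left[of "F s"])
    also have "F s * (\<psi> r * (\<psi> s * (G r t * ?Z))) = \<psi> s * (?g s t * (\<psi> r * (\<psi> s * (G r t * ?Z))))"
      using F_s[OF w4] ne eq by (simp add: pas del: perm_act_transpose)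
    also have "\<dots> = \<psi> s * (\<psi> r * (\<psi> s * ?al)) + (if ?A then 0 else ?c * (G r t * (G s t * ?E)))"
    proof (cases ?A)
      case True
      have "\<psi> s * (?g s t * (\<psi> r * (\<psi> s * (G r t * ?Z)))) = \<psi> s * (\<psi> r * (\<psi> s * (?c * (G r t * ?Z))))"
        using True by (simp add: gA \<kappa>_mult_left[of "\<psi> s"] \<kappa>_mult_left[of "\<psi> r"])
      also have "?c * (G r t * ?Z) = ?al"
        using True by (simp add: gA[of r s] \<kappa>_mult_left[of "G r t"])
      finally show ?thesis using True by simp
    next
      case False
      let ?Y = "\<psi> s * (G r t * ?Z)"
      have "?g s t * (\<psi> r * ?Y) = \<psi> r * (G r t * ?Y) + ?c * ?Y"
        using G_\<psi>_eq(1)[OF w3 r _ rst(3,6), folded st(1)] eq rst(7) False by (simp add: gA pas del: perm_act_transpose)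
      also have "G r t * ?Y = \<psi> s * (G r s * (G r t * ?Z))" by (rule g_s(4)[OF wt_pol[OF w2 pG(5)] ne'])
      finally have 1: "\<psi> s * (?g s t * (\<psi> r * ?Y)) = \<psi> s * (\<psi> r * (\<psi> s * (G r s * (G r t * ?Z)))) + ?c * (\<psi> s * ?Y)"
        by (simp add: distrib_left \<kappa>_mult_left[of "\<psi> s"])
      have "G r s * (G r t * ?Z) = ?al"
        using False cm[OF pG(1,5)] by (simp add: gA)
      moreover have "\<psi> s * ?Y = G r t * (G s t * ?E)"
      proof -
        have "G r t * (?g' s t * ?E) = ?g' s t * ?E * G r t"
          by (simp only: cm[OF pG(5) pg(7), of ?E] pol_\<epsilon>[OF pG(5) i] mult.assoc)
        then have "\<psi> s * ?Y = \<psi> s * (\<psi> s * (?g' s t * ?E)) * G r t" by (simp add: mult.assoc)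
        then show ?thesis unfolding \<psi>\<psi>s[OF False]
          by (simp only: mult.assoc pol_\<epsilon>[OF pG(5) i, symmetric] cm[OF pG(3,5), of ?E])
      qed
      ultimately show ?thesis unfolding 1 using False by simp
    qed
    finally show ?thesis unfolding FFs by simp
  qed
  have poly: "- (\<kappa> q * (G r t * G r s)) - G r s * G s r + G r t * G s t + G s t * G t s + h t * (G s r - \<kappa> q * G t s) = 0"
  proof -
    have q: "\<kappa> q = \<kappa> (q - 1) + 1" using \<kappa>_add[of "q - 1" 1] by simp
    note rules = u_x[OF rst(1)] x_u[OF rst(1)] u_x[OF rst(2)] x_u[OF rst(2)] u_x[OF rst(3)] x_u[OF rst(3)] u_u
      x_x[OF rst(2,1)] x_x[OF rst(3,1)] x_x[OF rst(3,2)] \<kappa>_central[of "x r"] \<kappa>_central[of "x s"] \<kappa>_central[of "x t"] \<kappa>_central[of u]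
    have ext: "A * B = D ==> A * (B * E) = D * E" for A B D E :: 'b by (metis mult.assoc)
    show ?thesis unfolding G_def h_def q
      by (simp add: algebra_simps rules rules[THEN ext])
  qed
  have polyE: "h t * ((G s r - \<kappa> q * G t s) * ?E) = \<kappa> q * (G r t * (G r s * ?E)) + G r s * (G s r * ?E)
      - G r t * (G s t * ?E) - G s t * (G t s * ?E)"
  proof -
    have "h t * (G s r - \<kappa> q * G t s) = \<kappa> q * (G r t * G r s) + G r s * G s r - G r t * G s t - G s t * G t s"
      using poly by (simp add: algebra_simps eq_neg_iff_add_eq_0)
    then have "h t * (G s r - \<kappa> q * G t s) * ?E = (\<kappa> q * (G r t * G r s) + G r s * G s r - G r t * G s t - G s t * G t s) * ?E"
      by simp
    then show ?thesis by (simp add: distrib_right left_diff_distrib mult.assoc)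
  qed
  have "DT r * (d r s * (d s t * ?E)) = F r * (T s * (F r * ?E)) - F s * (T r * (F s * ?E)) + h t * ((G s r - \<kappa> q * G t s) * ?E)"
    using arg_cong[OF DT_wt(3), of "\<lambda>z. z * ?E"] by (simp add: left_diff_distrib distrib_right mult.assoc)
  then have "?c * (DT r * (d r s * (d s t * ?E))) = ?c * (F r * (T s * (F r * ?E))) - ?c * (F s * (T r * (F s * ?E)))
      + ?c * (h t * ((G s r - \<kappa> q * G t s) * ?E))"
    by (simp add: distrib_left right_diff_distrib)
  also have "\<dots> = - (DP r * ?al)
      + ((if ?B then \<kappa> q * (?c * (G r t * (G r s * ?E))) else 0) - (if ?A then ?c * (G r t * (G s t * ?E)) else 0))"
    unfolding L1 L2 polyE DP_E by (simp add: distrib_left right_diff_distrib \<kappa>_mult_left[of ?c q])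
  also have "(if ?B then \<kappa> q * (?c * (G r t * (G r s * ?E))) else 0) - (if ?A then ?c * (G r t * (G s t * ?E)) else 0)
      = defect * ?al"
  proof -
    have B: "\<kappa> q * (?c * z) = ?c' * z" if ?B for z using qc(1)[OF that] by (metis mult.assoc)
    have inv: "\<kappa> (inverse (w j)) * (\<kappa> (w j) * z) = z" for j z
      using \<kappa>_inverse[OF w_nz] by (metis mult.assoc mult_1_left)
    note \<kappa>l = \<kappa>_mult_left[of "G r t"] \<kappa>_mult_left[of "G r s"] \<kappa>_mult_left[of "G s t"]
    consider "?A" "?B" | "?A" "\<not> ?B" | "\<not> ?A" "?B" | "\<not> ?A" "\<not> ?B" by blast
    then show ?thesis
    proof cases
      case 1
      have "defect * ?al = \<kappa> (inverse (w ?a)) * (G r s * (G r t * (?c * (?c' * ?E)))) - \<kappa> (inverse (w ?b)) * (G s t * (G r t * (?c * (?c' * ?E))))"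
        using 1 eq by (simp add: xdefect_def gA gB left_diff_distrib mult.assoc)
      also have "\<dots> = ?c' * (G r t * (G r s * ?E)) - ?c * (G r t * (G s t * ?E))"
      proof -
        have "G r s * (G r t * (?c * (?c' * ?E))) = ?c * (?c' * (G r t * (G r s * ?E)))"
          by (simp add: \<kappa>l cm[OF pG(1,5)])
        moreover have "G s t * (G r t * (?c * (?c' * ?E))) = ?c' * (?c * (G r t * (G s t * ?E)))"
          by (simp add: \<kappa>l cm[OF pG(3,5)] \<kappa>_mult_left[of ?c "w ?b"])
        ultimately show ?thesis by (simp add: inv)
      qed
      finally show ?thesis using 1 B by simp
    next
      case 2
      have "defect * ?al = - ?al" using 2 eq by (simp add: xdefect_def)
      moreover have "?al = ?c * (G r t * (G s t * ?E))" using 2 by (simp add: gA gB \<kappa>l)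
      ultimately show ?thesis using 2 by simp
    next
      case 3
      have "defect * ?al = ?al" using 3 eq by (simp add: xdefect_def)
      moreover have "?al = ?c' * (G r t * (G r s * ?E))" using 3 by (simp add: gA gB \<kappa>l)
      ultimately show ?thesis using 3 B by simp
    next
      case 4
      then show ?thesis using eq by (simp add: xdefect_def)
    qed
  qed
  finally show ?thesis by (simp add: left_diff_distrib)
qed

text \<open>In each case the two braid defects determine each other.\<close>

lemma braid_iff: "DT r * \<epsilon> i = 0 \<longleftrightarrow> DP r * \<epsilon> i = defect * \<epsilon> i"
proof -
  let ?E = "\<epsilon> i"
  have p: "pol (G k l)" "pol (gg a b k l)" "pol (d k l)" if "k \<in> {r, s, t}" "l \<in> {r, s, t}" for k l a b using pols that by blast+
  have wnz: "regular (\<kappa> (w j)) i" "regular (- \<kappa> (w j)) i" for j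
    using regular_\<kappa>[OF w_nz] regular_uminus by blast+
  have iff: ?thesis
    if key: "\<kappa> c * (DT r * (A * ?E)) = - ((DP r - defect) * (B * ?E))" and c: "c \<noteq> 0"
      and A: "pol A" "regular A i" and B: "pol B" "regular B i" for A B c
  proof
    assume 0: "DT r * ?E = 0"
    have "A * ?E = ?E * A" by (rule pol_\<epsilon>[OF A(1) i])
    then have "DT r * (A * ?E) = (DT r * ?E) * A" by (simp only: mult.assoc)
    then have "(DP r - defect) * B * ?E = 0" using key 0 by (simp add: mult.assoc)
    then have "(DP r - defect) * ?E = 0" using B(2) unfolding regular_def by blast
    then show "DP r * ?E = defect * ?E" by (simp add: left_diff_distrib)
  next
    assume "DP r * ?E = defect * ?E"
    then have 0: "(DP r - defect) * ?E = 0" by (simp add: left_diff_distrib)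
    have "B * ?E = ?E * B" by (rule pol_\<epsilon>[OF B(1) i])
    then have "(DP r - defect) * (B * ?E) = ((DP r - defect) * ?E) * B" by (simp only: mult.assoc)
    then have "\<kappa> c * (DT r * (A * ?E)) = \<kappa> c * 0" using key 0 by simp
    then have "DT r * (A * ?E) = 0" by (rule \<kappa>_cancel[OF c])
    then have "DT r * A * ?E = 0" by (simp only: mult.assoc)
    then show "DT r * ?E = 0" using A(2) unfolding regular_def by blast
  qed
  have rG: "regular (G k l) i" if "k \<in> {r, s, t}" "l \<in> {r, s, t}" "i k = i l" for k l
    using regular_G[OF i] rst(1-3) that zero_not_one by auto
  have rg: "regular (gg (i k) (i l) k l) i" if "k \<in> {r, s, t}" "l \<in> {r, s, t}" for k l
    using regular_gg[OF i _ _ refl refl] rst(1-3) that by auto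
  have rd: "regular (d k l) i" if "k \<in> {r, s, t}" "l \<in> {r, s, t}" "i k \<noteq> i l" for k l
    using regular_d[OF i] rst(1-3) that by auto
  have def0: "defect = 0" if "i t \<noteq> i r \<or> i s = i r"
    using that zero_not_one by (auto simp: xdefect_def)
  consider "i r \<noteq> i s" "i r \<noteq> i t" "i s \<noteq> i t" | "i r = i s" "i s \<noteq> i t" | "i r \<noteq> i s" "i s = i t"
    | "i r = i s" "i s = i t" | "i r \<noteq> i s" "i t = i r" by metis
  then show ?thesis
  proof cases
    case 1
    show ?thesis
      by (rule iff[of "- 1" "d r t * (d s t * d r s)" "gg (i s) (i t) s t * (gg (i r) (i t) r t * gg (i r) (i s) r s)"])
        (use braid_distinct[OF 1] 1 def0 in \<open>simp_all add: \<kappa>_uminus mult.assoc p pol_mult regular_mult rg rd\<close>)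
  next
    case 2
    have g: "regular (gg (i r) (i t) s t) i" using rg[of s t] 2 by simp
    show ?thesis
      by (rule iff[of "w (i r)" "d r t * d s t" "G r s * (gg (i r) (i t) r t * gg (i r) (i t) s t)"])
        (use braid_aab[OF 2] 2 def0 w_nz g rg[of r t] in \<open>simp_all add: mult.assoc p pol_mult regular_mult rg rd rG\<close>)
  next
    case 3
    have g: "regular (gg (i r) (i s) r t) i" using rg[of r t] 3 by simp
    show ?thesis
      by (rule iff[of "w (i s)" "d r s * d r t" "G s t * (gg (i r) (i s) r s * gg (i r) (i s) r t)"])
        (use braid_abb[OF 3] 3 def0 w_nz g rg[of r s] in \<open>simp_all add: mult.assoc p pol_mult regular_mult rd rG\<close>)
  next
    case 4
    show ?thesis
      by (rule iff[of "w (i r) * w (i r) * w (i r)" 1 "G r s * (G r t * G s t)"])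
        (use braid_aaa[OF 4] 4 def0 w_nz pol_\<kappa>[of 1] in
          \<open>simp_all add: \<kappa>_mult mult.assoc p pol_mult regular_mult rG, simp_all add: regular_def\<close>)
  next
    case 5
    have g: "regular (gg (i s) (i r) s t) i" using rg[of s t] 5 by simp
    show ?thesis
      by (rule iff[of "w (i r)" "d r s * d s t" "G r t * (gg (i r) (i s) r s * gg (i s) (i r) s t)"])
        (use braid_aba[OF 5] 5 w_nz g in \<open>simp_all add: mult.assoc p pol_mult regular_mult rd rG rg\<close>)
  qed
qed

end

section \<open>The KLR relations in the nilpotent variables\<close>

definition klr_square :: "(nat \<Rightarrow> 'r::ring_1) \<Rightarrow> nat \<Rightarrow> (nat \<Rightarrow> int) \<Rightarrow> nat \<Rightarrow> 'r" where
  "klr_square y e i r =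
     (if i r = i (Suc r) then 0
      else if [i r - i (Suc r) = 1] (mod int e) \<and> e \<noteq> 2 then y r - y (Suc r)
      else if [i r - i (Suc r) = -1] (mod int e) \<and> e \<noteq> 2 then y (Suc r) - y r
      else if [i r - i (Suc r) = 1] (mod int e) \<and> e = 2 then - ((y r - y (Suc r)) * (y r - y (Suc r)))
      else 1)"

definition klr_defect :: "(nat \<Rightarrow> 'r::ring_1) \<Rightarrow> nat \<Rightarrow> (nat \<Rightarrow> int) \<Rightarrow> nat \<Rightarrow> 'r" where
  "klr_defect y e i r =
     (if i (Suc (Suc r)) = i r \<and> [i r - i (Suc r) = 1] (mod int e) \<and> e \<noteq> 2 then -1
      else if i (Suc (Suc r)) = i r \<and> [i r - i (Suc r) = -1] (mod int e) \<and> e \<noteq> 2 then 1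
      else if i (Suc (Suc r)) = i r \<and> [i r - i (Suc r) = 1] (mod int e) \<and> e = 2
        then y r + y (Suc (Suc r)) - 2 * y (Suc r)
      else 0)"

text \<open>The KLR relations with local unit \<open>u\<close>.\<close>

locale klr_y = scalars \<kappa> + quantum q e v
  for \<kappa> :: "'k::field \<Rightarrow> 'r::ring_1" and q :: 'k and e and v :: "int \<Rightarrow> 'k" +
  fixes n :: nat and C :: "(nat \<Rightarrow> int) set" and u :: 'r and y \<psi> :: "nat \<Rightarrow> 'r" and \<epsilon> :: "(nat \<Rightarrow> int) \<Rightarrow> 'r"
  assumes C_finite: "finite C" and C_tuples: "C \<subseteq> tuples n e"
    and C_closed: "r \<in> {1..<n} ==> i \<in> C ==> perm_act (sigma r) i \<in> C"
    and \<epsilon>_mult: "i \<in> C ==> j \<in> C ==> \<epsilon> i * \<epsilon> j = (if i = j then \<epsilon> i else 0)"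
    and \<epsilon>_sum: "(\<Sum>i\<in>C. \<epsilon> i) = u"
    and y_u: "r \<in> {1..n} ==> y r * u = y r" and u_y: "r \<in> {1..n} ==> u * y r = y r"
    and \<psi>_u: "r \<in> {1..<n} ==> \<psi> r * u = \<psi> r" and u_\<psi>: "r \<in> {1..<n} ==> u * \<psi> r = \<psi> r"
    and y_\<epsilon>: "r \<in> {1..n} ==> i \<in> C ==> y r * \<epsilon> i = \<epsilon> i * y r"
    and y_y: "r \<in> {1..n} ==> s \<in> {1..n} ==> y r * y s = y s * y r"
    and \<psi>_\<epsilon>: "r \<in> {1..<n} ==> i \<in> C ==> \<psi> r * \<epsilon> i = \<epsilon> (perm_act (sigma r) i) * \<psi> r"
    and \<psi>_y: "r \<in> {1..<n} ==> s \<in> {1..n} ==> i \<in> C ==>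
        \<psi> r * y s * \<epsilon> i = (y (sigma r s) * \<psi> r + (if i r = i (Suc r) then partial r s else 0)) * \<epsilon> i"
    and \<psi>_\<psi>: "r \<in> {1..<n} ==> i \<in> C ==> \<psi> r * \<psi> r * \<epsilon> i = klr_square y e i r * \<epsilon> i"
    and \<psi>_comm: "r \<in> {1..<n} ==> s \<in> {1..<n} ==> \<bar>int r - int s\<bar> > 1 ==> \<psi> r * \<psi> s = \<psi> s * \<psi> r"
    and \<psi>_braid: "1 \<le> r ==> Suc r < n ==> i \<in> C ==>
        (\<psi> r * \<psi> (Suc r) * \<psi> r - \<psi> (Suc r) * \<psi> r * \<psi> (Suc r)) * \<epsilon> i = klr_defect y e i r * \<epsilon> i"

lemma nilp_power_eq_on:
  assumes "a ^ m * z = N * z" "a * N = N * a" "nilp N z"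
  shows "nilp a z"
proof -
  have "(a ^ m) ^ k * z = N ^ k * z" for k
  proof (induction k)
    case (Suc k)
    have c: "a ^ m * N ^ k = N ^ k * a ^ m"
      using power_commute[of N "a ^ m" k] power_commute[OF assms(2), of m] by simp
    have "(a ^ m) ^ Suc k * z = a ^ m * ((a ^ m) ^ k * z)" by (simp add: mult.assoc)
    also have "\<dots> = a ^ m * N ^ k * z" by (simp add: Suc mult.assoc)
    also have "\<dots> = N ^ k * (a ^ m * z)" by (simp add: c mult.assoc)
    also have "\<dots> = N ^ Suc k * z" by (simp add: assms(1) mult.assoc power_commutes[symmetric])
    finally show ?case .
  qed simp
  moreover obtain k where "N ^ k * z = 0" using assms(3) by (auto simp: nilp_def)
  ultimately have "a ^ (m * k) * z = 0" by (simp add: power_mult)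
  then show ?thesis by (auto simp: nilp_def)
qed

context klr_y
begin

lemma \<epsilon>_idem: "i \<in> C ==> \<epsilon> i * \<epsilon> i = \<epsilon> i" by (simp add: \<epsilon>_mult)

lemma y_power_\<epsilon>: "r \<in> {1..n} ==> i \<in> C ==> y r ^ m * \<epsilon> i = \<epsilon> i * y r ^ m"
  by (rule power_commute[OF y_\<epsilon>])

fun hsum :: "'r \<Rightarrow> 'r \<Rightarrow> nat \<Rightarrow> 'r" where
  "hsum a b 0 = 1"
| "hsum a b (Suc k) = b ^ Suc k + a * hsum a b k"

lemma hsum_commute: "a * b = b * a ==> c * a = a * c ==> c * b = b * c ==> c * hsum a b k = hsum a b k * c"
proof (induction k)
  case (Suc k)
  have "c * b ^ Suc k = b ^ Suc k * c" using power_commute[of b c "Suc k"] Suc.prems by simp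
  moreover have "c * (a * hsum a b k) = a * hsum a b k * c" using Suc by (metis mult.assoc)
  ultimately show ?case by (simp only: hsum.simps distrib_left distrib_right)
qed simp

text \<open>Nilpotency propagates from \<open>y r\<close> to \<open>y (Suc r)\<close>.\<close>

lemma y_nilp_step:
  assumes r: "r \<in> {1..<n}" and i: "i \<in> C" and nil: "\<And>j. j \<in> C ==> nilp (y r) (\<epsilon> j)"
  shows "nilp (y (Suc r)) (\<epsilon> i)"
proof -
  have rn: "r \<in> {1..n}" "Suc r \<in> {1..n}" using r by auto
  let ?a = "y r" and ?b = "y (Suc r)" and ?E = "\<epsilon> i" and ?j = "perm_act (sigma r) i"
  have j: "?j \<in> C" using C_closed r i by blast
  have ab: "?a * ?b = ?b * ?a" by (rule y_y[OF rn])
  have aE: "?a * ?E = ?E * ?a" and bE: "?b * ?E = ?E * ?b" using y_\<epsilon> rn i by blast+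
  show ?thesis
  proof (cases "i r = i (Suc r)")
    case True
    have s: "?j = i" by (rule ext) (use True in \<open>auto simp: transpose_def\<close>)
    have pE: "\<psi> r * ?E = ?E * \<psi> r" using \<psi>_\<epsilon>[OF r i] by (simp add: s)
    have pa: "\<psi> r * ?a * ?E = ?b * \<psi> r * ?E - ?E" and pb: "\<psi> r * ?b * ?E = ?a * \<psi> r * ?E + ?E"
      using \<psi>_y[OF r rn(1) i] \<psi>_y[OF r rn(2) i] True by (simp_all add: partial_def algebra_simps)
    have pp: "\<psi> r * \<psi> r * ?E = 0" using \<psi>_\<psi>[OF r i] True by (simp add: klr_square_def)
    have H: "\<psi> r * ?a ^ Suc k * ?E = ?b ^ Suc k * \<psi> r * ?E - hsum ?a ?b k * ?E" for k
    proof (induction k)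
      case 0 then show ?case using pa by simp
    next
      case (Suc k)
      have hE: "hsum ?a ?b k * ?E * ?a = ?a * hsum ?a ?b k * ?E"
        using hsum_commute[of ?a ?b ?a k] ab aE by (metis mult.assoc)
      have "\<psi> r * ?a ^ Suc (Suc k) * ?E = \<psi> r * ?a ^ Suc k * ?E * ?a"
        using aE by (simp only: power_Suc2[of ?a "Suc k"] mult.assoc)
      also have "\<dots> = ?b ^ Suc k * (\<psi> r * ?a * ?E) - hsum ?a ?b k * ?E * ?a"
        using aE unfolding Suc by (simp only: left_diff_distrib mult.assoc)
      also have "\<dots> = ?b ^ Suc (Suc k) * \<psi> r * ?E - (?b ^ Suc k * ?E + ?a * hsum ?a ?b k * ?E)"
        unfolding pa hE by (simp only: right_diff_distrib power_Suc2[of ?b "Suc k"] mult.assoc) simp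
      finally show ?case by (simp only: hsum.simps distrib_right)
    qed
    obtain M where M: "?a ^ M * ?E = 0" using nil[OF i] by (auto simp: nilp_def)
    have M': "?a ^ Suc (Suc M) * ?E = 0" using nilp_le[OF M, of "Suc (Suc M)"] by simp
    let ?h = "hsum ?a ?b (Suc M)"
    have bh: "?b ^ Suc (Suc M) * \<psi> r * ?E = ?h * ?E"
      using H[of "Suc M"] M' by (simp only: mult.assoc) simp
    have hp: "?h * \<psi> r * ?E = 0"
    proof -
      have "?h * \<psi> r * ?E = ?h * ?E * \<psi> r" using pE by (simp only: mult.assoc)
      also have "\<dots> = ?b ^ Suc (Suc M) * (\<psi> r * \<psi> r * ?E)"
      proof -
        have "\<psi> r * (?E * \<psi> r) = \<psi> r * (\<psi> r * ?E)" using pE by simp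
        then show ?thesis unfolding bh[symmetric] by (simp only: mult.assoc)
      qed
      finally show ?thesis using pp by simp
    qed
    have ha: "?a * ?h = ?h * ?a" by (rule hsum_commute) (use ab in auto)
    have "?h * ?E = ?h * (\<psi> r * ?b * ?E - ?a * \<psi> r * ?E)" using pb by simp
    also have "\<dots> = ?h * \<psi> r * ?E * ?b - ?a * (?h * \<psi> r * ?E)"
      using ha bE by (simp only: right_diff_distrib mult.assoc) (metis mult.assoc)
    also have "\<dots> = 0" using hp by simp
    finally have "?b ^ Suc M * ?E = (- (?a * hsum ?a ?b M)) * ?E"
      by (simp only: hsum.simps distrib_right) (simp add: eq_neg_iff_add_eq_0)
    moreover have "nilp (- (?a * hsum ?a ?b M)) ?E"
      by (intro nilp_uminus nilp_mult hsum_commute nil i) (use ab in auto)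
    moreover have "?b * (- (?a * hsum ?a ?b M)) = - (?a * hsum ?a ?b M) * ?b"
    proof -
      have "?b * hsum ?a ?b M = hsum ?a ?b M * ?b" by (rule hsum_commute) (use ab in auto)
      then show ?thesis using ab by simp (metis mult.assoc)
    qed
    ultimately show ?thesis using nilp_power_eq_on by blast
  next
    case False
    have bp: "?b * (\<psi> r * z) = \<psi> r * (?a * z)" if "\<epsilon> ?j * z = z" for z
    proof -
      have "\<psi> r * ?a * \<epsilon> ?j = ?b * \<psi> r * \<epsilon> ?j" using \<psi>_y[OF r rn(1) j] False by simp
      then show ?thesis using that by (metis mult.assoc)
    qed
    obtain M where M: "?a ^ M * \<epsilon> ?j = 0" using nil[OF j] by (auto simp: nilp_def)
    have ez: "\<epsilon> ?j * (\<psi> r * ?E) = \<psi> r * ?E" using \<psi>_\<epsilon>[OF r i] \<epsilon>_idem[OF i] by (metis mult.assoc)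
    have "?b ^ k * (\<psi> r * (\<psi> r * ?E)) = \<psi> r * (?a ^ k * (\<psi> r * ?E))" for k
    proof (induction k)
      case (Suc k)
      have "\<epsilon> ?j * (?a ^ k * (\<psi> r * ?E)) = ?a ^ k * (\<psi> r * ?E)"
        using y_power_\<epsilon>[OF rn(1) j, of k] ez by (metis mult.assoc)
      then show ?case using bp Suc by (simp add: mult.assoc)
    qed simp
    moreover have "?a ^ M * (\<psi> r * ?E) = 0" using M ez by (metis mult.assoc mult_zero_left)
    ultimately have bM: "?b ^ M * (klr_square y e i r * ?E) = 0" using \<psi>_\<psi>[OF r i] by (simp add: mult.assoc)
    have bMa: "?b ^ M * ?a = ?a * ?b ^ M" by (rule power_commute) (use ab in simp)
    have lin: ?thesis if "?b ^ M * ((?b - ?a) * ?E) = 0"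
    proof (rule nilp_power_eq_on)
      show "?b ^ Suc M * ?E = (?a * ?b ^ M) * ?E"
        using that bMa by (simp only: left_diff_distrib right_diff_distrib power_Suc2 mult.assoc) (metis eq_iff_diff_eq_0 mult.assoc)
      show "?b * (?a * ?b ^ M) = ?a * ?b ^ M * ?b" using ab by (metis mult.assoc power_commutes)
      show "nilp (?a * ?b ^ M) ?E" by (rule nilp_mult) (use bMa nil i in auto)
    qed
    have "klr_square y e i r = ?a - ?b \<or> klr_square y e i r = ?b - ?a
      \<or> klr_square y e i r = - ((?a - ?b) * (?a - ?b)) \<or> klr_square y e i r = 1"
      using False by (simp add: klr_square_def)
    then consider "klr_square y e i r = ?a - ?b" | "klr_square y e i r = ?b - ?a"
      | "klr_square y e i r = - ((?a - ?b) * (?a - ?b))" | "klr_square y e i r = 1"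
      by blast
    then show ?thesis
    proof cases
      case 1
      have "?b ^ M * ((?b - ?a) * ?E) = - (?b ^ M * ((?a - ?b) * ?E))" by (simp add: algebra_simps)
      then show ?thesis using lin bM 1 by simp
    next
      case 2 then show ?thesis using lin bM by simp
    next
      case 3
      let ?c = "2 * ?b - ?a"
      have ca: "?a * ?c = ?c * ?a" and cb: "?b * ?c = ?c * ?b" using ab by (simp_all add: algebra_simps mult_2)
      have bac: "?b * (?a * ?c) = ?a * ?c * ?b" using ab cb by (metis mult.assoc)
      have "(?a - ?b) * (?a - ?b) = ?b * ?b - ?a * ?c" using ab by (simp add: algebra_simps mult_2)
      then have "?b ^ M * (- (?b * ?b - ?a * ?c) * ?E) = 0" using bM 3 by simp
      then have "?b ^ M * ((?b * ?b - ?a * ?c) * ?E) = 0"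
        by (simp only: mult_minus_left mult_minus_right neg_equal_0_iff_equal)
      then have "?b ^ Suc (Suc M) * ?E = (?a * ?c * ?b ^ M) * ?E"
      proof -
        assume 0: "?b ^ M * ((?b * ?b - ?a * ?c) * ?E) = 0"
        have A: "?b ^ M * (?a * ?c) = ?a * ?c * ?b ^ M"
          by (rule power_commute[OF bac])
        have B: "?b ^ Suc (Suc M) = ?b ^ M * (?b * ?b)" by (simp only: power_Suc2 mult.assoc)
        have "?b ^ M * (?b * ?b) * ?E - ?b ^ M * (?a * ?c) * ?E = 0"
          using 0 by (simp only: left_diff_distrib right_diff_distrib mult.assoc)
        then have "?b ^ M * (?b * ?b) * ?E = ?b ^ M * (?a * ?c) * ?E" by (rule eq_iff_diff_eq_0[THEN iffD2])
        then show ?thesis by (simp only: A B)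
      qed
      moreover have "nilp (?a * (?c * ?b ^ M)) ?E"
      proof (rule nilp_mult)
        show "?a * (?c * ?b ^ M) = ?c * ?b ^ M * ?a" using ca bMa by (metis mult.assoc)
      qed (use nil i in auto)
      moreover have "?b * (?a * ?c * ?b ^ M) = ?a * ?c * ?b ^ M * ?b"
      proof -
        have "?b * (?a * ?c * ?b ^ M) = ?a * ?c * (?b * ?b ^ M)" using bac by (simp only: mult.assoc[symmetric])
        then show ?thesis by (simp only: power_commutes[symmetric] mult.assoc)
      qed
      ultimately show ?thesis using nilp_power_eq_on by (metis mult.assoc)
    next
      case 4
      then show ?thesis using bM by (auto simp: nilp_def)
    qed
  qed
qed

text \<open>The cyclotomic relation makes \<open>y 1\<close> nilpotent; nilpotency then passes
  from strand to strand.\<close>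

lemma y_nilp:
  assumes "\<And>j. j \<in> C ==> nilp (y 1) (\<epsilon> j)" "r \<in> {1..n}" "i \<in> C"
  shows "nilp (y r) (\<epsilon> i)"
proof -
  have "1 \<le> r ==> r \<le> n ==> \<forall>i\<in>C. nilp (y r) (\<epsilon> i)"
  proof (induction r rule: dec_induct)
    case base then show ?case using assms(1) by blast
  next
    case (step r) then show ?case using y_nilp_step[of r] by auto
  qed
  then show ?thesis using assms by auto
qed

end

section \<open>Change of variables\<close>
text \<open>The nilpotent variables: \<open>x r = v (i r) + w (i r) * y r\<close> on
  \<open>\<epsilon> i\<close>.\<close>

locale xy = orbit_system +
  fixes y \<psi> :: "nat \<Rightarrow> 'b"
  assumes y_u: "r \<in> {1..n} ==> y r * u = y r" and u_y: "r \<in> {1..n} ==> u * y r = y r"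
    and \<psi>_u: "r \<in> {1..<n} ==> \<psi> r * u = \<psi> r" and u_\<psi>: "r \<in> {1..<n} ==> u * \<psi> r = \<psi> r"
    and y_\<epsilon>: "r \<in> {1..n} ==> i \<in> C ==> y r * \<epsilon> i = \<epsilon> i * y r"
    and \<psi>_\<epsilon>: "r \<in> {1..<n} ==> i \<in> C ==> \<psi> r * \<epsilon> i = \<epsilon> (perm_act (sigma r) i) * \<psi> r"
    and xy: "r \<in> {1..n} ==> i \<in> C ==> x r * \<epsilon> i = (\<kappa> (v (i r)) + \<kappa> (w (i r)) * y r) * \<epsilon> i"
begin

lemma y_y:
  assumes rs: "r \<in> {1..n}" "s \<in> {1..n}"
  shows "y r * y s = y s * y r"
proof (rule eq_by_weights)
  fix i assume i: "i \<in> C"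
  have e: "\<kappa> (w (i r)) * (y r * \<epsilon> i) = (x r - \<kappa> (v (i r))) * \<epsilon> i"
    "\<kappa> (w (i s)) * (y s * \<epsilon> i) = (x s - \<kappa> (v (i s))) * \<epsilon> i"
    using xy[OF rs(1) i] xy[OF rs(2) i] by (simp_all add: algebra_simps)
  have p: "pol (x r - \<kappa> (v (i r)))" "pol (x s - \<kappa> (v (i s)))" using rs by (auto intro!: pol.intros)
  have A: "\<kappa> (w (i r)) * (\<kappa> (w (i s)) * (y r * y s * \<epsilon> i)) = (x r - \<kappa> (v (i r))) * ((x s - \<kappa> (v (i s))) * \<epsilon> i)"
  proof -
    have "\<kappa> (w (i r)) * (\<kappa> (w (i s)) * (y r * y s * \<epsilon> i)) = \<kappa> (w (i r)) * (y r * (\<kappa> (w (i s)) * (y s * \<epsilon> i)))"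
      by (simp add: mult.assoc \<kappa>_mult_left[of "y r"])
    also have "\<dots> = \<kappa> (w (i r)) * (y r * \<epsilon> i) * (x s - \<kappa> (v (i s)))"
      unfolding e(2) pol_\<epsilon>[OF p(2) i] by (simp add: mult.assoc)
    also have "\<dots> = (x r - \<kappa> (v (i r))) * ((x s - \<kappa> (v (i s))) * \<epsilon> i)"
      unfolding e(1) pol_\<epsilon>[OF p(2) i] by (simp add: mult.assoc)
    finally show ?thesis .
  qed
  have B: "\<kappa> (w (i s)) * (\<kappa> (w (i r)) * (y s * y r * \<epsilon> i)) = (x s - \<kappa> (v (i s))) * ((x r - \<kappa> (v (i r))) * \<epsilon> i)"
  proof -
    have "\<kappa> (w (i s)) * (\<kappa> (w (i r)) * (y s * y r * \<epsilon> i)) = \<kappa> (w (i s)) * (y s * (\<kappa> (w (i r)) * (y r * \<epsilon> i)))"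
      by (simp add: mult.assoc \<kappa>_mult_left[of "y s"])
    also have "\<dots> = \<kappa> (w (i s)) * (y s * \<epsilon> i) * (x r - \<kappa> (v (i r)))"
      unfolding e(1) pol_\<epsilon>[OF p(1) i] by (simp add: mult.assoc)
    also have "\<dots> = (x s - \<kappa> (v (i s))) * ((x r - \<kappa> (v (i r))) * \<epsilon> i)"
      unfolding e(2) pol_\<epsilon>[OF p(1) i] by (simp add: mult.assoc)
    finally show ?thesis .
  qed
  have "\<kappa> (w (i r)) * (\<kappa> (w (i s)) * (y r * y s * \<epsilon> i)) = \<kappa> (w (i r)) * (\<kappa> (w (i s)) * (y s * y r * \<epsilon> i))"
    using A B pol_commute[OF p] \<kappa>_mult_left[of "\<kappa> (w (i r))" "w (i s)"] by (metis mult.assoc)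
  then show "y r * y s * \<epsilon> i = y s * y r * \<epsilon> i" using \<kappa>_cancel[OF w_nz] by blast
qed (use y_u rs in \<open>simp_all add: mult.assoc\<close>)

lemma yE: "r \<in> {1..n} ==> i \<in> C ==> \<kappa> (w (i r)) * (y r * \<epsilon> i) = (x r - \<kappa> (v (i r))) * \<epsilon> i"
  using xy by (simp add: algebra_simps)

lemma \<psi>_y_iff:
  assumes r: "r \<in> {1..<n}" and s: "s \<in> {1..n}" and i: "i \<in> C"
  shows "\<psi> r * y s * \<epsilon> i = (y (sigma r s) * \<psi> r + \<kappa> c) * \<epsilon> i
    \<longleftrightarrow> \<psi> r * x s * \<epsilon> i = (x (sigma r s) * \<psi> r + \<kappa> (w (i s) * c)) * \<epsilon> i"
proof -
  let ?j = "perm_act (sigma r) i" and ?w = "\<kappa> (w (i s))" and ?v = "\<kappa> (v (i s))"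
  have j: "?j \<in> C" using C_closed r i by blast
  have ss: "sigma r s \<in> {1..n}" using s r by (auto simp: transpose_def)
  have js: "?j (sigma r s) = i s" by simp
  have ez: "\<epsilon> ?j * (\<psi> r * \<epsilon> i) = \<psi> r * \<epsilon> i" using \<psi>_\<epsilon>[OF r i] \<epsilon>_idem[OF i] by (metis mult.assoc)
  have 1: "?w * (\<psi> r * y s * \<epsilon> i) = \<psi> r * x s * \<epsilon> i - ?v * (\<psi> r * \<epsilon> i)"
  proof -
    have "?w * (\<psi> r * y s * \<epsilon> i) = \<psi> r * (?w * (y s * \<epsilon> i))" by (simp add: mult.assoc \<kappa>_mult_left[of "\<psi> r"])
    then show ?thesis unfolding yE[OF s i] by (simp add: algebra_simps \<kappa>_mult_left[of "\<psi> r"])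
  qed
  have 2: "?w * (y (sigma r s) * \<psi> r * \<epsilon> i) = x (sigma r s) * \<psi> r * \<epsilon> i - ?v * (\<psi> r * \<epsilon> i)"
  proof -
    have "?w * (y (sigma r s) * \<epsilon> ?j) * (\<psi> r * \<epsilon> i) = (x (sigma r s) - ?v) * \<epsilon> ?j * (\<psi> r * \<epsilon> i)"
      using yE[OF ss j] unfolding js by simp
    then show ?thesis using ez by (simp add: mult.assoc left_diff_distrib)
  qed
  have 3: "?w * ((y (sigma r s) * \<psi> r + \<kappa> c) * \<epsilon> i)
      = x (sigma r s) * \<psi> r * \<epsilon> i - ?v * (\<psi> r * \<epsilon> i) + \<kappa> (w (i s) * c) * \<epsilon> i"
    unfolding distrib_right distrib_left 2 by (simp add: \<kappa>_mult mult.assoc)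
  have "\<psi> r * y s * \<epsilon> i = (y (sigma r s) * \<psi> r + \<kappa> c) * \<epsilon> i
      \<longleftrightarrow> ?w * (\<psi> r * y s * \<epsilon> i) = ?w * ((y (sigma r s) * \<psi> r + \<kappa> c) * \<epsilon> i)"
    by (metis \<kappa>_cancel w_nz)
  also have "\<dots> \<longleftrightarrow> \<psi> r * x s * \<epsilon> i - ?v * (\<psi> r * \<epsilon> i)
      = x (sigma r s) * \<psi> r * \<epsilon> i - ?v * (\<psi> r * \<epsilon> i) + \<kappa> (w (i s) * c) * \<epsilon> i"
    by (simp only: 1 3)
  also have "\<dots> \<longleftrightarrow> \<psi> r * x s * \<epsilon> i = (x (sigma r s) * \<psi> r + \<kappa> (w (i s) * c)) * \<epsilon> i"
    by (simp add: distrib_right algebra_simps)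
  finally show ?thesis .
qed

lemma cong_flip: "[a - b = - 1] (mod int e) \<longleftrightarrow> [b - a = 1] (mod int e)"
  by (metis cong_minus_minus_iff minus_diff_eq minus_minus)

lemma both_iff: "[a - b = 1] (mod int e) ==> [b - a = 1] (mod int e) \<longleftrightarrow> e = 2"
proof
  assume "[a - b = 1] (mod int e)" "[b - a = 1] (mod int e)"
  then have "[(a - b) + (b - a) = 1 + 1] (mod int e)" by (rule cong_add)
  then have "int e dvd 2" by (simp add: cong_iff_dvd_diff)
  then have "e dvd 2" by (metis int_dvd_int_iff of_nat_numeral)
  then have "e = 1 \<or> e = 2" by (metis prime_nat_iff two_is_prime_nat)
  then show "e = 2" using zero_not_one by (auto simp: cong_def)
next
  assume "[a - b = 1] (mod int e)" "e = 2"
  then show "[b - a = 1] (mod int e)" by (simp add: cong_iff_dvd_diff)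
qed

lemma G_y:
  assumes rs: "r \<in> {1..n}" "s \<in> {1..n}" and i: "i \<in> C" and c: "[i r - i s = 1] (mod int e)"
  shows "G r s * \<epsilon> i = \<kappa> (w (i r)) * ((y r - y s) * \<epsilon> i)"
proof -
  have "w (i r) = w (i s + 1)" by (rule w_cong) (use c in \<open>simp add: cong_iff_dvd_diff algebra_simps\<close>)
  then have w: "w (i r) = q * w (i s)" by (simp add: w_Suc)
  have vz: "v (i r) - q * v (i s) - 1 = 0" using c v_step_iff by blast
  have "G r s * \<epsilon> i = x r * \<epsilon> i - \<kappa> q * (x s * \<epsilon> i) - \<epsilon> i"
    by (simp add: G_def left_diff_distrib mult.assoc u_\<epsilon>[OF i])
  also have "\<dots> = \<kappa> (w (i r)) * (y r * \<epsilon> i) - \<kappa> q * (\<kappa> (w (i s)) * (y s * \<epsilon> i)) + (\<kappa> (v (i r)) - \<kappa> q * \<kappa> (v (i s)) - 1) * \<epsilon> i"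
    unfolding xy[OF rs(1) i] xy[OF rs(2) i] by (simp add: algebra_simps)
  also have "\<kappa> (v (i r)) - \<kappa> q * \<kappa> (v (i s)) - 1 = \<kappa> (v (i r) - q * v (i s) - 1)" by (simp add: \<kappa>_minus \<kappa>_mult)
  also have "\<dots> = 0" using vz by simp
  also have "\<kappa> q * (\<kappa> (w (i s)) * (y s * \<epsilon> i)) = \<kappa> (w (i r)) * (y s * \<epsilon> i)" by (simp add: w \<kappa>_mult mult.assoc)
  finally show ?thesis by (simp add: algebra_simps)
qed

lemma \<psi>_\<psi>_iff:
  assumes r: "r \<in> {1..<n}" and i: "i \<in> C" and ne: "i r \<noteq> i (Suc r)"
  shows "\<psi> r * \<psi> r * \<epsilon> i = klr_square y e i r * \<epsilon> i
    \<longleftrightarrow> \<psi> r * \<psi> r * (gg (i r) (i (Suc r)) r (Suc r) * gg (i (Suc r)) (i r) (Suc r) r) * \<epsilon> i = G r (Suc r) * G (Suc r) r * \<epsilon> i"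
proof -
  have rn: "r \<in> {1..n}" "Suc r \<in> {1..n}" using r by auto
  let ?g = "gg (i r) (i (Suc r)) r (Suc r) * gg (i (Suc r)) (i r) (Suc r) r" and ?E = "\<epsilon> i"
  let ?A = "[i r - i (Suc r) = 1] (mod int e)" and ?B = "[i (Suc r) - i r = 1] (mod int e)"
  have E: "?E * ?E = ?E" by (rule \<epsilon>_idem[OF i])
  have GE: "G r (Suc r) * ?E = ?E * G r (Suc r)" "G (Suc r) r * ?E = ?E * G (Suc r) r"
    "y r * ?E = ?E * y r" "y (Suc r) * ?E = ?E * y (Suc r)"
    using pol_\<epsilon>[OF pol_G[OF rn] i] pol_\<epsilon>[OF pol_G[OF rn(2,1)] i] y_\<epsilon> rn i by blast+
  have key: "klr_square y e i r * ?g * ?E = G r (Suc r) * G (Suc r) r * ?E"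
  proof -
    consider "?A" "?B" | "?A" "\<not> ?B" | "\<not> ?A" "?B" | "\<not> ?A" "\<not> ?B" by blast
    then show ?thesis
    proof cases
      case 1
      then have e2: "e = 2" using both_iff by blast
      have "G r (Suc r) * G (Suc r) r * ?E = (G r (Suc r) * ?E) * (G (Suc r) r * ?E)"
        using GE(2) E by (metis mult.assoc)
      also have "\<dots> = \<kappa> (w (i r)) * ((y r - y (Suc r)) * ?E) * (\<kappa> (w (i (Suc r))) * ((y (Suc r) - y r) * ?E))"
        using G_y[OF rn i 1(1)] G_y[OF rn(2,1) i 1(2)] by simp
      also have "\<dots> = \<kappa> (w (i r)) * (\<kappa> (w (i (Suc r))) * ((y r - y (Suc r)) * (y (Suc r) - y r) * ?E))"
      proof -
        have "?E * ((y (Suc r) - y r) * ?E) = (y (Suc r) - y r) * ?E"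
          using GE(3,4) E by (simp add: left_diff_distrib right_diff_distrib) (metis mult.assoc)
        then show ?thesis
          by (simp only: mult.assoc \<kappa>_mult_left[of "?E"] \<kappa>_mult_left[of "y r - y (Suc r)"])
      qed
      also have "\<dots> = klr_square y e i r * ?g * ?E"
      proof -
        have sq: "klr_square y e i r = (y r - y (Suc r)) * (y (Suc r) - y r)"
          using 1 ne e2 by (simp add: klr_square_def algebra_simps)
        have g: "?g = \<kappa> (w (i r)) * \<kappa> (w (i (Suc r)))" using 1 by (simp add: gg_def)
        show ?thesis unfolding sq g
          by (simp only: mult.assoc \<kappa>_mult_left[of "y r - y (Suc r)"] \<kappa>_mult_left[of "y (Suc r) - y r"])
      qed
      finally show ?thesis by simp
    next
      case 2
      then have e2: "e \<noteq> 2" using both_iff by blast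
      have "G r (Suc r) * G (Suc r) r * ?E = (G r (Suc r) * ?E) * G (Suc r) r" using GE(2) by (metis mult.assoc)
      also have "\<dots> = \<kappa> (w (i r)) * ((y r - y (Suc r)) * ?E) * G (Suc r) r" using G_y[OF rn i 2(1)] by simp
      also have "\<dots> = \<kappa> (w (i r)) * ((y r - y (Suc r)) * (G (Suc r) r * ?E))" using GE(2) by (simp only: mult.assoc)
      also have "\<dots> = klr_square y e i r * ?g * ?E"
        using 2 ne e2 by (simp add: klr_square_def gg_def mult.assoc \<kappa>_mult_left[of "y r - y (Suc r)"])
      finally show ?thesis by simp
    next
      case 3
      then have e2: "e \<noteq> 2" using both_iff by blast
      have "G r (Suc r) * G (Suc r) r * ?E = (G (Suc r) r * ?E) * G r (Suc r)"
        using GE(1) pol_commute[OF pol_G[OF rn] pol_G[OF rn(2,1)]] by (metis mult.assoc)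
      also have "\<dots> = \<kappa> (w (i (Suc r))) * ((y (Suc r) - y r) * ?E) * G r (Suc r)" using G_y[OF rn(2,1) i 3(2)] by simp
      also have "\<dots> = \<kappa> (w (i (Suc r))) * ((y (Suc r) - y r) * (G r (Suc r) * ?E))" using GE(1) by (simp only: mult.assoc)
      also have "\<dots> = klr_square y e i r * ?g * ?E"
        using 3 ne e2 by (simp add: klr_square_def gg_def cong_flip mult.assoc \<kappa>_mult_left[of "y (Suc r) - y r"]
            \<kappa>_mult_left[of "G r (Suc r)"])
      finally show ?thesis by simp
    next
      case 4
      then show ?thesis using ne by (simp add: klr_square_def gg_def cong_flip)
    qed
  qed
  have reg: "regular ?g i" using regular_mult regular_gg[OF i rn refl refl] regular_gg[OF i rn(2,1) refl refl] by blast
  have gE: "?g * ?E = ?E * ?g" using pol_\<epsilon>[OF pol_mult[OF pol_gg[OF rn] pol_gg[OF rn(2,1)]] i] .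
  show ?thesis
  proof
    assume a: "\<psi> r * \<psi> r * ?E = klr_square y e i r * ?E"
    have "\<psi> r * \<psi> r * ?g * ?E = \<psi> r * \<psi> r * ?E * ?g" using gE by (simp only: mult.assoc)
    also have "\<dots> = klr_square y e i r * ?g * ?E" unfolding a using gE by (simp only: mult.assoc)
    finally show "\<psi> r * \<psi> r * ?g * ?E = G r (Suc r) * G (Suc r) r * ?E" using key by simp
  next
    assume "\<psi> r * \<psi> r * ?g * ?E = G r (Suc r) * G (Suc r) r * ?E"
    then have "\<psi> r * \<psi> r * ?g * ?E = klr_square y e i r * ?g * ?E" using key by simp
    then show "\<psi> r * \<psi> r * ?E = klr_square y e i r * ?E" using regular_cancel[OF reg] by blast
  qed
qed

end

section \<open>Existence of the other set of generators\<close>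

context xy
begin

lemma defect_y:
  assumes r: "r \<in> {1..<n}" "Suc r \<in> {1..<n}" and i: "i \<in> C"
  shows "xdefect i r (Suc r) (Suc (Suc r)) * \<epsilon> i = klr_defect y e i r * \<epsilon> i"
proof (cases "i (Suc (Suc r)) = i r \<and> [i r - i (Suc r) = 1] (mod int e) \<and> e = 2")
  case True
  then have A: "[i r - i (Suc r) = 1] (mod int e)" and B: "[i (Suc r) - i r = 1] (mod int e)"
    using both_iff by blast+
  have t: "i (Suc (Suc r)) = i r" using True by blast
  have rn: "r \<in> {1..n}" "Suc r \<in> {1..n}" "Suc (Suc r) \<in> {1..n}" using r by auto
  have inv: "\<kappa> (inverse (w j)) * (\<kappa> (w j) * z) = z" for j z
    using \<kappa>_inverse[OF w_nz] by (metis mult.assoc mult_1_left)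
  have "xdefect i r (Suc r) (Suc (Suc r)) * \<epsilon> i
      = \<kappa> (inverse (w (i r))) * (G r (Suc r) * \<epsilon> i) - \<kappa> (inverse (w (i (Suc r)))) * (G (Suc r) (Suc (Suc r)) * \<epsilon> i)"
    by (simp add: xdefect_def t A B left_diff_distrib mult.assoc)
  also have "\<dots> = (y r - y (Suc r)) * \<epsilon> i - (y (Suc r) - y (Suc (Suc r))) * \<epsilon> i"
    using G_y[OF rn(1,2) i A] G_y[OF rn(2,3) i] B True by (simp add: inv)
  also have "\<dots> = klr_defect y e i r * \<epsilon> i"
  proof -
    have "klr_defect y e i r = y r + y (Suc (Suc r)) - 2 * y (Suc r)"
      using True unfolding klr_defect_def by (metis (no_types, lifting))
    then show ?thesis by (simp only:) (simp add: algebra_simps mult_2)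
  qed
  finally show ?thesis .
next
  case False
  then show ?thesis
    using both_iff[of "i r" "i (Suc r)"] both_iff[of "i (Suc r)" "i r"]
    by (auto simp: xdefect_def klr_defect_def cong_flip)
qed

end

lemma nilp_cong:
  assumes "a * z = b * z" "b * z = z * b" "nilp b z"
  shows "nilp a z"
proof -
  have "a ^ m * z = b ^ m * z" for m
  proof (induction m)
    case (Suc m)
    have "a ^ Suc m * z = a * (b ^ m * z)" by (simp add: Suc[symmetric] mult.assoc)
    also have "b ^ m * z = z * b ^ m" by (rule power_commute[OF assms(2)])
    also have "a * (z * b ^ m) = b * (z * b ^ m)" using assms(1) by (simp only: mult.assoc[symmetric])
    also have "z * b ^ m = b ^ m * z" by (rule power_commute[OF assms(2), symmetric])
    finally show ?case by (simp add: mult.assoc)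
  qed simp
  then show ?thesis using assms(3) by (simp add: nilp_def)
qed

context orbit_system
begin

lemma sum_weights:
  assumes "\<And>j. j \<in> C ==> f j * \<epsilon> j = f j" "i \<in> C"
  shows "(\<Sum>j\<in>C. f j) * \<epsilon> i = f i"
proof -
  have "(\<Sum>j\<in>C. f j) * \<epsilon> i = (\<Sum>j\<in>C. f j * (\<epsilon> j * \<epsilon> i))"
    unfolding sum_distrib_right by (rule sum.cong) (simp_all add: mult.assoc[symmetric] assms(1))
  also have "\<dots> = (\<Sum>j\<in>C. if j = i then f i else 0)"
    by (rule sum.cong) (use assms \<epsilon>_mult in auto)
  finally show ?thesis using assms(2) C_finite by simp
qed

lemma linked_cong:
  assumes r: "r \<in> {1..<n}" and i: "i \<in> C" and "t * \<epsilon> i = t' * \<epsilon> i" "p * \<epsilon> i = p' * \<epsilon> i"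
  shows "linked t p r i \<longleftrightarrow> linked t' p' r i"
proof -
  have rn: "r \<in> {1..n}" "Suc r \<in> {1..n}" using r by auto
  have c: "f * \<epsilon> i = \<epsilon> i * f" if "f \<in> {d r (Suc r), G r (Suc r), gg (i r) (i (Suc r)) r (Suc r)}" for f
    using that pol_\<epsilon>[OF _ i] pol_d[OF rn] pol_G[OF rn] pol_gg[OF rn] by blast
  have e: "p * f * \<epsilon> i = p' * f * \<epsilon> i" "t * f * \<epsilon> i = t' * f * \<epsilon> i"
    if "f \<in> {d r (Suc r), G r (Suc r), gg (i r) (i (Suc r)) r (Suc r)}" for f
    using c[OF that] assms(3,4) by (metis mult.assoc)+
  have e': "t * (d r (Suc r) * \<epsilon> i) = t' * (d r (Suc r) * \<epsilon> i)" using e(2) by (simp add: mult.assoc)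
  show ?thesis
    unfolding linked_def using e(1) e' assms(3) by (simp add: distrib_right distrib_left mult.assoc)
qed

lemma xy_variable:
  assumes S: "subalg S" "u \<in> S" "\<And>i. i \<in> C ==> \<epsilon> i \<in> S" and r: "r \<in> {1..n}" "x r \<in> S"
  obtains y where "y \<in> S" "\<And>i. i \<in> C ==> x r * \<epsilon> i = (\<kappa> (v (i r)) + \<kappa> (w (i r)) * y) * \<epsilon> i"
    "\<And>i. i \<in> C ==> y * \<epsilon> i = \<epsilon> i * y"
proof -
  let ?f = "\<lambda>i. \<kappa> (inverse (w (i r))) * ((x r - \<kappa> (v (i r)) * u) * \<epsilon> i)"
  let ?y = "\<Sum>i\<in>C. ?f i"
  have y\<epsilon>: "?y * \<epsilon> i = ?f i" if "i \<in> C" for i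
    by (rule sum_weights[OF _ that]) (simp add: mult.assoc \<epsilon>_idem)
  have "\<epsilon> i * ?y = ?f i" if i: "i \<in> C" for i
  proof -
    have c: "\<epsilon> i * ?f j = ?f j * \<epsilon> i" if j: "j \<in> C" for j
    proof -
      let ?g = "x r - \<kappa> (v (j r)) * u" and ?c = "\<kappa> (inverse (w (j r)))"
      have "pol ?g" using r(1) by (auto intro!: pol.intros)
      then have g: "\<epsilon> i * ?g = ?g * \<epsilon> i" using pol_\<epsilon>[OF _ i] by simp
      have "\<epsilon> i * (?c * (?g * \<epsilon> j)) = ?c * (?g * (\<epsilon> i * \<epsilon> j))"
        using \<kappa>_central[of "\<epsilon> i"] g by (metis mult.assoc)
      also have "\<epsilon> i * \<epsilon> j = \<epsilon> j * \<epsilon> i" using \<epsilon>_mult[OF i j] \<epsilon>_mult[OF j i] by auto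
      finally show ?thesis by (simp only: mult.assoc)
    qed
    have "\<epsilon> i * ?y = ?y * \<epsilon> i"
      unfolding sum_distrib_left sum_distrib_right by (rule sum.cong[OF refl]) (rule c)
    then show ?thesis using y\<epsilon>[OF i] by simp
  qed
  then have c: "?y * \<epsilon> i = \<epsilon> i * ?y" if "i \<in> C" for i using y\<epsilon>[OF that] that by simp
  have "x r * \<epsilon> i = (\<kappa> (v (i r)) + \<kappa> (w (i r)) * ?y) * \<epsilon> i" if i: "i \<in> C" for i
  proof -
    have "\<kappa> (w (i r)) * (?y * \<epsilon> i) = (\<kappa> (w (i r)) * \<kappa> (inverse (w (i r)))) * ((x r - \<kappa> (v (i r)) * u) * \<epsilon> i)"
      unfolding y\<epsilon>[OF i] by (simp add: mult.assoc)
    also have "\<kappa> (w (i r)) * \<kappa> (inverse (w (i r))) = 1"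
      using \<kappa>_mult[of "w (i r)" "inverse (w (i r))"] w_nz by simp
    finally have "\<kappa> (w (i r)) * (?y * \<epsilon> i) = x r * \<epsilon> i - \<kappa> (v (i r)) * \<epsilon> i"
      by (simp add: left_diff_distrib mult.assoc u_\<epsilon>[OF i])
    then show ?thesis by (simp add: distrib_right mult.assoc)
  qed
  moreover have "?y \<in> S"
  proof (rule subalg_sum[OF S(1) subalg_zero[OF S(1,2)]])
    fix i assume "i \<in> C"
    then show "?f i \<in> S" using S r subalg_minus[OF S(1)] by (auto simp: subalg_def)
  qed
  ultimately show ?thesis using that[of ?y] c by blast
qed

end

text \<open>All relations of the affine Hecke algebra, on the weight spaces of one orbit.\<close>

locale hecke_full = orbit_system + hecke_rep +
  assumes T_comm: "r \<in> {1..<n} ==> s \<in> {1..<n} ==> \<bar>int r - int s\<bar> > 1 ==> T r * T s = T s * T r"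
    and T_braid: "1 \<le> r ==> Suc r < n ==> T r * T (Suc r) * T r = T (Suc r) * T r * T (Suc r)"
begin

text \<open>Define \<open>\<psi> r\<close> weight by weight by solving the link. The quadratic
  relations follow from the link, the remaining relations from the equivalences of braid and
  commutation relations.\<close>

theorem klr_from_hecke:
  assumes S: "subalg S" "\<And>z. z \<in> S ==> u * z = z \<and> z * u = z"
    "u \<in> S" "\<And>r. r \<in> {1..n} ==> x r \<in> S" "\<And>r. r \<in> {1..<n} ==> T r \<in> S" "\<And>i. i \<in> C ==> \<epsilon> i \<in> S"
  obtains y \<psi> where "\<And>r. r \<in> {1..n} ==> y r \<in> S" "\<And>r. r \<in> {1..<n} ==> \<psi> r \<in> S"
    "klr_y \<kappa> q e v n C u y \<psi> \<epsilon>"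
    "\<And>r i. r \<in> {1..n} ==> i \<in> C ==> x r * \<epsilon> i = (\<kappa> (v (i r)) + \<kappa> (w (i r)) * y r) * \<epsilon> i"
    "\<And>r i. r \<in> {1..<n} ==> i \<in> C ==> linked (T r) (\<psi> r) r i"
proof -
  have "\<exists>p\<in>S. linked (T r) p r i \<and> p * \<epsilon> i = p" if "r \<in> {1..<n}" "i \<in> C" for r i
    by (rule linked_exists(1)) (use that S in auto)
  then obtain p where p: "p r i \<in> S" "linked (T r) (p r i) r i" "p r i * \<epsilon> i = p r i"
    if "r \<in> {1..<n}" "i \<in> C" for r i by metis
  define \<psi> where "\<psi> r = (\<Sum>i\<in>C. p r i)" for r
  have \<psi>S: "\<psi> r \<in> S" if "r \<in> {1..<n}" for r
    unfolding \<psi>_def by (rule subalg_sum[OF S(1) subalg_zero[OF S(1,3)]]) (use p that in auto)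
  have link: "linked (T r) (\<psi> r) r i" if r: "r \<in> {1..<n}" and i: "i \<in> C" for r i
  proof -
    have "\<psi> r * \<epsilon> i = p r i * \<epsilon> i" unfolding \<psi>_def using sum_weights[of "p r" i] p r i by simp
    then show ?thesis using linked_cong[OF r i refl] p(2)[OF r i] by blast
  qed
  have "\<exists>y\<in>S. (\<forall>i\<in>C. x r * \<epsilon> i = (\<kappa> (v (i r)) + \<kappa> (w (i r)) * y) * \<epsilon> i) \<and> (\<forall>i\<in>C. y * \<epsilon> i = \<epsilon> i * y)"
    if "r \<in> {1..n}" for r
    using xy_variable[OF S(1,3,6) that S(4)[OF that]] by metis
  then have "\<forall>r. \<exists>y. r \<in> {1..n} \<longrightarrow> y \<in> S \<and>
      (\<forall>i\<in>C. x r * \<epsilon> i = (\<kappa> (v (i r)) + \<kappa> (w (i r)) * y) * \<epsilon> i) \<and> (\<forall>i\<in>C. y * \<epsilon> i = \<epsilon> i * y)" by blast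
  from choice[OF this] obtain y where y: "\<And>r. r \<in> {1..n} ==> y r \<in> S"
      "\<And>r i. r \<in> {1..n} ==> i \<in> C ==> x r * \<epsilon> i = (\<kappa> (v (i r)) + \<kappa> (w (i r)) * y r) * \<epsilon> i"
      "\<And>r i. r \<in> {1..n} ==> i \<in> C ==> y r * \<epsilon> i = \<epsilon> i * y r" by blast
  interpret L: hecke_link \<kappa> q e v n C u x \<epsilon> T \<psi>
    by unfold_locales (use link S \<psi>S in auto)
  interpret B: bk \<kappa> q e v n C u x \<epsilon> T \<psi>
    by unfold_locales (rule link)
  interpret XY: xy \<kappa> q e v n C u x \<epsilon> y \<psi>
    by unfold_locales (use y S \<psi>S L.klr.\<psi>_\<epsilon> in auto)
  have "klr_y \<kappa> q e v n C u y \<psi> \<epsilon>"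
  proof
    show "\<psi> r * y s * \<epsilon> i = (y (sigma r s) * \<psi> r + (if i r = i (Suc r) then partial r s else 0)) * \<epsilon> i"
      if r: "r \<in> {1..<n}" and s: "s \<in> {1..n}" and i: "i \<in> C" for r s i
    proof -
      let ?c = "if i r = i (Suc r) then partial r s else 0 :: 'a"
      have "\<kappa> ?c = (if i r = i (Suc r) then partial r s else 0)"
        by (simp add: partial_def \<kappa>_uminus)
      moreover have "\<psi> r * x s * \<epsilon> i = (x (sigma r s) * \<psi> r + \<kappa> (w (i s) * ?c)) * \<epsilon> i"
      proof (cases "i r = i (Suc r) \<and> (s = r \<or> s = Suc r)")
        case True
        then show ?thesis using L.klr.\<psi>_x1[OF r i] L.klr.\<psi>_x2[OF r i] by (auto simp: partial_def \<kappa>_uminus)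
      next
        case False
        then show ?thesis using L.klr.\<psi>_x3[OF r i s] by (auto simp: partial_def)
      qed
      ultimately show ?thesis using XY.\<psi>_y_iff[OF r s i, of ?c] by simp
    qed
    show "\<psi> r * \<psi> r * \<epsilon> i = klr_square y e i r * \<epsilon> i" if r: "r \<in> {1..<n}" and i: "i \<in> C" for r i
    proof (cases "i r = i (Suc r)")
      case True
      then show ?thesis using L.klr.\<psi>_\<psi>0[OF r i] by (simp add: klr_square_def)
    next
      case False
      then show ?thesis using XY.\<psi>_\<psi>_iff[OF r i False] L.klr.\<psi>_\<psi>1[OF r i False] by blast
    qed
    show "\<psi> r * \<psi> s = \<psi> s * \<psi> r" if "r \<in> {1..<n}" "s \<in> {1..<n}" "1 < \<bar>int r - int s\<bar>" for r s
      using B.far_commute_iff[OF that] T_comm[OF that] by blast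
    show "(\<psi> r * \<psi> (Suc r) * \<psi> r - \<psi> (Suc r) * \<psi> r * \<psi> (Suc r)) * \<epsilon> i = klr_defect y e i r * \<epsilon> i"
      if r: "1 \<le> r" "Suc r < n" and i: "i \<in> C" for r i
    proof -
      have rr: "r \<in> {1..<n}" "Suc r \<in> {1..<n}" using r by auto
      interpret B3: bk3 \<kappa> q e v n C u x \<epsilon> T \<psi> r "Suc r" "Suc (Suc r)" i
        by unfold_locales (use rr i in auto)
      have "B.DT r * \<epsilon> i = 0" using T_braid[OF r] by (simp add: B.DT_def)
      then have "B.DP r * \<epsilon> i = klr_defect y e i r * \<epsilon> i"
        using B3.braid_iff XY.defect_y[OF rr i] by simp
      then show ?thesis by (simp add: B.DP_def)
    qed
  qed (use C_finite C_tuples C_closed \<epsilon>_mult \<epsilon>_sum XY.y_u XY.u_y XY.\<psi>_u XY.u_\<psi> XY.y_\<epsilon> XY.y_y XY.\<psi>_\<epsilon> in auto)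
  then show ?thesis using that[of y \<psi>] y \<psi>S link by blast
qed

end

context klr_y
begin

text \<open>The same equivalences, read backwards: \<open>T r\<close> is defined weight by weight
  by solving the link.\<close>

theorem hecke_from_klr:
  assumes nil: "\<And>r i. r \<in> {1..n} ==> i \<in> C ==> nilp (y r) (\<epsilon> i)"
    and S: "subalg S" "\<And>z. z \<in> S ==> u * z = z \<and> z * u = z"
    "u \<in> S" "\<And>r. r \<in> {1..n} ==> y r \<in> S" "\<And>r. r \<in> {1..<n} ==> \<psi> r \<in> S" "\<And>i. i \<in> C ==> \<epsilon> i \<in> S"
  obtains x T where "\<And>r. r \<in> {1..n} ==> x r \<in> S" "\<And>r. r \<in> {1..<n} ==> T r \<in> S"
    "hecke_full \<kappa> q e v n C u x \<epsilon> T"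
    "\<And>r i. r \<in> {1..n} ==> i \<in> C ==> x r * \<epsilon> i = (\<kappa> (v (i r)) + \<kappa> (w (i r)) * y r) * \<epsilon> i"
    "\<And>r i. r \<in> {1..<n} ==> i \<in> C ==> orbit_system.linked \<kappa> q e v u x \<epsilon> (T r) (\<psi> r) r i"
proof -
  let ?f = "\<lambda>r i. (\<kappa> (v (i r)) + \<kappa> (w (i r)) * y r)"
  define x where "x r = (\<Sum>i\<in>C. ?f r i * \<epsilon> i)" for r
  have f\<epsilon>: "?f r i * \<epsilon> j = \<epsilon> j * ?f r i" if "r \<in> {1..n}" "j \<in> C" for r i j
    using y_\<epsilon>[OF that] by (simp add: distrib_left distrib_right mult.assoc \<kappa>_central[of "\<epsilon> j"] \<kappa>_mult_left[of "\<epsilon> j"])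
  have x\<epsilon>: "x r * \<epsilon> i = ?f r i * \<epsilon> i" if "r \<in> {1..n}" "i \<in> C" for r i
  proof -
    have "x r * \<epsilon> i = (\<Sum>j\<in>C. if j = i then ?f r i * \<epsilon> i else 0)"
      unfolding x_def sum_distrib_right by (rule sum.cong) (use that \<epsilon>_mult in \<open>auto simp: mult.assoc\<close>)
    then show ?thesis using that(2) C_finite by simp
  qed
  have \<epsilon>x: "\<epsilon> i * x r = ?f r i * \<epsilon> i" if "r \<in> {1..n}" "i \<in> C" for r i
  proof -
    have "\<epsilon> i * x r = (\<Sum>j\<in>C. if j = i then ?f r i * \<epsilon> i else 0)"
      unfolding x_def sum_distrib_left
    proof (rule sum.cong)
      fix j assume j: "j \<in> C"
      have "\<epsilon> i * (?f r j * \<epsilon> j) = ?f r j * (\<epsilon> i * \<epsilon> j)" using f\<epsilon>[OF that, of j] by (simp only: mult.assoc[symmetric])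
      then show "\<epsilon> i * (?f r j * \<epsilon> j) = (if j = i then ?f r i * \<epsilon> i else 0)" using \<epsilon>_mult[OF that(2) j] by auto
    qed simp
    then show ?thesis using that(2) C_finite by simp
  qed
  have xS: "x r \<in> S" if "r \<in> {1..n}" for r
    unfolding x_def
  proof (rule subalg_sum[OF S(1) subalg_zero[OF S(1,3)]])
    fix i assume i: "i \<in> C"
    have "?f r i * \<epsilon> i = \<kappa> (v (i r)) * \<epsilon> i + \<kappa> (w (i r)) * y r * \<epsilon> i" by (simp add: distrib_right)
    then show "?f r i * \<epsilon> i \<in> S" using S i that by (simp add: subalg_def)
  qed
  have eqC: "a = b" if "a \<in> S" "b \<in> S" "\<And>i. i \<in> C ==> a * \<epsilon> i = b * \<epsilon> i" for a b
  proof -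
    have "a * u = b * u" unfolding \<epsilon>_sum[symmetric] sum_distrib_left by (rule sum.cong) (auto simp: that)
    then show ?thesis using S(2) that by simp
  qed
  interpret O: orbit_system \<kappa> q e v n C u x \<epsilon>
  proof
    show "x r * x s = x s * x r" if rs: "r \<in> {1..n}" "s \<in> {1..n}" for r s
    proof (rule eqC)
      fix i assume i: "i \<in> C"
      have c: "?f r i * ?f s i = ?f s i * ?f r i"
        using y_y[OF rs] by (simp add: distrib_left distrib_right mult.assoc \<kappa>_mult_left[of "y r"] \<kappa>_mult_left[of "y s"]
            \<kappa>_central[of "y r"] \<kappa>_central[of "y s"] \<kappa>_mult_left[of "\<kappa> (w (i r))" "w (i s)"]
            \<kappa>_mult_left[of "\<kappa> (w (i r))" "v (i s)"] \<kappa>_mult_left[of "\<kappa> (v (i r))" "w (i s)"] \<kappa>_mult[symmetric] mult.commute[of "v (i r)"] add_ac)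
      have "x r * x s * \<epsilon> i = x r * \<epsilon> i * ?f s i" using x\<epsilon>[OF rs(2) i] f\<epsilon>[OF rs(2) i] by (metis mult.assoc)
      also have "\<dots> = ?f r i * ?f s i * \<epsilon> i" using x\<epsilon>[OF rs(1) i] f\<epsilon>[OF rs(2) i] by (metis mult.assoc)
      finally have 1: "x r * x s * \<epsilon> i = ?f r i * ?f s i * \<epsilon> i" .
      have "x s * x r * \<epsilon> i = x s * \<epsilon> i * ?f r i" using x\<epsilon>[OF rs(1) i] f\<epsilon>[OF rs(1) i] by (metis mult.assoc)
      also have "\<dots> = ?f s i * ?f r i * \<epsilon> i" using x\<epsilon>[OF rs(2) i] f\<epsilon>[OF rs(1) i] by (metis mult.assoc)
      finally show "x r * x s * \<epsilon> i = x s * x r * \<epsilon> i" using 1 c by simp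
    qed (use S xS rs in \<open>auto simp: subalg_def\<close>)
    show "nilp (x r - \<kappa> (v (i r))) (\<epsilon> i)" if "i \<in> C" "r \<in> {1..n}" for r i
    proof (rule nilp_cong[where b = "\<kappa> (w (i r)) * y r"])
      show "(x r - \<kappa> (v (i r))) * \<epsilon> i = \<kappa> (w (i r)) * y r * \<epsilon> i"
        using x\<epsilon>[OF that(2,1)] by (simp add: algebra_simps)
      show "\<kappa> (w (i r)) * y r * \<epsilon> i = \<epsilon> i * (\<kappa> (w (i r)) * y r)"
        using y_\<epsilon>[OF that(2,1)] by (simp add: mult.assoc \<kappa>_mult_left[of "\<epsilon> i"])
      show "nilp (\<kappa> (w (i r)) * y r) (\<epsilon> i)" by (rule nilp_\<kappa>[OF nil[OF that(2,1)]])
    qed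
  qed (use C_finite C_tuples \<epsilon>_mult \<epsilon>_sum C_closed S xS x\<epsilon> \<epsilon>x in auto)
  interpret XY: xy \<kappa> q e v n C u x \<epsilon> y \<psi>
    by unfold_locales (use y_u u_y \<psi>_u u_\<psi> y_\<epsilon> \<psi>_\<epsilon> x\<epsilon> in auto)
  have "\<exists>t\<in>S. O.linked t (\<psi> r) r i \<and> t * \<epsilon> i = t" if "r \<in> {1..<n}" "i \<in> C" for r i
    by (rule O.linked_exists(2)) (use that S xS in auto)
  then obtain t where t: "t r i \<in> S" "O.linked (t r i) (\<psi> r) r i" "t r i * \<epsilon> i = t r i"
    if "r \<in> {1..<n}" "i \<in> C" for r i by metis
  define T where "T r = (\<Sum>i\<in>C. t r i)" for r
  have TS: "T r \<in> S" if "r \<in> {1..<n}" for r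
    unfolding T_def by (rule subalg_sum[OF S(1) subalg_zero[OF S(1,3)]]) (use t that in auto)
  have link: "O.linked (T r) (\<psi> r) r i" if r: "r \<in> {1..<n}" and i: "i \<in> C" for r i
  proof -
    have "T r * \<epsilon> i = t r i * \<epsilon> i" unfolding T_def using O.sum_weights[of "t r" i] t r i by simp
    then show ?thesis using O.linked_cong[OF r i _ refl] t(2)[OF r i] by blast
  qed
  have c\<kappa>: "\<kappa> (if i r = i (Suc r) then partial r s else 0) = (if i r = i (Suc r) then partial r s else 0)" for i r s
    by (simp add: partial_def \<kappa>_uminus)
  have \<psi>x: "\<psi> r * x s * \<epsilon> i = (x (sigma r s) * \<psi> r + \<kappa> (w (i s) * (if i r = i (Suc r) then partial r s else 0))) * \<epsilon> i"
    if "r \<in> {1..<n}" "s \<in> {1..n}" "i \<in> C" for r s i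
    using XY.\<psi>_y_iff[OF that, of "if i r = i (Suc r) then partial r s else 0"] \<psi>_y[OF that]
    unfolding c\<kappa> by blast
  interpret L: klr_link \<kappa> q e v n C u x \<epsilon> \<psi> T
  proof
    show "\<psi> r * x r * \<epsilon> i = (x (Suc r) * \<psi> r - \<kappa> (w (i r))) * \<epsilon> i"
      if "r \<in> {1..<n}" "i \<in> C" "i r = i (Suc r)" for r i
      using \<psi>x[of r r i] that by (simp add: partial_def \<kappa>_uminus)
    show "\<psi> r * x (Suc r) * \<epsilon> i = (x r * \<psi> r + \<kappa> (w (i r))) * \<epsilon> i"
      if "r \<in> {1..<n}" "i \<in> C" "i r = i (Suc r)" for r i
      using \<psi>x[of r "Suc r" i] that by (simp add: partial_def)
    show "\<psi> r * x s * \<epsilon> i = x (sigma r s) * \<psi> r * \<epsilon> i"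
      if "r \<in> {1..<n}" "i \<in> C" "s \<in> {1..n}" "i r \<noteq> i (Suc r) \<or> s \<noteq> r \<and> s \<noteq> Suc r" for r s i
      using \<psi>x[of r s i] that by (auto simp: partial_def)
    show "\<psi> r * \<psi> r * \<epsilon> i = 0" if "r \<in> {1..<n}" "i \<in> C" "i r = i (Suc r)" for r i
      using \<psi>_\<psi>[OF that(1,2)] that(3) by (simp add: klr_square_def)
    show "\<psi> r * \<psi> r * (O.gg (i r) (i (Suc r)) r (Suc r) * O.gg (i (Suc r)) (i r) (Suc r) r) * \<epsilon> i
        = O.G r (Suc r) * O.G (Suc r) r * \<epsilon> i"
      if "r \<in> {1..<n}" "i \<in> C" "i r \<noteq> i (Suc r)" for r i
      using XY.\<psi>_\<psi>_iff[OF that] \<psi>_\<psi>[OF that(1,2)] by blast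
  qed (use \<psi>_u u_\<psi> \<psi>_\<epsilon> link TS S in auto)
  interpret B: bk \<kappa> q e v n C u x \<epsilon> T \<psi>
    by unfold_locales (rule link)
  have "hecke_full \<kappa> q e v n C u x \<epsilon> T"
  proof
    show "T r * T s = T s * T r" if "r \<in> {1..<n}" "s \<in> {1..<n}" "1 < \<bar>int r - int s\<bar>" for r s
      using B.far_commute_iff[OF that] \<psi>_comm[OF that] by blast
    show "T r * T (Suc r) * T r = T (Suc r) * T r * T (Suc r)" if r: "1 \<le> r" "Suc r < n" for r
    proof (rule eqC)
      have rr: "r \<in> {1..<n}" "Suc r \<in> {1..<n}" using r by auto
      show "T r * T (Suc r) * T r \<in> S" "T (Suc r) * T r * T (Suc r) \<in> S"
        using S(1) TS[OF rr(1)] TS[OF rr(2)] by (auto simp: subalg_def)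
      fix i assume i: "i \<in> C"
      interpret B3: bk3 \<kappa> q e v n C u x \<epsilon> T \<psi> r "Suc r" "Suc (Suc r)" i
        by unfold_locales (use rr i in auto)
      have "B.DP r * \<epsilon> i = klr_defect y e i r * \<epsilon> i" using \<psi>_braid[OF r i] by (simp add: B.DP_def)
      then have "B.DT r * \<epsilon> i = 0" using B3.braid_iff XY.defect_y[OF rr i] by simp
      then show "T r * T (Suc r) * T r * \<epsilon> i = T (Suc r) * T r * T (Suc r) * \<epsilon> i"
        by (simp add: B.DT_def left_diff_distrib)
    qed
  qed
  then show ?thesis using that[of x T] xS TS x\<epsilon> link by blast
qed

end

section \<open>Typed pictures of algebras\<close>
text \<open>An algebra together with a faithful image in a ring type.\<close>

locale embedded = kalg A for A :: "('k::field, 'a) module" (structure) +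
  fixes \<kappa> :: "'k \<Rightarrow> 'r::ring_1" and \<rho> :: "'a \<Rightarrow> 'r"
  assumes emb: "embeds \<kappa> A \<rho>"
begin

sublocale K: scalars \<kappa> using emb by (simp add: embeds_def)

lemma \<rho>_add: "a \<in> carrier A ==> b \<in> carrier A ==> \<rho> (a \<oplus> b) = \<rho> a + \<rho> b"
  and \<rho>_mult: "a \<in> carrier A ==> b \<in> carrier A ==> \<rho> (a \<otimes> b) = \<rho> a * \<rho> b"
  and \<rho>_smult: "a \<in> carrier A ==> \<rho> (c \<odot> a) = \<kappa> c * \<rho> a"
  and \<rho>_inj: "a \<in> carrier A ==> b \<in> carrier A ==> \<rho> a = \<rho> b \<longleftrightarrow> a = b"
  using emb by (auto simp: embeds_def inj_on_def)

lemma \<rho>_0 [simp]: "\<rho> \<zero> = 0"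
  using \<rho>_add[of \<zero> \<zero>] by simp

lemma \<rho>_minus: "a \<in> carrier A ==> b \<in> carrier A ==> \<rho> (a \<ominus> b) = \<rho> a - \<rho> b"
proof -
  assume a: "a \<in> carrier A" "b \<in> carrier A"
  have "\<rho> ((a \<ominus> b) \<oplus> b) = \<rho> (a \<ominus> b) + \<rho> b" using a by (intro \<rho>_add) auto
  moreover have "(a \<ominus> b) \<oplus> b = a" using a by (simp add: minus_eq a_assoc l_neg)
  ultimately show ?thesis by (simp add: algebra_simps)
qed

lemma \<rho>_unit: "z \<in> \<rho> ` carrier A ==> \<rho> \<one> * z = z \<and> z * \<rho> \<one> = z"
  using \<rho>_mult[of \<one>] \<rho>_mult[of _ \<one>] by (metis (no_types, lifting) imageE l_one one_closed r_one)

lemma \<rho>_pow: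
  assumes a: "a \<in> carrier A"
  shows "h \<in> carrier A ==> \<rho> (a [^] (m::nat) \<otimes> h) = \<rho> a ^ m * \<rho> h"
proof (induction m arbitrary: h)
  case (Suc m)
  have "a [^] Suc m \<otimes> h = a [^] m \<otimes> (a \<otimes> h)" using a Suc.prems by (simp add: m_assoc)
  then have "\<rho> (a [^] Suc m \<otimes> h) = \<rho> a ^ m * (\<rho> a * \<rho> h)"
    using a Suc.prems Suc.IH[of "a \<otimes> h"] by (simp add: \<rho>_mult)
  then show ?case by (simp only: power_Suc2 mult.assoc)
qed simp

lemma \<rho>_finsum:
  assumes "finite I" "\<And>i. i \<in> I ==> f i \<in> carrier A"
  shows "\<rho> (finsum A f I) = (\<Sum>i\<in>I. \<rho> (f i))"
  using assms by (induction I) (auto simp: \<rho>_add Pi_def)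

lemma \<rho>_subalg: "K.subalg (\<rho> ` carrier A)"
  unfolding K.subalg_def
  by (auto simp: \<rho>_add[symmetric] \<rho>_mult[symmetric] \<rho>_smult[symmetric])

lemma word_evalI:
  assumes "\<And>g. \<phi> g \<in> \<rho> ` carrier A"
  shows "word_eval \<kappa> (\<rho> \<one>) \<phi>"
  by unfold_locales (use assms \<rho>_unit in blast)+

end

context presentation
begin

lemma class_closed: "p \<in> words_in G ==> cyc_class G R S p \<in> carrier (cyc_alg G R S)"
  by (simp add: cyc_carrier)

lemma typed_class:
  assumes A: "embedded (cyc_alg G R S) \<kappa> \<rho>"
    and W: "word_eval \<kappa> (\<rho> \<one>\<^bsub>cyc_alg G R S\<^esub>) \<phi>"
    and \<phi>: "\<And>g. g \<in> G ==> \<phi> g = \<rho> (cyc_class G R S (gen g))" and p: "p \<in> words_in G"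
  shows "\<rho> (cyc_class G R S p) = word_eval.ev \<kappa> (\<rho> \<one>\<^bsub>cyc_alg G R S\<^esub>) \<phi> p"
proof -
  interpret A: embedded "cyc_alg G R S" \<kappa> \<rho> by (rule A)
  interpret W: word_eval \<kappa> "\<rho> \<one>\<^bsub>cyc_alg G R S\<^esub>" \<phi> by (rule W)
  note D = alg_homD[OF cyc_hom, unfolded carrier_free_alg free_alg_simps]
  show ?thesis using p
  proof (induction rule: free_alg_induct[case_names gen one add mult smult])
    case (smult a c)
    have "\<rho> (cyc_class G R S (scal c * a)) = \<kappa> c * W.ev a"
      using D(5)[OF smult(1)] smult D(1) A.\<rho>_smult by simp
    also have "\<dots> = W.ev (scal c * a)"
      by (simp only: W.ev_mult W.ev_scal mult.assoc W.ev_u)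
    finally show ?case .
  qed (use D in \<open>simp_all add: \<phi> W.ev_simps A.\<rho>_add A.\<rho>_mult\<close>)
qed

lemma typed_relations:
  assumes A: "embedded (cyc_alg G R S) \<kappa> \<rho>"
  defines "\<phi> \<equiv> \<lambda>g. if g \<in> G then \<rho> (cyc_class G R S (gen g)) else 0"
  shows "word_eval \<kappa> (\<rho> \<one>\<^bsub>cyc_alg G R S\<^esub>) \<phi>"
    and "\<phi> g \<in> \<rho> ` carrier (cyc_alg G R S)"
    and "R l r ==> word_eval.ev \<kappa> (\<rho> \<one>\<^bsub>cyc_alg G R S\<^esub>) \<phi> l = word_eval.ev \<kappa> (\<rho> \<one>\<^bsub>cyc_alg G R S\<^esub>) \<phi> r"
    and "s \<in> S ==> word_eval.ev \<kappa> (\<rho> \<one>\<^bsub>cyc_alg G R S\<^esub>) \<phi> s = 0"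
proof -
  interpret A: embedded "cyc_alg G R S" \<kappa> \<rho> by (rule A)
  show in_im: "\<phi> g \<in> \<rho> ` carrier (cyc_alg G R S)" for g
    using class_closed[OF words_in_gen] imageI[OF A.zero_closed, of \<rho>] by (simp add: \<phi>_def)
  show W: "word_eval \<kappa> (\<rho> \<one>\<^bsub>cyc_alg G R S\<^esub>) \<phi>" by (rule A.word_evalI[OF in_im])
  note c = typed_class[OF A W]
  show "R l r ==> word_eval.ev \<kappa> (\<rho> \<one>\<^bsub>cyc_alg G R S\<^esub>) \<phi> l = word_eval.ev \<kappa> (\<rho> \<one>\<^bsub>cyc_alg G R S\<^esub>) \<phi> r"
    using c[of l] c[of r] R_closed cyc_rel by (simp add: \<phi>_def)
  show "s \<in> S ==> word_eval.ev \<kappa> (\<rho> \<one>\<^bsub>cyc_alg G R S\<^esub>) \<phi> s = 0"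
    using c[of s] S_closed cyc_zero A.\<rho>_0 by (auto simp: \<phi>_def)
qed

text \<open>To define a homomorphism from a presented algebra into an embedded one it suffices to
  check the relations in the ring type.\<close>

lemma typed_lift:
  assumes B: "embedded B \<kappa> \<rho>" and \<phi>: "\<And>g. \<phi> g \<in> \<rho> ` carrier B"
    and rel: "\<And>l r. R l r ==> word_eval.ev \<kappa> (\<rho> \<one>\<^bsub>B\<^esub>) \<phi> l = word_eval.ev \<kappa> (\<rho> \<one>\<^bsub>B\<^esub>) \<phi> r"
    and zero: "\<And>s. s \<in> S ==> word_eval.ev \<kappa> (\<rho> \<one>\<^bsub>B\<^esub>) \<phi> s = 0"
  obtains h where "alg_hom (cyc_alg G R S) B h"
    "\<And>p. p \<in> words_in G ==> \<rho> (h (cyc_class G R S p)) = word_eval.ev \<kappa> (\<rho> \<one>\<^bsub>B\<^esub>) \<phi> p"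
proof -
  interpret B: embedded B \<kappa> \<rho> by (rule B)
  interpret W: word_eval \<kappa> "\<rho> \<one>\<^bsub>B\<^esub>" \<phi> by (rule B.word_evalI[OF \<phi>])
  have im: "W.ev p \<in> \<rho> ` carrier B" if "p \<in> words_in G" for p
    using that
  proof (induction rule: free_alg_induct[case_names gen one add mult smult])
    case (smult a c)
    have "W.ev (scal c * a) = \<kappa> c * W.ev a"
      by (simp only: W.ev_mult W.ev_scal mult.assoc W.ev_u)
    then show ?case using smult(2) B.\<rho>_subalg unfolding B.K.subalg_def by metis
  qed (use \<phi> B.\<rho>_subalg in \<open>auto simp: W.ev_simps B.K.subalg_def\<close>)
  define h where "h p = inv_into (carrier B) \<rho> (W.ev p)" for p
  have h: "\<rho> (h p) = W.ev p" "h p \<in> carrier B" if "p \<in> words_in G" for p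
    unfolding h_def using im[OF that] by (auto intro: f_inv_into_f inv_into_into)
  have eqI: "a = b" if "a \<in> carrier B" "b \<in> carrier B" "\<rho> a = \<rho> b" for a b
    using that B.\<rho>_inj by blast
  have "alg_hom (free_alg G) B h"
  proof (rule alg_homI; unfold carrier_free_alg free_alg_simps)
    show "h (scal c * x) = c \<odot>\<^bsub>B\<^esub> h x" if x: "x \<in> words_in G" for c x
    proof -
      have sx: "scal c * x \<in> words_in G" using x by (intro words_in_intros)
      show ?thesis
      proof (rule eqI)
      have "W.ev (scal c * x) = \<kappa> c * W.ev x"
        by (simp only: W.ev_mult W.ev_scal mult.assoc W.ev_u)
      then show "\<rho> (h (scal c * x)) = \<rho> (c \<odot>\<^bsub>B\<^esub> h x)"
        using h(1)[OF sx] h[OF x] B.\<rho>_smult by simp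
      qed (use h(2)[OF sx] h(2)[OF x] in auto)
    qed
    show "h 1 = \<one>\<^bsub>B\<^esub>"
      by (rule eqI) (use h[OF words_in_1] in \<open>auto simp: W.ev_1\<close>)
    show "h (x * y) = h x \<otimes>\<^bsub>B\<^esub> h y" if "x \<in> words_in G" "y \<in> words_in G" for x y
      by (rule eqI) (use h[OF words_in_mult[OF that]] h[OF that(1)] h[OF that(2)] in \<open>auto simp: W.ev_mult B.\<rho>_mult\<close>)
    show "h (x + y) = h x \<oplus>\<^bsub>B\<^esub> h y" if "x \<in> words_in G" "y \<in> words_in G" for x y
      by (rule eqI) (use h[OF words_in_add[OF that]] h[OF that(1)] h[OF that(2)] in \<open>auto simp: W.ev_add B.\<rho>_add\<close>)
  qed (use h in auto)
  moreover have "h l = h r" if "R l r" for l r by (simp add: h_def rel[OF that])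
  moreover have "h s = \<zero>\<^bsub>B\<^esub>" if "s \<in> S" for s
    by (rule eqI) (use h[of s] zero[OF that] that S_closed in auto)
  ultimately obtain h' where "alg_hom (cyc_alg G R S) B h'"
      "\<And>p. p \<in> words_in G ==> h' (cyc_class G R S p) = h p"
    using cyc_lift[OF B.kalg_axioms, of h] by metis
  then show ?thesis using that h by simp
qed

end

text \<open>An algebra homomorphism between two embedded algebras, seen between their images. It
  is defined on a subset because it need not extend to the ambient ring.\<close>

locale typed_hom = K1: scalars \<kappa>1 + K2: scalars \<kappa>2
  for \<kappa>1 :: "'k::field \<Rightarrow> 'r::ring_1" and \<kappa>2 :: "'k \<Rightarrow> 's::ring_1" +
  fixes S :: "'r set" and \<tau> :: "'r \<Rightarrow> 's"
  assumes S: "K1.subalg S" "0 \<in> S"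
    and \<tau>_add: "a \<in> S ==> b \<in> S ==> \<tau> (a + b) = \<tau> a + \<tau> b"
    and \<tau>_mult: "a \<in> S ==> b \<in> S ==> \<tau> (a * b) = \<tau> a * \<tau> b"
    and \<tau>_smult: "a \<in> S ==> \<tau> (\<kappa>1 c * a) = \<kappa>2 c * \<tau> a"
begin

lemma S_closed: "a \<in> S ==> b \<in> S ==> a + b \<in> S" "a \<in> S ==> b \<in> S ==> a * b \<in> S"
  "a \<in> S ==> b \<in> S ==> a - b \<in> S" "a \<in> S ==> - a \<in> S" "a \<in> S ==> \<kappa>1 c * a \<in> S"
  using S K1.subalg_minus K1.subalg_uminus by (auto simp: K1.subalg_def)

lemma \<tau>_0: "\<tau> 0 = 0" using \<tau>_add[OF S(2,2)] by simp

lemma \<tau>_uminus: "a \<in> S ==> \<tau> (- a) = - \<tau> a"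
  using \<tau>_smult[of a "- 1"] by (simp add: K1.\<kappa>_uminus K2.\<kappa>_uminus)

lemma \<tau>_minus: "a \<in> S ==> b \<in> S ==> \<tau> (a - b) = \<tau> a - \<tau> b"
  using \<tau>_add[of a "- b"] by (simp add: \<tau>_uminus S_closed)

lemma \<tau>_sum: "(\<And>i. i \<in> I ==> f i \<in> S) ==> \<tau> (sum f I) = (\<Sum>i\<in>I. \<tau> (f i))"
proof (induction I rule: infinite_finite_induct)
  case (insert i I)
  have "sum f I \<in> S" by (rule K1.subalg_sum[OF S]) (use insert in auto)
  then show ?case using insert by (simp add: \<tau>_add)
qed (simp_all add: \<tau>_0)

lemma \<tau>_pow: "a \<in> S ==> z \<in> S ==> a ^ m * z \<in> S \<and> \<tau> (a ^ m * z) = \<tau> a ^ m * \<tau> z"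
proof (induction m)
  case (Suc m)
  have e: "a ^ Suc m * z = a * (a ^ m * z)" by (simp add: mult.assoc)
  show ?case unfolding e using Suc by (simp add: S_closed \<tau>_mult mult.assoc)
qed simp

lemmas \<tau>_simps = \<tau>_add \<tau>_mult \<tau>_smult \<tau>_minus \<tau>_uminus \<tau>_0 S_closed

end

lemma typed_homI:
  assumes "embedded A \<kappa>1 \<rho>1" "embedded B \<kappa>2 \<rho>2" "alg_hom A B h"
  obtains \<tau> where "typed_hom \<kappa>1 \<kappa>2 (\<rho>1 ` carrier A) \<tau>" "\<And>a. a \<in> carrier A ==> \<tau> (\<rho>1 a) = \<rho>2 (h a)"
proof -
  interpret A: embedded A \<kappa>1 \<rho>1 by fact
  interpret B: embedded B \<kappa>2 \<rho>2 by fact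
  note D = alg_homD[OF assms(3)]
  define \<tau> where "\<tau> z = \<rho>2 (h (inv_into (carrier A) \<rho>1 z))" for z
  have "inj_on \<rho>1 (carrier A)" using A.emb by (simp add: embeds_def)
  then have \<tau>: "\<tau> (\<rho>1 a) = \<rho>2 (h a)" if "a \<in> carrier A" for a
    using that by (simp add: \<tau>_def)
  have z: "\<And>a. a \<in> carrier A ==> \<exists>b\<in>carrier A. \<rho>1 a = \<rho>1 b \<and> \<tau> (\<rho>1 a) = \<rho>2 (h b)" using \<tau> by blast
  have "typed_hom \<kappa>1 \<kappa>2 (\<rho>1 ` carrier A) \<tau>"
  proof
    show "A.K.subalg (\<rho>1 ` carrier A)" by (rule A.\<rho>_subalg)
    show "0 \<in> \<rho>1 ` carrier A" using A.\<rho>_0 A.zero_closed by (metis imageI)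
  next
    fix a b assume "a \<in> \<rho>1 ` carrier A" "b \<in> \<rho>1 ` carrier A"
    then obtain a' b' where ab: "a = \<rho>1 a'" "b = \<rho>1 b'" "a' \<in> carrier A" "b' \<in> carrier A" by blast
    show "\<tau> (a + b) = \<tau> a + \<tau> b"
      using ab \<tau>[of "a' \<oplus>\<^bsub>A\<^esub> b'"] D by (simp add: \<tau> A.\<rho>_add B.\<rho>_add)
    show "\<tau> (a * b) = \<tau> a * \<tau> b"
      using ab \<tau>[of "a' \<otimes>\<^bsub>A\<^esub> b'"] D by (simp add: \<tau> A.\<rho>_mult B.\<rho>_mult)
  next
    fix a c assume "a \<in> \<rho>1 ` carrier A"
    then obtain a' where ab: "a = \<rho>1 a'" "a' \<in> carrier A" by blast
    show "\<tau> (\<kappa>1 c * a) = \<kappa>2 c * \<tau> a"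
      using ab \<tau>[of "c \<odot>\<^bsub>A\<^esub> a'"] D by (simp add: \<tau> A.\<rho>_smult B.\<rho>_smult)
  qed
  then show ?thesis using that \<tau> by blast
qed

lemma embedded_exists:
  fixes A :: "('k::field, 'a) module"
  assumes "kalg A"
  obtains \<rho> :: "'a \<Rightarrow> ('a, 'k) lin_end" where "embedded A homothety \<rho>"
  using kalg.embedding[OF assms] assms by (metis embedded.intro embedded_axioms.intro)

section \<open>The defining relations in a typed ring\<close>

context word_eval
begin

lemma ev_if: "ev (if c then p else p') = (if c then ev p else ev p')" by simp

lemma ev_partial: "ev (partial r s) = partial r s * u"
  by (simp add: partial_def ev_simps)

text \<open>The abstract relations say the same as their typed form; \<open>u\<close> is the image
  of the empty word.\<close>

lemma klr_rel_iff:
  fixes \<phi>' and y \<psi> :: "nat \<Rightarrow> 'r" and \<epsilon> :: "(nat \<Rightarrow> int) \<Rightarrow> 'r"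
  assumes W: "word_eval \<kappa> u \<phi>'" and "quantum q e v"
    and C: "finite C" "C \<subseteq> tuples n e" "\<And>r i. r \<in> {1..<n} ==> i \<in> C ==> perm_act (sigma r) i \<in> C"
    and g: "\<And>r. r \<in> {1..n} ==> \<phi>' (Y r) = y r" "\<And>r. r \<in> {1..<n} ==> \<phi>' (Psi r) = \<psi> r"
      "\<And>i. i \<in> C ==> \<phi>' (Eps i) = \<epsilon> i"
  shows "(\<forall>l r. klr_rel n e C l r \<longrightarrow> word_eval.ev \<kappa> u \<phi>' l = word_eval.ev \<kappa> u \<phi>' r)
    \<longleftrightarrow> klr_y \<kappa> q e v n C u y \<psi> \<epsilon>" (is "?R \<longleftrightarrow> ?K")
proof -
  interpret W: word_eval \<kappa> u \<phi>' by (rule W)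
  interpret quantum q e v by fact
  have u: "u * \<epsilon> i = \<epsilon> i" "\<epsilon> i * u = \<epsilon> i" if "i \<in> C" for i
    using W.u_left[of "Eps i"] W.u_right[of "Eps i"] that by (simp_all add: g)
  have s: "r + 1 = Suc r" "r + 2 = Suc (Suc r)" for r :: nat by simp_all
  have sq: "W.ev (psi_square e i r) * \<epsilon> i = klr_square y e i r * \<epsilon> i" if "r \<in> {1..<n}" "i \<in> C" for r i
  proof -
    have "W.ev (if P then 0 else if Q then yg r - yg (Suc r) else if Q' then yg (Suc r) - yg r
        else if Q'' then - ((yg r - yg (Suc r)) ^ 2) else 1) * \<epsilon> i
      = (if P then 0 else if Q then y r - y (Suc r) else if Q' then y (Suc r) - y r
        else if Q'' then - ((y r - y (Suc r)) * (y r - y (Suc r))) else 1) * \<epsilon> i" for P Q Q' Q''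
      using that by (simp add: W.ev_simps g u power2_eq_square)
    then show ?thesis unfolding psi_square_def klr_square_def s .
  qed
  have def: "W.ev (braid_defect e i r) * \<epsilon> i = klr_defect y e i r * \<epsilon> i" if "1 \<le> r" "Suc r < n" "i \<in> C" for r i
  proof -
    have "W.ev (if Q then - 1 else if Q' then 1 else if Q'' then yg r + yg (Suc (Suc r)) - 2 * yg (Suc r) else 0) * \<epsilon> i
      = (if Q then - 1 else if Q' then 1 else if Q'' then y r + y (Suc (Suc r)) - 2 * y (Suc r) else 0) * \<epsilon> i"
      for Q Q' Q'' using that
      by (simp add: mult_2 W.ev_add W.ev_minus W.ev_uminus W.ev_gen W.ev_1 g u)
    then show ?thesis unfolding braid_defect_def klr_defect_def s .
  qed
  have sg: "sigma r s \<in> {1..n}" if "r \<in> {1..<n}" "s \<in> {1..n}" for r s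
    using that by (auto simp: transpose_def)
  have py: "W.ev ((yg (sigma r s) * psig r + (if c then partial r s else 0)) * epsg i)
      = (y (sigma r s) * \<psi> r + (if c then partial r s else 0)) * \<epsilon> i"
    if "r \<in> {1..<n}" "s \<in> {1..n}" "i \<in> C" for r s i c
    using sg[OF that(1,2)] that
    by (simp add: W.ev_mult W.ev_add W.ev_if W.ev_gen W.ev_partial g distrib_right mult.assoc u)
  show ?thesis
  proof
    assume K: ?K
    interpret klr_y \<kappa> q e v n C u y \<psi> \<epsilon> by (rule K)
    show ?R
    proof (intro allI impI)
      fix l r :: "'k klr_free" assume "klr_rel n e C l r"
      then show "W.ev l = W.ev r"
      proof cases
        case (eps_eps i j) then show ?thesis by (simp add: W.ev_mult W.ev_gen W.ev_if g \<epsilon>_mult)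
      next
        case eps_sum then show ?thesis by (simp add: W.ev_simps g \<epsilon>_sum)
      next
        case (y_eps r i) then show ?thesis by (simp add: W.ev_mult W.ev_gen g y_\<epsilon>)
      next
        case (y_y r s) then show ?thesis by (simp add: W.ev_mult W.ev_gen g klr_y.y_y[OF K])
      next
        case (psi_eps r i)
        then show ?thesis using C_closed[of r i] by (simp add: W.ev_mult W.ev_gen g \<psi>_\<epsilon>)
      next
        case (psi_y r s i)
        then show ?thesis using py[OF psi_y(3-5)] \<psi>_y[OF psi_y(3-5)] by (simp add: W.ev_mult W.ev_gen g)
      next
        case (psi_psi r i)
        then show ?thesis using \<psi>_\<psi>[OF psi_psi(3,4)] sq[OF psi_psi(3,4)]
          by (simp add: W.ev_mult W.ev_gen g power2_eq_square)
      next
        case (psi_comm r s) then show ?thesis using \<psi>_comm[of r s] by (simp add: W.ev_mult W.ev_gen g)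
      next
        case (psi_braid r i)
        then show ?thesis using \<psi>_braid[of r i] def[of r i] by (simp add: W.ev_mult W.ev_minus W.ev_gen g)
      qed
    qed
  next
    assume R: ?R
    then have rel: "klr_rel n e C l r ==> W.ev l = W.ev r" for l r :: "'k klr_free" by blast
    show ?K
    proof
      show "\<epsilon> i * \<epsilon> j = (if i = j then \<epsilon> i else 0)" if "i \<in> C" "j \<in> C" for i j
        using rel[OF klr_rel.eps_eps[OF that]] that by (simp add: W.ev_mult W.ev_gen W.ev_if g)
      show "(\<Sum>i\<in>C. \<epsilon> i) = u" using rel[OF klr_rel.eps_sum] by (simp add: W.ev_simps g)
      show "y r * u = y r" "u * y r = y r" if "r \<in> {1..n}" for r
        using W.u_left[of "Y r"] W.u_right[of "Y r"] that by (simp_all add: g)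
      show "\<psi> r * u = \<psi> r" "u * \<psi> r = \<psi> r" if "r \<in> {1..<n}" for r
        using W.u_left[of "Psi r"] W.u_right[of "Psi r"] that by (simp_all add: g)
      show "y r * \<epsilon> i = \<epsilon> i * y r" if "r \<in> {1..n}" "i \<in> C" for r i
        using rel[OF klr_rel.y_eps[OF that]] that by (simp add: W.ev_mult W.ev_gen g)
      show "y r * y s = y s * y r" if "r \<in> {1..n}" "s \<in> {1..n}" for r s
        using rel[OF klr_rel.y_y[OF that]] that by (simp add: W.ev_mult W.ev_gen g)
      show "\<psi> r * \<epsilon> i = \<epsilon> (perm_act (sigma r) i) * \<psi> r" if "r \<in> {1..<n}" "i \<in> C" for r i
        using rel[OF klr_rel.psi_eps[OF that]] C(3)[OF that] that by (simp add: W.ev_mult W.ev_gen g)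
      show "\<psi> r * y s * \<epsilon> i = (y (sigma r s) * \<psi> r + (if i r = i (Suc r) then partial r s else 0)) * \<epsilon> i"
        if "r \<in> {1..<n}" "s \<in> {1..n}" "i \<in> C" for r s i
        using rel[OF klr_rel.psi_y[OF that]] py[OF that, of "i r = i (Suc r)"] that by (simp add: W.ev_mult W.ev_gen g)
      show "\<psi> r * \<psi> r * \<epsilon> i = klr_square y e i r * \<epsilon> i" if "r \<in> {1..<n}" "i \<in> C" for r i
        using rel[OF klr_rel.psi_psi[OF that]] sq[OF that] that by (simp add: W.ev_mult W.ev_gen g power2_eq_square)
      show "\<psi> r * \<psi> s = \<psi> s * \<psi> r" if "r \<in> {1..<n}" "s \<in> {1..<n}" "1 < \<bar>int r - int s\<bar>" for r s
        using rel[OF klr_rel.psi_comm[OF that]] that by (simp add: W.ev_mult W.ev_gen g)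
      show "(\<psi> r * \<psi> (Suc r) * \<psi> r - \<psi> (Suc r) * \<psi> r * \<psi> (Suc r)) * \<epsilon> i = klr_defect y e i r * \<epsilon> i"
        if "1 \<le> r" "Suc r < n" "i \<in> C" for r i
      proof -
        have "klr_rel n e C ((psig r * psig (r + 1) * psig r - psig (r + 1) * psig r * psig (r + 1)) * epsg i)
            (braid_defect e i r * epsg i)" by (rule klr_rel.psi_braid) (use that in auto)
        from rel[OF this] show ?thesis
          using def[OF that] that by (simp add: W.ev_mult W.ev_minus W.ev_gen g)
      qed
    qed (use C in auto)
  qed
qed

end

text \<open>The relations of both affine Hecke algebras in the common variables \<open>x\<close>;
  for \<open>q = 1\<close> they are those of the degenerate algebra.\<close>

definition hecke_relations :: "('k::field \<Rightarrow> 'r::ring_1) \<Rightarrow> 'k \<Rightarrow> nat \<Rightarrow> 'r \<Rightarrow> (nat \<Rightarrow> 'r) \<Rightarrow> (nat \<Rightarrow> 'r) \<Rightarrow> bool" where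
  "hecke_relations \<kappa> q n u x T \<longleftrightarrow>
    (\<forall>r\<in>{1..n}. \<forall>s\<in>{1..n}. x r * x s = x s * x r) \<and>
    (\<forall>r\<in>{1..<n}. \<forall>s\<in>{1..n}.
       T r * x s = x (sigma r s) * T r + (u + \<kappa> (q - 1) * x (Suc r)) * partial r s) \<and>
    (\<forall>r\<in>{1..<n}. T r * T r = \<kappa> (q - 1) * T r + \<kappa> q * u) \<and>
    (\<forall>r\<in>{1..<n}. \<forall>s\<in>{1..<n}. \<bar>int r - int s\<bar> > 1 \<longrightarrow> T r * T s = T s * T r) \<and>
    (\<forall>r. 1 \<le> r \<and> Suc r < n \<longrightarrow> T r * T (Suc r) * T r = T (Suc r) * T r * T (Suc r))"

lemma (in weight_system) hecke_rep_of_relations: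
  assumes "hecke_relations \<kappa> q n u x T"
    and "\<And>r. r \<in> {1..<n} ==> T r * u = T r" "\<And>r. r \<in> {1..<n} ==> u * T r = T r"
  shows "hecke_rep \<kappa> q e v n C u x \<epsilon> T"
proof
  have Tx: "T r * x s = x (sigma r s) * T r + (u + \<kappa> (q - 1) * x (Suc r)) * partial r s"
    if "r \<in> {1..<n}" "s \<in> {1..n}" for r s using assms(1) that unfolding hecke_relations_def by blast
  show "T r * x r = x (Suc r) * T r - h (Suc r)" if "r \<in> {1..<n}" for r
    using Tx[OF that, of r] that by (simp add: partial_def h_def)
  show "T r * x (Suc r) = x r * T r + h (Suc r)" if "r \<in> {1..<n}" for r
    using Tx[OF that, of "Suc r"] that by (simp add: partial_def h_def)
  show "T r * x s = x s * T r" if "r \<in> {1..<n}" "s \<in> {1..n}" "s \<noteq> r" "s \<noteq> Suc r" for r s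
    using Tx[OF that(1,2)] that by (simp add: partial_def transpose_def)
  show "T r * T r = \<kappa> (q - 1) * T r + \<kappa> q * u" if "r \<in> {1..<n}" for r
    using assms(1) that unfolding hecke_relations_def by blast
qed (use assms in auto)

lemma (in hecke_full) relations: "hecke_relations \<kappa> q n u x T"
proof -
  have "T r * x s = x (sigma r s) * T r + (u + \<kappa> (q - 1) * x (Suc r)) * partial r s"
    if "r \<in> {1..<n}" "s \<in> {1..n}" for r s
    using T_x1[OF that(1)] T_x2[OF that(1)] T_x3[OF that]
    by (cases "s = r"; cases "s = Suc r") (auto simp: partial_def h_def transpose_def)
  then show ?thesis using x_x T_T T_comm T_braid unfolding hecke_relations_def by blast
qed

lemma (in orbit_system) hecke_full_of_relations:
  assumes "hecke_relations \<kappa> q n u x T"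
    and "\<And>r. r \<in> {1..<n} ==> T r * u = T r" "\<And>r. r \<in> {1..<n} ==> u * T r = T r"
  shows "hecke_full \<kappa> q e v n C u x \<epsilon> T"
proof -
  interpret hecke_rep \<kappa> q e v n C u x \<epsilon> T by (rule hecke_rep_of_relations[OF assms])
  show ?thesis
    by unfold_locales (use assms(1) in \<open>auto simp: hecke_relations_def\<close>)
qed

lemma inverse_unique:
  assumes "g * f = u" "f * g' = u" "u * g' = g'" "g * u = (g::'r::ring_1)"
  shows "g = g'"
  by (metis assms mult.assoc)

lemma inverse_commute:
  assumes "g * f = u" "f * g = u" "a * f = f * a" "u * a = a" "a * u = (a::'r::ring_1)" "g * u = g" "u * g = g"
  shows "g * a = a * g"
proof -
  have "g * a = g * (a * (f * g))" using assms by simp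
  also have "\<dots> = g * f * a * g" using assms(3) by (metis mult.assoc)
  finally show ?thesis using assms by simp
qed

text \<open>\<open>X r = a x r + b\<close>: the generators \<open>X r\<close> of the degenerate (\<open>a = 1\<close>, \<open>b = 0\<close>) and of the
  non-degenerate (\<open>a = q - 1\<close>, \<open>b = 1\<close>) affine Hecke algebra in terms of the common variables.\<close>

definition hecke_data :: "'k::field \<Rightarrow> 'k \<Rightarrow> 'k \<Rightarrow> nat \<Rightarrow> hecke_gen set \<Rightarrow> ('k hecke_free \<Rightarrow> 'k hecke_free \<Rightarrow> bool) \<Rightarrow> bool" where
  "hecke_data q a b n G R \<longleftrightarrow>
    q = 1 \<and> a = 1 \<and> b = 0 \<and> G = deg_hecke_gens n \<and> R = deg_hecke_rel n \<or>
    q \<noteq> 1 \<and> a = q - 1 \<and> b = 1 \<and> G = hecke_gens n \<and> R = hecke_rel q n"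

context word_eval
begin

lemma deg_hecke_rel_iff:
  fixes \<phi>' and x T :: "nat \<Rightarrow> 'r"
  assumes W: "word_eval \<kappa> u \<phi>'"
    and g: "\<And>r. r \<in> {1..n} ==> \<phi>' (GX r) = x r" "\<And>r. r \<in> {1..<n} ==> \<phi>' (GT r) = T r"
  shows "(\<forall>l r. deg_hecke_rel n l r \<longrightarrow> word_eval.ev \<kappa> u \<phi>' l = word_eval.ev \<kappa> u \<phi>' r)
    \<longleftrightarrow> hecke_relations \<kappa> 1 n u x T" (is "?R \<longleftrightarrow> ?K")
proof -
  interpret W: word_eval \<kappa> u \<phi>' by (rule W)
  have sg: "sigma r s \<in> {1..n}" if "r \<in> {1..<n}" "s \<in> {1..n}" for r s
    using that by (auto simp: transpose_def)
  have up: "u * partial r s = partial r s * u" for r s by (simp add: partial_def)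
  show ?thesis
  proof
    assume K: ?K
    show ?R
    proof (intro allI impI)
      fix l r :: "'k hecke_free" assume "deg_hecke_rel n l r"
      then show "W.ev l = W.ev r"
      proof cases
        case (T_X r s)
        then show ?thesis using K sg[of r s]
          by (simp add: hecke_relations_def W.ev_mult W.ev_add W.ev_gen W.ev_partial g up)
      qed (use K in \<open>auto simp: hecke_relations_def W.ev_mult W.ev_gen W.ev_1 g power2_eq_square\<close>)
    qed
  next
    assume R: ?R
    then have rel: "deg_hecke_rel n l r ==> W.ev l = W.ev r" for l r :: "'k hecke_free" by blast
    have "x r * x s = x s * x r" if "r \<in> {1..n}" "s \<in> {1..n}" for r s
      using rel[OF deg_hecke_rel.X_X[OF that]] that by (simp add: W.ev_mult W.ev_gen g)
    moreover have "T r * x s = x (sigma r s) * T r + (u + \<kappa> (1 - 1) * x (Suc r)) * partial r s"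
      if "r \<in> {1..<n}" "s \<in> {1..n}" for r s
      using rel[OF deg_hecke_rel.T_X[OF that]] that sg[OF that]
      by (simp add: W.ev_mult W.ev_add W.ev_gen W.ev_partial g up)
    moreover have "T r * T r = \<kappa> (1 - 1) * T r + \<kappa> 1 * u" if "r \<in> {1..<n}" for r
      using rel[OF deg_hecke_rel.T_T[OF that]] that by (simp add: W.ev_mult W.ev_gen W.ev_1 g power2_eq_square)
    moreover have "T r * T s = T s * T r" if "r \<in> {1..<n}" "s \<in> {1..<n}" "1 < \<bar>int r - int s\<bar>" for r s
      using rel[OF deg_hecke_rel.T_comm[OF that]] that by (simp add: W.ev_mult W.ev_gen g)
    moreover have "T r * T (Suc r) * T r = T (Suc r) * T r * T (Suc r)" if "1 \<le> r" "Suc r < n" for r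
      using rel[OF deg_hecke_rel.T_braid[of r n]] that by (simp add: W.ev_mult W.ev_gen g)
    ultimately show ?K unfolding hecke_relations_def by blast
  qed
qed

text \<open>Substituting \<open>X = (q - 1) x + u\<close>, every relation becomes a multiple of
  its counterpart for \<open>x\<close> by the invertible scalar \<open>q - 1\<close>.\<close>

lemma hecke_rel_iff:
  fixes \<phi>' and x T :: "nat \<Rightarrow> 'r"
  assumes W: "word_eval \<kappa> u \<phi>'" and q: "q \<noteq> 1"
    and g: "\<And>r. r \<in> {1..n} ==> \<phi>' (GX r) = \<kappa> (q - 1) * x r + u" "\<And>r. r \<in> {1..<n} ==> \<phi>' (GT r) = T r"
    and ux: "\<And>r. r \<in> {1..n} ==> u * x r = x r \<and> x r * u = x r"
  shows "(\<forall>l r. hecke_rel q n l r \<longrightarrow> word_eval.ev \<kappa> u \<phi>' l = word_eval.ev \<kappa> u \<phi>' r)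
    \<longleftrightarrow> hecke_relations \<kappa> q n u x T \<and>
      (\<forall>r\<in>{1..n}. \<phi>' (GX r) * \<phi>' (GXinv r) = u \<and> \<phi>' (GXinv r) * \<phi>' (GX r) = u)" (is "?R \<longleftrightarrow> ?K \<and> ?I")
proof -
  interpret W: word_eval \<kappa> u \<phi>' by (rule W)
  let ?c = "\<kappa> (q - 1)"
  have c: "?c * z = ?c * z' \<longleftrightarrow> z = z'" for z z' using \<kappa>_cancel[of "q - 1" z z'] q by auto
  have sg: "sigma r s \<in> {1..n}" if "r \<in> {1..<n}" "s \<in> {1..n}" for r s
    using that by (auto simp: transpose_def)
  have uT: "u * T r = T r" "T r * u = T r" if "r \<in> {1..<n}" for r
    using W.u_left[of "GT r"] W.u_right[of "GT r"] that by (simp_all add: g)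
  have TX: "W.ev (hT r * hX s) = W.ev (hX (sigma r s) * hT r + scal (q - 1) * hX (r+1) * partial r s) \<longleftrightarrow>
      T r * x s = x (sigma r s) * T r + (u + ?c * x (Suc r)) * partial r s"
    if rs: "r \<in> {1..<n}" "s \<in> {1..n}" for r s
  proof -
    have rn: "Suc r \<in> {1..n}" using rs by auto
    have l: "W.ev (hT r * hX s) = ?c * (T r * x s) + T r"
      using rs by (simp add: W.ev_mult W.ev_gen g distrib_left uT \<kappa>_mult_left)
    have p: "(?c * x (Suc r) + u) * u = ?c * x (Suc r) + u" using ux[OF rn] by (simp add: distrib_right mult.assoc W.uu)
    have "W.ev (hX (sigma r s) * hT r + scal (q - 1) * hX (r+1) * partial r s)
      = (?c * x (sigma r s) + u) * T r + ?c * u * (?c * x (Suc r) + u) * (partial r s * u)"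
      using rs rn sg[OF rs] by (simp add: W.ev_mult W.ev_add W.ev_gen W.ev_scal W.ev_partial g)
    also have "\<dots> = ?c * (x (sigma r s) * T r + (u + ?c * x (Suc r)) * partial r s) + T r"
    proof -
      have "u * (?c * x (Suc r) + u) = ?c * x (Suc r) + u"
        using ux[OF rn] by (simp add: distrib_left \<kappa>_mult_left[of u "q - 1"] W.uu)
      moreover have "(?c * x (Suc r) + u) * (partial r s * u) = (?c * x (Suc r) + u) * partial r s"
        using p by (auto simp: partial_def)
      ultimately have "?c * u * (?c * x (Suc r) + u) * (partial r s * u) = ?c * ((u + ?c * x (Suc r)) * partial r s)"
        by (simp only: mult.assoc add.commute)
      then show ?thesis using rs by (simp add: distrib_right distrib_left uT mult.assoc)
    qed
    finally show ?thesis unfolding l by (simp add: c)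
  qed
  have XX: "W.ev (hX r * hX s) = W.ev (hX s * hX r) \<longleftrightarrow> x r * x s = x s * x r"
    if rs: "r \<in> {1..n}" "s \<in> {1..n}" for r s
  proof -
    have e: "W.ev (hX r * hX s) = ?c * (?c * (x r * x s)) + (?c * x r + (?c * x s + u))"
      if "r \<in> {1..n}" "s \<in> {1..n}" for r s
    proof -
      have "W.ev (hX r * hX s) = (?c * x r + u) * (?c * x s + u)" using that by (simp add: W.ev_mult W.ev_gen g)
      also have "\<dots> = (?c * x r) * (?c * x s) + (?c * (x r * u) + ((u * ?c) * x s + u))"
        by (simp only: distrib_left distrib_right mult.assoc W.uu add_ac)
      also have "(?c * x r) * (?c * x s) = ?c * (?c * (x r * x s))"
        by (simp only: mult.assoc \<kappa>_mult_left[of "x r"])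
      also have "u * ?c * x s = ?c * (u * x s)" by (simp only: mult.assoc \<kappa>_mult_left[of u])
      finally show ?thesis using ux that by simp
    qed
    show ?thesis unfolding e[OF rs] e[OF rs(2,1)] by (simp add: c add.left_commute[of "?c * x s"])
  qed
  have TT: "W.ev (hT r ^ 2) = W.ev (scal (q - 1) * hT r + scal q) \<longleftrightarrow> T r * T r = ?c * T r + \<kappa> q * u"
    if r: "r \<in> {1..<n}" for r
    using r by (simp add: W.ev_mult W.ev_add W.ev_gen W.ev_scal g uT power2_eq_square mult.assoc)
  show ?thesis
  proof
    assume KI: "?K \<and> ?I"
    then have K: ?K and I: ?I by auto
    have xx: "\<phi>' (GX r) * \<phi>' (GX s) = \<phi>' (GX s) * \<phi>' (GX r)" if "r \<in> {1..n}" "s \<in> {1..n}" for r s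
      using XX[OF that] K that by (simp add: hecke_relations_def W.ev_mult W.ev_gen)
    have xi: "\<phi>' (GXinv s) * \<phi>' (GX r) = \<phi>' (GX r) * \<phi>' (GXinv s)" if "r \<in> {1..n}" "s \<in> {1..n}" for r s
      by (rule inverse_commute[where u = u and f = "\<phi>' (GX s)"])
        (use I that xx W.u_left W.u_right in auto)
    have ii: "\<phi>' (GXinv s) * \<phi>' (GXinv r) = \<phi>' (GXinv r) * \<phi>' (GXinv s)" if "r \<in> {1..n}" "s \<in> {1..n}" for r s
      by (rule inverse_commute[where u = u and f = "\<phi>' (GX s)"])
        (use I that xi W.u_left W.u_right in auto)
    show ?R
    proof (intro allI impI)
      fix l r assume "hecke_rel q n l r"
      then show "W.ev l = W.ev r"
      proof cases
        case (X_X r s) then show ?thesis using XX K by (simp add: hecke_relations_def)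
      next
        case (X_Xinv r s) then show ?thesis using xi by (simp add: W.ev_mult W.ev_gen)
      next
        case (Xinv_Xinv r s) then show ?thesis using ii by (simp add: W.ev_mult W.ev_gen)
      next
        case (X_inv_right r) then show ?thesis using I by (simp add: W.ev_mult W.ev_gen W.ev_1)
      next
        case (X_inv_left r) then show ?thesis using I by (simp add: W.ev_mult W.ev_gen W.ev_1)
      next
        case (T_X r s) then show ?thesis using TX[OF T_X(3,4)] K unfolding hecke_relations_def T_X(1,2) by blast
      next
        case (T_T r) then show ?thesis using TT[OF T_T(3)] K unfolding hecke_relations_def T_T(1,2) by blast
      qed (use K in \<open>auto simp: hecke_relations_def W.ev_mult W.ev_gen g\<close>)
    qed
  next
    assume R: ?R
    then have rel: "hecke_rel q n l r ==> W.ev l = W.ev r" for l r by blast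
    have "x r * x s = x s * x r" if "r \<in> {1..n}" "s \<in> {1..n}" for r s
      using XX[OF that] rel[OF hecke_rel.X_X[OF that]] by blast
    moreover have "T r * x s = x (sigma r s) * T r + (u + ?c * x (Suc r)) * partial r s"
      if "r \<in> {1..<n}" "s \<in> {1..n}" for r s
      using TX[OF that] rel[OF hecke_rel.T_X[OF that]] by blast
    moreover have "T r * T r = ?c * T r + \<kappa> q * u" if "r \<in> {1..<n}" for r
      using TT[OF that] rel[OF hecke_rel.T_T[OF that]] by blast
    moreover have "T r * T s = T s * T r" if "r \<in> {1..<n}" "s \<in> {1..<n}" "1 < \<bar>int r - int s\<bar>" for r s
      using rel[OF hecke_rel.T_comm[OF that]] that by (simp add: W.ev_mult W.ev_gen g)
    moreover have "T r * T (Suc r) * T r = T (Suc r) * T r * T (Suc r)" if "1 \<le> r" "Suc r < n" for r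
      using rel[OF hecke_rel.T_braid[of r n q]] that by (simp add: W.ev_mult W.ev_gen g)
    ultimately have ?K unfolding hecke_relations_def by blast
    moreover have ?I
      using rel[OF hecke_rel.X_inv_right] rel[OF hecke_rel.X_inv_left] by (simp add: W.ev_mult W.ev_gen W.ev_1)
    ultimately show "?K \<and> ?I" ..
  qed
qed

end

text \<open>The two instances of the residue parametrization.\<close>

lemma quantum_degenerate: "quantum (1::'k::field) CHAR('k) of_int"
proof
  show "(of_int i :: 'k) = of_int j \<longleftrightarrow> [i = j] (mod int CHAR('k))" for i j
    using of_int_eq_0_iff_char_dvd[of "i - j", where ?'a = 'k] by (simp add: cong_iff_dvd_diff)
qed auto

text \<open>For \<open>q \<noteq> 1\<close> the quantum characteristic is the multiplicative order
  of \<open>q\<close>, by the geometric sum.\<close>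

lemma quantum_char_dvd:
  fixes q :: "'k::field"
  assumes q: "q \<noteq> 0" "q \<noteq> 1"
  shows "q powi m = 1 \<longleftrightarrow> int (quantum_char q) dvd m"
proof -
  have g: "(\<Sum>k<d. q ^ k) = 0 \<longleftrightarrow> q ^ d = 1" for d
    using sum_gp_strict[of q d] q by auto
  let ?P = "\<lambda>d. d > 0 \<and> q ^ d = 1"
  have qc: "quantum_char q = (if \<exists>d. ?P d then LEAST d. ?P d else 0)"
    unfolding quantum_char_def g by simp
  show ?thesis
  proof (cases "\<exists>d. ?P d")
    case True
    let ?e = "quantum_char q"
    have e: "?P ?e" using LeastI_ex[OF True] True by (simp add: qc)
    have least: "\<not> ?P d" if "d < ?e" for d using not_less_Least[of d ?P] that True by (simp add: qc)
    have "q powi (int ?e * (m div int ?e)) = 1" using e by (simp add: power_int_mult)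
    then have "q powi m = q powi (m mod int ?e)"
      using power_int_add[of q "int ?e * (m div int ?e)" "m mod int ?e"] q by simp
    also have "\<dots> = q ^ nat (m mod int ?e)" using e by (simp add: power_int_def)
    finally have "q powi m = 1 \<longleftrightarrow> nat (m mod int ?e) = 0"
      using least[of "nat (m mod int ?e)"] e by (auto simp: nat_less_iff)
    moreover have "nat (m mod int ?e) = 0 \<longleftrightarrow> m mod int ?e = 0" using pos_mod_sign[of "int ?e" m] e by linarith
    ultimately show ?thesis unfolding dvd_eq_mod_eq_0 by (rule trans)
  next
    case False
    have "m = 0" if "q powi m = 1"
    proof (rule ccontr)
      assume "m \<noteq> 0"
      moreover have "q ^ nat \<bar>m\<bar> = 1"
      proof -
        have "q powi m = q ^ nat \<bar>m\<bar> \<or> q powi m = inverse (q ^ nat \<bar>m\<bar>)"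
          by (auto simp: power_int_def power_inverse)
        then show ?thesis using that by auto
      qed
      ultimately show False using False by (metis zero_less_abs_iff zero_less_nat_eq)
    qed
    moreover have "quantum_char q = 0" unfolding qc using False by (rule if_not_P)
    ultimately show ?thesis by auto
  qed
qed

lemma quantum_nondegenerate:
  fixes q :: "'k::field"
  assumes q: "q \<noteq> 0" "q \<noteq> 1"
  shows "quantum q (quantum_char q) (\<lambda>i. (q powi i - 1) / (q - 1))"
proof
  show "(q powi (i + 1) - 1) / (q - 1) = q * ((q powi i - 1) / (q - 1)) + 1" for i
    using q by (simp add: power_int_add field_simps)
  show "(q powi i - 1) / (q - 1) = (q powi j - 1) / (q - 1) \<longleftrightarrow> [i = j] (mod int (quantum_char q))" for i j
  proof -
    have "q powi i = q powi j \<longleftrightarrow> q powi (i - j) = 1" using q by (simp add: power_int_diff)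
    also have "\<dots> \<longleftrightarrow> [i = j] (mod int (quantum_char q))"
      by (simp add: quantum_char_dvd[OF q] cong_iff_dvd_diff)
    finally show ?thesis using q by simp
  qed
qed (use q in auto)

section \<open>Matched systems of generators and their transport\<close>
text \<open>A set of Hecke generators and a set of KLR generators that correspond to each
  other.\<close>

definition matched where
  "matched \<kappa> q e v n C u x \<epsilon> T y \<psi> \<longleftrightarrow>
     hecke_full \<kappa> q e v n C u x \<epsilon> T \<and> klr_y \<kappa> q e v n C u y \<psi> \<epsilon> \<and>
     (\<forall>r\<in>{1..n}. \<forall>i\<in>C. x r * \<epsilon> i = (\<kappa> (v (i r)) + \<kappa> (quantum.w q v (i r)) * y r) * \<epsilon> i) \<and>
     (\<forall>r\<in>{1..<n}. \<forall>i\<in>C. orbit_system.linked \<kappa> q e v u x \<epsilon> (T r) (\<psi> r) r i)"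

lemma matchedD:
  assumes "matched \<kappa> q e v n C u x \<epsilon> T y \<psi>"
  shows "hecke_full \<kappa> q e v n C u x \<epsilon> T" "klr_y \<kappa> q e v n C u y \<psi> \<epsilon>"
    "r \<in> {1..n} ==> i \<in> C ==> x r * \<epsilon> i = (\<kappa> (v (i r)) + \<kappa> (quantum.w q v (i r)) * y r) * \<epsilon> i"
    "s \<in> {1..<n} ==> i \<in> C ==> orbit_system.linked \<kappa> q e v u x \<epsilon> (T s) (\<psi> s) s i"
  using assms unfolding matched_def by blast+

context typed_hom
begin

lemma linked_transport:
  assumes O1: "orbit_system \<kappa>1 q e v n C u1 x1 \<epsilon>1" and O2: "orbit_system \<kappa>2 q e v n C u2 x2 \<epsilon>2"
    and mem: "u1 \<in> S" "x1 r \<in> S" "x1 (Suc r) \<in> S" "\<epsilon>1 i \<in> S" "t \<in> S" "p \<in> S"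
    and \<tau>: "\<tau> u1 = u2" "\<tau> (x1 r) = x2 r" "\<tau> (x1 (Suc r)) = x2 (Suc r)" "\<tau> (\<epsilon>1 i) = \<epsilon>2 i"
    and l: "orbit_system.linked \<kappa>1 q e v u1 x1 \<epsilon>1 t p r i"
  shows "orbit_system.linked \<kappa>2 q e v u2 x2 \<epsilon>2 (\<tau> t) (\<tau> p) r i"
proof -
  interpret O1: orbit_system \<kappa>1 q e v n C u1 x1 \<epsilon>1 by (rule O1)
  interpret O2: orbit_system \<kappa>2 q e v n C u2 x2 \<epsilon>2 by (rule O2)
  have d: "O1.d r (Suc r) \<in> S \<and> \<tau> (O1.d r (Suc r)) = O2.d r (Suc r)"
    and G: "O1.G r (Suc r) \<in> S \<and> \<tau> (O1.G r (Suc r)) = O2.G r (Suc r)"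
    and h: "O1.h (Suc r) \<in> S \<and> \<tau> (O1.h (Suc r)) = O2.h (Suc r)"
    unfolding O1.d_def O2.d_def O1.G_def O2.G_def O1.h_def O2.h_def using mem \<tau> by (simp_all add: \<tau>_simps)
  show ?thesis
  proof (cases "i r = i (Suc r)")
    case True
    have "\<kappa>1 (O1.w (i r)) * ((t + u1) * \<epsilon>1 i) = - (p * O1.G r (Suc r)) * \<epsilon>1 i"
      using l True by (simp add: O1.linked_def mult.assoc)
    then have "\<tau> (\<kappa>1 (O1.w (i r)) * ((t + u1) * \<epsilon>1 i)) = \<tau> (- (p * O1.G r (Suc r)) * \<epsilon>1 i)" by simp
    then have "\<kappa>2 (O1.w (i r)) * ((\<tau> t + u2) * \<epsilon>2 i) = - (\<tau> p * O2.G r (Suc r)) * \<epsilon>2 i"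
      using mem \<tau> G by (simp add: \<tau>_simps)
    then show ?thesis using True by (simp add: O2.linked_def mult.assoc)
  next
    case False
    have gg: "p * O1.gg a b r (Suc r) \<in> S \<and> \<tau> (p * O1.gg a b r (Suc r)) = \<tau> p * O2.gg a b r (Suc r)" for a b
      unfolding O1.gg_def O2.gg_def using mem G
      by (simp add: K1.\<kappa>_central[of p] K2.\<kappa>_central[of "\<tau> p"] \<tau>_simps)
    have "(t * O1.d r (Suc r) + O1.h (Suc r)) * \<epsilon>1 i = p * O1.gg (i r) (i (Suc r)) r (Suc r) * \<epsilon>1 i"
      using l False by (simp add: O1.linked_def)
    then have "\<tau> ((t * O1.d r (Suc r) + O1.h (Suc r)) * \<epsilon>1 i) = \<tau> (p * O1.gg (i r) (i (Suc r)) r (Suc r) * \<epsilon>1 i)"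
      by simp
    moreover have "\<tau> ((t * O1.d r (Suc r) + O1.h (Suc r)) * \<epsilon>1 i) = (\<tau> t * O2.d r (Suc r) + O2.h (Suc r)) * \<epsilon>2 i"
      using mem d h by (simp add: \<tau>_add \<tau>_mult S_closed(1,2) \<tau>(4))
    moreover have "\<tau> (p * O1.gg (i r) (i (Suc r)) r (Suc r) * \<epsilon>1 i) = \<tau> p * O2.gg (i r) (i (Suc r)) r (Suc r) * \<epsilon>2 i"
      using \<tau>_mult[OF conjunct1[OF gg[of "i r" "i (Suc r)"]] mem(4)] conjunct2[OF gg[of "i r" "i (Suc r)"]] \<tau>(4)
      by (simp only:)
    ultimately have "(\<tau> t * O2.d r (Suc r) + O2.h (Suc r)) * \<epsilon>2 i = \<tau> p * O2.gg (i r) (i (Suc r)) r (Suc r) * \<epsilon>2 i"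
      by (simp only:)
    then show ?thesis using False by (simp add: O2.linked_def)
  qed
qed

text \<open>Since each half of a matched system determines the other, a homomorphism that respects
  the idempotents and one half respects the other half as well. This is what makes the two
  homomorphisms between the KLR algebra and the block inverse to each other.\<close>

lemma matched_transport:
  assumes M1: "matched \<kappa>1 q e v n C u1 x1 \<epsilon>1 T1 y1 \<psi>1" and M2: "matched \<kappa>2 q e v n C u2 x2 \<epsilon>2 T2 y2 \<psi>2"
    and mem: "u1 \<in> S" "\<And>r. r \<in> {1..n} ==> x1 r \<in> S" "\<And>r. r \<in> {1..n} ==> y1 r \<in> S"
      "\<And>r. r \<in> {1..<n} ==> T1 r \<in> S" "\<And>r. r \<in> {1..<n} ==> \<psi>1 r \<in> S" "\<And>i. i \<in> C ==> \<epsilon>1 i \<in> S"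
    and \<tau>: "\<tau> u1 = u2" "\<And>i. i \<in> C ==> \<tau> (\<epsilon>1 i) = \<epsilon>2 i"
  shows "(\<forall>r\<in>{1..n}. \<tau> (x1 r) = x2 r) \<and> (\<forall>r\<in>{1..<n}. \<tau> (T1 r) = T2 r) \<longleftrightarrow>
         (\<forall>r\<in>{1..n}. \<tau> (y1 r) = y2 r) \<and> (\<forall>r\<in>{1..<n}. \<tau> (\<psi>1 r) = \<psi>2 r)"
proof -
  interpret H1: hecke_full \<kappa>1 q e v n C u1 x1 \<epsilon>1 T1 by (rule matchedD(1)[OF M1])
  interpret H2: hecke_full \<kappa>2 q e v n C u2 x2 \<epsilon>2 T2 by (rule matchedD(1)[OF M2])
  interpret Y1: klr_y \<kappa>1 q e v n C u1 y1 \<psi>1 \<epsilon>1 by (rule matchedD(2)[OF M1])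
  interpret Y2: klr_y \<kappa>2 q e v n C u2 y2 \<psi>2 \<epsilon>2 by (rule matchedD(2)[OF M2])
  have xy2: "x2 r * \<epsilon>2 i = \<kappa>2 (v (i r)) * \<epsilon>2 i + \<kappa>2 (H1.w (i r)) * (y2 r * \<epsilon>2 i)"
    if "r \<in> {1..n}" "i \<in> C" for r i
    unfolding matchedD(3)[OF M2 that] by (simp add: distrib_right mult.assoc)
  have xy1: "\<tau> (x1 r) * \<epsilon>2 i = \<kappa>2 (v (i r)) * \<epsilon>2 i + \<kappa>2 (H1.w (i r)) * (\<tau> (y1 r) * \<epsilon>2 i)"
    if "r \<in> {1..n}" "i \<in> C" for r i
  proof -
    have "x1 r * \<epsilon>1 i = \<kappa>1 (v (i r)) * \<epsilon>1 i + \<kappa>1 (H1.w (i r)) * (y1 r * \<epsilon>1 i)"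
      unfolding matchedD(3)[OF M1 that] by (simp add: distrib_right mult.assoc)
    then have "\<tau> (x1 r * \<epsilon>1 i) = \<tau> (\<kappa>1 (v (i r)) * \<epsilon>1 i + \<kappa>1 (H1.w (i r)) * (y1 r * \<epsilon>1 i))" by simp
    then show ?thesis using mem that \<tau> by (simp add: \<tau>_simps)
  qed
  have lk1: "orbit_system.linked \<kappa>2 q e v u2 x2 \<epsilon>2 (\<tau> (T1 r)) (\<tau> (\<psi>1 r)) r i"
    if "\<forall>r\<in>{1..n}. \<tau> (x1 r) = x2 r" "r \<in> {1..<n}" "i \<in> C" for r i
  proof -
    have rn: "r \<in> {1..n}" "Suc r \<in> {1..n}" using that(2) by auto
    show ?thesis
      by (rule linked_transport[OF H1.orbit_system_axioms H2.orbit_system_axioms mem(1) mem(2)[OF rn(1)]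
          mem(2)[OF rn(2)] mem(6)[OF that(3)] mem(4)[OF that(2)] mem(5)[OF that(2)] \<tau>(1)
          that(1)[rule_format, OF rn(1)] that(1)[rule_format, OF rn(2)] \<tau>(2)[OF that(3)]
          matchedD(4)[OF M1 that(2,3)]])
  qed
  have lk2: "orbit_system.linked \<kappa>2 q e v u2 x2 \<epsilon>2 (T2 r) (\<psi>2 r) r i" if "r \<in> {1..<n}" "i \<in> C" for r i
    by (rule matchedD(4)[OF M2 that])
  have \<tau>u: "\<tau> z * u2 = \<tau> z" if "z * u1 = z" "z \<in> S" for z
    using \<tau>_mult[OF that(2) mem(1)] that(1) \<tau>(1) by simp
  show ?thesis
  proof (intro iffI conjI ballI)
    assume a: "(\<forall>r\<in>{1..n}. \<tau> (x1 r) = x2 r) \<and> (\<forall>r\<in>{1..<n}. \<tau> (T1 r) = T2 r)"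
    show "\<tau> (y1 r) = y2 r" if r: "r \<in> {1..n}" for r
    proof (rule H2.eq_by_weights)
      show "\<tau> (y1 r) * \<epsilon>2 i = y2 r * \<epsilon>2 i" if i: "i \<in> C" for i
      proof (rule K2.\<kappa>_cancel[OF H1.w_nz[of "i r"]])
        show "\<kappa>2 (H1.w (i r)) * (\<tau> (y1 r) * \<epsilon>2 i) = \<kappa>2 (H1.w (i r)) * (y2 r * \<epsilon>2 i)"
          using xy1[OF r i] xy2[OF r i] a r by simp
      qed
    qed (rule \<tau>u[OF Y1.y_u[OF r] mem(3)[OF r]], rule Y2.y_u[OF r])
    show "\<tau> (\<psi>1 r) = \<psi>2 r" if r: "r \<in> {1..<n}" for r
    proof (rule H2.eq_by_weights)
      show "\<tau> (\<psi>1 r) * \<epsilon>2 i = \<psi>2 r * \<epsilon>2 i" if i: "i \<in> C" for i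
        by (rule H2.linked_unique(1)[OF r i, of "T2 r"])
          (use lk1[OF conjunct1[OF a] r i] lk2[OF r i] a r in auto)
    qed (rule \<tau>u[OF Y1.\<psi>_u[OF r] mem(5)[OF r]], rule Y2.\<psi>_u[OF r])
  next
    assume a: "(\<forall>r\<in>{1..n}. \<tau> (y1 r) = y2 r) \<and> (\<forall>r\<in>{1..<n}. \<tau> (\<psi>1 r) = \<psi>2 r)"
    have x: "\<tau> (x1 r) = x2 r" if r: "r \<in> {1..n}" for r
    proof (rule H2.eq_by_weights)
      show "\<tau> (x1 r) * \<epsilon>2 i = x2 r * \<epsilon>2 i" if i: "i \<in> C" for i
        using xy1[OF r i] xy2[OF r i] a r by simp
    qed (rule \<tau>u[OF H1.x_u[OF r] mem(2)[OF r]], rule H2.x_u[OF r])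
    show "\<tau> (x1 r) = x2 r" if r: "r \<in> {1..n}" for r by (rule x[OF r])
    show "\<tau> (T1 r) = T2 r" if r: "r \<in> {1..<n}" for r
    proof (rule H2.eq_by_weights)
      show "\<tau> (T1 r) * \<epsilon>2 i = T2 r * \<epsilon>2 i" if i: "i \<in> C" for i
      proof (rule H2.linked_unique(2)[OF r i])
        have "\<forall>r\<in>{1..n}. \<tau> (x1 r) = x2 r" using x by blast
        from lk1[OF this r i] show "H2.linked (\<tau> (T1 r)) (\<psi>2 r) r i" using a r by simp
        show "H2.linked (T2 r) (\<psi>2 r) r i" by (rule lk2[OF r i])
      qed
    qed (rule \<tau>u[OF H1.T_u[OF r] mem(4)[OF r]], rule H2.T_u[OF r])
  qed
qed

end

lemma (in hecke_full) matched_exists: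
  assumes S: "subalg S" "\<And>z. z \<in> S ==> u * z = z \<and> z * u = z"
    "u \<in> S" "\<And>r. r \<in> {1..n} ==> x r \<in> S" "\<And>r. r \<in> {1..<n} ==> T r \<in> S" "\<And>i. i \<in> C ==> \<epsilon> i \<in> S"
  obtains y \<psi> where "\<And>r. r \<in> {1..n} ==> y r \<in> S" "\<And>r. r \<in> {1..<n} ==> \<psi> r \<in> S"
    "matched \<kappa> q e v n C u x \<epsilon> T y \<psi>"
proof (rule klr_from_hecke[OF S])
  fix y \<psi> assume y: "\<And>r. r \<in> {1..n} ==> y r \<in> S" "\<And>r. r \<in> {1..<n} ==> \<psi> r \<in> S"
    "klr_y \<kappa> q e v n C u y \<psi> \<epsilon>"
    "\<And>r i. r \<in> {1..n} ==> i \<in> C ==> x r * \<epsilon> i = (\<kappa> (v (i r)) + \<kappa> (w (i r)) * y r) * \<epsilon> i"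
    "\<And>r i. r \<in> {1..<n} ==> i \<in> C ==> linked (T r) (\<psi> r) r i"
  have "matched \<kappa> q e v n C u x \<epsilon> T y \<psi>"
    unfolding matched_def by (intro conjI ballI hecke_full_axioms y(3-5))
  then show ?thesis using that y(1,2) by blast
qed

lemma (in klr_y) matched_exists:
  assumes nil: "\<And>r i. r \<in> {1..n} ==> i \<in> C ==> nilp (y r) (\<epsilon> i)"
    and S: "subalg S" "\<And>z. z \<in> S ==> u * z = z \<and> z * u = z"
    "u \<in> S" "\<And>r. r \<in> {1..n} ==> y r \<in> S" "\<And>r. r \<in> {1..<n} ==> \<psi> r \<in> S" "\<And>i. i \<in> C ==> \<epsilon> i \<in> S"
  obtains x T where "\<And>r. r \<in> {1..n} ==> x r \<in> S" "\<And>r. r \<in> {1..<n} ==> T r \<in> S"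
    "matched \<kappa> q e v n C u x \<epsilon> T y \<psi>"
proof (rule hecke_from_klr[OF nil S])
  fix x T assume x: "\<And>r. r \<in> {1..n} ==> x r \<in> S" "\<And>r. r \<in> {1..<n} ==> T r \<in> S"
    "hecke_full \<kappa> q e v n C u x \<epsilon> T"
    "\<And>r i. r \<in> {1..n} ==> i \<in> C ==> x r * \<epsilon> i = (\<kappa> (v (i r)) + \<kappa> (w (i r)) * y r) * \<epsilon> i"
    "\<And>r i. r \<in> {1..<n} ==> i \<in> C ==> orbit_system.linked \<kappa> q e v u x \<epsilon> (T r) (\<psi> r) r i"
  have "matched \<kappa> q e v n C u x \<epsilon> T y \<psi>"
    unfolding matched_def by (intro conjI ballI klr_y_axioms x(3-5))
  then show ?thesis using that x(1,2) by blast
qed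

section \<open>Invertible elements and the cyclotomic relation\<close>
text \<open>An element that is a nonzero scalar plus a nilpotent one on each weight space is
  invertible; the inverse is assembled from the weight spaces.\<close>

lemma (in scalars) inverse_by_weights:
  assumes C: "finite C" and \<epsilon>u: "(\<Sum>i\<in>C. \<epsilon> i) = u"
    and S: "subalg S" "\<And>z. z \<in> S ==> u * z = z \<and> z * u = z" "u \<in> S" "f \<in> S" "\<And>i. i \<in> C ==> \<epsilon> i \<in> S"
    and f: "\<And>i. i \<in> C ==> f * \<epsilon> i = \<epsilon> i * f" "\<And>i. i \<in> C ==> \<exists>c. c \<noteq> 0 \<and> nilp (f - \<kappa> c) (\<epsilon> i)"
  obtains g where "g \<in> S" "f * g = u" "g * f = u"
proof -
  have "\<exists>g\<in>S. f * g = \<epsilon> i \<and> g * f = \<epsilon> i" if i: "i \<in> C" for i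
  proof -
    obtain c where c: "c \<noteq> 0" "nilp (f - \<kappa> c) (\<epsilon> i)" using f(2)[OF i] by blast
    let ?N = "f - \<kappa> c * u"
    have e: "u * \<epsilon> i = \<epsilon> i" "u * f = f" "f * u = f" "\<epsilon> i * u = \<epsilon> i"
      using S(2)[OF S(4)] S(2)[OF S(5)[OF i]] by blast+
    have NS: "?N \<in> S" using S subalg_minus[OF S(1)] by (simp add: subalg_def)
    have fc: "(f - \<kappa> c) * \<epsilon> i = \<epsilon> i * (f - \<kappa> c)"
      using f(1)[OF i] by (simp add: left_diff_distrib right_diff_distrib \<kappa>_central[of "\<epsilon> i"])
    have "nilp ?N (\<epsilon> i)"
      by (rule nilp_cong[OF _ fc c(2)]) (simp add: left_diff_distrib mult.assoc e)
    then obtain g where g: "(\<kappa> c + ?N) * g = \<epsilon> i"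
        "\<And>a. a * ?N = ?N * a ==> a * \<epsilon> i = \<epsilon> i * a ==> a * g = g * a"
        "\<And>S. subalg S ==> ?N \<in> S ==> \<epsilon> i \<in> S ==> g \<in> S"
      using inverse_exists[OF _ c(1)] by blast
    have gS: "g \<in> S" by (rule g(3)[OF S(1) NS S(5)[OF i]])
    have "f * g = \<epsilon> i" using g(1) S(2)[OF gS] by (simp add: distrib_right left_diff_distrib mult.assoc)
    moreover have "f * g = g * f"
      by (rule g(2)[OF _ f(1)[OF i]]) (simp add: right_diff_distrib left_diff_distrib \<kappa>_mult_left mult.assoc e)
    ultimately show ?thesis using gS by metis
  qed
  then have "\<forall>i\<in>C. \<exists>g. g \<in> S \<and> f * g = \<epsilon> i \<and> g * f = \<epsilon> i" by blast
  from bchoice[OF this] obtain g where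
    g: "\<And>i. i \<in> C ==> g i \<in> S" "\<And>i. i \<in> C ==> f * g i = \<epsilon> i" "\<And>i. i \<in> C ==> g i * f = \<epsilon> i" by blast
  show ?thesis
  proof (rule that[of "\<Sum>i\<in>C. g i"])
    show "(\<Sum>i\<in>C. g i) \<in> S" by (rule subalg_sum[OF S(1) subalg_zero[OF S(1,3)]]) (use g in auto)
  qed (use g \<epsilon>u in \<open>simp_all add: sum_distrib_left sum_distrib_right\<close>)
qed

lemma (in word_eval) ev_prod_powers:
  assumes "u * z = z"
  shows "ev (prod_list (map (\<lambda>j. p j ^ \<Lambda> j) l)) * z = prod_list (map (\<lambda>j. ev (p j) ^ \<Lambda> j) l) * z"
  using assms
proof (induction l)
  case (Cons j l)
  have "ev (prod_list (map (\<lambda>j. p j ^ \<Lambda> j) (j # l))) * z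
      = ev (p j) ^ \<Lambda> j * (u * ev (prod_list (map (\<lambda>j. p j ^ \<Lambda> j) l)) * z)"
    by (simp add: ev_mult ev_power mult.assoc)
  then show ?case using Cons by (simp add: ev_u mult.assoc)
qed (simp add: ev_1)

context weight_system
begin

lemma residue_mem: "i \<in> C ==> r \<in> {1..n} ==> i r \<in> residue_set e"
  using C_tuples unfolding tuples_def by (blast intro: PiE_mem)

text \<open>On the weight space of \<open>i\<close> the factors with \<open>j \<noteq> i 1\<close>
  act injectively and can be cancelled, and the remaining factor is a nonzero multiple of
  \<open>y\<close>.\<close>

lemma cyclotomic_product:
  assumes n: "1 \<le> n" and a: "a \<noteq> 0" and i: "i \<in> C" and y: "y * \<epsilon> i = \<epsilon> i * y"
    and xy: "x 1 * \<epsilon> i = (\<kappa> (v (i 1)) + \<kappa> (w (i 1)) * y) * \<epsilon> i"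
    and F: "\<And>j. F j = \<kappa> a * x 1 + \<kappa> b * u - \<kappa> (a * v j + b) * u"
  shows "distinct l ==> set l \<subseteq> residue_set e ==> \<epsilon> i * z = z ==>
    prod_list (map (\<lambda>j. F j ^ \<Lambda> j) l) * z = 0 \<longleftrightarrow> y ^ (if i 1 \<in> set l then \<Lambda> (i 1) else 0) * z = 0"
proof (induction l arbitrary: z)
  case (Cons j l)
  let ?P = "prod_list (map (\<lambda>j. F j ^ \<Lambda> j) l)"
  have n1: "1 \<in> {1..n}" using n by simp
  have polF: "pol (F k)" for k unfolding F using n1 by (auto intro!: pol.intros)
  have FF: "F k * F m = F m * F k" for k m by (rule pol_commute[OF polF polF])
  have F\<epsilon>: "F k * \<epsilon> i = \<epsilon> i * F k" for k by (rule pol_\<epsilon>[OF polF i])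
  have FFp: "F k ^ s * F m ^ t = F m ^ t * F k ^ s" for k m s t
    using power_commute[OF power_commute[OF FF[of m k], of t, symmetric], of s] by simp
  have PF: "?P * F j ^ m = F j ^ m * ?P" for m
  proof (induction l)
    case (Cons k l)
    let ?Q = "prod_list (map (\<lambda>j. F j ^ \<Lambda> j) l)"
    have "F k ^ \<Lambda> k * ?Q * F j ^ m = F k ^ \<Lambda> k * F j ^ m * ?Q" by (simp only: mult.assoc Cons)
    also have "F k ^ \<Lambda> k * F j ^ m = F j ^ m * F k ^ \<Lambda> k" by (rule FFp)
    finally show ?case by (simp only: list.map prod_list.Cons mult.assoc)
  qed simp
  have Fpow\<epsilon>: "\<epsilon> i * (F k ^ m * z) = F k ^ m * z" if "\<epsilon> i * z = z" for k m z
    using power_commute[OF F\<epsilon>[of k], of m] that by (metis mult.assoc)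
  have P\<epsilon>: "\<epsilon> i * (prod_list (map (\<lambda>j. F j ^ \<Lambda> j) l) * z) = prod_list (map (\<lambda>j. F j ^ \<Lambda> j) l) * z"
    if "\<epsilon> i * z = z" for z l
    by (induction l) (use that Fpow\<epsilon> in \<open>simp_all add: mult.assoc\<close>)
  have Fz: "F k * z = \<kappa> a * ((x 1 - \<kappa> (v k)) * z)" if "\<epsilon> i * z = z" for k z
  proof -
    have "u * z = z" using that u_\<epsilon>(1)[OF i] by (metis mult.assoc)
    then show ?thesis
      by (simp add: F distrib_right left_diff_distrib right_diff_distrib mult.assoc \<kappa>_add \<kappa>_mult)
  qed
  show ?case
  proof (cases "j = i 1")
    case True
    have Fp: "F j ^ m * z = \<kappa> ((a * w (i 1)) ^ m) * (y ^ m * z)" if "\<epsilon> i * z = z" for m z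
      using that
    proof (induction m arbitrary: z)
      case (Suc m)
      have yz: "\<epsilon> i * (y * z) = y * z" using Suc.prems y by (metis mult.assoc)
      have "(x 1 - \<kappa> (v (i 1))) * z = (x 1 - \<kappa> (v (i 1))) * \<epsilon> i * z" using Suc.prems by (simp add: mult.assoc)
      also have "(x 1 - \<kappa> (v (i 1))) * \<epsilon> i = \<kappa> (w (i 1)) * y * \<epsilon> i"
        using xy by (simp add: left_diff_distrib distrib_right)
      finally have "F j * z = \<kappa> (a * w (i 1)) * (y * z)"
        using Fz[OF Suc.prems, of j] Suc.prems True by (simp add: \<kappa>_mult mult.assoc)
      then have "F j ^ Suc m * z = F j ^ m * (\<kappa> (a * w (i 1)) * (y * z))"
        by (simp only: power_Suc2 mult.assoc)
      also have "\<dots> = \<kappa> (a * w (i 1)) * (F j ^ m * (y * z))" by (rule \<kappa>_mult_left)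
      also have "\<dots> = \<kappa> ((a * w (i 1)) ^ Suc m) * (y ^ m * (y * z))"
        unfolding Suc.IH[OF yz] by (simp only: power_Suc \<kappa>_mult mult.assoc)
      finally show ?case by (simp only: power_Suc2[of y] mult.assoc)
    qed simp
    have "prod_list (map (\<lambda>j. F j ^ \<Lambda> j) (j # l)) * z = ?P * (F j ^ \<Lambda> j * z)"
      by (simp add: PF[symmetric] mult.assoc[symmetric])
    also have "\<dots> = 0 \<longleftrightarrow> y ^ 0 * (F j ^ \<Lambda> j * z) = 0"
      using Cons.IH[OF _ _ Fpow\<epsilon>[OF Cons.prems(3), of j "\<Lambda> j"]] Cons.prems True by simp
    also have "\<dots> \<longleftrightarrow> y ^ \<Lambda> j * z = 0"
      using Fp[OF Cons.prems(3), of "\<Lambda> j"] \<kappa>_cancel[of "(a * w (i 1)) ^ \<Lambda> j" "y ^ \<Lambda> j * z" 0] a w_nz by auto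
    finally show ?thesis using True by simp
  next
    case False
    have "F j * z' = 0 ==> z' = 0" if z': "\<epsilon> i * z' = z'" for z'
    proof -
      assume "F j * z' = 0"
      then have 0: "(x 1 - \<kappa> (v j)) * z' = 0"
        using Fz[OF z', of j] \<kappa>_cancel[OF a, of "(x 1 - \<kappa> (v j)) * z'" 0] by simp
      show "z' = 0"
      proof (rule cancel_left)
        obtain m where "(x 1 - \<kappa> (v (i 1))) ^ m * \<epsilon> i = 0" using x_nilp[OF i n1] by (auto simp: nilp_def)
        then have "(x 1 - \<kappa> (v (i 1))) ^ m * z' = 0" using z' by (metis mult.assoc mult_zero_left)
        then show "nilp (x 1 - \<kappa> (v (i 1))) z'" by (auto simp: nilp_def)
        have "i 1 \<in> residue_set e" by (rule residue_mem[OF i n1])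
        then show "v (i 1) - v j \<noteq> 0"
          using False Cons.prems(2) v_eq_iff[of "i 1" j] by (auto simp: residue_set_def cong_def)
        show "(\<kappa> (v (i 1) - v j) + (x 1 - \<kappa> (v (i 1)))) * z' = 0" using 0 by (simp add: \<kappa>_minus)
      qed
    qed
    then have "F j ^ m * z' = 0 \<longleftrightarrow> z' = 0" if "\<epsilon> i * z' = z'" for z' m
      using that
    proof (induction m)
      case (Suc m)
      have "F j ^ Suc m * z' = F j * (F j ^ m * z')" by (simp add: mult.assoc)
      then show ?case using Suc Fpow\<epsilon>[OF Suc.prems(2), of j m] by (metis mult_zero_right)
    qed simp
    from this[OF P\<epsilon>[OF Cons.prems(3), of l]]
    show ?thesis using Cons.IH[OF _ _ Cons.prems(3)] Cons.prems False by (simp add: mult.assoc)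
  qed
qed simp

text \<open>Thus the cyclotomic relations of the two algebras correspond to each other.\<close>

lemma cyclotomic_iff:
  assumes W: "word_eval \<kappa> u \<phi>" and X: "\<phi> (GX 1) = \<kappa> a * x 1 + \<kappa> b * u"
    and n: "1 \<le> n" and a: "a \<noteq> 0" and i: "i \<in> C" and y: "y * \<epsilon> i = \<epsilon> i * y"
    and xy: "x 1 * \<epsilon> i = (\<kappa> (v (i 1)) + \<kappa> (w (i 1)) * y) * \<epsilon> i"
    and fin: "finite {i \<in> residue_set e. \<Lambda> i \<noteq> 0}"
  shows "word_eval.ev \<kappa> u \<phi> (hecke_cyc_elem (\<lambda>j. a * v j + b) e \<Lambda>) * \<epsilon> i = 0 \<longleftrightarrow> y ^ \<Lambda> (i 1) * \<epsilon> i = 0"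
proof -
  interpret W: word_eval \<kappa> u \<phi> by (rule W)
  let ?l = "sorted_list_of_set {i \<in> residue_set e. \<Lambda> i \<noteq> 0}"
  have F: "W.ev (hX 1 - scal (a * v j + b)) = \<kappa> a * x 1 + \<kappa> b * u - \<kappa> (a * v j + b) * u" for j
    by (simp only: W.ev_minus W.ev_gen W.ev_scal X)
  have "i 1 \<in> residue_set e" by (rule residue_mem[OF i]) (use n in simp)
  then have k: "(if i 1 \<in> set ?l then \<Lambda> (i 1) else 0) = \<Lambda> (i 1)" using fin by auto
  have "prod_list (map (\<lambda>j. W.ev (hX 1 - scal (a * v j + b)) ^ \<Lambda> j) ?l) * \<epsilon> i = 0
      \<longleftrightarrow> y ^ (if i 1 \<in> set ?l then \<Lambda> (i 1) else 0) * \<epsilon> i = 0"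
    by (rule cyclotomic_product[OF n a i y xy F]) (use fin \<epsilon>_idem[OF i] in auto)
  then show ?thesis
    unfolding hecke_cyc_elem_def W.ev_prod_powers[OF u_\<epsilon>(1)[OF i]] k .
qed

end

section \<open>The semi-rationalization does not enlarge the cyclotomic quotient\<close>

lemma orbit_facts:
  assumes "is_orbit n e C"
  shows "finite C" "C \<subseteq> tuples n e" "r \<in> {1..<n} ==> i \<in> C ==> perm_act (sigma r) i \<in> C"
proof -
  obtain i0 where i0: "i0 \<in> tuples n e" and C: "C = {perm_act w i0 | w. w permutes {1..n}}"
    using assms by (auto simp: is_orbit_def)
  have "C = (\<lambda>w. perm_act w i0) ` {w. w permutes {1..n}}" using C by auto
  then show "finite C" by (simp add: finite_permutations)
  show "C \<subseteq> tuples n e"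
  proof
    fix i assume "i \<in> C"
    then obtain w where w: "w permutes {1..n}" "i = perm_act w i0" using C by blast
    have p: "inv_into UNIV w permutes {1..n}" by (rule permutes_inv[OF w(1)])
    show "i \<in> tuples n e"
      unfolding tuples_def w(2) perm_act_def
    proof (rule PiE_I)
      fix s assume "s \<in> {1..n}"
      then have "inv_into UNIV w s \<in> {1..n}" using permutes_in_image[OF p] by blast
      then show "i0 (inv_into UNIV w s) \<in> residue_set e" using i0 by (auto simp: tuples_def)
    next
      fix s assume "s \<notin> {1..n}"
      then show "i0 (inv_into UNIV w s) = undefined"
        using i0 permutes_not_in[OF p] by (auto simp: tuples_def PiE_iff extensional_def)
    qed
  qed
  show "perm_act (sigma r) i \<in> C" if r: "r \<in> {1..<n}" and "i \<in> C"
  proof -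
    obtain w where w: "w permutes {1..n}" "i = perm_act w i0" using C \<open>i \<in> C\<close> by blast
    have s: "sigma r permutes {1..n}" by (rule permutes_swap_id) (use r in auto)
    have "perm_act (sigma r) i = perm_act (sigma r \<circ> w) i0"
      unfolding w(2) perm_act_def
      by (simp add: o_inv_distrib permutes_bij[OF w(1)])
    then show ?thesis using C permutes_compose[OF w(1) s] by blast
  qed
qed

lemma (in word_eval) ev_cong:
  assumes W: "word_eval \<kappa> u \<phi>'" and "\<And>g. g \<in> G ==> \<phi> g = \<phi>' g" and p: "p \<in> words_in G"
  shows "ev p = word_eval.ev \<kappa> u \<phi>' p"
proof -
  interpret W: word_eval \<kappa> u \<phi>' by (rule W)
  interpret presentation G "\<lambda>_ _. False" "{}" by unfold_locales auto
  show ?thesis using p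
    by (induction rule: free_alg_induct) (simp_all add: ev_simps W.ev_simps assms(2))
qed

context klr_y
begin

text \<open>\<open>yval a c\<close>: the element \<open>a\<close> is a polynomial in the \<open>y r\<close> with constant term \<open>c\<close>.\<close>

inductive yval :: "'r \<Rightarrow> 'k \<Rightarrow> bool" where
  yval_u: "yval u 1"
| yval_0: "yval 0 0"
| yval_y: "r \<in> {1..n} ==> yval (y r) 0"
| yval_add: "yval a c ==> yval b d ==> yval (a + b) (c + d)"
| yval_mult: "yval a c ==> yval b d ==> yval (a * b) (c * d)"
| yval_smult: "yval a c ==> yval (\<kappa> d * a) (d * c)"

lemma yval_commute_gen:
  assumes "yval a c" "\<And>r. r \<in> {1..n} ==> y r * z = z * y r" "u * z = z * u"
  shows "a * z = z * a"
  using assms(1)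
proof induction
  case (yval_add a c b d) then show ?case by (simp only: distrib_left distrib_right)
next
  case (yval_mult a c b d) then show ?case by (metis mult.assoc)
next
  case (yval_smult a c d) then show ?case by (metis mult.assoc \<kappa>_central)
qed (use assms in auto)

lemma u_\<epsilon>: "i \<in> C ==> u * \<epsilon> i = \<epsilon> i" "i \<in> C ==> \<epsilon> i * u = \<epsilon> i"
  using C_finite by (simp_all add: \<epsilon>_sum[symmetric] sum_distrib_left sum_distrib_right \<epsilon>_mult
      if_distrib sum.delta sum.delta' cong: if_cong)

lemma yval_\<epsilon>: "yval a c ==> i \<in> C ==> a * \<epsilon> i = \<epsilon> i * a"
  by (rule yval_commute_gen) (auto simp: y_\<epsilon> u_\<epsilon>)

lemma yval_commute: "yval a c ==> yval b d ==> a * b = b * a"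
proof (rule yval_commute_gen)
  have uu: "u * u = u"
    unfolding \<epsilon>_sum[symmetric] sum_distrib_left by (rule sum.cong) (auto simp: u_\<epsilon> \<epsilon>_sum)
  show "u * b = b * u" if "yval b d"
    by (rule yval_commute_gen[OF that, symmetric]) (auto simp: y_u u_y)
  show "y r * b = b * y r" if "yval b d" "r \<in> {1..n}" for r
    by (rule yval_commute_gen[OF that(1), symmetric]) (use that in \<open>auto simp: y_y y_u u_y\<close>)
qed

text \<open>A polynomial in the \<open>y r\<close> minus its constant term is nilpotent on every
  weight space. This is why the inverses that are adjoined in the semi-rationalization exist
  already in the cyclotomic quotient.\<close>

lemma yval_nilp:
  assumes nil: "\<And>r i. r \<in> {1..n} ==> i \<in> C ==> nilp (y r) (\<epsilon> i)" and i: "i \<in> C"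
  shows "yval a c ==> nilp (a - \<kappa> c) (\<epsilon> i)"
proof (induction rule: yval.induct)
  case yval_u
  show ?case unfolding nilp_def by (rule exI[of _ 1]) (simp add: left_diff_distrib u_\<epsilon> i)
next
  case (yval_add a c b d)
  have "(a - \<kappa> c) * (b - \<kappa> d) = (b - \<kappa> d) * (a - \<kappa> c)"
    using yval_commute[OF yval_add(1,2)]
    by (simp add: left_diff_distrib right_diff_distrib \<kappa>_central[of a] \<kappa>_central[of b] \<kappa>_central[of "\<kappa> c" d])
  from nilp_add[OF this yval_add.IH] show ?case by (simp add: \<kappa>_add algebra_simps)
next
  case (yval_mult a c b d)
  have ab: "a * b = b * a" by (rule yval_commute[OF yval_mult(1,2)])
  have 1: "nilp ((a - \<kappa> c) * b) (\<epsilon> i)"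
    by (rule nilp_mult[OF _ yval_mult.IH(1)]) (simp add: left_diff_distrib right_diff_distrib ab \<kappa>_central[of b])
  have 2: "nilp (\<kappa> c * (b - \<kappa> d)) (\<epsilon> i)" by (rule nilp_\<kappa>[OF yval_mult.IH(2)])
  have "(a - \<kappa> c) * b * (\<kappa> c * (b - \<kappa> d)) = \<kappa> c * (b - \<kappa> d) * ((a - \<kappa> c) * b)"
  proof -
    have "(a - \<kappa> c) * b * (b - \<kappa> d) = (b - \<kappa> d) * ((a - \<kappa> c) * b)"
    proof -
      have "b * (b - \<kappa> d) = (b - \<kappa> d) * b"
        by (simp add: left_diff_distrib right_diff_distrib \<kappa>_central[of b])
      moreover have "(a - \<kappa> c) * (b - \<kappa> d) = (b - \<kappa> d) * (a - \<kappa> c)"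
        by (simp add: left_diff_distrib right_diff_distrib ab \<kappa>_central[of a] \<kappa>_central[of b] \<kappa>_central[of "\<kappa> c" d])
      ultimately show ?thesis by (metis mult.assoc)
    qed
    then show ?thesis by (simp only: \<kappa>_mult_left[of "(a - \<kappa> c) * b" c]) (simp only: mult.assoc)
  qed
  from nilp_add[OF this 1 2] show ?case
    by (simp add: \<kappa>_mult left_diff_distrib right_diff_distrib \<kappa>_central[of "\<kappa> c" d])
next
  case (yval_smult a c d)
  from nilp_\<kappa>[OF yval_smult.IH, of d] show ?case by (simp add: \<kappa>_mult right_diff_distrib)
qed (use nil i nilp_zero in auto)

end

text \<open>The value at \<open>0\<close> is the constant coefficient; \<open>0\<^sup>0 =
  1\<close> selects the empty monomial.\<close>

lemma mpol_value:
  assumes "f \<in> mpols n"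
  shows "(\<Sum>m \<in> Poly_Mapping.keys f. Poly_Mapping.lookup f m *
      prod_list (map (\<lambda>r. 0 ^ Poly_Mapping.lookup m r) [1..<Suc n])) = Poly_Mapping.lookup f 0"
proof -
  have z: "prod_list (map (\<lambda>r. (0::'a) ^ Poly_Mapping.lookup m r) [1..<Suc n]) = 0"
    if m: "m \<in> Poly_Mapping.keys f" "m \<noteq> 0" for m
  proof -
    obtain r where r: "r \<in> Poly_Mapping.keys m" using m(2) by (metis all_not_in_conv keys_eq_empty)
    then have "r \<in> {1..n}" using assms m(1) unfolding mpols_def by blast
    then have "r \<in> set [1..<Suc n]" by auto
    moreover have "(0::'a) ^ Poly_Mapping.lookup m r = 0" using r by (simp add: in_keys_iff)
    ultimately have "0 \<in> set (map (\<lambda>r. (0::'a) ^ Poly_Mapping.lookup m r) [1..<Suc n])" by force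
    then show ?thesis by (simp only: prod_list_zero_iff)
  qed
  have o: "prod_list (map (\<lambda>r. (0::'a) ^ Poly_Mapping.lookup 0 r) l) = 1" for l :: "nat list"
    by (induction l) auto
  have "(\<Sum>m \<in> Poly_Mapping.keys f. Poly_Mapping.lookup f m *
      prod_list (map (\<lambda>r. 0 ^ Poly_Mapping.lookup m r) [1..<Suc n]))
    = (\<Sum>m \<in> Poly_Mapping.keys f. if m = 0 then Poly_Mapping.lookup f 0 else 0)"
    by (rule sum.cong) (use z o in auto)
  then show ?thesis by (auto simp: in_keys_iff)
qed

lemma (in klr_y) yval_mpol:
  assumes W: "word_eval \<kappa> u \<phi>" and g: "\<And>r. r \<in> {1..n} ==> \<phi> (Y r) = y r" and f: "f \<in> mpols n"
  shows "yval (word_eval.ev \<kappa> u \<phi> (mpol_in_y n f)) (Poly_Mapping.lookup f 0)"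
proof -
  interpret W: word_eval \<kappa> u \<phi> by (rule W)
  have pw: "yval (W.ev (yg r ^ m)) (0 ^ m)" if "r \<in> {1..n}" for r m
  proof (induction m)
    case (Suc m)
    from yval_mult[OF yval_y[OF that] Suc] show ?case by (simp add: W.ev_mult W.ev_gen g[OF that])
  qed (simp add: W.ev_1 yval_u)
  have pl: "yval (W.ev (prod_list (map (\<lambda>r. yg r ^ k r) l))) (prod_list (map (\<lambda>r. 0 ^ k r) l))"
    if "set l \<subseteq> {1..n}" for l k
    using that
  proof (induction l)
    case (Cons r l)
    then show ?case using yval_mult[OF pw[of r "k r"]] by (simp add: W.ev_mult)
  qed (simp add: W.ev_1 yval_u)
  have s: "yval (\<Sum>m\<in>K. W.ev (F m)) (\<Sum>m\<in>K. c m)"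
    if "\<And>m. yval (W.ev (F m)) (c m)" for F c and K :: "(nat \<Rightarrow>\<^sub>0 nat) set"
    by (induction K rule: infinite_finite_induct) (use that in \<open>auto intro: yval.intros\<close>)
  have sc: "yval (W.ev (scal c * p)) (c * d)" if "yval (W.ev p) d" for c p d
  proof -
    have "W.ev (scal c * p) = \<kappa> c * W.ev p" by (simp only: W.ev_mult W.ev_scal mult.assoc W.ev_u)
    then show ?thesis using yval_smult[OF that] by simp
  qed
  have "yval (W.ev (mpol_in_y n f)) (\<Sum>m \<in> Poly_Mapping.keys f. Poly_Mapping.lookup f m *
      prod_list (map (\<lambda>r. 0 ^ Poly_Mapping.lookup m r) [1..<Suc n]))"
    unfolding mpol_in_y_def W.ev_sum by (intro s sc pl) auto
  then show ?thesis unfolding mpol_value[OF f] .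
qed

lemma words_in_mono: "G \<subseteq> H ==> p \<in> words_in G ==> p \<in> words_in H"
  unfolding words_in_def by blast

lemma (in presentation) typed_lift_ex:
  assumes B: "embedded B \<kappa> \<rho>" and \<phi>: "\<And>g. \<phi> g \<in> \<rho> ` carrier B"
    and rel: "\<And>l r. R l r ==> word_eval.ev \<kappa> (\<rho> \<one>\<^bsub>B\<^esub>) \<phi> l = word_eval.ev \<kappa> (\<rho> \<one>\<^bsub>B\<^esub>) \<phi> r"
    and zero: "\<And>s. s \<in> S ==> word_eval.ev \<kappa> (\<rho> \<one>\<^bsub>B\<^esub>) \<phi> s = 0"
  shows "\<exists>h. alg_hom (cyc_alg G R S) B h \<and>
    (\<forall>p \<in> words_in G. \<rho> (h (cyc_class G R S p)) = word_eval.ev \<kappa> (\<rho> \<one>\<^bsub>B\<^esub>) \<phi> p)"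
  by (rule typed_lift[OF assms]) blast+

lemma (in scalars) inverse_by_weights_ex:
  assumes C: "finite C" and \<epsilon>u: "(\<Sum>i\<in>C. \<epsilon> i) = u"
    and S: "subalg S" "\<And>z. z \<in> S ==> u * z = z \<and> z * u = z" "u \<in> S" "f \<in> S" "\<And>i. i \<in> C ==> \<epsilon> i \<in> S"
    and f: "\<And>i. i \<in> C ==> f * \<epsilon> i = \<epsilon> i * f" "\<And>i. i \<in> C ==> \<exists>c. c \<noteq> 0 \<and> nilp (f - \<kappa> c) (\<epsilon> i)"
  shows "\<exists>g\<in>S. f * g = u \<and> g * f = u"
  by (rule inverse_by_weights[OF assms]) blast+

lemmas words_in_closure = words_in_mult words_in_add words_in_uminus words_in_minus words_in_0
  words_in_1 words_in_numeral words_in_scal words_in_power words_in_sum words_in_prod_list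

locale klr_index = quantum q e v for q :: "'k::field" and e and v :: "int \<Rightarrow> 'k" +
  fixes n :: nat and C :: "(nat \<Rightarrow> int) set" and \<Lambda> :: "int \<Rightarrow> nat"
  assumes n1: "1 \<le> n" and orbit: "is_orbit n e C"
begin

abbreviation "RG \<equiv> (klr_gens n C :: 'k mpol klr_gen set)"
abbreviation "RR \<equiv> (klr_rel n e C :: 'k klr_free \<Rightarrow> 'k klr_free \<Rightarrow> bool)"
abbreviation "RS \<equiv> (klr_cyc_elems C \<Lambda> :: 'k klr_free set)"
abbreviation "LG \<equiv> (semirat_gens n C :: 'k mpol klr_gen set)"
abbreviation "LR \<equiv> (semirat_rel n e C :: 'k klr_free \<Rightarrow> 'k klr_free \<Rightarrow> bool)"

lemma klr_is_cyc: "cyclotomic_klr n e C \<Lambda> = cyc_alg RG RR RS"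
  by (simp add: cyclotomic_klr_def cyc_alg_def klr_alg_def)

lemma semirat_is_cyc: "cyclotomic_semirat n e C \<Lambda> = cyc_alg LG LR RS"
  by (simp add: cyclotomic_semirat_def cyc_alg_def semirat_alg_def)

lemma gens_in: "r \<in> {1..n} ==> Y r \<in> RG" "r \<in> {1..<n} ==> Psi r \<in> RG" "i \<in> C ==> Eps i \<in> RG"
  by (auto simp: klr_gens_def)

lemma klr_closed:
  assumes "RR l r" "RG \<subseteq> G"
  shows "l \<in> words_in G \<and> r \<in> words_in G"
proof -
  have g: "r \<in> {1..n} ==> yg r \<in> words_in G" "r \<in> {1..<n} ==> psig r \<in> words_in G"
    "i \<in> C ==> epsg i \<in> words_in G" for r i
    by (simp_all add: words_in_gen subsetD[OF assms(2)] gens_in)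
  have sg: "sigma r s \<in> {1..n}" if "r \<in> {1..<n}" "s \<in> {1..n}" for r s
    using that by (auto simp: transpose_def)
  have p: "partial r s \<in> words_in G" for r s by (simp add: partial_def words_in_closure)
  have sq: "psi_square e i r \<in> words_in G" if "r \<in> {1..<n}" for i r
    unfolding psi_square_def using that by (simp add: words_in_closure g)
  have d: "braid_defect e i r \<in> words_in G" if "1 \<le> r" "r + 1 < n" for i r
    unfolding braid_defect_def using that by (simp add: words_in_closure g)
  show ?thesis using assms(1)
  proof cases
    case (psi_y r s i)
    then show ?thesis using sg[of r s] by (simp add: words_in_closure g p)
  next
    case (psi_eps r i)
    then show ?thesis using orbit_facts(3)[OF orbit, of r i] by (simp add: words_in_closure g)
  next
    case (psi_psi r i)
    then show ?thesis using sq by (simp add: words_in_closure g)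
  next
    case (psi_braid r i)
    then show ?thesis using d[of r i] by (simp add: words_in_closure g)
  qed (simp_all add: words_in_closure g)
qed

lemma cyc_elems_closed: "RG \<subseteq> G ==> RS \<subseteq> words_in G"
proof
  fix s assume G: "RG \<subseteq> G" and "s \<in> RS"
  then obtain i where i: "i \<in> C" "s = yg 1 ^ \<Lambda> (i 1) * epsg i" by (auto simp: klr_cyc_elems_def)
  have "Y 1 \<in> G" "Eps i \<in> G" using G gens_in(1)[of 1] gens_in(3)[OF i(1)] n1 by auto
  then show "s \<in> words_in G" unfolding i(2) by (intro words_in_mult words_in_power words_in_gen)
qed

lemma mpol_closed: "mpol_in_y n f \<in> words_in RG"
  unfolding mpol_in_y_def
proof (intro words_in_sum words_in_mult words_in_scal words_in_prod_list)
  fix m :: "nat \<Rightarrow>\<^sub>0 nat" and p :: "'k klr_free"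
  assume "p \<in> set (map (\<lambda>r. yg r ^ Poly_Mapping.lookup m r) [1..<Suc n])"
  then obtain r where r': "r \<in> set [1..<Suc n]" and p: "p = yg r ^ Poly_Mapping.lookup m r"
    unfolding set_map by blast
  have r: "r \<in> {1..n}" using r' by auto
  show "p \<in> words_in RG" unfolding p by (intro words_in_power words_in_gen gens_in(1) r)
qed

sublocale R: presentation RG RR RS
proof
  show "RR l r ==> l \<in> words_in RG \<and> r \<in> words_in RG" for l r by (rule klr_closed[OF _ order_refl])
  show "RS \<subseteq> words_in RG" by (rule cyc_elems_closed[OF order_refl])
qed

lemma RG_LG: "RG \<subseteq> LG" by (simp add: semirat_gens_def)

sublocale L: presentation LG LR RS
proof
  fix l r assume "LR l r"
  then show "l \<in> words_in LG \<and> r \<in> words_in LG"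
  proof cases
    case klr then show ?thesis using klr_closed RG_LG by blast
  next
    case (inv_right f)
    have "mpol_in_y n f \<in> words_in LG" by (rule words_in_mono[OF RG_LG mpol_closed])
    moreover have "gen (Inv f) \<in> words_in LG" by (rule words_in_gen) (use inv_right in \<open>simp add: semirat_gens_def\<close>)
    ultimately show ?thesis unfolding inv_right(1,2) by (intro conjI words_in_mult words_in_1)
  next
    case (inv_left f)
    have "mpol_in_y n f \<in> words_in LG" by (rule words_in_mono[OF RG_LG mpol_closed])
    moreover have "gen (Inv f) \<in> words_in LG" by (rule words_in_gen) (use inv_left in \<open>simp add: semirat_gens_def\<close>)
    ultimately show ?thesis unfolding inv_left(1,2) by (intro conjI words_in_mult words_in_1)
  qed
qed (rule cyc_elems_closed[OF RG_LG])

lemma typed_klr_y: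
  assumes W: "word_eval \<kappa> u \<phi>"
    and rel: "\<And>l r. RR l r ==> word_eval.ev \<kappa> u \<phi> l = word_eval.ev \<kappa> u \<phi> r"
  shows "klr_y \<kappa> q e v n C u (\<lambda>r. \<phi> (Y r)) (\<lambda>r. \<phi> (Psi r)) (\<lambda>i. \<phi> (Eps i))"
proof -
  interpret W: word_eval \<kappa> u \<phi> by (rule W)
  show ?thesis
    using W.klr_rel_iff[OF W quantum_axioms orbit_facts[OF orbit] refl refl refl] rel by blast
qed

lemma cyc_elem_ev:
  assumes W: "word_eval \<kappa> u \<phi>"
  shows "word_eval.ev \<kappa> u \<phi> (yg 1 ^ m * epsg i) = \<phi> (Y 1) ^ m * \<phi> (Eps i)"
proof -
  interpret W: word_eval \<kappa> u \<phi> by (rule W)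
  show ?thesis by (simp add: W.ev_mult W.ev_power W.ev_gen mult.assoc W.u_left)
qed

lemma typed_nilp:
  assumes W: "word_eval \<kappa> u \<phi>"
    and rel: "\<And>l r. RR l r ==> word_eval.ev \<kappa> u \<phi> l = word_eval.ev \<kappa> u \<phi> r"
    and zero: "\<And>s. s \<in> RS ==> word_eval.ev \<kappa> u \<phi> s = 0"
    and r: "r \<in> {1..n}" and i: "i \<in> C"
  shows "nilp (\<phi> (Y r)) (\<phi> (Eps i))"
proof -
  interpret K: klr_y \<kappa> q e v n C u "\<lambda>r. \<phi> (Y r)" "\<lambda>r. \<phi> (Psi r)" "\<lambda>i. \<phi> (Eps i)"
    by (rule typed_klr_y[OF W rel])
  have "nilp (\<phi> (Y 1)) (\<phi> (Eps j))" if "j \<in> C" for j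
    using zero[of "yg 1 ^ \<Lambda> (j 1) * epsg j"] that cyc_elem_ev[OF W]
    by (auto simp: klr_cyc_elems_def nilp_def)
  then show ?thesis using K.y_nilp r i by blast
qed

end

context klr_index
begin

text \<open>The generators \<open>f\<^sup>-\<^sup>1\<close> are mapped to the inverses that exist
  in the cyclotomic KLR algebra. Both composites fix the KLR generators, and the inverses because
  inverses are unique.\<close>

theorem klr_semirat_iso: "cyc_alg RG RR RS \<cong>\<^sub>a\<^sub>l\<^sub>g cyc_alg LG LR RS"
proof -
  let ?R = "cyc_alg RG RR RS" and ?L = "cyc_alg LG LR RS"
  let ?cR = "cyc_class RG RR RS" and ?cL = "cyc_class LG LR RS"
  obtain \<rho>R :: "'k klr_free set set \<Rightarrow> ('k klr_free set set, 'k) lin_end" where \<rho>R: "embedded ?R homothety \<rho>R" using embedded_exists[OF R.cyc_kalg] .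
  obtain \<rho>L :: "'k klr_free set set \<Rightarrow> ('k klr_free set set, 'k) lin_end" where \<rho>L: "embedded ?L homothety \<rho>L" using embedded_exists[OF L.cyc_kalg] .
  interpret ER: embedded ?R homothety \<rho>R by (rule \<rho>R)
  interpret EL: embedded ?L homothety \<rho>L by (rule \<rho>L)
  define \<phi>R where "\<phi>R g = (if g \<in> RG then \<rho>R (?cR (gen g)) else 0)" for g
  define \<phi>L where "\<phi>L g = (if g \<in> LG then \<rho>L (?cL (gen g)) else 0)" for g
  note tR = R.typed_relations[OF \<rho>R, folded \<phi>R_def[abs_def]]
  note tL = L.typed_relations[OF \<rho>L, folded \<phi>L_def[abs_def]]
  have imR: "\<phi>R g \<in> \<rho>R ` carrier ?R" for g using R.typed_relations(2)[OF \<rho>R, of g] by (simp only: \<phi>R_def)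
  have imL: "\<phi>L g \<in> \<rho>L ` carrier ?L" for g using L.typed_relations(2)[OF \<rho>L, of g] by (simp only: \<phi>L_def)
  interpret WR: word_eval homothety "\<rho>R \<one>\<^bsub>?R\<^esub>" \<phi>R by (rule tR(1))
  interpret WL: word_eval homothety "\<rho>L \<one>\<^bsub>?L\<^esub>" \<phi>L by (rule tL(1))
  have words: "p \<in> words_in LG" if "p \<in> words_in RG" for p by (rule words_in_mono[OF RG_LG that])
  have cR: "\<rho>R (?cR p) = WR.ev p" if "p \<in> words_in RG" for p
    by (rule R.typed_class[OF \<rho>R tR(1) _ that]) (simp add: \<phi>R_def)
  have cL: "\<rho>L (?cL p) = WL.ev p" if "p \<in> words_in LG" for p
    by (rule L.typed_class[OF \<rho>L tL(1) _ that]) (simp add: \<phi>L_def)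
  have "\<exists>f. alg_hom ?R ?L f \<and> (\<forall>p\<in>words_in RG. \<rho>L (f (?cR p)) = WL.ev p)"
    by (rule R.typed_lift_ex[OF \<rho>L imL]) (rule tL(3)[OF semirat_rel.klr] tL(4), assumption)+
  then obtain f where f: "alg_hom ?R ?L f" "\<And>p. p \<in> words_in RG ==> \<rho>L (f (?cR p)) = WL.ev p" by blast
  have fc: "f (?cR p) = ?cL p" if "p \<in> words_in RG" for p
    using f(2)[OF that] cL[OF words[OF that]] EL.\<rho>_inj[OF alg_homD(1)[OF f(1) R.class_closed[OF that]]
        L.class_closed[OF words[OF that]]] by simp
  interpret K: klr_y homothety q e v n C "\<rho>R \<one>\<^bsub>?R\<^esub>" "\<lambda>r. \<phi>R (Y r)" "\<lambda>r. \<phi>R (Psi r)" "\<lambda>i. \<phi>R (Eps i)"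
    by (rule typed_klr_y[OF tR(1,3)])
  have nil: "nilp (\<phi>R (Y r)) (\<phi>R (Eps i))" if "r \<in> {1..n}" "i \<in> C" for r i
    by (rule typed_nilp[OF tR(1,3,4) that])
  have "\<exists>z\<in>\<rho>R ` carrier ?R. WR.ev (mpol_in_y n g) * z = \<rho>R \<one>\<^bsub>?R\<^esub> \<and> z * WR.ev (mpol_in_y n g) = \<rho>R \<one>\<^bsub>?R\<^esub>"
    if g: "g \<in> units_at_0 n" for g
  proof -
    have yv: "K.yval (WR.ev (mpol_in_y n g)) (Poly_Mapping.lookup g 0)"
      by (rule K.yval_mpol[OF tR(1) refl]) (use g in \<open>simp add: units_at_0_def\<close>)
    show ?thesis
    proof (rule ER.K.inverse_by_weights_ex[OF K.C_finite K.\<epsilon>_sum ER.\<rho>_subalg ER.\<rho>_unit])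
      show "WR.ev (mpol_in_y n g) \<in> \<rho>R ` carrier ?R"
        using cR[OF mpol_closed] R.class_closed[OF mpol_closed] by (metis imageI)
      show "\<exists>c. c \<noteq> 0 \<and> nilp (WR.ev (mpol_in_y n g) - homothety c) (\<phi>R (Eps i))" if "i \<in> C" for i
        using K.yval_nilp[OF nil that yv] g by (auto simp: units_at_0_def)
      show "WR.ev (mpol_in_y n g) * \<phi>R (Eps i) = \<phi>R (Eps i) * WR.ev (mpol_in_y n g)" if "i \<in> C" for i
        by (rule K.yval_\<epsilon>[OF yv that])
    qed (use imR in auto)
  qed
  then have "\<forall>g\<in>units_at_0 n. \<exists>z. z \<in> \<rho>R ` carrier ?R \<and> WR.ev (mpol_in_y n g) * z = \<rho>R \<one>\<^bsub>?R\<^esub> \<and>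
      z * WR.ev (mpol_in_y n g) = \<rho>R \<one>\<^bsub>?R\<^esub>" by blast
  from bchoice[OF this] obtain z where z: "\<And>g. g \<in> units_at_0 n ==> z g \<in> \<rho>R ` carrier ?R"
      "\<And>g. g \<in> units_at_0 n ==> WR.ev (mpol_in_y n g) * z g = \<rho>R \<one>\<^bsub>?R\<^esub>"
      "\<And>g. g \<in> units_at_0 n ==> z g * WR.ev (mpol_in_y n g) = \<rho>R \<one>\<^bsub>?R\<^esub>" by blast
  define \<phi> where "\<phi> g = (case g of Inv p \<Rightarrow> if p \<in> units_at_0 n then z p else 0 | _ \<Rightarrow> \<phi>R g)" for g
  have \<phi>RG: "\<phi> g = \<phi>R g" if "g \<in> RG" for g using that by (auto simp: \<phi>_def klr_gens_def)
  have \<phi>_im: "\<phi> g \<in> \<rho>R ` carrier ?R" for g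
    using imR z(1) imageI[OF ER.zero_closed, of \<rho>R] by (auto simp: \<phi>_def split: klr_gen.split)
  interpret W: word_eval homothety "\<rho>R \<one>\<^bsub>?R\<^esub>" \<phi> by (rule ER.word_evalI[OF \<phi>_im])
  have ev: "W.ev p = WR.ev p" if "p \<in> words_in RG" for p
    by (rule W.ev_cong[OF tR(1) \<phi>RG that])
  have "\<exists>g. alg_hom ?L ?R g \<and> (\<forall>p\<in>words_in LG. \<rho>R (g (?cL p)) = W.ev p)"
  proof (rule L.typed_lift_ex[OF \<rho>R \<phi>_im])
    fix l r assume "LR l r"
    then show "W.ev l = W.ev r"
    proof cases
      case klr
      have "l \<in> words_in RG" "r \<in> words_in RG" using R.R_closed[OF klr] by auto
      then show ?thesis using tR(3)[OF klr] by (simp only: ev)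
    next
      case (inv_right h)
      then show ?thesis using z(2)[of h] ev[OF mpol_closed] by (simp add: W.ev_mult W.ev_gen W.ev_1 \<phi>_def)
    next
      case (inv_left h)
      then show ?thesis using z(3)[of h] ev[OF mpol_closed] by (simp add: W.ev_mult W.ev_gen W.ev_1 \<phi>_def)
    qed
  next
    fix s assume "s \<in> RS"
    then show "W.ev s = 0" using tR(4)[of s] ev[OF subsetD[OF R.S_closed]] by simp
  qed
  then obtain g where g: "alg_hom ?L ?R g" "\<And>p. p \<in> words_in LG ==> \<rho>R (g (?cL p)) = W.ev p" by blast
  have gc: "g (?cL p) = ?cR p" if "p \<in> words_in RG" for p
    using g(2)[OF words[OF that]] cR[OF that] ev[OF that]
      ER.\<rho>_inj[OF alg_homD(1)[OF g(1) L.class_closed[OF words[OF that]]] R.class_closed[OF that]] by simp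
  have Rid: "alg_hom ?R ?R (\<lambda>x. x)" and Lid: "alg_hom ?L ?L (\<lambda>x. x)" by (rule alg_homI; simp)+
  show ?thesis
  proof (rule alg_isomorphicI[OF f(1) g(1)])
    fix x assume x: "x \<in> carrier ?R"
    show "g (f x) = x"
      using R.cyc_hom_ext[OF alg_hom_compose[OF f(1) g(1)] Rid _ x] fc[OF words_in_gen] gc[OF words_in_gen]
      by (simp add: comp_def)
  next
    fix x assume x: "x \<in> carrier ?L"
    have fg: "(f \<circ> g) (?cL p) = ?cL p" if "p \<in> words_in RG" for p using fc gc that by simp
    note H = alg_homD[OF alg_hom_compose[OF g(1) f(1)]]
    have "(f \<circ> g) (?cL (gen a)) = ?cL (gen a)" if a: "a \<in> LG" for a
    proof (cases "a \<in> RG")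
      case True then show ?thesis by (rule fg[OF words_in_gen])
    next
      case False
      then obtain p where p: "a = Inv p" "p \<in> units_at_0 n" using a by (auto simp: semirat_gens_def)
      let ?i = "?cL (gen (Inv p))" and ?m = "?cL (mpol_in_y n p)"
      have c: "?i \<in> carrier ?L" "?m \<in> carrier ?L"
        using L.class_closed[OF words_in_gen[OF a]] L.class_closed[OF words[OF mpol_closed]] by (simp_all add: p)
      note D = alg_homD[OF L.cyc_hom, unfolded carrier_free_alg free_alg_simps]
      have w: "gen (Inv p) \<in> words_in LG" "mpol_in_y n p \<in> words_in LG"
        using words_in_gen[OF a] words[OF mpol_closed] by (simp_all add: p)
      have mi: "?m \<otimes>\<^bsub>?L\<^esub> ?i = \<one>\<^bsub>?L\<^esub>" and im: "?i \<otimes>\<^bsub>?L\<^esub> ?m = \<one>\<^bsub>?L\<^esub>"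
        using L.cyc_rel[OF semirat_rel.inv_right[OF p(2)]] L.cyc_rel[OF semirat_rel.inv_left[OF p(2)]]
          D(2)[OF w] D(2)[OF w(2,1)] D(4) by simp_all
      let ?j = "(f \<circ> g) ?i"
      have j: "?j \<in> carrier ?L" using H(1)[OF c(1)] .
      have "?j \<otimes>\<^bsub>?L\<^esub> ?m = \<one>\<^bsub>?L\<^esub>"
        using H(2)[OF c] fg[OF mpol_closed, of p] im H(4) by simp
      then have "?j = ?i" using EL.inv_unique[of ?j ?m ?i] mi c j by blast
      then show ?thesis using p by simp
    qed
    then show "f (g x) = x"
      using L.cyc_hom_ext[OF alg_hom_compose[OF g(1) f(1)] Lid _ x] by (simp add: comp_def)
  qed
qed

end

section \<open>Blocks\<close>
text \<open>A central idempotent cuts out a direct factor, with the idempotent as its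
  unit.\<close>

lemma corner_kalg:
  fixes A :: "('k::field, 'a) module" (structure)
  assumes "kalg A" and e: "e \<in> carrier A" "e \<otimes> e = e" "\<And>a. a \<in> carrier A ==> a \<otimes> e = e \<otimes> a"
  defines "B \<equiv> A\<lparr>carrier := (\<lambda>h. h \<otimes> e) ` carrier A, one := e\<rparr>"
  shows "kalg B" "x \<in> carrier B \<longleftrightarrow> x \<in> carrier A \<and> x \<otimes> e = x"
proof -
  interpret kalg A by fact
  have le: "e \<otimes> x = x" if "x \<in> carrier A" "x \<otimes> e = x" for x using e(3)[OF that(1)] that(2) by simp
  have mem: "x \<in> carrier B \<longleftrightarrow> x \<in> carrier A \<and> x \<otimes> e = x" for x
  proof
    assume "x \<in> carrier B"
    then obtain h where "h \<in> carrier A" "x = h \<otimes> e" unfolding B_def by auto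
    then show "x \<in> carrier A \<and> x \<otimes> e = x" using e(1,2) by (simp add: m_assoc)
  next
    assume x: "x \<in> carrier A \<and> x \<otimes> e = x"
    then have "x = x \<otimes> e" by simp
    then have "x \<in> (\<lambda>h. h \<otimes> e) ` carrier A" using x by (rule image_eqI[OF _ conjunct1])
    then show "x \<in> carrier B" unfolding B_def by simp
  qed
  show "x \<in> carrier B \<longleftrightarrow> x \<in> carrier A \<and> x \<otimes> e = x" by (rule mem)
  have ops: "monoid.mult B = monoid.mult A" "one B = e" "ring.zero B = \<zero>" "add B = add A" "smult B = smult A"
    by (simp_all add: B_def)
  have "ring B"
  proof (rule ringI)
    show "abelian_group B"
    proof (rule abelian_groupI)
      show "\<exists>y\<in>carrier B. y \<oplus>\<^bsub>B\<^esub> x = \<zero>\<^bsub>B\<^esub>" if "x \<in> carrier B" for x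
        by (rule bexI[of _ "\<ominus> x"]) (use that e(1,2) in \<open>simp_all add: mem ops l_neg l_minus\<close>)
    qed (use e(1,2) in \<open>simp_all add: mem ops l_distr a_ac\<close>)
    show "Group.monoid B"
      by (rule monoidI) (use e(1,2) le in \<open>simp_all add: mem ops m_assoc\<close>)
  qed (use e(1,2) in \<open>simp_all add: mem ops l_distr r_distr\<close>)
  then interpret B: ring B .
  show "kalg B"
    by unfold_locales
      (use e(1,2) in \<open>simp_all add: mem ops smult_add_left smult_add_right smult_smult smult_mult_left smult_mult_right\<close>)
qed

lemma nilp_agree:
  assumes "\<And>z. u * z = z ==> a * z = b * z \<and> u * (b * z) = b * z" "u * z = z"
  shows "nilp a z \<longleftrightarrow> nilp b (z :: 'r::ring_1)"
proof -
  have "u * z = z ==> a ^ m * z = b ^ m * z" for m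
  proof (induction m arbitrary: z)
    case (Suc m)
    have "a ^ Suc m * z = a ^ m * (a * z)" by (simp only: power_Suc2 mult.assoc)
    also have "\<dots> = a ^ m * (b * z)" using assms(1)[OF Suc.prems] by simp
    also have "\<dots> = b ^ m * (b * z)" by (rule Suc.IH) (use assms(1)[OF Suc.prems] in simp)
    finally show ?case by (simp only: power_Suc2 mult.assoc)
  qed simp
  then show ?thesis using assms(2) by (simp add: nilp_def)
qed

context scalars
begin

lemma nilp_\<kappa>_iff: "c \<noteq> 0 ==> nilp (\<kappa> c * a) z \<longleftrightarrow> nilp a z"
  using nilp_\<kappa>[of a z c] nilp_\<kappa>[of "\<kappa> c * a" z "inverse c"] \<kappa>_inverse[of c]
  by (metis mult.assoc mult_1_left)

lemma nilp_two_values: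
  assumes "nilp (a - \<kappa> c) z" "nilp (a - \<kappa> d) z" "c \<noteq> d"
  shows "z = 0"
proof -
  have "(a - \<kappa> c) * (a - \<kappa> d) = (a - \<kappa> d) * (a - \<kappa> c)"
    by (simp add: left_diff_distrib right_diff_distrib \<kappa>_central[of a] \<kappa>_central[of "\<kappa> c" d])
  then have "nilp ((a - \<kappa> c) - (a - \<kappa> d)) z" using nilp_diff assms by blast
  then obtain m where "\<kappa> (d - c) ^ m * z = 0" by (auto simp: nilp_def \<kappa>_minus)
  moreover have "\<kappa> (d - c) ^ m = \<kappa> ((d - c) ^ m)" for m by (induction m) (simp_all add: \<kappa>_mult)
  ultimately show ?thesis using \<kappa>_cancel[of "(d - c) ^ m" z 0] assms(3) by auto
qed

lemma hecke_data_iff: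
  fixes \<phi> and x T :: "nat \<Rightarrow> 'r"
  assumes D: "hecke_data q a b n G R" and W: "word_eval \<kappa> u \<phi>"
    and g: "\<And>r. r \<in> {1..n} ==> \<phi> (GX r) = \<kappa> a * x r + \<kappa> b * u" "\<And>r. r \<in> {1..<n} ==> \<phi> (GT r) = T r"
    and ux: "\<And>r. r \<in> {1..n} ==> u * x r = x r \<and> x r * u = x r"
  shows "(\<forall>l r. R l r \<longrightarrow> word_eval.ev \<kappa> u \<phi> l = word_eval.ev \<kappa> u \<phi> r)
    \<longleftrightarrow> hecke_relations \<kappa> q n u x T \<and>
      (q \<noteq> 1 \<longrightarrow> (\<forall>r\<in>{1..n}. \<phi> (GX r) * \<phi> (GXinv r) = u \<and> \<phi> (GXinv r) * \<phi> (GX r) = u))"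
proof -
  interpret W: word_eval \<kappa> u \<phi> by (rule W)
  show ?thesis
  proof (cases "q = 1")
    case True
    then have D': "a = 1" "b = 0" "R = deg_hecke_rel n" using D by (auto simp: hecke_data_def)
    show ?thesis unfolding D' True
      using W.deg_hecke_rel_iff[OF W, of n x T] g by (simp add: D')
  next
    case False
    then have D': "a = q - 1" "b = 1" "R = hecke_rel q n" using D by (auto simp: hecke_data_def)
    have g1: "\<phi> (GX r) = \<kappa> (q - 1) * x r + u" if "r \<in> {1..n}" for r using g(1)[OF that] by (simp add: D')
    show ?thesis unfolding D'
      using W.hecke_rel_iff[OF W False g1 g(2) ux] False by blast
  qed
qed

end

lemma hecke_gens_cases:
  assumes "hecke_data q a b n G R"
  shows "g \<in> G \<longleftrightarrow> g \<in> GX ` {1..n} \<or> g \<in> GT ` {1..<n} \<or> q \<noteq> 1 \<and> g \<in> GXinv ` {1..n}"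
  using assms by (auto simp: hecke_data_def deg_hecke_gens_def hecke_gens_def)

lemma hecke_presentation:
  fixes R :: "'k::field hecke_free \<Rightarrow> 'k hecke_free \<Rightarrow> bool"
  assumes D: "hecke_data q a b n G R" and n: "1 \<le> n"
  shows "presentation G R {hecke_cyc_elem f e \<Lambda>}"
proof
  note c = hecke_gens_cases[OF D]
  have g: "r \<in> {1..n} ==> (hX r :: 'k hecke_free) \<in> words_in G"
    "r \<in> {1..<n} ==> (hT r :: 'k hecke_free) \<in> words_in G"
    and gi: "q \<noteq> 1 ==> r \<in> {1..n} ==> (hXinv r :: 'k hecke_free) \<in> words_in G" for r
    by (simp_all add: words_in_gen c)
  have sg: "sigma r s \<in> {1..n}" if "r \<in> {1..<n}" "s \<in> {1..n}" for r s
    using that by (auto simp: transpose_def)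
  have p: "(partial r s :: 'k hecke_free) \<in> words_in G" for r s by (simp add: partial_def words_in_closure)
  show "{hecke_cyc_elem f e \<Lambda>} \<subseteq> words_in G"
    unfolding hecke_cyc_elem_def
  proof (simp only: insert_subset empty_subsetI simp_thms, rule words_in_prod_list)
    fix p :: "'k hecke_free" assume "p \<in> set (map (\<lambda>i. (hX 1 - scal (f i)) ^ \<Lambda> i) (sorted_list_of_set {i \<in> residue_set e. \<Lambda> i \<noteq> 0}))"
    then obtain i where "p = (hX 1 - scal (f i)) ^ \<Lambda> i" by auto
    then show "p \<in> words_in G" using g(1)[of 1] n by (simp add: words_in_closure)
  qed
  fix l r :: "'k hecke_free" assume lr: "R l r"
  show "l \<in> words_in G \<and> r \<in> words_in G"
  proof (cases "q = 1")
    case True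
    then have "deg_hecke_rel n l r" using D lr by (auto simp: hecke_data_def)
    then show ?thesis
    proof cases
      case (T_X r s) then show ?thesis using sg[of r s] by (simp add: words_in_closure g p)
    qed (simp_all add: words_in_closure g)
  next
    case False
    then have "hecke_rel q n l r" using D lr by (auto simp: hecke_data_def)
    then show ?thesis
    proof cases
      case (T_X r s) then show ?thesis using sg[of r s] by (simp add: words_in_closure g p)
    qed (auto intro!: words_in_intros g gi[OF False])
  qed
qed

text \<open>\<open>T r\<close> maps weight spaces of an orbit to weight spaces of the same orbit, so the sum of the
  idempotents of an orbit is central.\<close>

lemma (in hecke_rep) orbit_sum_commutes:
  assumes D: "finite D" "D \<subseteq> tuples n e" "\<And>r i. r \<in> {1..<n} ==> i \<in> D ==> perm_act (sigma r) i \<in> D"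
    and E: "\<And>i. i \<in> tuples n e ==> i \<notin> C ==> \<epsilon> i = 0" and c: "c = (\<Sum>i\<in>D. \<epsilon> i)"
  shows "r \<in> {1..n} ==> c * x r = x r * c" "r \<in> {1..<n} ==> c * T r = T r * c"
    "i \<in> D ==> c * \<epsilon> i = \<epsilon> i \<and> \<epsilon> i * c = \<epsilon> i" "c * u = c" "u * c = c"
proof -
  have cC: "c = (\<Sum>i\<in>C \<inter> D. \<epsilon> i)"
    unfolding c by (rule sum.mono_neutral_right) (use D E in auto)
  have c\<epsilon>: "c * \<epsilon> i = (if i \<in> D then \<epsilon> i else 0)" "\<epsilon> i * c = (if i \<in> D then \<epsilon> i else 0)" if "i \<in> C" for i
  proof -
    have "c * \<epsilon> i = (\<Sum>j\<in>C \<inter> D. if j = i then \<epsilon> i else 0)" "\<epsilon> i * c = (\<Sum>j\<in>C \<inter> D. if j = i then \<epsilon> i else 0)"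
      unfolding cC sum_distrib_right sum_distrib_left by (rule sum.cong; use that \<epsilon>_mult in auto)+
    then show "c * \<epsilon> i = (if i \<in> D then \<epsilon> i else 0)" "\<epsilon> i * c = (if i \<in> D then \<epsilon> i else 0)"
      using that C_finite by auto
  qed
  show "i \<in> D ==> c * \<epsilon> i = \<epsilon> i \<and> \<epsilon> i * c = \<epsilon> i" using c\<epsilon>[of i] E[of i] D(2) by (cases "i \<in> C") auto
  show cu: "c * u = c" "u * c = c"
    unfolding cC sum_distrib_right sum_distrib_left by (rule sum.cong; use u_\<epsilon> in auto)+
  show "c * x r = x r * c" if "r \<in> {1..n}"
    unfolding cC sum_distrib_right sum_distrib_left by (rule sum.cong) (use x_\<epsilon>[OF that] in auto)
  show "c * T r = T r * c" if r: "r \<in> {1..<n}"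
  proof (rule eq_by_weights)
    fix j assume j: "j \<in> C"
    have "c * T r * \<epsilon> j = (\<Sum>k\<in>C \<inter> D. \<epsilon> k * T r * \<epsilon> j)" unfolding cC by (simp add: sum_distrib_right)
    also have "\<dots> = (if j \<in> D then T r * \<epsilon> j else 0)"
    proof (cases "j \<in> D")
      case True
      have "T r * \<epsilon> j = (\<Sum>k\<in>C. \<epsilon> k * T r * \<epsilon> j)"
      proof -
        have "T r * \<epsilon> j = u * T r * \<epsilon> j" by (simp only: u_T[OF r])
        then show ?thesis by (simp only: \<epsilon>_sum[symmetric] sum_distrib_right)
      qed
      also have "\<dots> = (\<Sum>k\<in>C \<inter> D. \<epsilon> k * T r * \<epsilon> j)"
        by (rule sum.mono_neutral_right) (use C_finite T_weights[OF r j] D(3)[OF r] True in auto)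
      finally show ?thesis using True by simp
    next
      case False
      have "\<epsilon> k * T r * \<epsilon> j = 0" if k: "k \<in> C \<inter> D" for k
      proof (rule ccontr)
        assume "\<epsilon> k * T r * \<epsilon> j \<noteq> 0"
        then have "k = j \<or> k = perm_act (sigma r) j" using T_weights[OF r j] k by auto
        then have "j = k \<or> j = perm_act (sigma r) k" by auto
        then show False using D(3)[OF r, of k] k False by auto
      qed
      then show ?thesis using False by simp
    qed
    also have "\<dots> = T r * c * \<epsilon> j" using c\<epsilon>(1)[OF j] by (simp add: mult.assoc)
    finally show "c * T r * \<epsilon> j = T r * c * \<epsilon> j" .
  qed (use T_u[OF r] cu in \<open>simp_all add: mult.assoc\<close>)
qed

text \<open>Two generalized eigenvalues on a common vector force it to vanish, so
  \<open>\<epsilon> j * F i = 0\<close> for \<open>i \<noteq> j\<close>, and both families sum to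
  \<open>u\<close>.\<close>

lemma (in weight_system) idempotents_determined:
  assumes J: "finite J" "J \<subseteq> tuples n e" "(\<Sum>i\<in>J. F i) = u" "\<And>i. i \<in> tuples n e ==> i \<notin> J ==> F i = 0"
    and F: "\<And>i. i \<in> tuples n e ==> u * F i = F i"
      "\<And>i r. i \<in> tuples n e ==> r \<in> {1..n} ==> nilp (x r - \<kappa> (v (i r))) (F i)"
    and j: "j \<in> C"
  shows "F j = \<epsilon> j"
proof -
  have z: "\<epsilon> k * F i = 0" if k: "k \<in> C" and i: "i \<in> tuples n e" and ne: "i \<noteq> k" for i k
  proof -
    have kt: "k \<in> tuples n e" using k C_tuples by blast
    obtain r where r: "r \<in> {1..n}" "i r \<noteq> k r" using tuple_eqI[OF i kt] ne by blast
    have "i r \<in> residue_set e" "k r \<in> residue_set e"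
      using i kt r(1) unfolding tuples_def by (blast intro: PiE_mem)+
    then have vne: "v (i r) \<noteq> v (k r)" using r(2) v_eq_iff by (auto simp: residue_set_def cong_def)
    have c: "(x r - \<kappa> d) ^ m * \<epsilon> k = \<epsilon> k * (x r - \<kappa> d) ^ m" for d m
      by (rule power_commute) (simp add: left_diff_distrib right_diff_distrib x_\<epsilon>[OF r(1) k] \<kappa>_central[of "\<epsilon> k"])
    show ?thesis
    proof (rule nilp_two_values[OF _ _ vne])
      obtain m where "(x r - \<kappa> (v (i r))) ^ m * F i = 0" using F(2)[OF i r(1)] by (auto simp: nilp_def)
      then have "(x r - \<kappa> (v (i r))) ^ m * (\<epsilon> k * F i) = 0" using c by (metis mult.assoc mult_zero_right)
      then show "nilp (x r - \<kappa> (v (i r))) (\<epsilon> k * F i)" by (auto simp: nilp_def)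
      obtain m where "(x r - \<kappa> (v (k r))) ^ m * \<epsilon> k = 0" using x_nilp[OF k r(1)] by (auto simp: nilp_def)
      then have "(x r - \<kappa> (v (k r))) ^ m * (\<epsilon> k * F i) = 0" by (metis mult.assoc mult_zero_left)
      then show "nilp (x r - \<kappa> (v (k r))) (\<epsilon> k * F i)" by (auto simp: nilp_def)
    qed
  qed
  have jt: "j \<in> tuples n e" using j C_tuples by blast
  have "\<epsilon> j = (\<Sum>i\<in>J. \<epsilon> j * F i)" using u_\<epsilon>(2)[OF j] by (simp add: J(3)[symmetric] sum_distrib_left)
  also have "\<dots> = (\<Sum>i\<in>J. if i = j then \<epsilon> j * F j else 0)"
    by (rule sum.cong) (use z[OF j] J(2) in auto)
  also have "\<dots> = \<epsilon> j * F j" using J(1) J(4)[OF jt] by auto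
  finally have 1: "\<epsilon> j = \<epsilon> j * F j" .
  have "F j = (\<Sum>i\<in>C. \<epsilon> i * F j)" using F(1)[OF jt] by (simp add: \<epsilon>_sum[symmetric] sum_distrib_right)
  also have "\<dots> = (\<Sum>i\<in>C. if i = j then \<epsilon> j * F j else 0)"
    by (rule sum.cong) (use z[OF _ jt] in auto)
  also have "\<dots> = \<epsilon> j * F j" using j C_finite by simp
  finally show ?thesis using 1 by simp
qed

text \<open>Cutting down to one orbit.\<close>

lemma (in hecke_rep) block_restrict:
  assumes rel: "hecke_relations \<kappa> q n u x T"
    and D: "finite D" "D \<subseteq> tuples n e" "\<And>r i. r \<in> {1..<n} ==> i \<in> D ==> perm_act (sigma r) i \<in> D"
    and E: "\<And>i. i \<in> tuples n e ==> i \<notin> C ==> \<epsilon> i = 0" and c: "c = (\<Sum>i\<in>D. \<epsilon> i)"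
  shows "hecke_full \<kappa> q e v n D c (\<lambda>r. x r * c) \<epsilon> (\<lambda>r. T r * c)"
proof -
  have O: "\<And>r. r \<in> {1..n} ==> c * x r = x r * c" "\<And>r. r \<in> {1..<n} ==> c * T r = T r * c"
    "\<And>i. i \<in> D ==> c * \<epsilon> i = \<epsilon> i \<and> \<epsilon> i * c = \<epsilon> i" "c * u = c" "u * c = c"
    by (rule orbit_sum_commutes[OF D E c]; assumption)+
  have cc: "c * c = c"
    unfolding c sum_distrib_left by (rule sum.cong) (use O(3) c in auto)
  have xc: "a * c * (x r * c) = a * x r * c" if "r \<in> {1..n}" for a r
    using O(1)[OF that] cc by (metis mult.assoc)
  have Tc: "a * c * (T r * c) = a * T r * c" if "r \<in> {1..<n}" for a r
    using O(2)[OF that] cc by (metis mult.assoc)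
  have R: "hecke_relations \<kappa> q n c (\<lambda>r. x r * c) (\<lambda>r. T r * c)"
    unfolding hecke_relations_def
  proof (intro conjI ballI allI impI)
    fix r s assume rs: "r \<in> {1..n}" "s \<in> {1..n}"
    show "x r * c * (x s * c) = x s * c * (x r * c)" using rs by (simp add: xc x_x)
  next
    fix r s assume rs: "r \<in> {1..<n}" "s \<in> {1..n}"
    then have sg: "sigma r s \<in> {1..n}" by (auto simp: transpose_def)
    have "T r * x s = x (sigma r s) * T r + (u + \<kappa> (q - 1) * x (Suc r)) * partial r s"
      using rel rs unfolding hecke_relations_def by blast
    then have "T r * x s * c = x (sigma r s) * T r * c + (u + \<kappa> (q - 1) * x (Suc r)) * c * partial r s"
      by (auto simp: partial_def distrib_right left_diff_distrib)
    then show "T r * c * (x s * c) = x (sigma r s) * c * (T r * c) + (c + \<kappa> (q - 1) * (x (Suc r) * c)) * partial r s"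
      using xc[OF rs(2)] Tc[OF rs(1)] O(5) by (simp add: distrib_right mult.assoc)
  next
    fix r assume r: "r \<in> {1..<n}"
    show "T r * c * (T r * c) = \<kappa> (q - 1) * (T r * c) + \<kappa> q * c"
      unfolding Tc[OF r] T_T[OF r] by (simp add: distrib_right mult.assoc O(5))
  next
    fix r s assume rs: "r \<in> {1..<n}" "s \<in> {1..<n}" "1 < \<bar>int r - int s\<bar>"
    then have "T r * T s = T s * T r" using rel unfolding hecke_relations_def by blast
    then show "T r * c * (T s * c) = T s * c * (T r * c)" unfolding Tc[OF rs(1)] Tc[OF rs(2)] by simp
  next
    fix r assume r: "1 \<le> r \<and> Suc r < n"
    then have rr: "r \<in> {1..<n}" "Suc r \<in> {1..<n}" by auto
    have "T r * T (Suc r) * T r = T (Suc r) * T r * T (Suc r)" using rel r unfolding hecke_relations_def by blast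
    then show "T r * c * (T (Suc r) * c) * (T r * c) = T (Suc r) * c * (T r * c) * (T (Suc r) * c)"
      unfolding Tc[OF rr(1)] Tc[OF rr(2)] by simp
  qed
  have xr: "nilp (x r - \<kappa> (v (i r))) (\<epsilon> i)" "x r * \<epsilon> i = \<epsilon> i * x r" if "i \<in> D" "r \<in> {1..n}" for r i
    using x_nilp[of i r] x_\<epsilon>[of r i] E[of i] that D(2) by (cases "i \<in> C"; auto simp: nilp_def)+
  interpret B: orbit_system \<kappa> q e v n D c "\<lambda>r. x r * c" \<epsilon>
  proof
    show "\<epsilon> i * \<epsilon> j = (if i = j then \<epsilon> i else 0)" if "i \<in> D" "j \<in> D" for i j
      using \<epsilon>_mult[of i j] E[of i] E[of j] D(2) that by (cases "i \<in> C"; cases "j \<in> C") auto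
    show "(\<Sum>i\<in>D. \<epsilon> i) = c" by (simp add: c)
    show "x r * c * c = x r * c" "c * (x r * c) = x r * c" if "r \<in> {1..n}" for r
      using O(1)[OF that] cc by (metis mult.assoc)+
    show "x r * c * \<epsilon> i = \<epsilon> i * (x r * c)" if "r \<in> {1..n}" "i \<in> D" for r i
      using xr(2)[OF that(2,1)] O(3)[OF that(2)] by (metis O(1) mult.assoc that(1))
    show "x r * c * (x s * c) = x s * c * (x r * c)" if "r \<in> {1..n}" "s \<in> {1..n}" for r s
      using R that unfolding hecke_relations_def by blast
    show "nilp (x r * c - \<kappa> (v (i r))) (\<epsilon> i)" if "i \<in> D" "r \<in> {1..n}" for r i
    proof (rule nilp_cong[OF _ _ xr(1)[OF that]])
      show "(x r * c - \<kappa> (v (i r))) * \<epsilon> i = (x r - \<kappa> (v (i r))) * \<epsilon> i"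
        using O(3)[OF that(1)] by (simp add: left_diff_distrib mult.assoc)
      show "(x r - \<kappa> (v (i r))) * \<epsilon> i = \<epsilon> i * (x r - \<kappa> (v (i r)))"
        using xr(2)[OF that] by (simp add: left_diff_distrib right_diff_distrib \<kappa>_central[of "\<epsilon> i"])
    qed
  qed (use D in auto)
  show ?thesis
  proof (rule B.hecke_full_of_relations[OF R])
    show "T r * c * c = T r * c" "c * (T r * c) = T r * c" if "r \<in> {1..<n}" for r
      using O(2)[OF that] cc by (metis mult.assoc)+
  qed
qed

section \<open>The block of the Hecke algebra and the cyclotomic KLR algebra\<close>

lemma (in word_eval) ev_corner:
  assumes c: "\<And>g. c * \<phi> g = \<phi> g * c" "c * u = c" "u * c = c" "c * c = c"
  shows "word_eval \<kappa> c (\<lambda>g. \<phi> g * c)" "word_eval.ev \<kappa> c (\<lambda>g. \<phi> g * c) p = ev p * c"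
    "c * ev p = ev p * c"
proof -
  show W: "word_eval \<kappa> c (\<lambda>g. \<phi> g * c)"
    by unfold_locales (use c in \<open>simp_all add: mult.assoc mult.assoc[symmetric, of c]\<close>)
  interpret W: word_eval \<kappa> c "\<lambda>g. \<phi> g * c" by (rule W)
  interpret presentation UNIV "\<lambda>_ _. False" "{}" by unfold_locales auto
  have p: "p \<in> words_in UNIV" by (simp add: words_in_def)
  have "c * ev p = ev p * c \<and> W.ev p = ev p * c"
    using p
  proof (induction rule: free_alg_induct[case_names gen one add mult smult])
    case (gen g) then show ?case by (simp add: ev_gen W.ev_gen c)
  next
    case one then show ?case by (simp add: ev_1 W.ev_1 c)
  next
    case (add a b) then show ?case by (simp add: ev_add W.ev_add distrib_left distrib_right)
  next
    case (mult a b)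
    have ac: "c * ev a = ev a * c" and bc: "c * ev b = ev b * c" using mult.IH by auto
    have "ev a * c * (ev b * c) = ev a * (c * ev b) * c" by (simp only: mult.assoc)
    also have "\<dots> = ev a * ev b * c" by (simp only: bc mult.assoc c(4))
    finally have "ev a * c * (ev b * c) = ev a * ev b * c" .
    moreover have "c * (ev a * ev b) = ev a * ev b * c"
      using ac bc by (metis mult.assoc)
    ultimately show ?case using mult.IH by (simp add: ev_mult W.ev_mult)
  next
    case (smult a d)
    have "ev (scal d * a) = \<kappa> d * ev a" by (simp only: ev_mult ev_scal mult.assoc ev_u)
    moreover have "W.ev (scal d * a) = \<kappa> d * W.ev a" by (simp only: W.ev_mult W.ev_scal mult.assoc W.ev_u)
    ultimately show ?case using smult.IH by (simp add: \<kappa>_mult_left mult.assoc)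
  qed
  then show "c * ev p = ev p * c" "W.ev p = ev p * c" by auto
qed

text \<open>The generalized eigenspace that defines \<open>E i\<close>, in the common
  variables.\<close>

lemma (in embedded) weights_typed:
  assumes a: "a \<noteq> 0" and X: "\<And>r. r \<in> {1..n} ==> X r \<in> carrier A"
    "\<And>r. r \<in> {1..n} ==> \<rho> (X r) = \<kappa> a * x r + \<kappa> b * \<rho> \<one>" "\<And>r. r \<in> {1..n} ==> \<rho> \<one> * x r = x r"
    and E: "weight_idempotents (\<lambda>j. a * v j + b) n e A X E" and i: "i \<in> tuples n e" and h: "h \<in> carrier A"
  shows "\<rho> (E i) * \<rho> h = \<rho> h \<longleftrightarrow> (\<forall>r\<in>{1..n}. nilp (x r - \<kappa> (v (i r))) (\<rho> h))"
proof -
  let ?d = "\<lambda>r. X r \<ominus> ((a * v (i r) + b) \<odot> \<one>)"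
  have Ei: "E i \<in> carrier A" "E i \<otimes> E i = E i" using E i by (auto simp: weight_idempotents_def)
  have im: "(\<lambda>h. E i \<otimes> h) ` carrier A =
      {h \<in> carrier A. \<forall>r\<in>{1..n}. \<exists>M::nat. \<forall>m\<ge>M. (?d r [^] m) \<otimes> h = \<zero>}"
    using E i unfolding weight_idempotents_def by blast
  have "\<rho> (E i) * \<rho> h = \<rho> h \<longleftrightarrow> E i \<otimes> h = h"
    using \<rho>_mult[OF Ei(1) h] \<rho>_inj[of "E i \<otimes> h" h] Ei h by simp
  also have "\<dots> \<longleftrightarrow> h \<in> (\<lambda>h. E i \<otimes> h) ` carrier A"
  proof
    assume "h \<in> (\<lambda>h. E i \<otimes> h) ` carrier A"
    then obtain k where "k \<in> carrier A" "h = E i \<otimes> k" by blast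
    then show "E i \<otimes> h = h" using Ei by (simp add: m_assoc[symmetric])
  qed (use h in \<open>auto intro: rev_image_eqI\<close>)
  also have "\<dots> \<longleftrightarrow> (\<forall>r\<in>{1..n}. \<exists>M::nat. \<forall>m\<ge>M. (?d r [^] m) \<otimes> h = \<zero>)"
    unfolding im using h by simp
  also have "\<dots> \<longleftrightarrow> (\<forall>r\<in>{1..n}. nilp (x r - \<kappa> (v (i r))) (\<rho> h))"
  proof (rule ball_cong[OF refl])
    fix r assume r: "r \<in> {1..n}"
    let ?g = "x r - \<kappa> (v (i r)) * \<rho> \<one>"
    have dr: "?d r \<in> carrier A" using X r by simp
    have "\<rho> (?d r) = \<kappa> a * x r + \<kappa> b * \<rho> \<one> - \<kappa> (a * v (i r) + b) * \<rho> \<one>"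
      using \<rho>_minus[of "X r" "(a * v (i r) + b) \<odot> \<one>"] \<rho>_smult[of \<one>] X r by simp
    also have "\<dots> = \<kappa> a * ?g"
      by (simp add: K.\<kappa>_add K.\<kappa>_mult distrib_right right_diff_distrib mult.assoc)
    finally have \<rho>d: "\<rho> (?d r) = \<kappa> a * ?g" .
    have "(?d r [^] m) \<otimes> h = \<zero> \<longleftrightarrow> (\<kappa> a * ?g) ^ m * \<rho> h = 0" for m :: nat
      using \<rho>_pow[OF dr h, of m] \<rho>_inj[of "(?d r [^] m) \<otimes> h" \<zero>] dr h by (simp add: \<rho>d)
    then have "(\<exists>M::nat. \<forall>m\<ge>M. (?d r [^] m) \<otimes> h = \<zero>) \<longleftrightarrow> (\<exists>M. \<forall>m\<ge>M. (\<kappa> a * ?g) ^ m * \<rho> h = 0)" by simp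
    also have "\<dots> \<longleftrightarrow> nilp (\<kappa> a * ?g) (\<rho> h)"
      unfolding nilp_def using nilp_le by blast
    also have "\<dots> \<longleftrightarrow> nilp ?g (\<rho> h)" by (rule K.nilp_\<kappa>_iff[OF a])
    also have "\<dots> \<longleftrightarrow> nilp (x r - \<kappa> (v (i r))) (\<rho> h)"
    proof (rule nilp_agree[where u = "\<rho> \<one>"])
      show "\<rho> \<one> * \<rho> h = \<rho> h" using \<rho>_unit h by blast
      show "?g * z = (x r - \<kappa> (v (i r))) * z \<and> \<rho> \<one> * ((x r - \<kappa> (v (i r))) * z) = (x r - \<kappa> (v (i r))) * z"
        if z: "\<rho> \<one> * z = z" for z
      proof
        show "?g * z = (x r - \<kappa> (v (i r))) * z" using z by (simp add: left_diff_distrib mult.assoc)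
        have "\<rho> \<one> * (x r * z) = x r * z" using X(3)[OF r] by (simp add: mult.assoc[symmetric])
        then show "\<rho> \<one> * ((x r - \<kappa> (v (i r))) * z) = (x r - \<kappa> (v (i r))) * z"
          using z by (simp add: left_diff_distrib right_diff_distrib K.\<kappa>_mult_left[of "\<rho> \<one>"])
      qed
    qed
    finally show "(\<exists>M::nat. \<forall>m\<ge>M. (?d r [^] m) \<otimes> h = \<zero>) \<longleftrightarrow> nilp (x r - \<kappa> (v (i r))) (\<rho> h)" .
  qed
  finally show ?thesis .
qed

context embedded
begin

text \<open>The \<open>x r\<close> preserve the generalized eigenspaces, hence commute with the
  projections.\<close>

lemma hecke_weight_system:
  assumes Q: "quantum q e v" and a: "a \<noteq> 0" and X: "\<And>r. r \<in> {1..n} ==> X r \<in> carrier A"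
    "\<And>r. r \<in> {1..n} ==> \<rho> (X r) = \<kappa> a * x r + \<kappa> b * \<rho> \<one>"
    and xS: "\<And>r. r \<in> {1..n} ==> x r \<in> \<rho> ` carrier A"
    and xx: "\<And>r s. r \<in> {1..n} ==> s \<in> {1..n} ==> x r * x s = x s * x r"
    and E: "weight_idempotents (\<lambda>j. a * v j + b) n e A X E"
  shows "weight_system \<kappa> q e v n {i \<in> tuples n e. E i \<noteq> \<zero>} (\<rho> \<one>) x (\<lambda>i. \<rho> (E i))"
proof -
  interpret quantum q e v by (rule Q)
  let ?I = "{i \<in> tuples n e. E i \<noteq> \<zero>}" and ?u = "\<rho> \<one>"
  let ?E = "\<lambda>i. \<rho> (E i)"
  have Ec: "E i \<in> carrier A" if "i \<in> tuples n e" for i using E that by (simp add: weight_idempotents_def)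
  have fin: "finite ?I" using E by (simp add: weight_idempotents_def)
  have EE: "?E i * ?E j = (if i = j then ?E i else 0)" if "i \<in> tuples n e" "j \<in> tuples n e" for i j
    using E that \<rho>_mult[OF Ec[OF that(1)] Ec[OF that(2)], symmetric] by (simp add: weight_idempotents_def)
  have sum: "(\<Sum>i\<in>?I. ?E i) = ?u"
    using \<rho>_finsum[OF fin, of E] Ec E by (simp add: weight_idempotents_def)
  have ux: "?u * x r = x r" "x r * ?u = x r" if "r \<in> {1..n}" for r using \<rho>_unit xS[OF that] by blast+
  have W: "?E i * z = z \<longleftrightarrow> (\<forall>r\<in>{1..n}. nilp (x r - \<kappa> (v (i r))) z)"
    if "i \<in> tuples n e" "z \<in> \<rho> ` carrier A" for i z
    using weights_typed[OF a X ux(1) E that(1)] that(2) by blast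
  have nil: "nilp (x r - \<kappa> (v (i r))) (?E i)" if "i \<in> tuples n e" "r \<in> {1..n}" for i r
    using W[OF that(1), of "?E i"] EE[OF that(1) that(1)] Ec[OF that(1)] that(2) by simp
  have Ex: "?E i * (x r * ?E i) = x r * ?E i" if i: "i \<in> tuples n e" and r: "r \<in> {1..n}" for i r
  proof -
    have "x r * ?E i \<in> \<rho> ` carrier A"
      using \<rho>_subalg xS[OF r] Ec[OF i] unfolding K.subalg_def by blast
    moreover have "nilp (x s - \<kappa> (v (i s))) (x r * ?E i)" if s: "s \<in> {1..n}" for s
    proof -
      obtain m where m: "(x s - \<kappa> (v (i s))) ^ m * ?E i = 0" using nil[OF i s] by (auto simp: nilp_def)
      have "(x s - \<kappa> (v (i s))) ^ m * x r = x r * (x s - \<kappa> (v (i s))) ^ m"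
        by (rule power_commute) (simp add: left_diff_distrib right_diff_distrib xx[OF r s] K.\<kappa>_central[of "x r"])
      then have "(x s - \<kappa> (v (i s))) ^ m * (x r * ?E i) = x r * ((x s - \<kappa> (v (i s))) ^ m * ?E i)"
        by (simp only: mult.assoc[symmetric])
      then show ?thesis using m by (auto simp: nilp_def)
    qed
    ultimately show ?thesis using W[OF i] by blast
  qed
  show ?thesis
  proof
    show "x r * ?E i = ?E i * x r" if r: "r \<in> {1..n}" and i: "i \<in> ?I" for r i
    proof -
      have "?E i * x r = ?E i * x r * ?u" using ux[OF r] by (simp add: mult.assoc)
      also have "\<dots> = (\<Sum>j\<in>?I. ?E i * (x r * ?E j))" unfolding sum[symmetric] by (simp only: sum_distrib_left mult.assoc)
      also have "\<dots> = (\<Sum>j\<in>?I. if j = i then x r * ?E i else 0)"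
      proof (rule sum.cong[OF refl])
        fix j assume j: "j \<in> ?I"
        have "?E i * (x r * ?E j) = (?E i * ?E j) * (x r * ?E j)" using Ex[of j r] j r by (simp add: mult.assoc)
        then show "?E i * (x r * ?E j) = (if j = i then x r * ?E i else 0)" using EE[of i j] Ex[of i r] i j r by auto
      qed
      also have "\<dots> = x r * ?E i" using i fin by simp
      finally show ?thesis by simp
    qed
  qed (use fin EE sum ux xx nil in auto)
qed

end

context klr_index
begin

text \<open>The KLR generators found inside the block and the Hecke generators found inside the
  cyclotomic KLR algebra satisfy the cyclotomic relations too, and so give homomorphisms in both
  directions. The homomorphism from the Hecke algebra sends its weight idempotents to the KLR
  idempotents of the orbit and all others to zero, as these are determined by eigenvalues;
  therefore it restricts to the block as a unital map. Matched systems are transported to matched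
  systems, so that the composites fix the generators.\<close>

theorem klr_block_iso:
  fixes G :: "hecke_gen set" and R :: "'k hecke_free \<Rightarrow> 'k hecke_free \<Rightarrow> bool"
  assumes D: "hecke_data q a b n G R" and fin: "finite {i \<in> residue_set e. \<Lambda> i \<noteq> 0}"
  defines "P \<equiv> hecke_cyc_elem (\<lambda>j. a * v j + b) e \<Lambda>"
  defines "A \<equiv> cyc_alg G R {P}" and "X \<equiv> \<lambda>r. cyc_class G R {P} (hX r)"
  assumes E: "weight_idempotents (\<lambda>j. a * v j + b) n e A X E"
  shows "cyc_alg RG RR RS \<cong>\<^sub>a\<^sub>l\<^sub>g block_alg A E C"
proof -
  let ?K = "cyc_alg RG RR RS" and ?cK = "cyc_class RG RR RS" and ?cA = "cyc_class G R {P}"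
  interpret H: presentation G R "{P}" unfolding P_def by (rule hecke_presentation[OF D n1])
  have a: "a \<noteq> 0" using D by (auto simp: hecke_data_def)
  note C = orbit_facts[OF orbit]
  note gens = hecke_gens_cases[OF D]
  have gG: "r \<in> {1..n} ==> GX r \<in> G" "r \<in> {1..<n} ==> GT r \<in> G" "q \<noteq> 1 ==> r \<in> {1..n} ==> GXinv r \<in> G" for r
    using gens by auto
  have kA: "kalg A" unfolding A_def by (rule H.cyc_kalg)
  obtain \<rho> :: "'k hecke_free set set \<Rightarrow> ('k hecke_free set set, 'k) lin_end" where \<rho>': "embedded A homothety \<rho>" using embedded_exists[OF kA] .
  note \<rho> = \<rho>'[unfolded A_def]
  interpret EA: embedded A homothety \<rho> by (rule \<rho>')
  let ?\<kappa> = "homothety :: 'k \<Rightarrow> (('k hecke_free) set set, 'k) lin_end"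
  define \<phi> where "\<phi> g = (if g \<in> G then \<rho> (?cA (gen g)) else 0)" for g
  note t = H.typed_relations[OF \<rho>, folded \<phi>_def[abs_def], folded A_def]
  define u where "u = \<rho> \<one>\<^bsub>A\<^esub>"
  interpret W: word_eval ?\<kappa> u \<phi> unfolding u_def by (rule t(1))
  have cA: "\<rho> (?cA p) = W.ev p" if "p \<in> words_in G" for p
    unfolding u_def using H.typed_class[OF \<rho>, folded A_def, OF t(1) _ that] by (simp add: \<phi>_def)
  let ?S = "\<rho> ` carrier A"
  have S: "EA.K.subalg ?S" "\<And>z. z \<in> ?S ==> u * z = z \<and> z * u = z" "u \<in> ?S" "0 \<in> ?S"
    using EA.\<rho>_subalg EA.\<rho>_unit imageI[OF EA.zero_closed, of \<rho>] unfolding u_def by auto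
  have Scl: "z \<in> ?S ==> w \<in> ?S ==> z + w \<in> ?S" "z \<in> ?S ==> w \<in> ?S ==> z * w \<in> ?S"
    "z \<in> ?S ==> w \<in> ?S ==> z - w \<in> ?S" "z \<in> ?S ==> ?\<kappa> d * z \<in> ?S" for z w d
    using S(1) EA.K.subalg_minus unfolding EA.K.subalg_def by blast+
  have \<phi>S: "\<phi> g \<in> ?S" for g
    using H.typed_relations(2)[OF \<rho>, of g, folded A_def] by (simp only: \<phi>_def)
  define x where "x r = ?\<kappa> (inverse a) * (\<phi> (GX r) - ?\<kappa> b * u)" for r
  define T where "T r = \<phi> (GT r)" for r
  have xS: "x r \<in> ?S" and TS: "T r \<in> ?S" for r
    unfolding x_def T_def using \<phi>S S Scl by auto
  have \<phi>x: "\<phi> (GX r) = ?\<kappa> a * x r + ?\<kappa> b * u" for r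
    unfolding x_def by (simp add: mult.assoc[symmetric] EA.K.\<kappa>_mult[symmetric] a)
  have rel: "hecke_relations ?\<kappa> q n u x T \<and>
      (q \<noteq> 1 \<longrightarrow> (\<forall>r\<in>{1..n}. \<phi> (GX r) * \<phi> (GXinv r) = u \<and> \<phi> (GXinv r) * \<phi> (GX r) = u))"
    using EA.K.hecke_data_iff[OF D W.word_eval_axioms \<phi>x T_def[symmetric]] S(2)[OF xS] t(3)[folded u_def] by blast
  then have hr: "hecke_relations ?\<kappa> q n u x T" by blast
  have P0: "W.ev P = 0" using t(4)[of P] by (simp add: u_def)
  have Xc: "X r \<in> carrier A" "\<rho> (X r) = ?\<kappa> a * x r + ?\<kappa> b * \<rho> \<one>\<^bsub>A\<^esub>" if "r \<in> {1..n}" for r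
  proof -
    note w = words_in_gen[OF gG(1)[OF that]]
    show "X r \<in> carrier A" using H.class_closed[OF w] by (simp add: X_def A_def)
    have "\<rho> (X r) = \<phi> (GX r)" using cA[OF w] by (simp add: X_def W.ev_gen)
    then show "\<rho> (X r) = ?\<kappa> a * x r + ?\<kappa> b * \<rho> \<one>\<^bsub>A\<^esub>" unfolding \<phi>x u_def .
  qed
  let ?I = "{i \<in> tuples n e. E i \<noteq> \<zero>\<^bsub>A\<^esub>}" and ?E = "\<lambda>i. \<rho> (E i)"
  have xx: "x r * x s = x s * x r" if "r \<in> {1..n}" "s \<in> {1..n}" for r s
    using hr that unfolding hecke_relations_def by blast
  interpret V: weight_system ?\<kappa> q e v n ?I u x ?E
    unfolding u_def by (rule EA.hecke_weight_system[OF quantum_axioms a Xc xS xx E])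
  have Tu: "T r * u = T r" "u * T r = T r" for r using S(2)[OF TS] by blast+
  interpret V: hecke_rep ?\<kappa> q e v n ?I u x ?E T
    by (rule V.hecke_rep_of_relations[OF hr Tu])
  have E0: "?E i = 0" if "i \<in> tuples n e" "i \<notin> ?I" for i using that by simp
  have Ec: "E i \<in> carrier A" if "i \<in> tuples n e" for i using E that by (simp add: weight_idempotents_def)
  define c where "c = (\<Sum>i\<in>C. ?E i)"
  have O: "\<And>r. r \<in> {1..n} ==> c * x r = x r * c" "\<And>r. r \<in> {1..<n} ==> c * T r = T r * c"
    "\<And>i. i \<in> C ==> c * ?E i = ?E i \<and> ?E i * c = ?E i" "c * u = c" "u * c = c"
    by (rule V.orbit_sum_commutes[OF C E0 c_def]; assumption)+
  have cc: "c * c = c"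
    unfolding c_def sum_distrib_left by (rule sum.cong) (use O(3) c_def in auto)
  have c\<phi>: "c * \<phi> g = \<phi> g * c" for g
  proof (cases "g \<in> G")
    case True
    have cX: "c * \<phi> (GX r) = \<phi> (GX r) * c" if "r \<in> {1..n}" for r
      unfolding \<phi>x using O(1)[OF that] O(4,5) by (simp add: distrib_left distrib_right EA.K.\<kappa>_mult_left mult.assoc)
    have cI: "\<phi> (GXinv r) * c = c * \<phi> (GXinv r)" if "r \<in> {1..n}" "q \<noteq> 1" for r
      by (rule inverse_commute[where u = u and f = "\<phi> (GX r)"])
        (use rel that cX[OF that(1)] O(4,5) W.u_left W.u_right in auto)
    from True show ?thesis unfolding gens using cX cI O(2) by (auto simp: T_def)
  qed (simp add: \<phi>_def)
  note corner = W.ev_corner[OF c\<phi> O(4,5) cc]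
  define eC where "eC = finsum A E C"
  have eC: "eC \<in> carrier A" "\<rho> eC = c"
  proof -
    have "E i \<in> carrier A" if "i \<in> C" for i using Ec C(2) that by blast
    then show "eC \<in> carrier A" "\<rho> eC = c"
      unfolding eC_def c_def using EA.\<rho>_finsum[OF C(1), of E] EA.finsum_closed[of E C] by blast+
  qed
  have central: "h \<otimes>\<^bsub>A\<^esub> eC = eC \<otimes>\<^bsub>A\<^esub> h" if h: "h \<in> carrier A" for h
  proof -
    obtain p where p: "p \<in> words_in G" "h = ?cA p" using h H.cyc_carrier unfolding A_def by blast
    have "\<rho> (h \<otimes>\<^bsub>A\<^esub> eC) = \<rho> (eC \<otimes>\<^bsub>A\<^esub> h)"
      using corner(3)[of p] cA[OF p(1)] h eC by (simp add: EA.\<rho>_mult p(2))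
    then show ?thesis using EA.\<rho>_inj h eC by simp
  qed
  have ee: "eC \<otimes>\<^bsub>A\<^esub> eC = eC"
    using EA.\<rho>_inj[of "eC \<otimes>\<^bsub>A\<^esub> eC" eC] EA.\<rho>_mult[OF eC(1) eC(1)] eC cc by simp
  define B where "B = block_alg A E C"
  have Bdef: "B = A\<lparr>carrier := (\<lambda>h. h \<otimes>\<^bsub>A\<^esub> eC) ` carrier A, one := eC\<rparr>"
    by (simp add: B_def block_alg_def eC_def)
  have kB: "kalg B" unfolding Bdef by (rule corner_kalg(1)[OF kA eC(1) ee central])
  have Bmem: "h \<in> carrier B \<longleftrightarrow> h \<in> carrier A \<and> h \<otimes>\<^bsub>A\<^esub> eC = h" for h
    unfolding Bdef by (rule corner_kalg(2)[OF kA eC(1) ee central])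
  have Bops: "monoid.mult B = monoid.mult A" "one B = eC" "add B = add A" "smult B = smult A"
    by (simp_all add: Bdef)
  have \<rho>B: "embedded B ?\<kappa> \<rho>"
  proof (intro embedded.intro kB embedded_axioms.intro)
    have "carrier B \<subseteq> carrier A" using Bmem by blast
    then show "embeds ?\<kappa> B \<rho>" using EA.emb unfolding embeds_def Bops by (meson inj_on_subset subsetD)
  qed
  interpret EB: embedded B ?\<kappa> \<rho> by (rule \<rho>B)
  let ?SB = "\<rho> ` carrier B"
  have SB: "EA.K.subalg ?SB" "\<And>z. z \<in> ?SB ==> c * z = z \<and> z * c = z"
    using EB.\<rho>_subalg EB.\<rho>_unit eC(2) unfolding Bops by auto
  have SBI: "z * c \<in> ?SB" if "z \<in> ?S" for z
  proof -
    from that obtain h where h': "z = \<rho> h" "h \<in> carrier A" by (rule imageE)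
    note h = h'(2,1)
    have "h \<otimes>\<^bsub>A\<^esub> eC \<in> carrier B" using h by (simp add: Bdef)
    then show ?thesis using EA.\<rho>_mult[OF h(1) eC(1)] eC(2) h(2) by (metis imageI)
  qed
  have BA: "h \<in> carrier A" if "h \<in> carrier B" for h using Bmem that by blast
  have SBS: "?SB \<subseteq> ?S" by (rule image_mono) (rule subsetI, rule BA)
  have cS: "c \<in> ?SB" using SBI[OF imageI[OF eC(1), of \<rho>]] eC(2) cc by simp
  have ES: "?E i \<in> ?SB" if "i \<in> C" for i
  proof -
    have "?E i \<in> ?S" by (rule imageI[OF Ec[OF subsetD[OF C(2) that]]])
    from SBI[OF this] show ?thesis using O(3)[OF that] by simp
  qed
  let ?x = "\<lambda>r. x r * c" and ?T = "\<lambda>r. T r * c"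
  interpret HB: hecke_full ?\<kappa> q e v n C c ?x ?E ?T
    by (rule V.block_restrict[OF hr C E0 c_def])
  have "\<exists>yB \<psi>B. (\<forall>r\<in>{1..n}. yB r \<in> ?SB) \<and> (\<forall>r\<in>{1..<n}. \<psi>B r \<in> ?SB) \<and>
      matched ?\<kappa> q e v n C c ?x ?E ?T yB \<psi>B"
  proof (rule HB.matched_exists[OF SB cS SBI[OF xS] SBI[OF TS] ES])
    fix yB \<psi>B
    assume "\<And>r. r \<in> {1..n} ==> yB r \<in> ?SB" "\<And>r. r \<in> {1..<n} ==> \<psi>B r \<in> ?SB"
      "matched ?\<kappa> q e v n C c ?x ?E ?T yB \<psi>B"
    then show ?thesis by (intro exI conjI ballI)
  qed
  then obtain yB \<psi>B where yB': "\<forall>r\<in>{1..n}. yB r \<in> ?SB" "\<forall>r\<in>{1..<n}. \<psi>B r \<in> ?SB"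
      and MB: "matched ?\<kappa> q e v n C c ?x ?E ?T yB \<psi>B" by (elim exE conjE) (rule that)
  note yB = bspec[OF yB'(1)] bspec[OF yB'(2)]
  \<comment> \<open>the KLR side\<close>
  obtain \<rho>K :: "'k klr_free set set \<Rightarrow> ('k klr_free set set, 'k) lin_end" where \<rho>K: "embedded ?K homothety \<rho>K" using embedded_exists[OF R.cyc_kalg] .
  interpret EK: embedded ?K homothety \<rho>K by (rule \<rho>K)
  let ?\<kappa>' = "homothety :: 'k \<Rightarrow> (('k klr_free) set set, 'k) lin_end"
  define \<phi>K where "\<phi>K g = (if g \<in> RG then \<rho>K (?cK (gen g)) else 0)" for g
  define uK where "uK = \<rho>K \<one>\<^bsub>?K\<^esub>"
  note tK = R.typed_relations[OF \<rho>K, folded \<phi>K_def[abs_def], folded uK_def]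
  have imK: "\<phi>K g \<in> \<rho>K ` carrier ?K" for g using R.typed_relations(2)[OF \<rho>K, of g] by (simp only: \<phi>K_def)
  interpret WK: word_eval ?\<kappa>' uK \<phi>K by (rule tK(1))
  have cK: "\<rho>K (?cK p) = WK.ev p" if "p \<in> words_in RG" for p
    using R.typed_class[OF \<rho>K, folded uK_def, OF tK(1) _ that] by (simp add: \<phi>K_def)
  let ?SK = "\<rho>K ` carrier ?K"
  have SK: "EK.K.subalg ?SK" "\<And>z. z \<in> ?SK ==> uK * z = z \<and> z * uK = z" "uK \<in> ?SK" "0 \<in> ?SK"
    using EK.\<rho>_subalg EK.\<rho>_unit imageI[OF EK.zero_closed, of \<rho>K] unfolding uK_def by auto
  have SKcl: "z \<in> ?SK ==> z' \<in> ?SK ==> z + z' \<in> ?SK" "z \<in> ?SK ==> ?\<kappa>' d * z \<in> ?SK" for z z' d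
    using SK(1) unfolding EK.K.subalg_def by blast+
  let ?yK = "\<lambda>r. \<phi>K (Y r)" and ?\<psi>K = "\<lambda>r. \<phi>K (Psi r)" and ?\<epsilon> = "\<lambda>i. \<phi>K (Eps i)"
  interpret YK: klr_y ?\<kappa>' q e v n C uK ?yK ?\<psi>K ?\<epsilon> by (rule typed_klr_y[OF tK(1,3)])
  have nilK: "nilp (?yK r) (?\<epsilon> i)" if "r \<in> {1..n}" "i \<in> C" for r i
    by (rule typed_nilp[OF tK(1,3,4) that])
  have "\<exists>xK TK. (\<forall>r\<in>{1..n}. xK r \<in> ?SK) \<and> (\<forall>r\<in>{1..<n}. TK r \<in> ?SK) \<and>
      matched ?\<kappa>' q e v n C uK xK ?\<epsilon> TK ?yK ?\<psi>K"
  proof (rule YK.matched_exists[OF nilK SK(1-3) imK imK imK])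
    fix xK TK
    assume "\<And>r. r \<in> {1..n} ==> xK r \<in> ?SK" "\<And>r. r \<in> {1..<n} ==> TK r \<in> ?SK"
      "matched ?\<kappa>' q e v n C uK xK ?\<epsilon> TK ?yK ?\<psi>K"
    then show ?thesis by (intro exI conjI ballI)
  qed
  then obtain xK TK where xK': "\<forall>r\<in>{1..n}. xK r \<in> ?SK" "\<forall>r\<in>{1..<n}. TK r \<in> ?SK"
      and MK: "matched ?\<kappa>' q e v n C uK xK ?\<epsilon> TK ?yK ?\<psi>K" by (elim exE conjE) (rule that)
  note xK = bspec[OF xK'(1)] bspec[OF xK'(2)]
  interpret HK: hecke_full ?\<kappa>' q e v n C uK xK ?\<epsilon> TK by (rule matchedD(1)[OF MK])
  have n1': "1 \<in> {1..n}" using n1 by simp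
  \<comment> \<open>from the KLR algebra to the block\<close>
  define \<phi>f where "\<phi>f g = (case g of Y r \<Rightarrow> if r \<in> {1..n} then yB r else 0 | Psi r \<Rightarrow> if r \<in> {1..<n} then \<psi>B r else 0
      | Eps i \<Rightarrow> if i \<in> C then ?E i else 0 | Inv p \<Rightarrow> 0)" for g :: "'k mpol klr_gen"
  have zB: "0 \<in> ?SB" using EB.\<rho>_0 EB.zero_closed by (metis imageI)
  have \<phi>fS: "\<phi>f g \<in> ?SB" for g using yB ES zB by (simp add: \<phi>f_def split: klr_gen.split)
  interpret Wf: word_eval ?\<kappa> c \<phi>f using EB.word_evalI[OF \<phi>fS] by (simp add: Bops eC(2))
  have cyc_iff: "word_eval.ev ?\<kappa> c (\<lambda>g. \<phi> g * c) P * ?E i = 0 \<longleftrightarrow> yB 1 ^ \<Lambda> (i 1) * ?E i = 0" if i: "i \<in> C" for i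
    unfolding P_def
  proof (rule HB.cyclotomic_iff[OF corner(1) _ n1 a i _ _ fin])
    show "\<phi> (GX 1) * c = ?\<kappa> a * ?x 1 + ?\<kappa> b * c" unfolding \<phi>x by (simp add: distrib_right mult.assoc O(5))
    show "?x 1 * ?E i = (?\<kappa> (v (i 1)) + ?\<kappa> (w (i 1)) * yB 1) * ?E i" by (rule matchedD(3)[OF MB n1' i])
    show "yB 1 * ?E i = ?E i * yB 1" by (rule klr_y.y_\<epsilon>[OF matchedD(2)[OF MB] n1' i])
  qed
  have "\<exists>f. alg_hom ?K B f \<and> (\<forall>p\<in>words_in RG. \<rho> (f (?cK p)) = Wf.ev p)"
  proof (rule R.typed_lift_ex[OF \<rho>B \<phi>fS, unfolded Bops eC(2)])
    fix l r assume lr: "RR l r"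
    have "(\<forall>l r. RR l r \<longrightarrow> Wf.ev l = Wf.ev r) \<longleftrightarrow> klr_y ?\<kappa> q e v n C c yB \<psi>B ?E"
      by (rule Wf.klr_rel_iff[OF Wf.word_eval_axioms quantum_axioms C]) (simp_all add: \<phi>f_def)
    then show "Wf.ev l = Wf.ev r" using matchedD(2)[OF MB] lr by blast
  next
    fix s assume "s \<in> RS"
    then obtain i where i: "i \<in> C" "s = yg 1 ^ \<Lambda> (i 1) * epsg i" by (auto simp: klr_cyc_elems_def)
    have "Wf.ev s = yB 1 ^ \<Lambda> (i 1) * ?E i"
      unfolding i(2) cyc_elem_ev[OF Wf.word_eval_axioms] using i(1) n1' by (simp add: \<phi>f_def)
    also have "\<dots> = 0" using cyc_iff[OF i(1)] unfolding corner(2) P0 by simp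
    finally show "Wf.ev s = 0" .
  qed
  then obtain f where f: "alg_hom ?K B f" "\<And>p. p \<in> words_in RG ==> \<rho> (f (?cK p)) = Wf.ev p"
    by (elim exE conjE) (rule that, assumption, erule bspec)
  \<comment> \<open>from the Hecke algebra to the KLR algebra\<close>
  have "\<exists>z\<in>?SK. (q \<noteq> 1 \<longrightarrow> (?\<kappa>' a * xK r + ?\<kappa>' b * uK) * z = uK \<and> z * (?\<kappa>' a * xK r + ?\<kappa>' b * uK) = uK)"
    if r: "r \<in> {1..n}" for r
  proof (cases "q = 1")
    case False
    let ?X = "?\<kappa>' a * xK r + ?\<kappa>' b * uK"
    have ab: "a = q - 1" "b = 1" using D False unfolding hecke_data_def by blast+
    have we: "w j = a * v j + b" for j unfolding ab w_def by (rule add.commute)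
    have "\<exists>z\<in>?SK. ?X * z = uK \<and> z * ?X = uK"
    proof (rule EK.K.inverse_by_weights_ex[OF YK.C_finite YK.\<epsilon>_sum SK(1-3)])
      show "?X \<in> ?SK" by (rule SKcl(1)[OF SKcl(2)[OF xK(1)[OF r]] SKcl(2)[OF SK(3)]])
      show "?\<epsilon> i \<in> ?SK" for i by (rule imK)
      show X\<epsilon>: "?X * ?\<epsilon> i = ?\<epsilon> i * ?X" if "i \<in> C" for i
        using HK.x_\<epsilon>[OF r that] HK.u_\<epsilon>[OF that]
        by (simp add: distrib_left distrib_right mult.assoc EK.K.\<kappa>_mult_left[of "?\<epsilon> i"])
      show "\<exists>d. d \<noteq> 0 \<and> nilp (?X - ?\<kappa>' d) (?\<epsilon> i)" if i: "i \<in> C" for i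
      proof (intro exI conjI)
        show "w (i r) \<noteq> 0" by (rule w_nz)
        show "nilp (?X - ?\<kappa>' (w (i r))) (?\<epsilon> i)"
        proof (rule nilp_cong[OF _ _ EK.K.nilp_\<kappa>[OF HK.x_nilp[OF i r], of a]])
          show "(?X - ?\<kappa>' (w (i r))) * ?\<epsilon> i = ?\<kappa>' a * (xK r - ?\<kappa>' (v (i r))) * ?\<epsilon> i"
            unfolding we by (simp only: EK.K.\<kappa>_add EK.K.\<kappa>_mult distrib_right left_diff_distrib
                right_diff_distrib mult.assoc HK.u_\<epsilon>(1)[OF i]) simp
          show "?\<kappa>' a * (xK r - ?\<kappa>' (v (i r))) * ?\<epsilon> i = ?\<epsilon> i * (?\<kappa>' a * (xK r - ?\<kappa>' (v (i r))))"
            using HK.x_\<epsilon>[OF r i]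
            by (simp add: left_diff_distrib right_diff_distrib mult.assoc EK.K.\<kappa>_mult_left[of "?\<epsilon> i"] EK.K.\<kappa>_central[of "?\<epsilon> i"])
        qed
      qed
    qed
    then show ?thesis by blast
  qed (rule bexI[OF _ SK(3)], simp)
  then have "\<forall>r\<in>{1..n}. \<exists>z. z \<in> ?SK \<and> (q \<noteq> 1 \<longrightarrow> (?\<kappa>' a * xK r + ?\<kappa>' b * uK) * z = uK \<and> z * (?\<kappa>' a * xK r + ?\<kappa>' b * uK) = uK)"
    unfolding Bex_def by (rule ballI)
  from bchoice[OF this] obtain zK where zK': "\<forall>r\<in>{1..n}. zK r \<in> ?SK \<and>
      (q \<noteq> 1 \<longrightarrow> (?\<kappa>' a * xK r + ?\<kappa>' b * uK) * zK r = uK \<and> zK r * (?\<kappa>' a * xK r + ?\<kappa>' b * uK) = uK)"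
    by (elim exE) (rule that)
  have zK: "\<And>r. r \<in> {1..n} ==> zK r \<in> ?SK"
    "\<And>r. r \<in> {1..n} ==> q \<noteq> 1 ==> (?\<kappa>' a * xK r + ?\<kappa>' b * uK) * zK r = uK \<and> zK r * (?\<kappa>' a * xK r + ?\<kappa>' b * uK) = uK"
    by (rule conjunct1[OF bspec[OF zK']], assumption) (rule mp[OF conjunct2[OF bspec[OF zK']]])
  define \<phi>g where "\<phi>g g = (case g of GX r \<Rightarrow> if r \<in> {1..n} then ?\<kappa>' a * xK r + ?\<kappa>' b * uK else 0
      | GXinv r \<Rightarrow> if r \<in> {1..n} then zK r else 0 | GT r \<Rightarrow> if r \<in> {1..<n} then TK r else 0)" for g
  have XK: "?\<kappa>' a * xK r + ?\<kappa>' b * uK \<in> ?SK" if "r \<in> {1..n}" for r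
    by (rule SKcl(1)[OF SKcl(2)[OF xK(1)[OF that]] SKcl(2)[OF SK(3)]])
  have \<phi>gS: "\<phi>g g \<in> ?SK" for g using XK xK(2) zK(1) SK(4) by (simp add: \<phi>g_def split: hecke_gen.split)
  interpret Wg: word_eval ?\<kappa>' uK \<phi>g using EK.word_evalI[OF \<phi>gS] by (simp add: uK_def)
  have "\<exists>g. alg_hom A ?K g \<and> (\<forall>p\<in>words_in G. \<rho>K (g (?cA p)) = Wg.ev p)"
    unfolding A_def
  proof (rule H.typed_lift_ex[OF \<rho>K \<phi>gS, folded uK_def])
    fix l r assume lr: "R l r"
    have "(\<forall>l r. R l r \<longrightarrow> Wg.ev l = Wg.ev r) \<longleftrightarrow> hecke_relations ?\<kappa>' q n uK xK TK \<and>
        (q \<noteq> 1 \<longrightarrow> (\<forall>r\<in>{1..n}. \<phi>g (GX r) * \<phi>g (GXinv r) = uK \<and> \<phi>g (GXinv r) * \<phi>g (GX r) = uK))"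
      by (rule EK.K.hecke_data_iff[OF D Wg.word_eval_axioms]) (use SK(2)[OF xK(1)] in \<open>auto simp: \<phi>g_def\<close>)
    moreover have "\<phi>g (GX r) * \<phi>g (GXinv r) = uK \<and> \<phi>g (GXinv r) * \<phi>g (GX r) = uK" if "r \<in> {1..n}" "q \<noteq> 1" for r
      using zK(2)[OF that] that(1) by (simp add: \<phi>g_def)
    ultimately show "Wg.ev l = Wg.ev r" using HK.relations lr by blast
  next
    fix s assume s: "s \<in> {P}"
    have "Wg.ev P * ?\<epsilon> i = 0" if i: "i \<in> C" for i
    proof -
      have "Wg.ev P * ?\<epsilon> i = 0 \<longleftrightarrow> ?yK 1 ^ \<Lambda> (i 1) * ?\<epsilon> i = 0"
        unfolding P_def
      proof (rule HK.cyclotomic_iff[OF Wg.word_eval_axioms _ n1 a i YK.y_\<epsilon>[OF n1' i] _ fin])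
        show "\<phi>g (GX 1) = ?\<kappa>' a * xK 1 + ?\<kappa>' b * uK" using n1' by (simp add: \<phi>g_def)
        show "xK 1 * ?\<epsilon> i = (?\<kappa>' (v (i 1)) + ?\<kappa>' (w (i 1)) * ?yK 1) * ?\<epsilon> i" by (rule matchedD(3)[OF MK n1' i])
      qed
      moreover have "?yK 1 ^ \<Lambda> (i 1) * ?\<epsilon> i = 0"
        using tK(4)[of "yg 1 ^ \<Lambda> (i 1) * epsg i"] i cyc_elem_ev[OF tK(1)] by (auto simp: klr_cyc_elems_def)
      ultimately show ?thesis by blast
    qed
    then have "Wg.ev P = 0" by - (rule HK.eq_by_weights, simp_all add: Wg.ev_u)
    then show "Wg.ev s = 0" using s by simp
  qed
  then obtain g where g: "alg_hom A ?K g" "\<And>p. p \<in> words_in G ==> \<rho>K (g (?cA p)) = Wg.ev p"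
    by (elim exE conjE) (rule that, assumption, erule bspec)
  \<comment> \<open>the two homomorphisms are inverse to each other\<close>
  obtain \<tau> where \<tau>: "typed_hom ?\<kappa> ?\<kappa>' ?S \<tau>" "\<And>h. h \<in> carrier A ==> \<tau> (\<rho> h) = \<rho>K (g h)"
    using typed_homI[OF \<rho>' \<rho>K g(1)] by blast
  interpret \<tau>: typed_hom ?\<kappa> ?\<kappa>' ?S \<tau> by (rule \<tau>(1))
  have \<tau>ev: "\<tau> (W.ev p) = Wg.ev p" if "p \<in> words_in G" for p
    using \<tau>(2)[OF H.class_closed[OF that, folded A_def]] cA[OF that] g(2)[OF that] by simp
  have \<tau>u: "\<tau> u = uK" using \<tau>(2)[OF EA.one_closed] alg_homD(4)[OF g(1)] by (simp add: u_def uK_def)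
  have \<tau>\<phi>: "\<tau> (\<phi> k) = \<phi>g k" if "k \<in> G" for k
    using \<tau>ev[OF words_in_gen[OF that]] by (simp add: W.ev_gen Wg.ev_gen)
  have \<tau>x: "\<tau> (x r) = xK r" if r: "r \<in> {1..n}" for r
  proof -
    have "\<tau> (x r) = ?\<kappa>' (inverse a) * (\<phi>g (GX r) - ?\<kappa>' b * uK)"
      unfolding x_def \<tau>.\<tau>_smult[OF Scl(3)[OF \<phi>S Scl(4)[OF S(3)]]] \<tau>.\<tau>_minus[OF \<phi>S Scl(4)[OF S(3)]]
        \<tau>.\<tau>_smult[OF S(3)] \<tau>\<phi>[OF gG(1)[OF r]] \<tau>u by (rule refl)
    also have "\<dots> = (?\<kappa>' (inverse a) * ?\<kappa>' a) * xK r" using r by (simp add: \<phi>g_def mult.assoc)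
    also have "\<dots> = xK r" using EK.K.\<kappa>_inverse[OF a] by simp
    finally show ?thesis .
  qed
  have \<tau>T: "\<tau> (T r) = TK r" if "r \<in> {1..<n}" for r
    unfolding T_def using \<tau>\<phi>[OF gG(2)[OF that]] that by (simp add: \<phi>g_def)
  have \<tau>E: "\<tau> (?E i) = ?\<epsilon> i" if i: "i \<in> C" for i
  proof (rule HK.idempotents_determined[where F = "\<lambda>i. \<tau> (\<rho> (E i))", OF V.C_finite _ _ _ _ _ i])
    show "(\<Sum>i\<in>?I. \<tau> (?E i)) = uK"
      unfolding \<tau>u[symmetric] V.\<epsilon>_sum[symmetric] by (rule \<tau>.\<tau>_sum[symmetric]) (use Ec in auto)
    show "\<tau> (?E i) = 0" if "i \<in> tuples n e" "i \<notin> ?I" for i using E0[OF that] \<tau>.\<tau>_0 by simp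
    show "uK * \<tau> (?E i) = \<tau> (?E i)" if "i \<in> tuples n e" for i
      unfolding \<tau>(2)[OF Ec[OF that]]
      by (rule conjunct1[OF SK(2)[OF imageI[OF alg_homD(1)[OF g(1) Ec[OF that]]]]])
    show "nilp (xK r - ?\<kappa>' (v (i r))) (\<tau> (?E i))" if i: "i \<in> tuples n e" and r: "r \<in> {1..n}" for i r
    proof -
      have ES: "?E i \<in> ?S" by (rule imageI[OF Ec[OF i]])
      have uE: "u * ?E i = ?E i" using S(2)[OF ES] by blast
      have "nilp (x r - ?\<kappa> (v (i r))) (?E i)"
        using V.x_nilp[of i r] i r E0[OF i] by (cases "i \<in> ?I") (auto simp: nilp_def)
      moreover have "nilp (x r - ?\<kappa> (v (i r)) * u) (?E i) \<longleftrightarrow> nilp (x r - ?\<kappa> (v (i r))) (?E i)"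
      proof (rule nilp_agree[OF _ uE])
        fix z assume z: "u * z = z"
        have "u * (x r * z) = x r * z" using V.u_x[OF r] by (simp add: mult.assoc[symmetric])
        then show "(x r - ?\<kappa> (v (i r)) * u) * z = (x r - ?\<kappa> (v (i r))) * z \<and>
            u * ((x r - ?\<kappa> (v (i r))) * z) = (x r - ?\<kappa> (v (i r))) * z"
          using z by (simp add: left_diff_distrib right_diff_distrib mult.assoc EA.K.\<kappa>_mult_left[of u])
      qed
      ultimately obtain m where m: "(x r - ?\<kappa> (v (i r)) * u) ^ m * ?E i = 0" by (auto simp: nilp_def)
      have gS: "x r - ?\<kappa> (v (i r)) * u \<in> ?S" by (rule Scl(3)[OF xS Scl(4)[OF S(3)]])
      have \<tau>g: "\<tau> (x r - ?\<kappa> (v (i r)) * u) = xK r - ?\<kappa>' (v (i r)) * uK"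
        using \<tau>.\<tau>_minus[OF xS Scl(4)[OF S(3)]] \<tau>.\<tau>_smult[OF S(3)] \<tau>x[OF r] \<tau>u by simp
      have "(xK r - ?\<kappa>' (v (i r)) * uK) ^ m * \<tau> (?E i) = 0"
        using \<tau>.\<tau>_pow[OF gS ES, of m] m \<tau>g \<tau>.\<tau>_0 by simp
      then have "nilp (xK r - ?\<kappa>' (v (i r)) * uK) (\<tau> (?E i))" by (auto simp: nilp_def)
      moreover have "nilp (xK r - ?\<kappa>' (v (i r)) * uK) (\<tau> (?E i)) \<longleftrightarrow> nilp (xK r - ?\<kappa>' (v (i r))) (\<tau> (?E i))"
      proof (rule nilp_agree[where u = uK])
        show "uK * \<tau> (?E i) = \<tau> (?E i)" using \<tau>.\<tau>_mult[OF S(3) ES] uE \<tau>u by simp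
        fix z assume z: "uK * z = z"
        have "uK * (xK r * z) = xK r * z" using HK.u_x[OF r] by (simp add: mult.assoc[symmetric])
        then show "(xK r - ?\<kappa>' (v (i r)) * uK) * z = (xK r - ?\<kappa>' (v (i r))) * z \<and>
            uK * ((xK r - ?\<kappa>' (v (i r))) * z) = (xK r - ?\<kappa>' (v (i r))) * z"
          using z by (simp add: left_diff_distrib right_diff_distrib mult.assoc EK.K.\<kappa>_mult_left[of uK])
      qed
      ultimately show ?thesis by blast
    qed
  qed auto
  have \<tau>c: "\<tau> c = uK"
  proof -
    have "\<tau> c = (\<Sum>i\<in>C. \<tau> (?E i))" unfolding c_def by (rule \<tau>.\<tau>_sum) (use Ec C(2) in auto)
    also have "\<dots> = uK" unfolding YK.\<epsilon>_sum[symmetric] by (rule sum.cong) (use \<tau>E in auto)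
    finally show ?thesis .
  qed
  have cS': "c \<in> ?S" by (rule subsetD[OF SBS cS])
  have "(\<forall>r\<in>{1..n}. \<tau> (yB r) = ?yK r) \<and> (\<forall>r\<in>{1..<n}. \<tau> (\<psi>B r) = ?\<psi>K r)"
  proof (rule iffD1[OF \<tau>.matched_transport[OF MB MK cS' _ _ _ _ _ \<tau>c \<tau>E]])
    show "(\<forall>r\<in>{1..n}. \<tau> (?x r) = xK r) \<and> (\<forall>r\<in>{1..<n}. \<tau> (?T r) = TK r)"
      using \<tau>.\<tau>_mult[OF xS cS'] \<tau>.\<tau>_mult[OF TS cS'] \<tau>x \<tau>T \<tau>c HK.x_u HK.T_u by simp
    show "?x r \<in> ?S" "?T r \<in> ?S" for r using Scl(2)[OF xS cS'] Scl(2)[OF TS cS'] by blast+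
    show "yB r \<in> ?S" if "r \<in> {1..n}" for r by (rule subsetD[OF SBS yB(1)[OF that]])
    show "\<psi>B r \<in> ?S" if "r \<in> {1..<n}" for r by (rule subsetD[OF SBS yB(2)[OF that]])
    show "?E i \<in> ?S" if "i \<in> C" for i by (rule subsetD[OF SBS ES[OF that]])
  qed
  then have \<tau>y: "\<And>r. r \<in> {1..n} ==> \<tau> (yB r) = ?yK r" "\<And>r. r \<in> {1..<n} ==> \<tau> (\<psi>B r) = ?\<psi>K r" by blast+
  have oneK: "g eC = \<one>\<^bsub>?K\<^esub>"
  proof -
    have "\<rho>K (g eC) = \<rho>K \<one>\<^bsub>?K\<^esub>" using \<tau>(2)[OF eC(1)] eC(2) \<tau>c by (simp add: uK_def)
    then show ?thesis using EK.\<rho>_inj[OF alg_homD(1)[OF g(1) eC(1)] EK.one_closed] by blast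
  qed
  have gB: "alg_hom B ?K g"
  proof (rule alg_homI)
    show "g h \<in> carrier ?K" if "h \<in> carrier B" for h
      by (rule alg_homD(1)[OF g(1) BA[OF that]])
    show "g (h \<otimes>\<^bsub>B\<^esub> k) = g h \<otimes>\<^bsub>?K\<^esub> g k" if "h \<in> carrier B" "k \<in> carrier B" for h k
      unfolding Bops by (rule alg_homD(2)[OF g(1) BA[OF that(1)] BA[OF that(2)]])
    show "g (h \<oplus>\<^bsub>B\<^esub> k) = g h \<oplus>\<^bsub>?K\<^esub> g k" if "h \<in> carrier B" "k \<in> carrier B" for h k
      unfolding Bops by (rule alg_homD(3)[OF g(1) BA[OF that(1)] BA[OF that(2)]])
    show "g \<one>\<^bsub>B\<^esub> = \<one>\<^bsub>?K\<^esub>" unfolding Bops by (rule oneK)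
    show "g (b \<odot>\<^bsub>B\<^esub> h) = b \<odot>\<^bsub>?K\<^esub> g h" if "h \<in> carrier B" for b h
      unfolding Bops by (rule alg_homD(5)[OF g(1) BA[OF that]])
  qed
  have gf: "g (f k) = k" if k: "k \<in> carrier ?K" for k
  proof -
    have gen: "(g \<circ> f) (?cK (gen j)) = ?cK (gen j)" if j: "j \<in> RG" for j
    proof -
      note w = words_in_gen[OF j]
      have fB: "f (?cK (gen j)) \<in> carrier B" by (rule alg_homD(1)[OF f(1) R.class_closed[OF w]])
      have "\<rho>K (g (f (?cK (gen j)))) = \<tau> (\<phi>f j)"
        using \<tau>(2)[OF BA[OF fB]] f(2)[OF w] by (simp add: Wf.ev_gen)
      also have "\<dots> = \<phi>K j" using j \<tau>y \<tau>E by (auto simp: klr_gens_def \<phi>f_def)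
      also have "\<dots> = \<rho>K (?cK (gen j))" using cK[OF w] by (simp add: WK.ev_gen)
      finally show ?thesis
        using EK.\<rho>_inj[OF alg_homD(1)[OF gB fB] R.class_closed[OF w]] by simp
    qed
    have id: "alg_hom ?K ?K (\<lambda>k. k)" by (rule alg_homI; simp)
    have "(g \<circ> f) k = k"
      by (rule R.cyc_hom_ext[OF alg_hom_compose[OF f(1) gB] id gen k])
    then show ?thesis by simp
  qed
  obtain \<sigma> where \<sigma>: "typed_hom ?\<kappa>' ?\<kappa> ?SK \<sigma>" "\<And>k. k \<in> carrier ?K ==> \<sigma> (\<rho>K k) = \<rho> (f k)"
    using typed_homI[OF \<rho>K \<rho>B f(1)] by blast
  interpret \<sigma>: typed_hom ?\<kappa>' ?\<kappa> ?SK \<sigma> by (rule \<sigma>(1))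
  have \<sigma>u: "\<sigma> uK = c" using \<sigma>(2)[OF EK.one_closed] alg_homD(4)[OF f(1)] eC(2) by (simp add: uK_def Bops)
  have \<sigma>\<phi>: "\<sigma> (\<phi>K j) = \<phi>f j" if "j \<in> RG" for j
    using \<sigma>(2)[OF R.class_closed[OF words_in_gen[OF that]]] cK[OF words_in_gen[OF that]] f(2)[OF words_in_gen[OF that]]
    by (simp add: WK.ev_gen Wf.ev_gen)
  have \<sigma>E: "\<sigma> (?\<epsilon> i) = ?E i" if "i \<in> C" for i using \<sigma>\<phi>[OF gens_in(3)[OF that]] that by (simp add: \<phi>f_def)
  have "(\<forall>r\<in>{1..n}. \<sigma> (xK r) = ?x r) \<and> (\<forall>r\<in>{1..<n}. \<sigma> (TK r) = ?T r)"
  proof (rule iffD2[OF \<sigma>.matched_transport[OF MK MB SK(3) xK(1) imK xK(2) imK imK \<sigma>u \<sigma>E]])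
    show "(\<forall>r\<in>{1..n}. \<sigma> (?yK r) = yB r) \<and> (\<forall>r\<in>{1..<n}. \<sigma> (?\<psi>K r) = \<psi>B r)"
      using \<sigma>\<phi> gens_in by (simp add: \<phi>f_def)
  qed
  then have \<sigma>x: "\<And>r. r \<in> {1..n} ==> \<sigma> (xK r) = ?x r" "\<And>r. r \<in> {1..<n} ==> \<sigma> (TK r) = ?T r" by blast+
  have \<sigma>X: "\<sigma> (\<phi>g (GX r)) = \<phi> (GX r) * c" if r: "r \<in> {1..n}" for r
    unfolding \<phi>x using r xK(1)[OF r] SK(3) \<sigma>x(1)[OF r] \<sigma>u
    by (simp add: \<phi>g_def \<sigma>.\<tau>_simps distrib_right mult.assoc O(5))
  have \<sigma>g: "\<sigma> (\<phi>g k) = \<phi> k * c" if k: "k \<in> G" for k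
  proof -
    have "\<sigma> (\<phi>g (GXinv r)) = \<phi> (GXinv r) * c" if r: "r \<in> {1..n}" and q1: "q \<noteq> 1" for r
    proof (rule inverse_unique[where u = c and f = "\<phi> (GX r) * c"])
      have z: "zK r \<in> ?SK" "zK r * \<phi>g (GX r) = uK" using zK(1)[OF r] zK(2)[OF r q1] r by (simp_all add: \<phi>g_def)
      have e: "\<phi>g (GXinv r) = zK r" using r by (simp add: \<phi>g_def)
      show "\<sigma> (\<phi>g (GXinv r)) * (\<phi> (GX r) * c) = c"
        unfolding e \<sigma>X[OF r, symmetric]
        by (simp only: \<sigma>.\<tau>_mult[OF z(1) \<phi>gS, symmetric] z(2) \<sigma>u)
      show "\<sigma> (\<phi>g (GXinv r)) * c = \<sigma> (\<phi>g (GXinv r))"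
        unfolding e by (simp only: \<sigma>u[symmetric] \<sigma>.\<tau>_mult[OF z(1) SK(3), symmetric] SK(2)[OF z(1)])
      have inv: "\<phi> (GX r) * \<phi> (GXinv r) = u" using rel r q1 by blast
      have "\<phi> (GX r) * c * (\<phi> (GXinv r) * c) = \<phi> (GX r) * (c * \<phi> (GXinv r)) * c" by (simp only: mult.assoc)
      also have "\<dots> = \<phi> (GX r) * \<phi> (GXinv r) * (c * c)" unfolding c\<phi> by (simp only: mult.assoc)
      also have "\<dots> = c" by (simp only: inv cc O(5))
      finally show "\<phi> (GX r) * c * (\<phi> (GXinv r) * c) = c" .
      show "c * (\<phi> (GXinv r) * c) = \<phi> (GXinv r) * c"
        using c\<phi>[of "GXinv r"] cc by (metis mult.assoc)
    qed
    moreover have "\<sigma> (\<phi>g (GT r)) = \<phi> (GT r) * c" if "r \<in> {1..<n}" for r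
      using \<sigma>x(2)[OF that] that by (simp add: \<phi>g_def T_def)
    ultimately show ?thesis using k \<sigma>X unfolding gens by blast
  qed
  have proj: "alg_hom A B (\<lambda>h. h \<otimes>\<^bsub>A\<^esub> eC)"
  proof (rule alg_homI)
    show "h \<otimes>\<^bsub>A\<^esub> eC \<in> carrier B" if "h \<in> carrier A" for h
      using that eC(1) unfolding Bdef by (blast | auto)
    show "h \<otimes>\<^bsub>A\<^esub> k \<otimes>\<^bsub>A\<^esub> eC = (h \<otimes>\<^bsub>A\<^esub> eC) \<otimes>\<^bsub>B\<^esub> (k \<otimes>\<^bsub>A\<^esub> eC)" if "h \<in> carrier A" "k \<in> carrier A" for h k
    proof -
      have kc: "k \<otimes>\<^bsub>A\<^esub> eC \<in> carrier A" by (rule EA.m_closed[OF that(2) eC(1)])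
      have "eC \<otimes>\<^bsub>A\<^esub> (k \<otimes>\<^bsub>A\<^esub> eC) = (eC \<otimes>\<^bsub>A\<^esub> k) \<otimes>\<^bsub>A\<^esub> eC"
        by (rule EA.m_assoc[OF eC(1) that(2) eC(1), symmetric])
      also have "\<dots> = (k \<otimes>\<^bsub>A\<^esub> eC) \<otimes>\<^bsub>A\<^esub> eC" by (simp only: central[OF that(2)])
      also have "\<dots> = k \<otimes>\<^bsub>A\<^esub> (eC \<otimes>\<^bsub>A\<^esub> eC)" by (rule EA.m_assoc[OF that(2) eC(1) eC(1)])
      also have "\<dots> = k \<otimes>\<^bsub>A\<^esub> eC" by (simp only: ee)
      finally have absorb: "eC \<otimes>\<^bsub>A\<^esub> (k \<otimes>\<^bsub>A\<^esub> eC) = k \<otimes>\<^bsub>A\<^esub> eC" .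
      have "h \<otimes>\<^bsub>A\<^esub> k \<otimes>\<^bsub>A\<^esub> eC = h \<otimes>\<^bsub>A\<^esub> (k \<otimes>\<^bsub>A\<^esub> eC)" by (rule EA.m_assoc[OF that(1) that(2) eC(1)])
      also have "\<dots> = h \<otimes>\<^bsub>A\<^esub> (eC \<otimes>\<^bsub>A\<^esub> (k \<otimes>\<^bsub>A\<^esub> eC))" by (simp only: absorb)
      also have "\<dots> = (h \<otimes>\<^bsub>A\<^esub> eC) \<otimes>\<^bsub>A\<^esub> (k \<otimes>\<^bsub>A\<^esub> eC)"
        by (rule EA.m_assoc[OF that(1) eC(1) kc, symmetric])
      finally show ?thesis unfolding Bops .
    qed
    show "(h \<oplus>\<^bsub>A\<^esub> k) \<otimes>\<^bsub>A\<^esub> eC = (h \<otimes>\<^bsub>A\<^esub> eC) \<oplus>\<^bsub>B\<^esub> (k \<otimes>\<^bsub>A\<^esub> eC)" if "h \<in> carrier A" "k \<in> carrier A" for h k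
      unfolding Bops by (rule EA.l_distr[OF that(1) that(2) eC(1)])
    show "\<one>\<^bsub>A\<^esub> \<otimes>\<^bsub>A\<^esub> eC = \<one>\<^bsub>B\<^esub>" unfolding Bops by (rule EA.l_one[OF eC(1)])
    show "(b \<odot>\<^bsub>A\<^esub> h) \<otimes>\<^bsub>A\<^esub> eC = b \<odot>\<^bsub>B\<^esub> (h \<otimes>\<^bsub>A\<^esub> eC)" if "h \<in> carrier A" for b h
      using that eC(1) unfolding Bops by (simp add: EA.smult_mult_left)
  qed
  have fg: "f (g h) = h" if h: "h \<in> carrier B" for h
  proof -
    have gen: "(f \<circ> g) (?cA (gen k)) = ?cA (gen k) \<otimes>\<^bsub>A\<^esub> eC" if k: "k \<in> G" for k
    proof -
      note w = words_in_gen[OF k] and wc = H.class_closed[OF words_in_gen[OF k], folded A_def]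
      have "\<rho> (f (g (?cA (gen k)))) = \<sigma> (\<phi>g k)"
        using \<sigma>(2)[OF alg_homD(1)[OF g(1) wc]] g(2)[OF w] by (simp add: Wg.ev_gen)
      also have "\<dots> = \<rho> (?cA (gen k) \<otimes>\<^bsub>A\<^esub> eC)"
        using \<sigma>g[OF k] cA[OF w] EA.\<rho>_mult[OF wc eC(1)] eC(2) by (simp add: W.ev_gen)
      finally show ?thesis
        using EB.\<rho>_inj[OF alg_homD(1)[OF f(1) alg_homD(1)[OF g(1) wc]] alg_homD(1)[OF proj wc]] by simp
    qed
    have "(f \<circ> g) h = h \<otimes>\<^bsub>A\<^esub> eC"
      by (rule H.cyc_hom_ext[folded A_def, OF alg_hom_compose[OF g(1) f(1)] proj gen BA[OF h]])
    then show ?thesis using Bmem h by simp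
  qed
  show ?thesis unfolding B_def[symmetric] by (rule alg_isomorphicI[OF f(1) gB gf fg])
qed

end

text \<open>Both cases are instances of the two preceding isomorphisms: \<open>q = 1\<close> and residues \<open>v i = i\<close> in the
  degenerate case, \<open>v i = (q\<^sup>i - 1) / (q - 1)\<close> in the non-degenerate one.\<close>

theorem theorem5p6:
  fixes n e :: nat and C :: "(nat \<Rightarrow> int) set" and \<Lambda> :: "int \<Rightarrow> nat"
  assumes "n \<ge> 1" and "is_orbit n e C" and "finite {i \<in> residue_set e. \<Lambda> i \<noteq> 0}"
  shows
    "(e = CHAR('k::field) \<longrightarrow>
        (cyclotomic_klr n e C \<Lambda> :: ('k, 'k klr_free set set) module) \<cong>\<^sub>a\<^sub>l\<^sub>g
          (cyclotomic_semirat n e C \<Lambda> :: ('k, 'k klr_free set set) module) \<and>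
        (\<forall>E. weight_idempotents deg_val n e (cyclotomic_deg_hecke n e \<Lambda>) (deg_X n e \<Lambda>) E \<longrightarrow>
           (cyclotomic_semirat n e C \<Lambda> :: ('k, 'k klr_free set set) module) \<cong>\<^sub>a\<^sub>l\<^sub>g
             block_alg (cyclotomic_deg_hecke n e \<Lambda>) E C))
     \<and>
     (\<forall>q::'k. q \<noteq> 0 \<and> q \<noteq> 1 \<and> e = quantum_char q \<longrightarrow>
        (cyclotomic_klr n e C \<Lambda> :: ('k, 'k klr_free set set) module) \<cong>\<^sub>a\<^sub>l\<^sub>g
          (cyclotomic_semirat n e C \<Lambda> :: ('k, 'k klr_free set set) module) \<and>
        (\<forall>E. weight_idempotents (q_val q) n e (cyclotomic_hecke q n e \<Lambda>) (q_X q n e \<Lambda>) E \<longrightarrow>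
           (cyclotomic_semirat n e C \<Lambda> :: ('k, 'k klr_free set set) module) \<cong>\<^sub>a\<^sub>l\<^sub>g
             block_alg (cyclotomic_hecke q n e \<Lambda>) E C))"
proof (intro conjI impI allI)
  assume e: "e = CHAR('k)"
  interpret klr_index "1 :: 'k" e of_int n C \<Lambda>
    by (intro klr_index.intro klr_index_axioms.intro assms(1,2)) (simp add: e quantum_degenerate)
  show iso: "(cyclotomic_klr n e C \<Lambda> :: ('k, 'k klr_free set set) module) \<cong>\<^sub>a\<^sub>l\<^sub>g cyclotomic_semirat n e C \<Lambda>"
    unfolding klr_is_cyc semirat_is_cyc by (rule klr_semirat_iso)
  fix E assume E: "weight_idempotents deg_val n e
      (cyclotomic_deg_hecke n e \<Lambda> :: ('k, 'k hecke_free set set) module) (deg_X n e \<Lambda>) E"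
  have v: "(\<lambda>j. 1 * of_int j + 0) = (deg_val :: int \<Rightarrow> 'k)" by (simp add: deg_val_def[abs_def])
  let ?P = "hecke_cyc_elem deg_val e \<Lambda> :: 'k hecke_free"
  have A: "cyclotomic_deg_hecke n e \<Lambda> = cyc_alg (deg_hecke_gens n) (deg_hecke_rel n) {?P}"
    by (simp add: cyclotomic_deg_hecke_def cyc_alg_def deg_hecke_alg_def deg_cyc_ideal_def)
  have X: "deg_X n e \<Lambda> = (\<lambda>r. cyc_class (deg_hecke_gens n) (deg_hecke_rel n) {?P} (hX r))"
    by (simp add: deg_X_def[abs_def] cyc_class_def deg_hecke_alg_def deg_cyc_ideal_def)
  have "hecke_data (1 :: 'k) 1 0 n (deg_hecke_gens n) (deg_hecke_rel n)" by (simp add: hecke_data_def)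
  from klr_block_iso[OF this assms(3), unfolded v, OF E[unfolded A X]]
  have blk: "(cyclotomic_klr n e C \<Lambda> :: ('k, 'k klr_free set set) module) \<cong>\<^sub>a\<^sub>l\<^sub>g block_alg (cyclotomic_deg_hecke n e \<Lambda>) E C"
    unfolding klr_is_cyc A .
  have kR: "kalg (cyclotomic_klr n e C \<Lambda> :: ('k, 'k klr_free set set) module)"
    unfolding klr_is_cyc by (rule R.cyc_kalg)
  show "(cyclotomic_semirat n e C \<Lambda> :: ('k, 'k klr_free set set) module) \<cong>\<^sub>a\<^sub>l\<^sub>g
      block_alg (cyclotomic_deg_hecke n e \<Lambda>) E C"
    by (rule alg_isomorphic_trans[OF alg_isomorphic_sym[OF kR iso] blk])
next
  fix q :: 'k assume q: "q \<noteq> 0 \<and> q \<noteq> 1 \<and> e = quantum_char q"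
  let ?v = "\<lambda>i. (q powi i - 1) / (q - 1)"
  interpret klr_index q e ?v n C \<Lambda>
    by (intro klr_index.intro klr_index_axioms.intro assms(1,2)) (use q quantum_nondegenerate in auto)
  show iso: "(cyclotomic_klr n e C \<Lambda> :: ('k, 'k klr_free set set) module) \<cong>\<^sub>a\<^sub>l\<^sub>g cyclotomic_semirat n e C \<Lambda>"
    unfolding klr_is_cyc semirat_is_cyc by (rule klr_semirat_iso)
  fix E assume E: "weight_idempotents (q_val q) n e (cyclotomic_hecke q n e \<Lambda>) (q_X q n e \<Lambda>) E"
  have v: "(\<lambda>j. (q - 1) * ?v j + 1) = q_val q" using q by (simp add: q_val_def[abs_def])
  let ?P = "hecke_cyc_elem (q_val q) e \<Lambda>"
  have A: "cyclotomic_hecke q n e \<Lambda> = cyc_alg (hecke_gens n) (hecke_rel q n) {?P}"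
    by (simp add: cyclotomic_hecke_def cyc_alg_def hecke_alg_def q_cyc_ideal_def)
  have X: "q_X q n e \<Lambda> = (\<lambda>r. cyc_class (hecke_gens n) (hecke_rel q n) {?P} (hX r))"
    by (simp add: q_X_def[abs_def] cyc_class_def hecke_alg_def q_cyc_ideal_def)
  have "hecke_data q (q - 1) 1 n (hecke_gens n) (hecke_rel q n)" using q by (simp add: hecke_data_def)
  from klr_block_iso[OF this assms(3), unfolded v, OF E[unfolded A X]]
  have blk: "(cyclotomic_klr n e C \<Lambda> :: ('k, 'k klr_free set set) module) \<cong>\<^sub>a\<^sub>l\<^sub>g block_alg (cyclotomic_hecke q n e \<Lambda>) E C"
    unfolding klr_is_cyc A .
  have kR: "kalg (cyclotomic_klr n e C \<Lambda> :: ('k, 'k klr_free set set) module)"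
    unfolding klr_is_cyc by (rule R.cyc_kalg)
  show "(cyclotomic_semirat n e C \<Lambda> :: ('k, 'k klr_free set set) module) \<cong>\<^sub>a\<^sub>l\<^sub>g
      block_alg (cyclotomic_hecke q n e \<Lambda>) E C"
    by (rule alg_isomorphic_trans[OF alg_isomorphic_sym[OF kR iso] blk])
qed

end
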